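(* Let $S(t_1,t_2)$ be a real analytic function, not identically zero, defined on a neighborhood of the origin in $\mathbb{R}^2$, with $S(0,0)=0$ and $\nabla S(0,0)=(0,0)$. Let $H=S_{t_1t_1}S_{t_2t_2}-(S_{t_1t_2})^2$ be its Hessian determinant, assume $H(0,0)=0$ and $H$ not identically zero. Let $\eta$, $\eta'$ be the integrability exponents of $S$ and $H$ respectively, and assume $\frac{2\eta'}{1+2\eta'}\ge\eta$. For a bump function $\phi$ let \[ Tf(x_1,x_2,x_3)=\int_{\mathbb{R}^2} f(x_1-t_1,x_2-t_2,x_3-S(t_1,t_2))\,\phi(t_1,t_2)\,dt_1\,dt_2 .\] Then there is a neighborhood $U$ of the origin such that if $\phi$ is supported in $U$, then $T$ is bounded from $L^p(\mathbb{R}^3)$ to $L^q(\mathbb{R}^3)$ for all $(\frac1p,\frac1q)$ in the interior of the trapezoid in the $xy$-plane bounded by the lines $y=x$, $y=x-\frac{\eta}{\eta+1}$, $y=\frac x3$ and $y=3x-2$.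
   Context: $T$ is initially defined on Schwartz functions on $\mathbb{R}^3$; $\phi$ is a smooth compactly supported function on $\mathbb{R}^2$. Integrability exponent: for a real analytic $g$ near the origin of $\mathbb{R}^2$ with $g(0,0)=0$, not identically zero, there exist $0<\eta_g\le1$, $k\in\{0,1\}$ and a neighborhood $U$ of the origin such that for every neighborhood $V\subset U$ of the origin there are $b_V,c_V>0$ with $b_V\delta^{\eta_g}|\ln\delta|^k<m(\{t\in V:|g(t)|<\delta\})<c_V\delta^{\eta_g}|\ln\delta|^k$ for $0<\delta<\frac12$ ($m$ = Lebesgue measure); equivalently $\eta_g$ is the supremum of the $\epsilon>0$ for which $|g|^{-\epsilon}$ is integrable near the origin. $\eta=\eta_S$, $\eta'=\eta_H$. *)

theory Defs
  imports "HOL-Analysis.Analysis"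
begin

definition partial :: "'n::finite \<Rightarrow> (real^'n \<Rightarrow> 'a::real_normed_vector) \<Rightarrow> real^'n \<Rightarrow> 'a" where
  "partial i g x = vector_derivative (\<lambda>s. g (x + s *\<^sub>R axis i 1)) (at 0)"

fun iter_partial :: "'n::finite list \<Rightarrow> (real^'n \<Rightarrow> 'a::real_normed_vector) \<Rightarrow> real^'n \<Rightarrow> 'a" where
  "iter_partial [] g = g"
| "iter_partial (i # is) g = partial i (iter_partial is g)"

definition smooth_fun :: "(real^'n::finite \<Rightarrow> 'a::real_normed_vector) \<Rightarrow> bool" where
  "smooth_fun g \<longleftrightarrow> (\<forall>is. continuous_on UNIV (iter_partial is g) \<and>
      (\<forall>i x. (\<lambda>s. iter_partial is g (x + s *\<^sub>R axis i 1)) differentiable (at 0)))"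

definition schwartz :: "(real^'n::finite \<Rightarrow> 'a::real_normed_vector) \<Rightarrow> bool" where
  "schwartz g \<longleftrightarrow> smooth_fun g \<and>
     (\<forall>is (N::nat). bounded (range (\<lambda>x. (1 + norm x) ^ N *\<^sub>R iter_partial is g x)))"

definition bump :: "(real^'n::finite \<Rightarrow> real) \<Rightarrow> bool" where
  "bump g \<longleftrightarrow> smooth_fun g \<and> compact (closure {x. g x \<noteq> 0})"

definition real_analytic_on :: "(real^2 \<Rightarrow> real) \<Rightarrow> (real^2) set \<Rightarrow> bool" where
  "real_analytic_on g W \<longleftrightarrow> (\<forall>a\<in>W. \<exists>r>0. \<exists>c::nat \<Rightarrow> nat \<Rightarrow> real. \<forall>x\<in>ball a r.
      ((\<lambda>(i,j). c i j * (x$1 - a$1)^i * (x$2 - a$2)^j) has_sum g x) UNIV)"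

definition hessian_det :: "(real^2 \<Rightarrow> real) \<Rightarrow> real^2 \<Rightarrow> real" where
  "hessian_det g x = partial 1 (partial 1 g) x * partial 2 (partial 2 g) x
                     - (partial 1 (partial 2 g) x)^2"

definition int_exp :: "(real^2 \<Rightarrow> real) \<Rightarrow> real" where
  "int_exp g = Sup {\<epsilon>. \<epsilon> > 0 \<and> (\<exists>V. open V \<and> 0 \<in> V \<and>
       set_integrable lborel V (\<lambda>t. \<bar>g t\<bar> powr (-\<epsilon>)))}"

definition avg_op :: "(real^2 \<Rightarrow> real) \<Rightarrow> (real^2 \<Rightarrow> real) \<Rightarrow> (real^3 \<Rightarrow> complex) \<Rightarrow> real^3 \<Rightarrow> complex" where
  "avg_op S \<phi> f x = (\<integral>t. complex_of_real (\<phi> t) *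
       f (vector [x$1 - t$1, x$2 - t$2, x$3 - S t]) \<partial>lborel)"

text \<open>L^p to L^q boundedness of an operator initially defined on Schwartz functions.\<close>
definition LpLq_bounded :: "real \<Rightarrow> real \<Rightarrow> ((real^3 \<Rightarrow> complex) \<Rightarrow> real^3 \<Rightarrow> complex) \<Rightarrow> bool" where
  "LpLq_bounded p q T \<longleftrightarrow> (\<exists>C. \<forall>f. schwartz f \<longrightarrow>
      integrable lborel (\<lambda>x. norm (T f x) powr q) \<and>
      (\<integral>x. norm (T f x) powr q \<partial>lborel) powr (1/q)
        \<le> C * (\<integral>x. norm (f x) powr p \<partial>lborel) powr (1/p))"

end

theory Submission
  imports Defs "HOL-Complex_Analysis.Complex_Analysis" "HOL-Computational_Algebra.Field_as_Ring"
    "HOL-Computational_Algebra.Polynomial_Factorial"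
begin

text \<open>
  No Fourier analysis is needed. Let \<open>Q\<close> be a small box, \<open>\<gamma>(t) = (t, S(t))\<close> and \<open>H\<close> the Hessian determinant.
  If many points \<open>y - \<gamma>(t)\<close> with \<open>|H(t)| \<ge> \<delta>\<close> lie in a set \<open>E\<close>, then for many triples of such \<open>t\<close> the
  gradients of \<open>S\<close> span a triangle of large area, because \<open>\<nabla>S\<close> has Jacobian \<open>H\<close>. This area is the Jacobian of
  \<open>(y, t, t', t'') \<mapsto> (y - \<gamma>(t), y - \<gamma>(t'), y - \<gamma>(t''))\<close>, whose fibres are counted by a Bezout bound for
  Taylor polynomials of \<open>S\<close> of logarithmic degree. Up to \<open>\<epsilon>\<close>-losses, this bounds the incidences between
  \<open>E\<close> and \<open>F\<close> with \<open>|H| \<ge> \<delta>\<close> by \<open>(|E| |F|)\<^sup>3\<^sup>/\<^sup>4\<close> times \<open>\<delta>\<close> to the power \<open>-1/4\<close>. Interpolating on each dyadic layer of \<open>H\<close>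
  with the trivial bounds \<open>|{|H| < \<delta>}| |E|\<close> and \<open>|{|H| < \<delta>}| |F|\<close> and summing gives restricted bounds at
  \<open>(x, y)\<close> for \<open>x - y < 2\<eta>' / (1 + 4\<eta>')\<close>; the hypothesis on the exponents says exactly that the right-hand side is
  at least \<open>\<eta> / (1 + \<eta>)\<close>. Summation over dyadic levels of \<open>f\<close> and \<open>Tf\<close> yields the strong bounds.

  The neighbourhood must not depend on \<open>p\<close> and \<open>q\<close>: a sublevel estimate valid near the origin with some exponent has
  to hold with the same exponent on a fixed box. At a nearby point it can only fail through a zero of
  higher multiplicity in one variable, and such zeros persist along curves reaching the origin.
\<close>

text \<open>Fibres of the gradient map and of the map built from chords can be counted only where
  the Jacobian is at least some \<kappa>. There a zero is stable at a scale comparable to \<kappa>,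
  so a Taylor polynomial with error of order \<kappa>^2 has its own nondegenerate zero near each
  zero of the analytic map, and the number of these depends on the degree alone. Truncation errors
  decay geometrically, which keeps the degree logarithmic. The losses \<kappa>^-\<epsilon> are
  harmless because the trapezoid is open: every sum over layers or levels is made to converge by
  moving slightly inside it.

  The three-point estimate sits at (3/4, 1/4), where the lines y = x/3 and y = 3x - 2 meet; the two
  trivial bounds sit at (1, 1) and (0, 0). This is why these lines bound the region.

  Multiplicity of zeros is tracked through holomorphic symmetric functions of the values that one
  derivative takes at the zeros of another; this is the reason for the complex extensions.\<close>

type_synonym plane = "real \<times> real"
type_synonym spc = "(real \<times> real) \<times> real"

abbreviation vol :: "'a::euclidean_space set \<Rightarrow> ennreal" where "vol \<equiv> emeasure lborel"

abbreviation nn_lborel :: "('a::euclidean_space \<Rightarrow> ennreal) \<Rightarrow> ennreal" (binder "LI " 10) where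
  "nn_lborel f \<equiv> nn_integral lborel f"

abbreviation (input) unit_fun :: "real \<Rightarrow> (spc \<Rightarrow> real) \<Rightarrow> bool" where
  "unit_fun p f \<equiv> f \<in> borel_measurable borel \<and> (\<forall>z. 0 \<le> f z) \<and> (LI z. ennreal (f z powr p)) \<le> 1"

abbreviation (input) fin_sets :: "spc set \<Rightarrow> spc set \<Rightarrow> bool" where
  "fin_sets E F \<equiv> E \<in> sets borel \<and> F \<in> sets borel \<and> vol E < \<infinity> \<and> vol F < \<infinity>"

section \<open>Counting nondegenerate common zeros of two polynomials in two variables\<close>

text \<open>Gaussian elimination: an equation with a nonzero coefficient is solved for one unknown,
  which removes one equation and one unknown and so preserves the strict inequality between their
  numbers.\<close>

lemma homogeneous_system_nontrivial:
 fixes A :: "'i => 'j => real"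
 assumes "finite J" "finite I" "card J < card I"
 shows "\<exists>c. (\<exists>i\<in>I. c i ~= 0) \<and> (\<forall>j\<in>J. (\<Sum>i\<in>I. c i * A i j) = 0)"
 using assms
proof (induction J arbitrary: I A rule: finite_induct)
 case empty
 then show ?case by (intro exI[of _ "\<lambda>_. 1"]) (auto simp: card_gt_0_iff)
next
 case (insert j J)
 show ?case
 proof (cases "\<forall>i\<in>I. A i j = 0")
  case True
  have "card J < card I" using insert by auto
  from insert.IH[OF \<open>finite I\<close> this, of A] True show ?thesis by auto
 next
  case False
  then obtain k where k: "k \<in> I" "A k j ~= 0" by auto
  let ?I = "I - {k}"
  \<comment> \<open>The column operation with pivot \<open>A k j\<close> that makes equation
    \<open>j\<close> disappear for the remaining unknowns.\<close>
  define B where "B i l = A i l - A i j / A k j * A k l" for i l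
  have "card J < card ?I" using insert k by auto
  from insert.IH[OF _ this, of B] insert.prems obtain c where
   c: "\<exists>i\<in>?I. c i ~= 0" "\<forall>l\<in>J. (\<Sum>i\<in>?I. c i * B i l) = 0" by auto
  define ck where "ck = - (\<Sum>i\<in>?I. c i * A i j) / A k j"
  have expand: "(\<Sum>i\<in>I. (c(k := ck)) i * A i l) = ck * A k l + (\<Sum>i\<in>?I. c i * A i l)" for l
   using insert.prems k by (simp add: sum.remove[of I k])
  have "(\<Sum>i\<in>I. (c(k := ck)) i * A i j) = 0"
   unfolding expand using k by (simp add: ck_def)
  moreover have "(\<Sum>i\<in>I. (c(k := ck)) i * A i l) = 0" if "l \<in> J" for l
  proof -
   have "0 = (\<Sum>i\<in>?I. c i * A i l) - (\<Sum>i\<in>?I. c i * A i j) / A k j * A k l"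
    using c(2) that unfolding B_def
    by (simp add: algebra_simps sum_subtractf sum_distrib_left sum_distrib_right sum_divide_distrib)
   then show ?thesis unfolding expand by (simp add: ck_def)
  qed
  ultimately show ?thesis using c(1) by (intro exI[of _ "c(k := ck)"]) auto
 qed
qed

text \<open>The outer variable of the nested polynomial is \<open>y\<close> and its coefficients are
  polynomials in \<open>x\<close>. So \<open>degree f\<close> is the degree in \<open>y\<close>, and
  the degrees of the coefficients record the degree in \<open>x\<close>.\<close>

definition ev2 :: "real poly poly => real => real => real" where
 "ev2 f x y = poly (poly f [:y:]) x"

lemma ev2_mult: "ev2 (f * g) x y = ev2 f x y * ev2 g x y"
 and ev2_add: "ev2 (f + g) x y = ev2 f x y + ev2 g x y"
 by (simp_all add: ev2_def)

lemma ev2_DERIV_x: "((\<lambda>x. ev2 f x y) has_field_derivative poly (pderiv (poly f [:y:])) x) (at x)"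
 unfolding ev2_def by (rule poly_DERIV)

lemma ev2_DERIV_y: "\<exists>d. ((\<lambda>y. ev2 f x y) has_field_derivative d) (at y)"
proof (induction f)
 case 0
 then show ?case by (auto simp: ev2_def intro!: exI[of _ 0])
next
 case (pCons a f)
 then obtain d where d: "((\<lambda>y. ev2 f x y) has_field_derivative d) (at y)" by auto
 have "((\<lambda>y. poly a x + y * ev2 f x y) has_field_derivative (ev2 f x y + y * d)) (at y)"
  by (auto intro!: derivative_eq_intros d)
 moreover have "(\<lambda>y. ev2 (pCons a f) x y) = (\<lambda>y. poly a x + y * ev2 f x y)"
  by (auto simp: ev2_def)
 ultimately show ?case by auto
qed

lemma coeff_mult_at_degree_bounds:
 fixes p q :: "real poly"
 assumes "degree p <= a" "degree q <= b"
 shows "coeff (p * q) (a + b) = coeff p a * coeff q b"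
proof -
 have "coeff (p * q) (a + b) = (\<Sum>i\<le>a+b. coeff p i * coeff q (a + b - i))"
  by (simp add: coeff_mult)
 also have "... = (\<Sum>i\<in>{a}. coeff p i * coeff q (a + b - i))"
 proof (rule sum.mono_neutral_right)
  show "\<forall>i\<in>{..a + b} - {a}. coeff p i * coeff q (a + b - i) = 0"
  proof
   fix i assume "i \<in> {..a + b} - {a}"
   then have "i > a \<or> a + b - i > b" by auto
   then show "coeff p i * coeff q (a + b - i) = 0"
    using assms by (auto simp: coeff_eq_0)
  qed
 qed auto
 finally show ?thesis by simp
qed

text \<open>The pair (\<open>d\<close>, \<open>j\<close>) is the leading exponent in the
  lexicographic order that looks at the degree in \<open>x\<close> first. Taking the last such
  \<open>j\<close> makes the leading coefficient of a product the product of the leading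
  coefficients.\<close>

lemma inner_degree_attained:
 fixes f :: "real poly poly"
 assumes "f ~= 0"
 obtains d j where "!!i. degree (coeff f i) <= d" "coeff (coeff f j) d ~= 0"
  "!!i. i > j ==> coeff (coeff f i) d = 0"
proof -
 define d where "d = Max ((\<lambda>i. degree (coeff f i)) ` {..degree f})"
 have le: "degree (coeff f i) <= d" for i
 proof (cases "i <= degree f")
  case True
  then show ?thesis unfolding d_def by (intro Max_ge) auto
 qed (simp add: coeff_eq_0)
 have "d \<in> (\<lambda>i. degree (coeff f i)) ` {..degree f}"
  unfolding d_def by (rule Max_in) auto
 then obtain i0 where i0: "d = degree (coeff f i0)" by auto
 have ex: "\<exists>i. coeff (coeff f i) d ~= 0"
 \<comment> \<open>The zero polynomial also has degree 0, so for \<open>d = 0\<close> the index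
   \<open>i0\<close> may point to a zero coefficient; the leading coefficient in \<open>y\<close> is
   used instead.\<close>
 proof (cases "d = 0")
  case True
  have "degree (coeff f (degree f)) = 0" using le[of "degree f"] True by simp
  then have "coeff (coeff f (degree f)) d ~= 0"
   using assms True by (metis leading_coeff_0_iff)
  then show ?thesis by auto
 next
  case False
  then have "coeff f i0 ~= 0" using i0 by auto
  then show ?thesis using i0 by (auto intro!: exI[of _ i0])
 qed
 let ?A = "{i. coeff (coeff f i) d ~= 0}"
 have "?A \<subseteq> {..degree f}"
  by (auto intro!: le_degree)
 then have fin: "finite ?A" by (rule finite_subset) auto
 have "Max ?A \<in> ?A" using fin ex by (intro Max_in) auto
 moreover have "coeff (coeff f i) d = 0" if "i > Max ?A" for i
  using that fin Max_ge[of ?A i] by (metis (mono_tags, lifting) leD mem_Collect_eq)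
 ultimately show ?thesis using that[of d "Max ?A"] le by blast
qed

text \<open>Leading terms multiply without cancellation, so degrees in \<open>x\<close> add over the
  factors of a nonzero product. This keeps the degree bounds after a common factor is divided
  out.\<close>

lemma inner_degree_factor_le:
 fixes f h k :: "real poly poly"
 assumes f: "f = h * k" "f ~= 0" and d: "!!i. degree (coeff f i) <= d"
 shows "degree (coeff k i) <= d"
proof -
 have "h ~= 0" "k ~= 0" using f by auto
 obtain dh jh where h: "!!i. degree (coeff h i) <= dh" "coeff (coeff h jh) dh ~= 0"
  "!!i. i > jh ==> coeff (coeff h i) dh = 0" using inner_degree_attained[OF \<open>h ~= 0\<close>] by metis
 obtain dk jk where k: "!!i. degree (coeff k i) <= dk" "coeff (coeff k jk) dk ~= 0"
  "!!i. i > jk ==> coeff (coeff k i) dk = 0" using inner_degree_attained[OF \<open>k ~= 0\<close>] by metis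
 have "coeff (coeff f (jh + jk)) (dh + dk)
   = (\<Sum>i\<le>jh+jk. coeff (coeff h i) dh * coeff (coeff k (jh + jk - i)) dk)"
  unfolding f(1) coeff_mult coeff_sum
  by (intro sum.cong refl) (simp add: coeff_mult_at_degree_bounds h k flip: coeff_mult)
 also have "... = (\<Sum>i\<in>{jh}. coeff (coeff h i) dh * coeff (coeff k (jh + jk - i)) dk)"
 proof (rule sum.mono_neutral_right)
  show "\<forall>i\<in>{..jh + jk} - {jh}. coeff (coeff h i) dh * coeff (coeff k (jh + jk - i)) dk = 0"
  proof
   fix i assume "i \<in> {..jh + jk} - {jh}"
   then have "i > jh \<or> jh + jk - i > jk" by auto
   then show "coeff (coeff h i) dh * coeff (coeff k (jh + jk - i)) dk = 0"
    using h k by auto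
  qed
 qed auto
 finally have "coeff (coeff f (jh + jk)) (dh + dk) ~= 0" using h k by simp
 then have "dh + dk <= degree (coeff f (jh + jk))" by (rule le_degree)
 then show ?thesis using d[of "jh + jk"] k(1)[of i] by linarith
qed

text \<open>A dimension count takes the place of the resultant: cofactors u and v, of degree in
  \<open>y\<close> below \<open>degree g\<close> and \<open>degree f\<close>, and a polynomial
  \<open>r\<close> in \<open>x\<close> alone are sought with u f + v g + r = 0. There are more
  coefficients than equations. Coprimality rules out \<open>r = 0\<close>: then \<open>g\<close>
  would divide u, which has smaller degree, and everything would vanish.\<close>

lemma coprime_bipoly_elimination:
 fixes f g :: "real poly poly"
 assumes cop: "coprime f g" and nz: "f ~= 0" "g ~= 0"
  and df: "degree f <= N" "!!i. degree (coeff f i) <= N"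
  and dg: "degree g <= N" "!!i. degree (coeff g i) <= N"
 obtains r :: "real poly" where "r ~= 0" "degree r <= 2*N*(N+1) + N"
  "!!x y. ev2 f x y = 0 ==> ev2 g x y = 0 ==> poly r x = 0"
\<comment> \<open>If one of the polynomials does not involve \<open>y\<close>, it is itself the
  eliminant.\<close>
proof (cases "degree g = 0 \<or> degree f = 0")
 case True
 then obtain u where u: "u = f \<or> u = g" "degree u = 0" "u ~= 0" using nz by auto
 then obtain w where w: "u = [:w:]" by (metis degree_eq_zeroE)
 then have "ev2 u x y = poly (coeff u 0) x" for x y by (simp add: ev2_def)
 moreover have "coeff u 0 ~= 0" using w u by auto
 moreover have "degree (coeff u 0) <= 2*N*(N+1) + N" using u df(2)[of 0] dg(2)[of 0] by auto
 ultimately show ?thesis using that[of "coeff u 0"] u(1) by metis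
next
 case False
 define m n where "m = degree f" and "n = degree g"
 have mn: "m > 0" "n > 0" using False by (auto simp: m_def n_def)
 \<comment> \<open>\<open>K\<close> limits the degree in \<open>x\<close> of the cofactors. With
   this value the (m+n)(K+N+1) equations number (m+n)K + K, which is N+1 fewer than the
   unknowns.\<close>
 define K where "K = (m + n) * (N + 1)"
 \<comment> \<open>The tags 0, 1, 2 mark the coefficients of the cofactor of \<open>f\<close>, of
   the cofactor of \<open>g\<close> and of \<open>r\<close>; the other two entries are the degrees
   in \<open>x\<close> and in \<open>y\<close>.\<close>
 define I where "I = ({0::nat} \<times> {..<K} \<times> {..<n}) \<union> ({1} \<times> {..<K} \<times> {..<m}) \<union> ({2} \<times> {..<K+N+1} \<times> {0})"
 define e :: "nat \<times> nat \<times> nat => real poly poly" where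
  "e = (\<lambda>(t,p,l). monom (monom 1 p) l * (if t = 0 then f else if t = 1 then g else 1))"
 have cI: "card I = n * K + m * K + (K + N + 1)"
  unfolding I_def by (subst card_Un_disjoint; auto simp: card_cartesian_product)+
 have fI: "finite I" unfolding I_def by auto
 define J where "J = {..<m+n} \<times> {..<K+N+1}"
 have "card J = (m + n) * (K + N + 1)" unfolding J_def by (simp add: card_cartesian_product)
 also have "... = (m + n) * K + K" by (simp add: K_def algebra_simps)
 also have "... < card I" unfolding cI by (simp add: algebra_simps)
 finally have "card J < card I" .
 then obtain c where c: "\<exists>i\<in>I. c i ~= 0"
  "\<forall>j\<in>J. (\<Sum>i\<in>I. c i * (\<lambda>i (j,k). coeff (coeff (e i) j) k) i j) = 0"
  using homogeneous_system_nontrivial[of J I "\<lambda>i (j,k). coeff (coeff (e i) j) k"] fI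
  by (auto simp: J_def)
 have e0: "coeff (coeff (e i) j) k = 0" if "i \<in> I" "(j,k) \<notin> J" for i j k
 proof -
  obtain t p l where i: "i = (t,p,l)" by (cases i)
  have *: "coeff (coeff (monom (monom 1 p) l * u) j) k =
    (if l <= j \<and> p <= k then coeff (coeff u (j - l)) (k - p) else 0)" for u :: "real poly poly"
   by (simp add: coeff_monom_mult)
  have f0: "coeff (coeff f j) k = 0" if "j > m \<or> k > N" for j k
   using that df by (metis coeff_0 coeff_eq_0 le_less_trans m_def)
  have g0: "coeff (coeff g j) k = 0" if "j > n \<or> k > N" for j k
   using that dg by (metis coeff_0 coeff_eq_0 le_less_trans n_def)
  have one0: "coeff (coeff 1 j) k = (0::real)" if "j > 0 \<or> k > 0" for j k
   using that by (auto simp: coeff_1 simp del: One_nat_def split: if_splits)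
  show ?thesis using that mn unfolding i e_def prod.case * I_def J_def
   by (auto intro!: f0 g0 one0)
 qed
 have rel: "(\<Sum>i\<in>I. smult [:c i:] (e i)) = 0"
 proof (intro poly_eqI)
  fix j k
  show "coeff (coeff (\<Sum>i\<in>I. smult [:c i:] (e i)) j) k = coeff (coeff 0 j) k"
  proof (cases "(j,k) \<in> J")
   case True
   then show ?thesis using c(2) by (force simp: coeff_sum)
  next
   case False
   then show ?thesis using e0 by (simp add: coeff_sum)
  qed
 qed
 define part where "part t = (\<Sum>i\<in>{i\<in>I. fst i = t}. smult [:c i:] (monom (monom 1 (fst (snd i))) (snd (snd i))))" for t
 have cpart: "coeff (coeff (part t) l) p = (if (t,p,l) \<in> I then c (t,p,l) else 0)" for t p l
 proof -
  have "coeff (coeff (part t) l) p = (\<Sum>i\<in>{i\<in>I. fst i = t}. if i = (t,p,l) then c i else 0)"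
   unfolding part_def coeff_sum by (intro sum.cong refl) (auto simp: coeff_monom)
  also have "... = (if (t,p,l) \<in> I then c (t,p,l) else 0)"
   using fI by (simp add: sum.delta')
  finally show ?thesis .
 qed
 have split: "(\<Sum>i\<in>I. smult [:c i:] (e i)) = part 0 * f + part 1 * g + part 2"
 proof -
  have "(\<Sum>i\<in>I. smult [:c i:] (e i)) = (\<Sum>t\<in>{0,1,2}. \<Sum>i\<in>{i\<in>I. fst i = t}. smult [:c i:] (e i))"
   by (rule sum.group[symmetric]) (use fI in \<open>auto simp: I_def\<close>)
  also have "... = part 0 * f + part 1 * g + part 2"
  proof -
   have "(\<Sum>i\<in>{i\<in>I. fst i = t}. smult [:c i:] (e i)) = part t * (if t = 0 then f else if t = 1 then g else 1)" for t
    unfolding part_def sum_distrib_right by (intro sum.cong refl) (auto simp: e_def)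
   then show ?thesis by simp
  qed
  finally show ?thesis .
 qed
 define r where "r = coeff (part 2) 0"
 have part2: "part 2 = [:r:]"
 proof (rule poly_eqI)
  fix j show "coeff (part 2) j = coeff [:r:] j"
  proof (cases j)
   case (Suc j')
   have "coeff (part 2) j = 0" by (rule poly_eqI) (auto simp: cpart I_def Suc)
   then show ?thesis by (simp add: Suc)
  qed (simp add: r_def)
 qed
 have eq: "part 0 * f + part 1 * g + [:r:] = 0" using rel split part2 by simp
 have "r ~= 0"
 proof
  assume "r = 0"
  then have eq': "part 0 * f = - (part 1 * g)" using eq by (simp add: eq_neg_iff_add_eq_0)
  have "g dvd part 0 * f" unfolding eq' by auto
  then have "g dvd part 0" using cop by (metis coprime_commute coprime_dvd_mult_left_iff)
  moreover have "degree (part 0) < degree g"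
   unfolding n_def[symmetric]
  proof (rule degree_lessI)
   show "\<forall>k\<ge>n. coeff (part 0) k = 0" by (auto intro!: poly_eqI simp: cpart I_def)
  qed (use mn in auto)
  ultimately have p0: "part 0 = 0" by (metis dvd_imp_degree_le leD)
  then have p1: "part 1 = 0" using eq' nz by auto
  have "part 2 = 0" using part2 \<open>r = 0\<close> by simp
  obtain t p l where i: "(t,p,l) \<in> I" "c (t,p,l) ~= 0" using c(1) by (metis prod_cases3)
  then have "t = 0 \<or> t = 1 \<or> t = 2" by (auto simp: I_def)
  then show False using cpart[of t l p] i p0 p1 \<open>part 2 = 0\<close> by auto
 qed
 moreover have "degree r <= 2*N*(N+1) + N"
 proof (rule degree_le, intro allI impI)
  fix i assume i: "2 * N * (N + 1) + N < i"
  have "m + n <= 2 * N" using df dg by (simp add: m_def n_def)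
  then have "K <= 2 * N * (N + 1)" unfolding K_def by (rule mult_right_mono) simp
  then show "coeff r i = 0" using i by (auto simp: r_def cpart I_def)
 qed
 moreover have "poly r x = 0" if "ev2 f x y = 0" "ev2 g x y = 0" for x y
  using arg_cong[OF eq, of "\<lambda>u. ev2 u x y"] that unfolding ev2_add ev2_mult by (simp add: ev2_def)
 ultimately show ?thesis using that by blast
qed

definition bipoly :: "nat => (real => real => real) => bool" where
 "bipoly N F \<longleftrightarrow> (\<exists>a. \<forall>x y. F x y = (\<Sum>i\<le>N. \<Sum>j\<le>N. a i j * x^i * y^j))"

definition nondeg_zero :: "(real => real => real) => (real => real => real) => real => real => bool" where
 "nondeg_zero F G x y \<longleftrightarrow> F x y = 0 \<and> G x y = 0 \<and> (\<exists>fx fy gx gy.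
   ((\<lambda>x. F x y) has_field_derivative fx) (at x) \<and> ((\<lambda>y. F x y) has_field_derivative fy) (at y) \<and>
   ((\<lambda>x. G x y) has_field_derivative gx) (at x) \<and> ((\<lambda>y. G x y) has_field_derivative gy) (at y) \<and>
   fx * gy - fy * gx ~= 0)"

lemma bipoly_ev2:
 assumes "bipoly N F"
 obtains f where "F = ev2 f" "degree f <= N" "!!i. degree (coeff f i) <= N"
proof -
 obtain a where a: "!!x y. F x y = (\<Sum>i\<le>N. \<Sum>j\<le>N. a i j * x^i * y^j)"
  using assms unfolding bipoly_def by auto
 define f where "f = (\<Sum>i\<le>N. \<Sum>j\<le>N. monom (monom (a i j) i) j)"
 have cf: "coeff f l = (\<Sum>i\<le>N. if l <= N then monom (a i l) i else 0)" for l
  unfolding f_def coeff_sum by (intro sum.cong refl) (simp add: coeff_monom)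
 have "degree f <= N" by (rule degree_le) (auto simp: cf)
 moreover have "degree (coeff f l) <= N" for l
  unfolding cf by (rule degree_le) (auto simp: coeff_sum intro!: sum.neutral)
 moreover have "F = ev2 f"
  by (intro ext) (simp add: a ev2_def f_def poly_sum poly_monom algebra_simps)
 ultimately show ?thesis using that by blast
qed

text \<open>On the zero set of the common factor both gradients are multiples of the gradient of
  \<open>H\<close>, so the Jacobian determinant vanishes there.\<close>

lemma nondeg_zero_not_common_factor:
 assumes nd: "nondeg_zero (\<lambda>x y. H x y * F x y) (\<lambda>x y. H x y * G x y) x y"
  and H: "((\<lambda>x. H x y) has_field_derivative hx) (at x)" "((\<lambda>y. H x y) has_field_derivative hy) (at y)"
  and F: "((\<lambda>x. F x y) has_field_derivative fx) (at x)" "((\<lambda>y. F x y) has_field_derivative fy) (at y)"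
  and G: "((\<lambda>x. G x y) has_field_derivative gx) (at x)" "((\<lambda>y. G x y) has_field_derivative gy) (at y)"
 shows "H x y ~= 0"
proof
 assume H0: "H x y = 0"
 obtain px py qx qy where d:
   "((\<lambda>x. H x y * F x y) has_field_derivative px) (at x)" "((\<lambda>y. H x y * F x y) has_field_derivative py) (at y)"
   "((\<lambda>x. H x y * G x y) has_field_derivative qx) (at x)" "((\<lambda>y. H x y * G x y) has_field_derivative qy) (at y)"
   and nz: "px * qy - py * qx ~= 0"
  using nd unfolding nondeg_zero_def by blast
 have "px = hx * F x y" "py = hy * F x y" "qx = hx * G x y" "qy = hy * G x y"
  using DERIV_unique[OF d(1) DERIV_mult[OF H(1) F(1)]] DERIV_unique[OF d(2) DERIV_mult[OF H(2) F(2)]]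
   DERIV_unique[OF d(3) DERIV_mult[OF H(1) G(1)]] DERIV_unique[OF d(4) DERIV_mult[OF H(2) G(2)]] H0 by auto
 then show False using nz by (simp add: algebra_simps)
qed

lemma bipoly_nonzero_roots:
 assumes "bipoly N F" "F x y0 ~= 0"
 shows "finite {y. F x y = 0}" "card {y. F x y = 0} <= N"
proof -
 obtain a where a: "!!x y. F x y = (\<Sum>i\<le>N. \<Sum>j\<le>N. a i j * x^i * y^j)"
  using assms unfolding bipoly_def by auto
 define p where "p = (\<Sum>i\<le>N. \<Sum>j\<le>N. monom (a i j * x^i) j)"
 have p: "poly p y = F x y" for y by (simp add: p_def a poly_sum poly_monom)
 have "p ~= 0" using assms p[of y0] by auto
 have "degree p <= N" unfolding p_def
  by (intro degree_sum_le) (auto intro: order_trans[OF degree_monom_le])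
 moreover have "{y. F x y = 0} = {y. poly p y = 0}" by (simp add: p)
 ultimately show "finite {y. F x y = 0}" "card {y. F x y = 0} <= N"
  using poly_roots_finite[OF \<open>p ~= 0\<close>] card_poly_roots_bound[OF \<open>p ~= 0\<close>] by auto
qed

text \<open>Nondegenerate zeros avoid the zero set of the gcd, so they are common zeros of coprime
  polynomials: their abscissae are roots of the eliminant, and each vertical line carries at most
  \<open>N\<close> of them. The bound is cubic in \<open>N\<close> rather than quadratic, which is
  enough for a logarithmic \<open>N\<close>.\<close>

theorem card_nondeg_zeros_le:
 assumes F: "bipoly N F" and G: "bipoly N G"
 shows "finite {(x,y). nondeg_zero F G x y} \<and> card {(x,y). nondeg_zero F G x y} <= (2*N*(N+1) + N) * N"
proof (cases "\<exists>x y. nondeg_zero F G x y")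
 case False
 then have "{(x,y). nondeg_zero F G x y} = {}" by auto
 then show ?thesis by (metis card.empty finite.emptyI le0)
next
 case True
 obtain f where f: "F = ev2 f" "degree f <= N" "!!i. degree (coeff f i) <= N" using bipoly_ev2[OF F] by metis
 obtain g where g: "G = ev2 g" "degree g <= N" "!!i. degree (coeff g i) <= N" using bipoly_ev2[OF G] by metis
 have nz: "f ~= 0" "g ~= 0"
 proof -
  have "\<not> nondeg_zero (\<lambda>x y. 0) Q x y \<and> \<not> nondeg_zero Q (\<lambda>x y. 0) x y" for Q x y
   unfolding nondeg_zero_def
   by (auto dest!: DERIV_unique[OF _ DERIV_const])
  moreover have "ev2 0 = (\<lambda>x y. 0)" by (simp add: ev2_def fun_eq_iff)
  ultimately show "f ~= 0" "g ~= 0" using True f g by metis+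
 qed
 define h where "h = gcd f g"
 obtain f1 where f1: "f = h * f1" unfolding h_def by (metis dvdE gcd_dvd1)
 obtain g1 where g1: "g = h * g1" unfolding h_def by (metis dvdE gcd_dvd2)
 have "h ~= 0" using nz f1 by auto
 have cop: "coprime f1 g1"
 proof -
  have "normalize h * gcd f1 g1 = normalize h"
   using gcd_mult_left[of h f1 g1] by (metis f1 g1 h_def normalize_gcd normalize_mult)
  then have "gcd f1 g1 = 1" using \<open>h ~= 0\<close> by (metis mult_cancel_left2 normalize_eq_0_iff)
  then show ?thesis by (rule gcd_eq_1_imp_coprime)
 qed
 have nz1: "f1 ~= 0" "g1 ~= 0" using nz f1 g1 by auto
 have dg: "degree f1 <= N" "degree g1 <= N"
  using f(2) g(2) nz1 \<open>h ~= 0\<close> unfolding f1 g1 by (simp_all add: degree_mult_eq)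
 obtain r where r: "r ~= 0" "degree r <= 2*N*(N+1) + N"
  "!!x y. ev2 f1 x y = 0 ==> ev2 g1 x y = 0 ==> poly r x = 0"
  using coprime_bipoly_elimination[OF cop nz1 dg(1) inner_degree_factor_le[OF f1 nz(1) f(3)]
    dg(2) inner_degree_factor_le[OF g1 nz(2) g(3)]] by metis
 have fh: "F = (\<lambda>x y. ev2 h x y * ev2 f1 x y)" "G = (\<lambda>x y. ev2 h x y * ev2 g1 x y)"
  by (simp_all add: f(1) g(1) f1 g1 ev2_mult fun_eq_iff)
 have root: "poly r x = 0" if "nondeg_zero F G x y" for x y
 proof -
  obtain hy where hy: "((\<lambda>y. ev2 h x y) has_field_derivative hy) (at y)" using ev2_DERIV_y by blast
  obtain fy where fy: "((\<lambda>y. ev2 f1 x y) has_field_derivative fy) (at y)" using ev2_DERIV_y by blast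
  obtain gy where gy: "((\<lambda>y. ev2 g1 x y) has_field_derivative gy) (at y)" using ev2_DERIV_y by blast
  have "ev2 h x y ~= 0"
   by (rule nondeg_zero_not_common_factor[OF that[unfolded fh] ev2_DERIV_x hy ev2_DERIV_x fy ev2_DERIV_x gy])
  moreover have "F x y = 0" "G x y = 0" using that by (auto simp: nondeg_zero_def)
  ultimately show ?thesis using r(3) by (auto simp: fh)
 qed
 define X where "X = {x. poly r x = 0}"
 define Y where "Y x = {y. nondeg_zero F G x y}" for x
 have X: "finite X" "card X <= 2*N*(N+1) + N"
  unfolding X_def using poly_roots_finite[OF r(1)] card_poly_roots_bound[OF r(1)] r(2) by auto
 have Y: "finite (Y x) \<and> card (Y x) <= N" for x
 proof (cases "Y x = {}")
  case True
  then show ?thesis by auto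
 next
  case False
  then obtain y where y: "nondeg_zero F G x y" by (auto simp: Y_def)
  \<comment> \<open>If both polynomials vanished identically on this vertical line, both derivatives
    in \<open>y\<close> would be 0 at the nondegenerate point.\<close>
  have "\<exists>y. F x y ~= 0 \<or> G x y ~= 0"
  proof (rule ccontr)
   assume "\<not> ?thesis"
   then have "(\<lambda>y. F x y) = (\<lambda>y. 0)" "(\<lambda>y. G x y) = (\<lambda>y. 0)" by auto
   then show False using y unfolding nondeg_zero_def
    by (auto dest!: DERIV_unique[OF _ DERIV_const])
  qed
  then obtain P y0 where P: "P = F \<or> P = G" "P x y0 ~= 0" by blast
  have "Y x \<subseteq> {y. P x y = 0}" using P by (auto simp: Y_def nondeg_zero_def)
  moreover have "finite {y. P x y = 0}" "card {y. P x y = 0} <= N"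
   using bipoly_nonzero_roots[of N P x y0] P F G by auto
  ultimately show ?thesis by (meson card_mono finite_subset le_trans)
 qed
 have eq: "{(x,y). nondeg_zero F G x y} = Sigma X Y"
  using root by (auto simp: X_def Y_def)
 have "finite (Sigma X Y)" using X Y by auto
 moreover have "card (Sigma X Y) <= card X * N"
  using X Y by (subst card_SigmaI) (auto intro: sum_bounded_above[where K=N, simplified])
 moreover have "card X * N <= (2*N*(N+1) + N) * N" using X by (intro mult_right_mono) auto
 ultimately show ?thesis unfolding eq by linarith
qed

section \<open>Double power series with geometric coefficient bounds\<close>

text \<open>A Cauchy estimate, which encodes convergence on the open polydisc of radius
  \<open>R\<close>. The type is generic because the same coefficients are summed over the reals and
  over the complex numbers.\<close>

definition dps_bd :: "(nat => nat => 'a::real_normed_field) => real => real => bool" where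
 "dps_bd c R C \<longleftrightarrow> 0 < R \<and> (\<forall>i j. norm (c i j) * R^(i+j) <= C)"

definition dval :: "(nat => nat => 'a::{real_normed_field,banach}) => 'a => 'a => 'a" where
 "dval c x y = infsum (\<lambda>(i,j). c i j * x^i * y^j) UNIV"

definition dps_dx :: "(nat => nat => 'a::real_normed_field) => nat => nat => 'a" where
 "dps_dx c i j = of_nat (Suc i) * c (Suc i) j"

definition dps_dy :: "(nat => nat => 'a::real_normed_field) => nat => nat => 'a" where
 "dps_dy c i j = of_nat (Suc j) * c i (Suc j)"

lemma dps_bdD: "dps_bd c R C ==> norm (c i j) <= C / R^(i+j)"
 by (auto simp: dps_bd_def field_simps)

lemma dps_bd_pos: "dps_bd c R C ==> 0 < R" by (simp add: dps_bd_def)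

lemma dps_bd_nonneg: "dps_bd c R C ==> 0 <= C"
 unfolding dps_bd_def by (metis norm_ge_zero order_trans mult_1_right add_0 power_0)

lemma geometric_product_has_sum:
 fixes a b :: real
 assumes "0 <= a" "a < 1" "0 <= b" "b < 1"
 shows "((\<lambda>(i,j). C * a^i * b^j) has_sum (C / ((1 - a) * (1 - b)))) UNIV"
proof -
 have ga: "((\<lambda>i. a^i) has_sum (1 / (1 - a))) UNIV"
  using assms geometric_sums[of a] by (intro norm_summable_imp_has_sum) (auto simp: power_abs)
 have gb: "((\<lambda>i. b^i) has_sum (1 / (1 - b))) UNIV"
  using assms geometric_sums[of b] by (intro norm_summable_imp_has_sum) (auto simp: power_abs)
 have inner: "((\<lambda>j. (\<lambda>(i,j). a^i * b^j) (i,j)) has_sum (a^i * (1 / (1 - b)))) UNIV" for i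
  using has_sum_cmult_right[OF gb, of "a^i"] by simp
 have outer: "((\<lambda>i. a^i * (1 / (1 - b))) has_sum (1 / (1 - a) * (1 / (1 - b)))) UNIV"
  by (rule has_sum_cmult_left[OF ga])
 have "(\<lambda>(i,j). a^i * b^j) summable_on (UNIV \<times> UNIV)"
  by (rule summable_on_SigmaI[OF inner]) (use outer assms in \<open>auto simp: summable_on_def\<close>)
 then have "((\<lambda>(i,j). a^i * b^j) has_sum (1 / (1 - a) * (1 / (1 - b)))) (UNIV \<times> UNIV)"
  by (rule has_sum_SigmaI[OF inner outer])
 from has_sum_cmult_right[OF this, of C] show ?thesis
  by (simp add: case_prod_unfold mult.assoc)
qed

lemma dps_term_bound:
 assumes "dps_bd c R C"
 shows "norm (c i j * x^i * y^j) <= C * (norm x / R)^i * (norm y / R)^j"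
proof -
 have "norm (c i j * x^i * y^j) = norm (c i j) * (norm x^i * norm y^j)"
  by (simp add: norm_mult norm_power)
 also have "... <= C / R^(i+j) * (norm x^i * norm y^j)"
  by (intro mult_right_mono dps_bdD[OF assms]) auto
 finally show ?thesis by (simp add: power_add power_divide)
qed

lemma dval_has_sum:
 fixes c :: "nat => nat => 'a::{real_normed_field,banach}"
 assumes "dps_bd c R C" "norm x < R" "norm y < R"
 shows dps_abs_summable: "(\<lambda>p. norm ((\<lambda>(i,j). c i j * x^i * y^j) p)) summable_on UNIV"
  and "((\<lambda>(i,j). c i j * x^i * y^j) has_sum dval c x y) UNIV"
  and "norm (dval c x y) <= C / ((1 - norm x / R) * (1 - norm y / R))"
proof -
 have R: "R > 0" and C: "C >= 0" using assms dps_bd_pos dps_bd_nonneg by blast+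
 have g: "((\<lambda>(i,j). C * (norm x / R)^i * (norm y / R)^j) has_sum (C / ((1 - norm x / R) * (1 - norm y / R)))) UNIV"
  using assms R by (intro geometric_product_has_sum) auto
 show abs: "(\<lambda>p. norm ((\<lambda>(i,j). c i j * x^i * y^j) p)) summable_on UNIV"
 proof (rule Infinite_Sum.abs_summable_on_comparison_test[where g = "\<lambda>(i,j). C * (norm x / R)^i * (norm y / R)^j"])
  show "(\<lambda>p. norm ((\<lambda>(i,j). C * (norm x / R)^i * (norm y / R)^j) p)) summable_on UNIV"
   using g C R by (auto simp: summable_on_def case_prod_unfold norm_mult)
 qed (use dps_term_bound[OF assms(1)] R C in \<open>auto simp: abs_mult\<close>)
 show hs: "((\<lambda>(i,j). c i j * x^i * y^j) has_sum dval c x y) UNIV"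
  unfolding dval_def by (rule has_sum_infsum[OF Infinite_Sum.abs_summable_summable[OF abs]])
 show "norm (dval c x y) <= C / ((1 - norm x / R) * (1 - norm y / R))"
  by (rule norm_infsum_le[OF hs g]) (use dps_term_bound[OF assms(1)] in auto)
qed

lemma dval_norm_le:
 fixes c :: "nat => nat => 'a::{real_normed_field,banach}"
 assumes bd: "dps_bd c R C" and xy: "norm x <= R/2" "norm y <= R/2"
 shows "norm (dval c x y) <= 4 * C"
proof -
 have R: "R > 0" and C: "C >= 0" using assms dps_bd_pos dps_bd_nonneg by blast+
 have "norm x / R <= 1/2" "norm y / R <= 1/2" using xy R by (auto simp: field_simps)
 then have "(1/2) * (1/2) <= (1 - norm x / R) * (1 - norm y / R)" by (intro mult_mono) linarith+
 then have "C / ((1 - norm x / R) * (1 - norm y / R)) <= C / ((1/2) * (1/2))"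
  using C \<open>norm x / R <= 1/2\<close> \<open>norm y / R <= 1/2\<close> by (intro divide_left_mono mult_pos_pos) linarith+
 moreover have "norm x < R" "norm y < R" using xy R by linarith+
 ultimately show ?thesis using dval_has_sum(3)[OF bd, of x y] by simp
qed

text \<open>Summing over \<open>j\<close> first turns the double series into a power series in
  \<open>x\<close>, to which one-variable results apply.\<close>

lemma dval_nested:
 fixes c :: "nat => nat => 'a::{real_normed_field,banach}"
 assumes "dps_bd c R C" "norm x < R" "norm y < R"
 shows "summable (\<lambda>j. c i j * y^j)"
  and "(\<lambda>i. (\<Sum>j. c i j * y^j) * x^i) sums dval c x y"
proof -
 have R: "R > 0" and C: "C >= 0" using assms dps_bd_pos dps_bd_nonneg by blast+
 have in_sum: "summable (\<lambda>j. norm (c i j * y^j))" for i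
 proof (rule summable_comparison_test)
  show "\<exists>N. \<forall>n\<ge>N. norm (norm (c i n * y^n)) <= C / R^i * (norm y / R)^n"
  proof (intro exI allI impI)
   fix n
   have "norm (c i n * y^n) <= C / R^(i+n) * norm y ^ n"
    unfolding norm_mult norm_power by (intro mult_right_mono dps_bdD[OF assms(1)]) auto
   then show "norm (norm (c i n * y^n)) <= C / R^i * (norm y / R)^n"
    by (simp add: power_add power_divide)
  qed
  show "summable (\<lambda>n. C / R^i * (norm y / R)^n)"
   using assms R by (intro summable_mult summable_geometric) auto
 qed
 show "summable (\<lambda>j. c i j * y^j)" by (rule summable_norm_cancel[OF in_sum])
 have inner: "((\<lambda>j. c i j * x^i * y^j) has_sum (\<Sum>j. c i j * y^j) * x^i) UNIV" for i
 proof -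
  have "((\<lambda>j. c i j * y^j) has_sum (\<Sum>j. c i j * y^j)) UNIV"
   by (rule norm_summable_imp_has_sum[OF in_sum summable_sums[OF summable_norm_cancel[OF in_sum]]])
  from has_sum_cmult_left[OF this, of "x^i"] show ?thesis by (simp add: mult_ac)
 qed
 have "((\<lambda>(i,j). c i j * x^i * y^j) has_sum dval c x y) (Sigma UNIV (\<lambda>_. UNIV))"
  using dval_has_sum(2)[OF assms] by simp
 then have "((\<lambda>i. (\<Sum>j. c i j * y^j) * x^i) has_sum dval c x y) UNIV"
  by (rule has_sum_SigmaD) (use inner in auto)
 then show "(\<lambda>i. (\<Sum>j. c i j * y^j) * x^i) sums dval c x y"
  by (rule has_sum_imp_sums)
qed

lemma dval_swap: "dval c x y = dval (\<lambda>i j. c j i) y x"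
 unfolding dval_def
 by (rule infsum_reindex_bij_witness[where i = prod.swap and j = prod.swap]) (auto simp: mult_ac)

lemma dps_bd_swap: "dps_bd c R C ==> dps_bd (\<lambda>i j. c j i) R C"
 unfolding dps_bd_def by (metis add.commute)

text \<open>Halving the radius absorbs the factor \<open>Suc i\<close>, which is at most
  \<open>2^i\<close>.\<close>

lemma dps_bd_dx:
 assumes "dps_bd c R C" shows "dps_bd (dps_dx c) (R/2) (C/R)"
proof -
 have R: "R > 0" and C: "C >= 0" using assms dps_bd_pos dps_bd_nonneg by blast+
 have "norm (dps_dx c i j) * (R/2)^(i+j) <= C / R" for i j
 proof -
  have i2: "real (Suc i) <= 2^i" by (induction i) auto
  have "norm (dps_dx c i j) * (R/2)^(i+j) = real (Suc i) * norm (c (Suc i) j) * (R/2)^(i+j)"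
   by (simp add: dps_dx_def norm_mult del: of_nat_Suc)
  also have "... <= 2^i * (C / R^(Suc i+j)) * (R/2)^(i+j)"
   using i2 R by (intro mult_right_mono mult_mono dps_bdD[OF assms]) auto
  also have "... = (C / R) * (1 / 2^j)"
   using R by (simp add: power_add power_divide)
  also have "... <= (C / R) * 1"
   using C R by (intro mult_left_mono) auto
  finally show ?thesis by simp
 qed
 then show ?thesis using R by (simp add: dps_bd_def)
qed

lemma dps_dy_swap: "dps_dy c = (\<lambda>i j. dps_dx (\<lambda>i j. c j i) j i)"
 by (simp add: dps_dy_def dps_dx_def fun_eq_iff)

lemma dps_bd_dy:
 assumes "dps_bd c R C" shows "dps_bd (dps_dy c) (R/2) (C/R)"
 unfolding dps_dy_swap by (rule dps_bd_swap[OF dps_bd_dx[OF dps_bd_swap[OF assms]]])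

text \<open>For fixed \<open>y\<close> the nested form is a power series in \<open>x\<close> and may
  be differentiated termwise; the result is then identified with the double series of
  \<open>dps_dx c\<close>. This works on the whole polydisc, not only on the half radius of
  \<open>dps_bd_dx\<close>.\<close>

lemma dval_deriv_x:
 fixes c :: "nat => nat => 'a::{real_normed_field,banach}"
 assumes "dps_bd c R C" "norm x < R" "norm y < R"
 shows "((\<lambda>x. dval c x y) has_field_derivative dval (dps_dx c) x y) (at x)"
proof -
 have R: "R > 0" using assms dps_bd_pos by blast
 define a where "a i = (\<Sum>j. c i j * y^j)" for i
 have sm: "summable (\<lambda>i. a i * z^i)" "(\<Sum>i. a i * z^i) = dval c z y" if "norm z < R" for z
  using dval_nested(2)[OF assms(1) that assms(3)] by (auto simp: a_def sums_iff)
 have D: "((\<lambda>z. \<Sum>n. a n * z^n) has_field_derivative (\<Sum>n. diffs a n * x^n)) (at x)"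
  by (rule termdiffs_strong') (use sm assms in auto)
 have ev: "\<forall>\<^sub>F z in nhds x. (\<Sum>n. a n * z^n) = dval c z y"
  using assms(2) sm(2) by (intro eventually_nhds_in_open[of "ball 0 R" x, THEN eventually_mono]) auto
 have D2: "((\<lambda>z. dval c z y) has_field_derivative (\<Sum>n. diffs a n * x^n)) (at x)"
  using D DERIV_cong_ev[OF refl ev refl] by simp
 \<comment> \<open>The differentiated double series converges absolutely on the same polydisc, by comparison at an intermediate radius.\<close>
 obtain \<rho> where \<rho>: "norm x < \<rho>" "norm y < \<rho>" "\<rho> < R"
  using assms dense[of "max (norm x) (norm y)" R] by auto
 have \<rho>0: "0 < \<rho>" using \<rho>(1) norm_ge_zero[of x] by linarith
 define q where "q = \<rho> / R"
 have q: "0 < q" "q < 1" using \<rho> R \<rho>0 by (auto simp: q_def)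
 have "(\<lambda>n. real n * q^n) \<longlonglongrightarrow> 0"
  using q by (intro powser_times_n_limit_0) auto
 then obtain K where K: "!!n. norm (real n * q^n) <= K"
  using convergent_imp_Bseq[OF convergentI, of "\<lambda>n. real n * q^n" 0] unfolding Bseq_def by blast
 have bd': "dps_bd (dps_dx c) \<rho> (K * C / \<rho>)"
 proof -
  have "norm (dps_dx c i j) * \<rho>^(i+j) <= K * C / \<rho>" for i j
  proof -
   have "norm (dps_dx c i j) * \<rho>^(i+j) = real (Suc i) * norm (c (Suc i) j) * \<rho>^(i+j)"
    by (simp add: dps_dx_def norm_mult del: of_nat_Suc)
   also have "... <= real (Suc i) * (C / R^(Suc i+j)) * \<rho>^(i+j)"
    using \<rho>0 by (intro mult_right_mono mult_left_mono dps_bdD[OF assms(1)]) auto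
   also have "... = (real (Suc i) * q^Suc i) * q^j * (C / \<rho>)"
    using R \<rho>0 by (simp add: q_def power_add power_divide field_simps)
   also have "... <= K * 1 * (C / \<rho>)"
   proof (intro mult_right_mono mult_mono)
    show "real (Suc i) * q^Suc i <= K" using K[of "Suc i"] by (metis abs_le_D1 real_norm_def)
    show "q^j <= 1" using q by (intro power_le_one) auto
    show "0 <= K" using K[of 0] by simp
   qed (use q dps_bd_nonneg[OF assms(1)] \<rho>0 in auto)
   finally show ?thesis by simp
  qed
  then show ?thesis using \<rho>0 by (simp add: dps_bd_def)
 qed
 have "(\<lambda>i. (\<Sum>j. dps_dx c i j * y^j) * x^i) sums dval (dps_dx c) x y"
  using dval_nested(2)[OF bd'] \<rho> by auto
 moreover have "(\<Sum>j. dps_dx c i j * y^j) = diffs a i" for i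
  using suminf_mult[OF dval_nested(1)[OF assms(1-3), of "Suc i"], of "of_nat (Suc i)"]
  by (simp add: dps_dx_def diffs_def a_def mult.assoc)
 ultimately have "(\<Sum>n. diffs a n * x^n) = dval (dps_dx c) x y" by (simp add: sums_iff)
 then show ?thesis using D2 by simp
qed

lemma dval_deriv_y:
 fixes c :: "nat => nat => 'a::{real_normed_field,banach}"
 assumes "dps_bd c R C" "norm x < R" "norm y < R"
 shows "((\<lambda>y. dval c x y) has_field_derivative dval (dps_dy c) x y) (at y)"
 using dval_deriv_x[OF dps_bd_swap[OF assms(1)] assms(3,2)]
 by (simp add: dval_swap[of c] dval_swap[of "\<lambda>i j. dps_dx (\<lambda>i j. c j i) j i"] dps_dy_swap)

lemma dval_lipschitz:
 fixes c :: "nat => nat => 'a::{real_normed_field,banach}"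
 assumes bd: "dps_bd c R C" and "norm x <= R/4" "norm y <= R/4" "norm x' <= R/4" "norm y' <= R/4"
 shows "norm (dval c x y - dval c x' y') <= 4 * C / R * (norm (x - x') + norm (y - y'))"
proof -
 have R: "R > 0" using assms dps_bd_pos by blast
 have b1: "norm (dval (dps_dx c) u v) <= 4 * C / R" if "norm u <= R/4" "norm v <= R/4" for u v
  using dval_norm_le[OF dps_bd_dx[OF bd], of u v] that by simp
 have b2: "norm (dval (dps_dy c) u v) <= 4 * C / R" if "norm u <= R/4" "norm v <= R/4" for u v
  using dval_norm_le[OF dps_bd_dy[OF bd], of u v] that by simp
 have "norm (dval c x y - dval c x' y) <= 4 * C / R * norm (x - x')"
  by (rule field_differentiable_bound[of "cball 0 (R/4)" _ "\<lambda>z. dval (dps_dx c) z y"])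
    (use assms R b1 in \<open>auto intro!: has_field_derivative_at_within[OF dval_deriv_x[OF bd]]\<close>)
 moreover have "norm (dval c x' y - dval c x' y') <= 4 * C / R * norm (y - y')"
  by (rule field_differentiable_bound[of "cball 0 (R/4)" _ "\<lambda>z. dval (dps_dy c) x' z"])
    (use assms R b2 in \<open>auto intro!: has_field_derivative_at_within[OF dval_deriv_y[OF bd]]\<close>)
 moreover have "norm (dval c x y - dval c x' y') \<le>
   norm (dval c x y - dval c x' y) + norm (dval c x' y - dval c x' y')"
  by (metis norm_triangle_ineq diff_add_cancel add_diff_eq)
 ultimately show ?thesis by (simp add: distrib_left)
qed

lemma dval_continuous:
 fixes c :: "nat => nat => 'a::{real_normed_field,banach}"
 assumes bd: "dps_bd c R C"
 shows "continuous_on (cball 0 (R/4) \<times> cball 0 (R/4)) (\<lambda>(x,y). dval c x y)"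
proof -
 have R: "R > 0" and C: "C >= 0" using assms dps_bd_pos dps_bd_nonneg by blast+
 have "dist (dval c x y) (dval c x' y') <= (8 * C / R) * dist (x,y) (x',y')"
  if "(x,y) \<in> cball 0 (R/4) \<times> cball 0 (R/4)" "(x',y') \<in> cball 0 (R/4) \<times> cball 0 (R/4)" for x y x' y'
 proof -
  have "norm (x - x') <= dist (x,y) (x',y')" "norm (y - y') <= dist (x,y) (x',y')"
   using norm_fst_le[of "(x,y) - (x',y')"] norm_snd_le[of "(y - y')" "(x - x')"]
   by (auto simp: dist_norm norm_fst_le norm_snd_le)
  then have "4 * C / R * (norm (x - x') + norm (y - y')) <= 4 * C / R * (2 * dist (x,y) (x',y'))"
   using C R by (intro mult_left_mono) auto
  then show ?thesis using dval_lipschitz[OF bd, of x y x' y'] that by (simp add: dist_norm)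
 qed
 then have "(8 * C / R)-lipschitz_on (cball 0 (R/4) \<times> cball 0 (R/4)) (\<lambda>(x,y). dval c x y)"
  using C R by (intro lipschitz_onI) auto
 then show ?thesis by (rule lipschitz_on_continuous_on)
qed

lemma dval_of_real:
 assumes "dps_bd c R C" "\<bar>x\<bar> < R" "\<bar>y\<bar> < R"
 shows "dval (\<lambda>i j. complex_of_real (c i j)) (of_real x) (of_real y) = of_real (dval c x y)"
proof -
 have "((\<lambda>(i,j). c i j * x^i * y^j) has_sum dval c x y) UNIV"
  using dval_has_sum(2)[OF assms(1)] assms by simp
 then have "((\<lambda>p. of_real ((\<lambda>(i,j). c i j * x^i * y^j) p)) has_sum complex_of_real (dval c x y)) UNIV"
  by (rule has_sum_of_real)
 then show ?thesis unfolding dval_def by (intro infsumI) (simp add: case_prod_unfold)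
qed

definition dps_trunc :: "nat => (nat => nat => real) => nat => nat => real" where
 "dps_trunc N c i j = (if i <= N \<and> j <= N then c i j else 0)"

lemma dps_bd_trunc: "dps_bd c R C ==> dps_bd (dps_trunc N c) R C"
 using dps_bd_nonneg[of c R C] by (auto simp: dps_bd_def dps_trunc_def)

text \<open>Every surviving term has total degree above \<open>N\<close>, so halving the radius
  gains \<open>2^N\<close>. This geometric rate is what makes logarithmic degrees
  sufficient.\<close>

lemma dps_bd_trunc_diff:
 assumes "dps_bd c R C"
 shows "dps_bd (\<lambda>i j. c i j - dps_trunc N c i j) (R/2) (C / 2^N)"
proof -
 have R: "R > 0" and C: "C >= 0" using assms dps_bd_pos dps_bd_nonneg by blast+
 have "norm (c i j - dps_trunc N c i j) * (R/2)^(i+j) <= C / 2^N" for i j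
 proof (cases "i <= N \<and> j <= N")
  case False
  then have "N <= i + j" by auto
  have "norm (c i j - dps_trunc N c i j) * (R/2)^(i+j) = norm (c i j) * R^(i+j) / 2^(i+j)"
   using False by (auto simp: dps_trunc_def power_divide)
  also have "... <= C / 2^N"
   using assms \<open>N <= i + j\<close> C by (intro frac_le) (auto simp: dps_bd_def)
  finally show ?thesis .
 qed (use C in \<open>auto simp: dps_trunc_def\<close>)
 then show ?thesis using R by (simp add: dps_bd_def)
qed

lemma dval_diff:
 fixes c d :: "nat => nat => 'a::{real_normed_field,banach}"
 assumes "dps_bd c R C" "dps_bd d R' D" "norm x < R" "norm y < R" "norm x < R'" "norm y < R'"
 shows "dval (\<lambda>i j. c i j - d i j) x y = dval c x y - dval d x y"
proof -
 have "((\<lambda>p. (\<lambda>(i,j). c i j * x^i * y^j) p + - (\<lambda>(i,j). d i j * x^i * y^j) p) has_sum (dval c x y + - dval d x y)) UNIV"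
  by (intro has_sum_add has_sum_uminusI dval_has_sum(2)[OF assms(1,3,4)] dval_has_sum(2)[OF assms(2,5,6)])
 then show ?thesis unfolding dval_def[of "\<lambda>i j. c i j - d i j"]
  by (intro infsumI) (simp add: case_prod_unfold algebra_simps)
qed

lemma dps_dx_diff: "dps_dx (\<lambda>i j. c i j - d i j) = (\<lambda>i j. dps_dx c i j - dps_dx d i j)"
 and dps_dy_diff: "dps_dy (\<lambda>i j. c i j - d i j) = (\<lambda>i j. dps_dy c i j - dps_dy d i j)"
 by (simp_all add: dps_dx_def dps_dy_def fun_eq_iff algebra_simps)

lemma dval_trunc_finite: "dval (dps_trunc N c) x y = (\<Sum>i\<le>N. \<Sum>j\<le>N. c i j * x^i * y^j)"
proof -
 have "dval (dps_trunc N c) x y = infsum (\<lambda>(i,j). dps_trunc N c i j * x^i * y^j) ({..N} \<times> {..N})"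
  unfolding dval_def by (rule infsum_cong_neutral) (auto simp: dps_trunc_def split: if_splits)
 also have "... = (\<Sum>(i,j)\<in>{..N} \<times> {..N}. dps_trunc N c i j * x^i * y^j)" by simp
 also have "... = (\<Sum>i\<le>N. \<Sum>j\<le>N. c i j * x^i * y^j)"
  unfolding sum.cartesian_product[symmetric] by (intro sum.cong refl) (auto simp: dps_trunc_def)
 finally show ?thesis .
qed

lemma dps_dx_trunc_finite:
 "dval (dps_dx (dps_trunc N c)) x y = (\<Sum>i\<le>N. \<Sum>j\<le>N. dps_dx (dps_trunc N c) i j * x^i * y^j)"
 and dps_dy_trunc_finite:
 "dval (dps_dy (dps_trunc N c)) x y = (\<Sum>i\<le>N. \<Sum>j\<le>N. dps_dy (dps_trunc N c) i j * x^i * y^j)"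
proof -
 have "dps_trunc N (dps_dx (dps_trunc N c)) = dps_dx (dps_trunc N c)"
  "dps_trunc N (dps_dy (dps_trunc N c)) = dps_dy (dps_trunc N c)"
  by (auto simp: dps_trunc_def dps_dx_def dps_dy_def fun_eq_iff)
 then show "dval (dps_dx (dps_trunc N c)) x y = (\<Sum>i\<le>N. \<Sum>j\<le>N. dps_dx (dps_trunc N c) i j * x^i * y^j)"
  "dval (dps_dy (dps_trunc N c)) x y = (\<Sum>i\<le>N. \<Sum>j\<le>N. dps_dy (dps_trunc N c) i j * x^i * y^j)"
  by (metis dval_trunc_finite)+
qed

section \<open>Stability of zeros of plane maps under perturbation\<close>

text \<open>The difference of \<open>g\<close> and \<open>A\<close> has Lipschitz constant
  \<open>m/2\<close> on the convex set \<open>T\<close>, half of the expansion factor of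
  \<open>A\<close>.\<close>

lemma near_linear_expansive:
 fixes g :: "'a::euclidean_space => 'a"
 assumes "convex T" and der: "!!w. w \<in> T ==> (g has_derivative g' w) (at w within T)"
  and A: "linear A" "!!h. m * norm h <= norm (A h)"
  and close: "!!w h. w \<in> T ==> norm (g' w h - A h) <= m/2 * norm h"
  and w: "w \<in> T" "w' \<in> T"
 shows "norm ((g w - A w) - (g w' - A w')) <= m/2 * norm (w - w')"
  and "m/2 * norm (w - w') <= norm (g w - g w')"
proof -
 have dA: "(A has_derivative A) (at x within T)" for x
  using A(1) by (simp add: linear_imp_has_derivative)
 show *: "norm ((g w - A w) - (g w' - A w')) <= m/2 * norm (w - w')"
 proof (rule differentiable_bound[OF \<open>convex T\<close>, where f' = "\<lambda>w h. g' w h - A h"])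
  show "((\<lambda>x. g x - A x) has_derivative (\<lambda>h. g' x h - A h)) (at x within T)" if "x \<in> T" for x
   by (intro has_derivative_diff der dA that)
  show "onorm (\<lambda>h. g' x h - A h) <= m / 2" if "x \<in> T" for x
   by (rule onorm_le) (use close[OF that] in auto)
 qed (use w in auto)
 have "m * norm (w - w') <= norm (A w - A w')"
  using A(2)[of "w - w'"] linear_diff[OF A(1)] by simp
 also have "... <= norm (g w - g w') + norm ((g w - A w) - (g w' - A w'))"
  using norm_triangle_ineq4[of "g w - g w'" "(g w - A w) - (g w' - A w')"] by simp
 finally show "m/2 * norm (w - w') <= norm (g w - g w')" using * by (simp add: field_simps)
qed

lemma near_linear_zero:
 fixes g :: "'a::euclidean_space => 'a"
 assumes der: "!!w. w \<in> cball z \<rho> ==> (g has_derivative g' w) (at w within cball z \<rho>)"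
  and A: "linear A" "!!h. m * norm h <= norm (A h)"
  and close: "!!w h. w \<in> cball z \<rho> ==> norm (g' w h - A h) <= m/2 * norm h"
  and m: "m > 0" and \<rho>: "\<rho> >= 0" and gz: "norm (g z) <= m * \<rho> / 2"
 shows "\<exists>w\<in>cball z \<rho>. g w = 0"
proof -
 have "inj A"
 proof (rule linear_injective_0[THEN iffD2, OF A(1)], intro allI impI)
  fix h assume "A h = 0"
  then show "h = 0" using A(2)[of h] m by (auto simp: mult_le_0_iff)
 qed
 then obtain B where B: "linear B" "!!x. B (A x) = x" "!!x. A (B x) = x"
  using linear_injective_isomorphism[OF A(1)] by auto
 have nB: "norm (B u) <= norm u / m" for u
  using A(2)[of "B u"] B(3) m by (simp add: field_simps)
 define \<Phi> where "\<Phi> w = w - B (g w)" for w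
 have lip: "norm (\<Phi> w - \<Phi> w') <= 1/2 * norm (w - w')" if "w \<in> cball z \<rho>" "w' \<in> cball z \<rho>" for w w'
 proof -
  have "\<Phi> w - \<Phi> w' = - B ((g w - A w) - (g w' - A w'))"
   using B by (simp add: \<Phi>_def linear_diff[OF B(1)])
  then have "norm (\<Phi> w - \<Phi> w') <= norm ((g w - A w) - (g w' - A w')) / m"
   using nB by simp
  also have "... <= (m/2 * norm (w - w')) / m"
   using near_linear_expansive(1)[OF convex_cball der A close that] m by (intro divide_right_mono) auto
  finally show ?thesis using m by simp
 qed
 have "\<exists>!w\<in>cball z \<rho>. \<Phi> w = w"
 proof (rule Banach_fix[where c = "1/2"])
  show "complete (cball z \<rho>)" by (simp add: complete_eq_closed)
  show "\<Phi> ` cball z \<rho> \<subseteq> cball z \<rho>"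
  proof clarify
   fix w assume w: "w \<in> cball z \<rho>"
   have "norm (\<Phi> z - z) <= \<rho>/2"
   proof -
    have "norm (B (g z)) <= (m * \<rho> / 2) / m"
     using nB[of "g z"] gz m by (meson divide_right_mono less_imp_le order_trans)
    then show ?thesis using m by (simp add: \<Phi>_def)
   qed
   moreover have "norm (\<Phi> w - \<Phi> z) <= 1/2 * \<rho>"
    using lip[OF w, of z] w \<rho> by (simp add: dist_norm norm_minus_commute)
   moreover have "norm (\<Phi> w - z) <= norm (\<Phi> w - \<Phi> z) + norm (\<Phi> z - z)"
    using norm_triangle_ineq[of "\<Phi> w - \<Phi> z" "\<Phi> z - z"] by simp
   ultimately show "\<Phi> w \<in> cball z \<rho>" by (simp add: dist_norm norm_minus_commute)
  qed
 qed (use \<rho> lip in \<open>auto simp: dist_norm\<close>)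
 then obtain w where "w \<in> cball z \<rho>" "\<Phi> w = w" by auto
 then have "B (g w) = 0" by (simp add: \<Phi>_def)
 then have "g w = 0" using B(3)[of "g w"] linear_0[OF A(1)] by simp
 then show ?thesis using \<open>w \<in> _\<close> by auto
qed

definition lin2 :: "real => real => real => real => plane => plane" where
 "lin2 a b c d = (\<lambda>(h,k). (a * h + b * k, c * h + d * k))"

lemma linear_lin2: "linear (lin2 a b c d)"
 unfolding lin2_def by (rule linearI) (auto simp: algebra_simps)

lemma norm_pair_le: "norm (p, q) <= \<bar>p::real\<bar> + \<bar>q::real\<bar>"
 by (simp add: norm_Pair sqrt_sum_squares_le_sum_abs)

text \<open>Cramer's rule: the determinant times a coordinate of \<open>h\<close> is a combination
  of the two coordinates of the image, with coefficients at most \<open>L\<close>.\<close>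

lemma lin2_lower:
 assumes "\<bar>a\<bar> <= L" "\<bar>b\<bar> <= L" "\<bar>c\<bar> <= L" "\<bar>d\<bar> <= L" "\<kappa> <= \<bar>a * d - b * c\<bar>" "0 < \<kappa>" "0 < L"
 shows "\<kappa> / (4 * L) * norm h <= norm (lin2 a b c d h)"
proof -
 obtain x y where h: "h = (x,y)" by (cases h)
 define p q where "p = a * x + b * y" and "q = c * x + d * y"
 let ?n = "norm (lin2 a b c d h)"
 have n: "?n = norm (p,q)" by (simp add: lin2_def h p_def q_def)
 have pq: "\<bar>p\<bar> <= ?n" "\<bar>q\<bar> <= ?n" unfolding n by (simp_all add: norm_Pair)
 have "(a * d - b * c) * x = d * p - b * q" "(a * d - b * c) * y = a * q - c * p"
  by (simp_all add: p_def q_def algebra_simps)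
 then have e: "\<bar>a * d - b * c\<bar> * \<bar>x\<bar> = \<bar>d * p - b * q\<bar>" "\<bar>a * d - b * c\<bar> * \<bar>y\<bar> = \<bar>a * q - c * p\<bar>"
  by (metis abs_mult)+
 have m: "\<bar>u * v\<bar> <= L * ?n" if "\<bar>u\<bar> <= L" "\<bar>v\<bar> <= ?n" for u v
  unfolding abs_mult using that assms by (intro mult_mono) auto
 have "\<bar>d * p - b * q\<bar> <= 2 * L * ?n" "\<bar>a * q - c * p\<bar> <= 2 * L * ?n"
  using m[OF assms(4) pq(1)] m[OF assms(2) pq(2)] m[OF assms(1) pq(2)] m[OF assms(3) pq(1)] by linarith+
 then have "\<kappa> * \<bar>x\<bar> <= 2 * L * ?n" "\<kappa> * \<bar>y\<bar> <= 2 * L * ?n"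
  using e mult_right_mono[OF assms(5), of "\<bar>x\<bar>"] mult_right_mono[OF assms(5), of "\<bar>y\<bar>"] by auto
 moreover have "norm h <= \<bar>x\<bar> + \<bar>y\<bar>" unfolding h by (rule norm_pair_le)
 ultimately have "\<kappa> * norm h <= 4 * L * ?n"
  using mult_left_mono[of "norm h" "\<bar>x\<bar> + \<bar>y\<bar>" \<kappa>] assms by (simp add: algebra_simps)
 then show ?thesis using assms by (simp add: field_simps)
qed

lemma lin2_close:
 assumes "\<bar>a - a'\<bar> <= e" "\<bar>b - b'\<bar> <= e" "\<bar>c - c'\<bar> <= e" "\<bar>d - d'\<bar> <= e"
 shows "norm (lin2 a b c d h - lin2 a' b' c' d' h) <= 4 * e * norm h"
proof -
 obtain x y where h: "h = (x,y)" by (cases h)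
 have xy: "\<bar>x\<bar> <= norm h" "\<bar>y\<bar> <= norm h" unfolding h by (simp_all add: norm_Pair)
 have m: "\<bar>u * v\<bar> <= e * norm h" if "\<bar>u\<bar> <= e" "\<bar>v\<bar> <= norm h" for u v
  unfolding abs_mult using that by (intro mult_mono) auto
 have "lin2 a b c d h - lin2 a' b' c' d' h = ((a-a')*x + (b-b')*y, (c-c')*x + (d-d')*y)"
  by (simp add: lin2_def h algebra_simps)
 then have "norm (lin2 a b c d h - lin2 a' b' c' d' h) <= \<bar>(a-a')*x + (b-b')*y\<bar> + \<bar>(c-c')*x + (d-d')*y\<bar>"
  using norm_pair_le by metis
 then show ?thesis
  using m[OF assms(1) xy(1)] m[OF assms(2) xy(2)] m[OF assms(3) xy(1)] m[OF assms(4) xy(2)] by linarith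
qed

lemma lin2_lower_det:
 assumes "m > 0" "!!h. m * norm h <= norm (lin2 a b c d h)"
 shows "a * d - b * c ~= 0"
proof
 assume z: "a * d - b * c = 0"
 have k: "h = 0" if "lin2 a b c d h = 0" for h using assms(2)[of h] that assms(1) by (auto simp: mult_le_0_iff)
 have "lin2 a b c d (b, - a) = 0" "lin2 a b c d (d, - c) = 0" using z by (auto simp: lin2_def zero_prod_def algebra_simps)
 then have "(b, -a) = 0" "(d, -c) = 0" using k by blast+
 then have "lin2 a b c d (1, 0) = 0" by (auto simp: lin2_def zero_prod_def)
 then show False using k[of "(1,0)"] by (auto simp: zero_prod_def)
qed

text \<open>One constant \<open>L\<close> bounds the entries of the Jacobian matrix and their
  Lipschitz constants, so that all later radii are explicit in \<open>L\<close> and in the lower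
  bound \<kappa> of the Jacobian.\<close>

definition C1_pair :: "real => (plane) set => (plane => plane) =>
  (plane => real) => (plane => real) => (plane => real) => (plane => real) => bool" where
 "C1_pair L D g a b c d \<longleftrightarrow> L >= 1 \<and>
   (\<forall>z\<in>D. (g has_derivative lin2 (a z) (b z) (c z) (d z)) (at z)) \<and>
   (\<forall>z\<in>D. \<bar>a z\<bar> <= L \<and> \<bar>b z\<bar> <= L \<and> \<bar>c z\<bar> <= L \<and> \<bar>d z\<bar> <= L) \<and>
   (\<forall>z\<in>D. \<forall>z'\<in>D. \<bar>a z - a z'\<bar> <= L * dist z z' \<and> \<bar>b z - b z'\<bar> <= L * dist z z' \<and>
     \<bar>c z - c z'\<bar> <= L * dist z z' \<and> \<bar>d z - d z'\<bar> <= L * dist z z')"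

text \<open>On a ball of radius \<kappa> / (32 L^2) the derivative moves by at most half of its
  lower bound \<kappa> / (4 L), so the map is expansive there.\<close>

lemma C1_pair_inj_small:
 assumes g: "C1_pair L D g a b c d" and D: "cball z \<rho> \<subseteq> D" and \<rho>: "0 <= \<rho>"
  and \<kappa>: "0 < \<kappa>" "\<kappa> <= \<bar>a z * d z - b z * c z\<bar>" and small: "\<rho> <= \<kappa> / (32 * L\<^sup>2)"
 shows "inj_on g (cball z \<rho>)"
proof (rule inj_onI)
 fix w w' assume w: "w \<in> cball z \<rho>" "w' \<in> cball z \<rho>" and eq: "g w = g w'"
 have zD: "z \<in> D" using D \<rho> by auto
 have L: "L >= 1" using g by (auto simp: C1_pair_def)
 define m where "m = \<kappa> / (4 * L)"
 have "m/2 * norm (w - w') <= norm (g w - g w')"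
 proof (rule near_linear_expansive(2)[OF convex_cball _ linear_lin2 _ _ w])
  show "(g has_derivative lin2 (a x) (b x) (c x) (d x)) (at x within cball z \<rho>)" if "x \<in> cball z \<rho>" for x
   using g D that unfolding C1_pair_def by (meson has_derivative_at_withinI subsetD)
  show "m * norm h <= norm (lin2 (a z) (b z) (c z) (d z) h)" for h
   unfolding m_def by (rule lin2_lower) (use g zD \<kappa> L in \<open>auto simp: C1_pair_def\<close>)
  show "norm (lin2 (a x) (b x) (c x) (d x) h - lin2 (a z) (b z) (c z) (d z) h) <= m/2 * norm h"
   if "x \<in> cball z \<rho>" for x h
  proof -
   have "L * dist x z <= L * \<rho>" using that L by (intro mult_left_mono) (auto simp: dist_commute)
   moreover have "\<bar>a x - a z\<bar> <= L * dist x z" "\<bar>b x - b z\<bar> <= L * dist x z"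
     "\<bar>c x - c z\<bar> <= L * dist x z" "\<bar>d x - d z\<bar> <= L * dist x z"
    using g D that zD unfolding C1_pair_def by (meson subsetD)+
   ultimately have "norm (lin2 (a x) (b x) (c x) (d x) h - lin2 (a z) (b z) (c z) (d z) h) <= 4 * (L * \<rho>) * norm h"
    by (intro lin2_close) linarith+
   also have "4 * (L * \<rho>) <= 4 * (L * (\<kappa> / (32 * L\<^sup>2)))" using small L by (intro mult_left_mono) auto
   also have "... = m/2" using L by (simp add: m_def power2_eq_square field_simps)
   finally show ?thesis by (simp add: mult_right_mono)
  qed
 qed
 moreover have "m > 0" using \<kappa> L by (simp add: m_def)
 ultimately show "w = w'" using eq by (auto simp: mult_le_0_iff)
qed

text \<open>Every such zero of \<open>g\<close> has a nondegenerate zero of the polynomial map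
  \<open>p\<close> within \<rho>/3, and two zeros of \<open>g\<close> sharing it would lie in one
  ball on which \<open>g\<close> is injective. So the polynomial count applies to
  \<open>Z\<close>.\<close>

lemma card_quantitative_zeros_le:
 fixes g p :: "plane => plane"
 assumes g: "C1_pair L D g a b c d"
  and p: "!!z. z \<in> D ==> (p has_derivative lin2 (a' z) (b' z) (c' z) (d' z)) (at z)"
  and pol: "bipoly N (\<lambda>x y. fst (p (x,y)))" "bipoly N (\<lambda>x y. snd (p (x,y)))"
  and near: "!!z. z \<in> D ==> norm (g z - p z) <= 2 * e \<and> \<bar>a z - a' z\<bar> <= e \<and> \<bar>b z - b' z\<bar> <= e \<and> \<bar>c z - c' z\<bar> <= e \<and> \<bar>d z - d' z\<bar> <= e"
  and \<kappa>: "0 < \<kappa>" "\<kappa> <= 1" and \<rho>0: "0 < \<rho>0" "\<rho>0 <= 1"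
  and Z: "!!z. z \<in> Z ==> cball z \<rho>0 \<subseteq> D \<and> g z = 0 \<and> \<kappa> <= \<bar>a z * d z - b z * c z\<bar>"
  and e: "e <= \<kappa>\<^sup>2 * \<rho>0 / (4000 * L^3)"
 shows "finite Z \<and> card Z <= (2*N*(N+1) + N) * N"
proof -
 have L: "L >= 1" using g by (auto simp: C1_pair_def)
 \<comment> \<open>Small enough to stay below \<rho>0 and to let the derivative of \<open>g\<close>
   vary by at most \<open>m/4\<close>; the other \<open>m/4\<close> of the allowance
   \<open>m/2\<close> is left for the derivative error \<open>e\<close>.\<close>
 define \<rho> where "\<rho> = \<kappa> * \<rho>0 / (64 * L\<^sup>2)"
 have L2: "1 <= L\<^sup>2" using L by simp
 have k1: "\<kappa> * \<rho>0 <= 1" using \<kappa> \<rho>0 by (simp add: mult_le_one)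
 have \<rho>: "0 < \<rho>" "\<rho> <= \<rho>0" "\<rho> <= \<kappa> / (64 * L\<^sup>2)"
 proof -
  show "0 < \<rho>" using \<kappa> \<rho>0 L by (simp add: \<rho>_def)
  have "\<kappa> * \<rho>0 <= \<rho>0 * (64 * L\<^sup>2)"
   using mult_mono[of \<kappa> "64 * L\<^sup>2" \<rho>0 \<rho>0] \<kappa> \<rho>0 L2 by (simp add: mult.commute)
  then show "\<rho> <= \<rho>0" unfolding \<rho>_def using L2 by (subst pos_divide_le_eq) auto
  show "\<rho> <= \<kappa> / (64 * L\<^sup>2)" unfolding \<rho>_def using \<kappa> \<rho>0 L2 by (intro divide_right_mono) auto
 qed
 define m where "m = \<kappa> / (4 * L)"
 have m: "m > 0" using \<kappa> L by (simp add: m_def)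
 have e1: "e <= \<kappa> / (64 * L)"
 proof -
  have "\<kappa>\<^sup>2 * \<rho>0 / (4000 * L^3) <= \<kappa> / (64 * L)"
  proof (rule frac_le)
   show "\<kappa>\<^sup>2 * \<rho>0 <= \<kappa>" using k1 \<kappa> by (simp add: power2_eq_square mult.assoc mult_left_le)
   have "L * 1 <= L * L\<^sup>2" using L L2 by (intro mult_left_mono) auto
   then show "64 * L <= 4000 * L^3" using L by (simp add: power3_eq_cube power2_eq_square)
  qed (use \<kappa> L in auto)
  then show ?thesis using e by simp
 qed
 \<comment> \<open>The condition that places a zero of \<open>p\<close> within \<rho>/3. It is the
   origin of the factor \<kappa>^2 and of the constant in the bound for \<open>e\<close>: 4000
   exceeds 2 times 1536.\<close>
 have e2: "2 * e <= m * (\<rho>/3) / 2"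
 proof -
  have eq: "m * (\<rho>/3) / 2 = \<kappa>\<^sup>2 * \<rho>0 / (1536 * L^3)"
   by (simp add: m_def \<rho>_def power2_eq_square power3_eq_cube)
  have "2 * (\<kappa>\<^sup>2 * \<rho>0 / (4000 * L^3)) = \<kappa>\<^sup>2 * \<rho>0 / (2000 * L^3)" by simp
  also have "... <= \<kappa>\<^sup>2 * \<rho>0 / (1536 * L^3)"
   using \<kappa> \<rho>0 L by (intro divide_left_mono) auto
  finally show ?thesis unfolding eq using e by linarith
 qed
 have ex: "\<exists>w. w \<in> cball z (\<rho>/3) \<and> nondeg_zero (\<lambda>x y. fst (p (x,y))) (\<lambda>x y. snd (p (x,y))) (fst w) (snd w)" if z: "z \<in> Z" for z
 proof -
  have "cball z (\<rho>/3) \<subseteq> cball z \<rho>0" using \<rho> by (intro subset_cball) auto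
  then have sub: "cball z (\<rho>/3) \<subseteq> D" using Z[OF z] by blast
  have zD: "z \<in> D" using sub \<rho> by auto
  have low: "m * norm h <= norm (lin2 (a z) (b z) (c z) (d z) h)" for h
   unfolding m_def by (rule lin2_lower) (use g zD \<kappa> L Z[OF z] in \<open>auto simp: C1_pair_def\<close>)
  have close: "norm (lin2 (a' x) (b' x) (c' x) (d' x) h - lin2 (a z) (b z) (c z) (d z) h) <= m/2 * norm h"
   if x: "x \<in> cball z (\<rho>/3)" for x h
  proof -
   have "dist x z <= \<rho>" using x \<rho> by (auto simp: dist_commute)
   then have Lr: "L * dist x z <= L * \<rho>" using L by (intro mult_left_mono) auto
   have xD: "x \<in> D" using x sub by auto
   have lipx: "\<bar>a x - a z\<bar> <= L * dist x z" "\<bar>b x - b z\<bar> <= L * dist x z"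
     "\<bar>c x - c z\<bar> <= L * dist x z" "\<bar>d x - d z\<bar> <= L * dist x z"
    using g xD zD by (auto simp: C1_pair_def)
   have t: "\<bar>v' - v0\<bar> <= e + L * \<rho>" if "\<bar>v - v'\<bar> <= e" "\<bar>v - v0\<bar> <= L * dist x z" for v v' v0
    using that Lr by linarith
   have "norm (lin2 (a' x) (b' x) (c' x) (d' x) h - lin2 (a z) (b z) (c z) (d z) h) <= 4 * (e + L * \<rho>) * norm h"
    using near[OF xD] lipx by (intro lin2_close) (blast intro: t)+
   also have "4 * (e + L * \<rho>) <= 4 * (\<kappa> / (64 * L) + L * (\<kappa> / (64 * L\<^sup>2)))"
    using e1 \<rho> L by (intro mult_left_mono add_mono) auto
   also have "... = m/2" using L by (simp add: m_def power2_eq_square field_simps)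
   finally show ?thesis by (simp add: mult_right_mono)
  qed
  have "\<exists>w\<in>cball z (\<rho>/3). p w = 0"
  proof (rule near_linear_zero[OF _ linear_lin2 low close m])
   show "(p has_derivative lin2 (a' w) (b' w) (c' w) (d' w)) (at w within cball z (\<rho>/3))" if "w \<in> cball z (\<rho>/3)" for w
    by (meson p sub has_derivative_at_withinI subsetD that)
   show "norm (p z) <= m * (\<rho>/3) / 2" using near[OF zD] Z[OF z] e2 by simp
  qed (use \<rho> in auto)
  then obtain w where w: "w \<in> cball z (\<rho>/3)" "p w = 0" by auto
  \<comment> \<open>The derivative of \<open>p\<close> at its zero keeps half of the lower bound, so
    that zero is nondegenerate.\<close>
  have "m/2 * norm h <= norm (lin2 (a' w) (b' w) (c' w) (d' w) h)" for h
   using low[of h] close[OF w(1), of h]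
    norm_triangle_ineq2[of "lin2 (a z) (b z) (c z) (d z) h" "lin2 (a z) (b z) (c z) (d z) h - lin2 (a' w) (b' w) (c' w) (d' w) h"]
   by (simp add: norm_minus_commute)
  then have det: "a' w * d' w - b' w * c' w ~= 0" using m by (intro lin2_lower_det[of "m/2"]) auto
  obtain x y where xy: "w = (x,y)" by (cases w)
  have dw: "(p has_derivative lin2 (a' w) (b' w) (c' w) (d' w)) (at (x,y))" using p sub w(1) xy by auto
  have dx: "((\<lambda>s. (s,y)) has_derivative (\<lambda>h. (h,0))) (at x)" by (auto intro!: derivative_eq_intros)
  have dy: "((\<lambda>s. (x,s)) has_derivative (\<lambda>h. (0,h))) (at y)" by (auto intro!: derivative_eq_intros)
  have px: "((\<lambda>s. p (s,y)) has_derivative (\<lambda>h. lin2 (a' w) (b' w) (c' w) (d' w) (h,0))) (at x)"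
   by (rule has_derivative_compose[OF dx dw])
  have py: "((\<lambda>s. p (x,s)) has_derivative (\<lambda>h. lin2 (a' w) (b' w) (c' w) (d' w) (0,h))) (at y)"
   by (rule has_derivative_compose[OF dy dw])
  have "((\<lambda>x. fst (p (x,y))) has_field_derivative a' w) (at x)" "((\<lambda>x. snd (p (x,y))) has_field_derivative c' w) (at x)"
   using has_derivative_fst[OF px] has_derivative_snd[OF px]
   by (simp_all add: lin2_def has_field_derivative_def)
  moreover have "((\<lambda>y. fst (p (x,y))) has_field_derivative b' w) (at y)" "((\<lambda>y. snd (p (x,y))) has_field_derivative d' w) (at y)"
   using has_derivative_fst[OF py] has_derivative_snd[OF py]
   by (simp_all add: lin2_def has_field_derivative_def)
  ultimately have "nondeg_zero (\<lambda>x y. fst (p (x,y))) (\<lambda>x y. snd (p (x,y))) x y"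
   unfolding nondeg_zero_def using w(2) xy det by auto
  then show ?thesis using w xy by auto
 qed
 then obtain W where W: "!!z. z \<in> Z ==> W z \<in> cball z (\<rho>/3)"
  "!!z. z \<in> Z ==> nondeg_zero (\<lambda>x y. fst (p (x,y))) (\<lambda>x y. snd (p (x,y))) (fst (W z)) (snd (W z))" by metis
 have "inj_on W Z"
 proof (rule inj_onI)
  fix z z' assume z: "z \<in> Z" "z' \<in> Z" and eq: "W z = W z'"
  have "dist z (W z) <= \<rho>/3" "dist z' (W z) <= \<rho>/3" using W(1)[OF z(1)] W(1)[OF z(2)] eq by auto
  then have "dist z z' <= \<rho>" using dist_triangle2[of z z' "W z"] \<rho> by linarith
  moreover have "inj_on g (cball z \<rho>)"
  proof (rule C1_pair_inj_small[OF g])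
   show "cball z \<rho> \<subseteq> D" using Z[OF z(1)] \<rho> by (meson order_trans subset_cball)
   have "\<kappa> / (64 * L\<^sup>2) <= \<kappa> / (32 * L\<^sup>2)" using \<kappa> L by (intro divide_left_mono) auto
   then show "\<rho> <= \<kappa> / (32 * L\<^sup>2)" using \<rho> by linarith
  qed (use \<rho> \<kappa> Z[OF z(1)] in auto)
  ultimately show "z = z'" using Z[OF z(1)] Z[OF z(2)] \<rho> unfolding inj_on_def by auto
 qed
 have sub: "W ` Z \<subseteq> {(x,y). nondeg_zero (\<lambda>x y. fst (p (x,y))) (\<lambda>x y. snd (p (x,y))) x y}"
  using W(2) by (metis (no_types, lifting) case_prod_unfold image_subsetI mem_Collect_eq)
 have fc: "finite {(x,y). nondeg_zero (\<lambda>x y. fst (p (x,y))) (\<lambda>x y. snd (p (x,y))) x y}"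
   "card {(x,y). nondeg_zero (\<lambda>x y. fst (p (x,y))) (\<lambda>x y. snd (p (x,y))) x y} <= (2*N*(N+1) + N) * N"
  using card_nondeg_zeros_le[OF pol] by auto
 have "finite (W ` Z)" using finite_subset[OF sub fc(1)] .
 then have "finite Z" using \<open>inj_on W Z\<close> finite_imageD by blast
 moreover have "card Z <= (2*N*(N+1) + N) * N"
  using card_mono[OF fc(1) sub] fc(2) card_image[OF \<open>inj_on W Z\<close>] by linarith
 ultimately show ?thesis by simp
qed

text \<open>A polynomial of degree about \<open>log (1/\<kappa>)\<close> approximates to within \<open>\<kappa>\<^sup>2\<close>, so the cubic count above costs only \<open>\<kappa> powr - \<epsilon>\<close>.\<close>

lemma approximation_degree_bound:
 assumes "0 < \<epsilon>" "0 < B"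
 shows "\<exists>M. \<forall>\<kappa>. 0 < \<kappa> \<and> \<kappa> <= 1 --> (\<exists>N. B / 2^N <= \<kappa>\<^sup>2 \<and> real ((2*N*(N+1) + N) * N) <= M * \<kappa> powr (- \<epsilon>))"
proof -
 \<comment> \<open>The degree is about log(1/\<kappa>^2), which is at most a constant times
   \<kappa>^(-2t); the zero count is cubic in the degree, and 6t = \<epsilon>.\<close>
 define t where "t = \<epsilon> / 6"
 have t: "t > 0" using assms by (simp add: t_def)
 define B1 where "B1 = max 1 B"
 have B1: "B1 >= 1" "B <= B1" by (auto simp: B1_def)
 define K where "K = B1 powr t / (t * ln 2) + 2"
 have K: "K >= 0" using t B1 by (simp add: K_def)
 show ?thesis
 proof (intro exI[of _ "5 * K^3"] allI impI)
  fix \<kappa> :: real assume \<kappa>: "0 < \<kappa> \<and> \<kappa> <= 1"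
  define X where "X = B1 / \<kappa>\<^sup>2"
  have k2: "0 < \<kappa>\<^sup>2" "\<kappa>\<^sup>2 <= 1" using \<kappa> by (auto simp: power_le_one)
  have X: "X >= 1" using k2 B1 by (simp add: X_def field_simps)
  define N where "N = nat \<lceil>log 2 X\<rceil>"
  have l0: "log 2 X >= 0" using X by simp
  have N: "log 2 X <= real N" "real N <= log 2 X + 1" using l0 by (auto simp: N_def)
  have "X = 2 powr (log 2 X)" using X by simp
  also have "... <= 2 powr (real N)" using N by (intro powr_mono) auto
  finally have "X <= 2^N" by (simp add: powr_realpow)
  then have "B1 <= \<kappa>\<^sup>2 * 2^N" using k2 by (simp add: X_def field_simps)
  then have 1: "B / 2^N <= \<kappa>\<^sup>2" using B1 by (simp add: field_simps)
  have "log 2 X = ln X / ln 2" by (simp add: log_def)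
  also have "... <= (X powr t / t) / ln 2" using ln_powr_bound[OF X t] by (intro divide_right_mono) auto
  also have "X powr t = B1 powr t * \<kappa> powr (- 2 * t)"
   using \<kappa> B1 by (simp add: X_def powr_divide powr_minus powr_powr flip: powr_numeral) (simp add: divide_inverse powr_minus)
  finally have lX: "log 2 X <= B1 powr t / (t * ln 2) * \<kappa> powr (- 2 * t)" by (simp add: mult_ac)
  have k1: "1 <= \<kappa> powr (- 2 * t)" using \<kappa> t powr_mono'[of "- 2 * t" 0 \<kappa>] by simp
  have "real N + 1 <= K * \<kappa> powr (- 2 * t)"
   using N lX k1 by (simp add: K_def distrib_right)
  then have "(real N + 1)^3 <= (K * \<kappa> powr (- 2 * t))^3" by (intro power_mono) auto
  also have "... = K^3 * \<kappa> powr (- \<epsilon>)"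
   using \<kappa> by (simp add: power_mult_distrib t_def powr_powr flip: powr_numeral)
  finally have c: "(real N + 1)^3 <= K^3 * \<kappa> powr (- \<epsilon>)" .
  have "(2*N*(N+1) + N) * N <= 5 * (N+1)^3"
   by (simp add: power3_eq_cube algebra_simps)
  then have "real ((2*N*(N+1) + N) * N) <= real (5 * (N+1)^3)" by (rule of_nat_mono)
  also have "... = 5 * (real N + 1)^3" by (simp add: add.commute)
  finally have 2: "real ((2*N*(N+1) + N) * N) <= 5 * (real N + 1)^3" .
  show "\<exists>N. B / 2^N <= \<kappa>\<^sup>2 \<and> real ((2*N*(N+1) + N) * N) <= 5 * K^3 * \<kappa> powr (- \<epsilon>)"
   using 1 2 c by (intro exI[of _ N]) auto
 qed
qed

section \<open>Analytic functions on squares: derivatives, uniform bounds, truncation\<close>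

definition box2 :: "real => (plane) set" where
 "box2 r = {z. \<bar>fst z\<bar> < r \<and> \<bar>snd z\<bar> < r}"

definition pval :: "(nat => nat => real) => plane => real" where
 "pval c z = dval c (fst z) (snd z)"

lemma open_box2: "open (box2 r)"
 unfolding box2_def by (intro open_Collect_conj open_Collect_less continuous_intros)

lemma dps_bd_mono: "dps_bd c R C ==> 0 < R' ==> R' <= R ==> C <= C' ==> dps_bd c R' C'"
 unfolding dps_bd_def
 by (meson mult_left_mono norm_ge_zero order_trans power_mono less_imp_le)

text \<open>Partial derivatives combine to a total derivative because the one in \<open>y\<close> is
  jointly continuous.\<close>

lemma dval_has_derivative:
 assumes bd: "dps_bd c R C" and xy: "z \<in> box2 (R/8)"
 shows "(pval c has_derivative (\<lambda>(h,k). pval (dps_dx c) z * h + pval (dps_dy c) z * k)) (at z)"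
proof -
 obtain x y where z: "z = (x,y)" by (cases z)
 have R: "R > 0" using bd by (rule dps_bd_pos)
 let ?X = "ball 0 (R/8) :: real set"
 have xy': "x \<in> ?X" "y \<in> ?X" using xy by (auto simp: box2_def z)
 have "((\<lambda>(x,y). dval c x y) has_derivative (\<lambda>(tx,ty). (\<lambda>h. dval (dps_dx c) x y * h) tx + blinfun_mult_right (dval (dps_dy c) x y) ty)) (at (x,y) within ?X \<times> ?X)"
 proof (rule has_derivative_partialsI)
  show "((\<lambda>x. dval c x y) has_derivative (*) (dval (dps_dx c) x y)) (at x within ?X)"
   using dval_deriv_x[OF bd, of x y] xy' R unfolding has_field_derivative_def
   by (auto intro: has_derivative_at_withinI)
  show "((\<lambda>y. dval c x y) has_derivative blinfun_apply (blinfun_mult_right (dval (dps_dy c) x y))) (at y within ?X)"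
   if "x \<in> ?X" "y \<in> ?X" for x y
   using dval_deriv_y[OF bd, of x y] that R unfolding has_field_derivative_def
   by (auto intro: has_derivative_at_withinI simp: blinfun_mult_right.rep_eq)
  have "continuous_on (cball 0 (R/8) \<times> cball 0 (R/8)) (\<lambda>(x,y). dval (dps_dy c) x y)"
   using dval_continuous[OF dps_bd_dy[OF bd]] by simp
  then have "continuous_on (?X \<times> ?X) (\<lambda>(x,y). dval (dps_dy c) x y)"
   by (rule continuous_on_subset) auto
  then have "continuous_on (?X \<times> ?X) (\<lambda>p. blinfun_mult_right ((\<lambda>(x,y). dval (dps_dy c) x y) p))"
   by (intro bounded_linear.continuous_on[OF bounded_linear_blinfun_mult_right])
  then show "continuous (at (x,y) within ?X \<times> ?X) (\<lambda>(x,y). blinfun_mult_right (dval (dps_dy c) x y))"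
   using xy' by (auto simp: continuous_on_eq_continuous_within case_prod_unfold)
 qed (use xy' in auto)
 moreover have "at (x,y) within ?X \<times> ?X = at (x,y)"
  using xy' by (intro at_within_open open_Times) auto
 ultimately show ?thesis
  by (simp add: z pval_def[abs_def] case_prod_unfold blinfun_mult_right.rep_eq)
qed

text \<open>The derivatives of order at most two, mixed ones in one order only. Collecting them in a
  finite set gives a single constant for bounds, Lipschitz constants and truncation errors.\<close>

definition diff_ops :: "((nat => nat => real) => nat => nat => real) set" where
 "diff_ops = {id, dps_dx, dps_dy, dps_dx \<circ> dps_dx, dps_dx \<circ> dps_dy, dps_dy \<circ> dps_dy}"

lemma dps_dy_dx: "dps_dy (dps_dx c) = dps_dx (dps_dy c)"
 by (simp add: dps_dx_def dps_dy_def fun_eq_iff algebra_simps)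

lemma diff_ops_diff:
 assumes "F \<in> diff_ops" shows "F (\<lambda>i j. c i j - d i j) = (\<lambda>i j. F c i j - F d i j)"
 using assms unfolding diff_ops_def by (auto simp: dps_dx_diff dps_dy_diff)

lemma diff_ops_bd:
 assumes bd: "dps_bd c R C" and F: "F \<in> diff_ops"
 shows "dps_bd (F c) (R/4) ((1 + 1/R + 2/R\<^sup>2) * C)"
proof -
 have R: "R > 0" and C: "C >= 0" using bd dps_bd_pos dps_bd_nonneg by blast+
 have le: "C <= (1 + 1/R + 2/R\<^sup>2) * C" "C / R <= (1 + 1/R + 2/R\<^sup>2) * C" "C / R / (R/2) <= (1 + 1/R + 2/R\<^sup>2) * C"
  using R C by (simp_all add: algebra_simps power2_eq_square)
 note m = dps_bd_mono[where R' = "R/4" and C' = "(1 + 1/R + 2/R\<^sup>2) * C"]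
 have 0: "dps_bd c (R/4) ((1 + 1/R + 2/R\<^sup>2) * C)"
  by (rule m[OF bd]) (use R le in auto)
 have 1: "dps_bd (dps_dx c) (R/4) ((1 + 1/R + 2/R\<^sup>2) * C)"
  by (rule m[OF dps_bd_dx[OF bd]]) (use R le in auto)
 have 2: "dps_bd (dps_dy c) (R/4) ((1 + 1/R + 2/R\<^sup>2) * C)"
  by (rule m[OF dps_bd_dy[OF bd]]) (use R le in auto)
 have 3: "dps_bd (dps_dx (dps_dx c)) (R/4) ((1 + 1/R + 2/R\<^sup>2) * C)"
  by (rule m[OF dps_bd_dx[OF dps_bd_dx[OF bd]]]) (use R le in auto)
 have 4: "dps_bd (dps_dx (dps_dy c)) (R/4) ((1 + 1/R + 2/R\<^sup>2) * C)"
  by (rule m[OF dps_bd_dx[OF dps_bd_dy[OF bd]]]) (use R le in auto)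
 have 5: "dps_bd (dps_dy (dps_dy c)) (R/4) ((1 + 1/R + 2/R\<^sup>2) * C)"
  by (rule m[OF dps_bd_dy[OF dps_bd_dy[OF bd]]]) (use R le in auto)
 show ?thesis using F 0 1 2 3 4 5 unfolding diff_ops_def by auto
qed

lemma norm_sum_le_2dist: "\<bar>fst z - fst z'\<bar> + \<bar>snd z - snd z'\<bar> <= 2 * dist z (z' :: plane)"
 using dist_fst_le[of z z'] dist_snd_le[of z z'] by (simp add: dist_real_def)

text \<open>An operator costs a constant factor and a fixed fraction of the radius, also for the
  tail of the series, where \<open>C / 2^N\<close> takes the place of \<open>C\<close>. Evaluating
  the differentiated tail on half of its radius \<open>R/8\<close> leads to the square of size
  \<open>R/16\<close>.\<close>

lemma pval_uniform_bounds:
 assumes bd: "dps_bd c R C"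
 obtains L where "L >= 1"
  "!!F z. F \<in> diff_ops ==> z \<in> box2 (R/16) ==> \<bar>pval (F c) z\<bar> <= L"
  "!!F z z'. F \<in> diff_ops ==> z \<in> box2 (R/16) ==> z' \<in> box2 (R/16) ==>
    \<bar>pval (F c) z - pval (F c) z'\<bar> <= L * dist z z'"
  "!!F z N. F \<in> diff_ops ==> z \<in> box2 (R/16) ==>
    \<bar>pval (F c) z - pval (F (dps_trunc N c)) z\<bar> <= L / 2^N"
proof -
 have R: "R > 0" and C: "C >= 0" using bd dps_bd_pos dps_bd_nonneg by blast+
 define k where "k = (1 + 1/R + 2/R\<^sup>2) * C"
 define k' where "k' = (1 + 1/(R/2) + 2/(R/2)\<^sup>2) * C"
 have k: "k >= 0" "k' >= 0" using R C by (auto simp: k_def k'_def)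
 define L where "L = 1 + 4 * k + 32 * k / R + 4 * k'"
 have L: "1 <= L" "4 * k <= L" "32 * k / R <= L" "4 * k' <= L" using k R by (auto simp: L_def)
 show ?thesis
 proof (rule that[of L])
  fix F :: "(nat => nat => real) => nat => nat => real" and z z' :: "plane" and N assume F: "F \<in> diff_ops" and z: "z \<in> box2 (R/16)"
  note Fbd = diff_ops_bd[OF bd F, folded k_def]
  show "\<bar>pval (F c) z\<bar> <= L"
   using dval_norm_le[OF Fbd, of "fst z" "snd z"] z R L by (auto simp: box2_def pval_def)
  show "\<bar>pval (F c) z - pval (F c) z'\<bar> <= L * dist z z'" if z': "z' \<in> box2 (R/16)"
  proof -
   have "\<bar>pval (F c) z - pval (F c) z'\<bar> <= 4 * k / (R/4) * (\<bar>fst z - fst z'\<bar> + \<bar>snd z - snd z'\<bar>)"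
    using dval_lipschitz[OF Fbd, of "fst z" "snd z" "fst z'" "snd z'"] z z' R by (auto simp: box2_def pval_def)
   also have "... <= 4 * k / (R/4) * (2 * dist z z')"
    using norm_sum_le_2dist k R by (intro mult_left_mono) auto
   also have "... = (32 * k / R) * dist z z'" by simp
   also have "... <= L * dist z z'" using L by (intro mult_right_mono) auto
   finally show ?thesis .
  qed
  have e: "dps_bd (F (\<lambda>i j. c i j - dps_trunc N c i j)) (R/2/4) (k' / 2^N)"
   using diff_ops_bd[OF dps_bd_trunc_diff[OF bd] F, of N] by (simp add: k'_def)
  have "pval (F c) z - pval (F (dps_trunc N c)) z = pval (F (\<lambda>i j. c i j - dps_trunc N c i j)) z"
   unfolding diff_ops_diff[OF F] pval_def
   by (rule dval_diff[symmetric, OF Fbd diff_ops_bd[OF dps_bd_trunc[OF bd] F]]) (use z R in \<open>auto simp: box2_def\<close>)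
  moreover have "norm (pval (F (\<lambda>i j. c i j - dps_trunc N c i j)) z) <= 4 * (k' / 2^N)"
   unfolding pval_def by (rule dval_norm_le[OF e]) (use z R in \<open>auto simp: box2_def\<close>)
  moreover have "4 * (k' / 2^N) <= L / 2^N" using L by (simp add: divide_right_mono)
  ultimately show "\<bar>pval (F c) z - pval (F (dps_trunc N c)) z\<bar> <= L / 2^N" by simp
 qed (rule L)
qed

lemma bipoly_const: "bipoly N (\<lambda>x y. k)"
proof -
 have "(\<Sum>i\<le>N. \<Sum>j\<le>N. (if i = 0 \<and> j = 0 then k else 0) * x^i * y^j) = k" for x y :: real
 proof -
  have "(\<Sum>i\<le>N. \<Sum>j\<le>N. (if i = 0 \<and> j = 0 then k else 0) * x^i * y^j) = (\<Sum>i\<le>N. if i = 0 then k else 0)"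
  proof (intro sum.cong refl)
   fix i
   have "(\<Sum>j\<le>N. (if i = 0 \<and> j = 0 then k else 0) * x^i * y^j) = (\<Sum>j\<le>N. if j = 0 then (if i = 0 then k else 0) else 0)"
    by (intro sum.cong refl) auto
   then show "(\<Sum>j\<le>N. (if i = 0 \<and> j = 0 then k else 0) * x^i * y^j) = (if i = 0 then k else 0)"
    by (simp add: sum.delta)
  qed
  then show ?thesis by (simp add: sum.delta)
 qed
 then show ?thesis unfolding bipoly_def by (intro exI[of _ "\<lambda>i j. if i = 0 \<and> j = 0 then k else 0"]) simp
qed

lemma bipoly_diff: "bipoly N f ==> bipoly N g ==> bipoly N (\<lambda>x y. f x y - g x y)"
 unfolding bipoly_def
proof (elim exE)
 fix a b assume "\<forall>x y. f x y = (\<Sum>i\<le>N. \<Sum>j\<le>N. a i j * x^i * y^j)" "\<forall>x y. g x y = (\<Sum>i\<le>N. \<Sum>j\<le>N. b i j * x^i * y^j)"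
 then show "\<exists>a. \<forall>x y. f x y - g x y = (\<Sum>i\<le>N. \<Sum>j\<le>N. a i j * x^i * y^j)"
  by (intro exI[of _ "\<lambda>i j. a i j - b i j"]) (simp add: left_diff_distrib sum_subtractf)
qed

lemma power_shift_expand:
 fixes x u :: real
 assumes "i <= N"
 shows "(x - u)^i = (\<Sum>k\<le>N. (if k <= i then of_nat (i choose k) * (- u)^(i - k) else 0) * x^k)"
proof -
 have "(x - u)^i = (\<Sum>k\<le>i. of_nat (i choose k) * x^k * (- u)^(i - k))"
  using binomial_ring[of x "- u" i] by simp
 also have "... = (\<Sum>k\<le>N. (if k <= i then of_nat (i choose k) * (- u)^(i - k) else 0) * x^k)"
  using assms by (intro sum.mono_neutral_cong_left) auto
 finally show ?thesis .
qed

text \<open>Translates occur in the chord map; the binomial expansion keeps both degrees at most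
  \<open>N\<close>.\<close>

lemma bipoly_shift:
 assumes "bipoly N f" shows "bipoly N (\<lambda>x y. f (x - u) (y - v))"
proof -
 obtain a where a: "!!x y. f x y = (\<Sum>i\<le>N. \<Sum>j\<le>N. a i j * x^i * y^j)"
  using assms unfolding bipoly_def by auto
 define B :: "real => nat => nat => real" where
  "B u i k = (if k <= i then of_nat (i choose k) * (- u)^(i - k) else 0)" for u i k
 define a' where "a' k l = (\<Sum>i\<le>N. \<Sum>j\<le>N. a i j * B u i k * B v j l)" for k l
 have "f (x - u) (y - v) = (\<Sum>k\<le>N. \<Sum>l\<le>N. a' k l * x^k * y^l)" for x y
 proof -
  have "f (x - u) (y - v) = (\<Sum>i\<le>N. \<Sum>j\<le>N. a i j * (\<Sum>k\<le>N. B u i k * x^k) * (\<Sum>l\<le>N. B v j l * y^l))"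
   unfolding a B_def by (intro sum.cong refl) (simp add: power_shift_expand[of _ N])
  also have "... = (\<Sum>i\<le>N. \<Sum>j\<le>N. \<Sum>k\<le>N. \<Sum>l\<le>N. a i j * B u i k * B v j l * x^k * y^l)"
   by (intro sum.cong refl) (simp add: sum_distrib_left sum_distrib_right mult_ac)
  also have "... = (\<Sum>i\<le>N. \<Sum>k\<le>N. \<Sum>l\<le>N. \<Sum>j\<le>N. a i j * B u i k * B v j l * x^k * y^l)"
   by (rule sum.cong[OF refl], subst sum.swap, rule sum.cong[OF refl], rule sum.swap)
  also have "... = (\<Sum>k\<le>N. \<Sum>l\<le>N. \<Sum>i\<le>N. \<Sum>j\<le>N. a i j * B u i k * B v j l * x^k * y^l)"
   by (subst sum.swap, rule sum.cong[OF refl], rule sum.swap)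
  finally show ?thesis by (simp add: a'_def sum_distrib_right)
 qed
 then show ?thesis unfolding bipoly_def by blast
qed

lemma bipoly_trunc:
 "bipoly N (dval (dps_trunc N c))" "bipoly N (dval (dps_dx (dps_trunc N c)))" "bipoly N (dval (dps_dy (dps_trunc N c)))"
 unfolding bipoly_def using dval_trunc_finite dps_dx_trunc_finite dps_dy_trunc_finite by blast+


section \<open>Fibres of the gradient map and of the chord map\<close>

definition hess :: "(nat => nat => real) => plane => real" where
 "hess c z = pval (dps_dx (dps_dx c)) z * pval (dps_dy (dps_dy c)) z - (pval (dps_dx (dps_dy c)) z)\<^sup>2"

definition grad :: "(nat => nat => real) => plane => plane" where
 "grad c z = (pval (dps_dx c) z, pval (dps_dy c) z)"

definition det2 :: "plane => plane => real" where
 "det2 v w = fst v * snd w - snd v * fst w"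

text \<open>For parameters z, z - a and z - b, the three points y - (t, S(t)) determine
  \<open>a\<close>, \<open>b\<close> and this pair of height differences. The Jacobian in
  \<open>z\<close> is \<open>det2\<close> of the gradient differences, up to sign twice the area of
  the triangle of gradients.\<close>

definition chord_map :: "(nat => nat => real) => plane => plane => plane => plane" where
 "chord_map c a b z = (pval c z - pval c (z - a), pval c z - pval c (z - b))"

lemma has_derivative_lin2_pair:
 assumes "(f has_derivative (\<lambda>(h,k). a * h + b * k)) (at z)" "(g has_derivative (\<lambda>(h,k). c * h + d * k)) (at z)"
 shows "((\<lambda>z. (f z, g z)) has_derivative lin2 a b c d) (at z)"
 using has_derivative_Pair[OF assms] by (simp add: lin2_def case_prod_unfold)

lemma pval_shift_has_derivative:
 assumes bd: "dps_bd c R C" and "z - a \<in> box2 (R/8)"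
 shows "((\<lambda>z. pval c (z - a)) has_derivative (\<lambda>(h,k). pval (dps_dx c) (z - a) * h + pval (dps_dy c) (z - a) * k)) (at z)"
proof -
 have "((\<lambda>z. z - a) has_derivative (\<lambda>h. h)) (at z)" by (auto intro!: derivative_eq_intros)
 from has_derivative_compose[OF this dval_has_derivative[OF assms]] show ?thesis .
qed

lemma chord_map_derivative:
 assumes bd: "dps_bd c R C" and z: "z \<in> box2 (R/8)" "z - a \<in> box2 (R/8)" "z - b \<in> box2 (R/8)"
 shows "(chord_map c a b has_derivative
   lin2 (pval (dps_dx c) z - pval (dps_dx c) (z - a)) (pval (dps_dy c) z - pval (dps_dy c) (z - a))
     (pval (dps_dx c) z - pval (dps_dx c) (z - b)) (pval (dps_dy c) z - pval (dps_dy c) (z - b))) (at z)"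
 unfolding chord_map_def[abs_def]
 by (rule has_derivative_lin2_pair;
   rule has_derivative_eq_rhs[OF has_derivative_diff[OF dval_has_derivative[OF bd z(1)] pval_shift_has_derivative[OF bd]]])
   (use z in \<open>auto simp: algebra_simps fun_eq_iff\<close>)

lemma grad_derivative:
 assumes bd: "dps_bd c R C" and z: "z \<in> box2 (R/16)"
 shows "(grad c has_derivative lin2 (pval (dps_dx (dps_dx c)) z) (pval (dps_dx (dps_dy c)) z)
   (pval (dps_dx (dps_dy c)) z) (pval (dps_dy (dps_dy c)) z)) (at z)"
 unfolding grad_def[abs_def]
 using dval_has_derivative[OF dps_bd_dx[OF bd], of z] dval_has_derivative[OF dps_bd_dy[OF bd], of z] z
 by (intro has_derivative_lin2_pair) (simp_all add: dps_dy_dx)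

lemma box2_mono: "r <= s ==> box2 r \<subseteq> box2 s" by (auto simp: box2_def)

lemma cball_box2:
 assumes "z \<in> box2 r" "r + \<rho> <= s" shows "cball z \<rho> \<subseteq> box2 s"
proof
 fix w assume "w \<in> cball z \<rho>"
 then have "\<bar>fst z - fst w\<bar> <= \<rho>" "\<bar>snd z - snd w\<bar> <= \<rho>"
  using dist_fst_le[of z w] dist_snd_le[of z w] by (auto simp: dist_real_def)
 then show "w \<in> box2 s" using assms by (auto simp: box2_def)
qed

lemma diff_ops_mem: "id \<in> diff_ops" "dps_dx \<in> diff_ops" "dps_dy \<in> diff_ops" "dps_dx \<circ> dps_dx \<in> diff_ops"
 "dps_dx \<circ> dps_dy \<in> diff_ops" "dps_dy \<circ> dps_dy \<in> diff_ops"
 by (auto simp: diff_ops_def)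

abbreviation (input) grad_fibre where
 "grad_fibre c R \<kappa> q \<equiv> {z\<in>box2 (R/32). grad c z = q \<and> \<kappa> <= \<bar>hess c z\<bar>}"

abbreviation (input) chord_fibre where
 "chord_fibre c R \<kappa> a b q \<equiv> {z\<in>box2 (R/32). z - a \<in> box2 (R/32) \<and> z - b \<in> box2 (R/32) \<and>
   chord_map c a b z = q \<and> \<kappa> <= \<bar>det2 (grad c z - grad c (z - a)) (grad c z - grad c (z - b))\<bar>}"

text \<open>Both maps are replaced by their truncations, of degree about log(1/\<kappa>), whence the
  count of order \<kappa>^-\<epsilon>. The translations \<open>a\<close> and \<open>b\<close> do not
  enter the constants; this is essential, since all of them are integrated over later.\<close>

theorem hypersurface_multiplicity:
 assumes bd: "dps_bd c R C"
 obtains L where "L >= 1"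
  "C1_pair L (box2 (R/16)) (grad c) (pval (dps_dx (dps_dx c))) (pval (dps_dx (dps_dy c))) (pval (dps_dx (dps_dy c))) (pval (dps_dy (dps_dy c)))"
  "!!a b. C1_pair L {z. z \<in> box2 (R/16) \<and> z - a \<in> box2 (R/16) \<and> z - b \<in> box2 (R/16)} (chord_map c a b)
    (\<lambda>z. pval (dps_dx c) z - pval (dps_dx c) (z - a)) (\<lambda>z. pval (dps_dy c) z - pval (dps_dy c) (z - a))
    (\<lambda>z. pval (dps_dx c) z - pval (dps_dx c) (z - b)) (\<lambda>z. pval (dps_dy c) z - pval (dps_dy c) (z - b))"
  "!!\<epsilon>. \<epsilon> > 0 ==> \<exists>M. \<forall>\<kappa>. 0 < \<kappa> \<and> \<kappa> <= 1 --> (\<exists>n. real n <= M * \<kappa> powr (-\<epsilon>) \<and>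
   (\<forall>q. finite (grad_fibre c R \<kappa> q) \<and>
      card (grad_fibre c R \<kappa> q) <= n) \<and>
   (\<forall>a b q. finite (chord_fibre c R \<kappa> a b q) \<and>
      card (chord_fibre c R \<kappa> a b q) <= n))"
proof -
 have R: "R > 0" using bd dps_bd_pos by blast
 obtain L where L: "L >= 1"
  "!!F z. F \<in> diff_ops ==> z \<in> box2 (R/16) ==> \<bar>pval (F c) z\<bar> <= L"
  "!!F z z'. F \<in> diff_ops ==> z \<in> box2 (R/16) ==> z' \<in> box2 (R/16) ==>
    \<bar>pval (F c) z - pval (F c) z'\<bar> <= L * dist z z'"
  "!!F z N. F \<in> diff_ops ==> z \<in> box2 (R/16) ==>
    \<bar>pval (F c) z - pval (F (dps_trunc N c)) z\<bar> <= L / 2^N"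
  using pval_uniform_bounds[OF bd] by blast
 note ops = diff_ops_mem[simplified comp_def id_def]
 \<comment> \<open>The constant is doubled so that one value serves the gradient and the differences
   in the chord map.\<close>
 have L2: "\<bar>pval (F c) z\<bar> <= 2 * L" if "F \<in> diff_ops" "z \<in> box2 (R/16)" for F z
  using L(1) L(2)[OF that] by linarith
 have Lip2: "\<bar>pval (F c) z - pval (F c) z'\<bar> <= 2 * L * dist z z'"
  if "F \<in> diff_ops" "z \<in> box2 (R/16)" "z' \<in> box2 (R/16)" for F z z'
 proof -
  have "L * dist z z' <= 2 * L * dist z z'" using L(1) by (intro mult_right_mono) auto
  then show ?thesis using L(3)[OF that] by linarith
 qed
 have b16: "box2 (R/16) \<subseteq> box2 (R/8)" using R by (intro box2_mono) auto
 have G: "C1_pair (2 * L) (box2 (R/16)) (grad c) (pval (dps_dx (dps_dx c))) (pval (dps_dx (dps_dy c))) (pval (dps_dx (dps_dy c))) (pval (dps_dy (dps_dy c)))"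
  unfolding C1_pair_def using L(1) L2[OF ops(4)] L2[OF ops(5)] L2[OF ops(6)]
   Lip2[OF ops(4)] Lip2[OF ops(5)] Lip2[OF ops(6)] grad_derivative[OF bd] by auto
 have Ch: "C1_pair (2 * L) {z. z \<in> box2 (R/16) \<and> z - a \<in> box2 (R/16) \<and> z - b \<in> box2 (R/16)} (chord_map c a b)
    (\<lambda>z. pval (dps_dx c) z - pval (dps_dx c) (z - a)) (\<lambda>z. pval (dps_dy c) z - pval (dps_dy c) (z - a))
    (\<lambda>z. pval (dps_dx c) z - pval (dps_dx c) (z - b)) (\<lambda>z. pval (dps_dy c) z - pval (dps_dy c) (z - b))" for a b
 proof -
  have B: "\<bar>pval (F c) z - pval (F c) w\<bar> <= 2 * L"
   if "F \<in> diff_ops" "z \<in> box2 (R/16)" "w \<in> box2 (R/16)" for F z w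
   using L(2)[OF that(1,2)] L(2)[OF that(1,3)] by linarith
  have Li: "\<bar>pval (F c) z - pval (F c) (z - u) - (pval (F c) w - pval (F c) (w - u))\<bar> <= 2 * L * dist z w"
   if "F \<in> diff_ops" "z \<in> box2 (R/16)" "w \<in> box2 (R/16)" "z - u \<in> box2 (R/16)" "w - u \<in> box2 (R/16)" for F z w u
  proof -
   have eq: "dist (z - u) (w - u) = dist z w" by (simp add: dist_norm)
   show ?thesis using L(3)[OF that(1,2,3)] L(3)[OF that(1,4,5), unfolded eq] by linarith
  qed
  note b16' = subsetD[OF b16]
  show ?thesis
   unfolding C1_pair_def mem_Collect_eq
  proof (intro conjI ballI; (elim CollectE conjE)?)
   show "1 <= 2 * L" using L(1) by linarith
  qed (assumption | rule chord_map_derivative[OF bd] b16' B[OF ops(2)] B[OF ops(3)] Li[OF ops(2)] Li[OF ops(3)])+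
 qed
 \<comment> \<open>The margin between the squares of size \<open>R/32\<close> and
   \<open>R/16\<close>, capped at 1.\<close>
 define \<rho>0 where "\<rho>0 = min 1 (R/32)"
 have \<rho>0: "0 < \<rho>0" "\<rho>0 <= 1" "R/32 + \<rho>0 <= R/16" using R by (auto simp: \<rho>0_def)
 have count: "\<exists>M. \<forall>\<kappa>. 0 < \<kappa> \<and> \<kappa> <= 1 --> (\<exists>n. real n <= M * \<kappa> powr (-\<epsilon>) \<and>
   (\<forall>q. finite (grad_fibre c R \<kappa> q) \<and>
      card (grad_fibre c R \<kappa> q) <= n) \<and>
   (\<forall>a b q. finite (chord_fibre c R \<kappa> a b q) \<and>
      card (chord_fibre c R \<kappa> a b q) <= n))" if \<epsilon>: "\<epsilon> > 0" for \<epsilon>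
 proof -
  \<comment> \<open>With \<open>e = 2 * L / 2^N\<close>, the requirement that \<open>B / 2^N\<close>
    be at most \<kappa>^2 is exactly the accuracy demanded by the zero count.\<close>
  define B where "B = 2 * L * (4000 * (2 * L)^3) / \<rho>0"
  have B: "B > 0" using L \<rho>0 by (simp add: B_def)
  obtain M where M: "!!\<kappa>. 0 < \<kappa> \<and> \<kappa> <= 1 ==> \<exists>N. B / 2^N <= \<kappa>\<^sup>2 \<and> real ((2*N*(N+1) + N) * N) <= M * \<kappa> powr (- \<epsilon>)"
   using approximation_degree_bound[OF \<epsilon> B] by blast
  show ?thesis
  proof (intro exI[of _ M] allI impI)
   fix \<kappa> :: real assume \<kappa>: "0 < \<kappa> \<and> \<kappa> <= 1"
   obtain N where N: "B / 2^N <= \<kappa>\<^sup>2" "real ((2*N*(N+1) + N) * N) <= M * \<kappa> powr (- \<epsilon>)" using M[OF \<kappa>] by blast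
   let ?n = "(2*N*(N+1) + N) * N"
   define e where "e = 2 * L / 2^N"
   have e: "e <= \<kappa>\<^sup>2 * \<rho>0 / (4000 * (2 * L)^3)"
   proof -
    have "B / 2^N = e * ((4000 * (2 * L)^3) / \<rho>0)" by (simp add: B_def e_def)
    then have "e * ((4000 * (2 * L)^3) / \<rho>0) <= \<kappa>\<^sup>2" using N by simp
    moreover have "0 < (4000 * (2 * L)^3) / \<rho>0" using L(1) \<rho>0 by simp
    ultimately have "e <= \<kappa>\<^sup>2 / ((4000 * (2 * L)^3) / \<rho>0)" by (simp only: pos_le_divide_eq)
    then show ?thesis by simp
   qed
   have ap: "\<bar>pval (F c) z - pval (F (dps_trunc N c)) z\<bar> <= L / 2^N" "\<bar>pval (F c) z - pval (F (dps_trunc N c)) z\<bar> <= e"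
    if "F \<in> diff_ops" "z \<in> box2 (R/16)" for F z
   proof -
    show 1: "\<bar>pval (F c) z - pval (F (dps_trunc N c)) z\<bar> <= L / 2^N" by (rule L(4)[OF that])
    have "L / 2^N <= e" using L(1) unfolding e_def by (intro divide_right_mono) auto
    then show "\<bar>pval (F c) z - pval (F (dps_trunc N c)) z\<bar> <= e" using 1 by linarith
   qed
   note bt = dps_bd_trunc[OF bd, of N]
   let ?t = "dps_trunc N c"
   have 1: "finite (grad_fibre c R \<kappa> q) \<and>
      card (grad_fibre c R \<kappa> q) <= ?n" for q
   proof (rule card_quantitative_zeros_le[where g = "\<lambda>z. grad c z - q" and p = "\<lambda>z. grad ?t z - q" and D = "box2 (R/16)"
     and a = "pval (dps_dx (dps_dx c))" and b = "pval (dps_dx (dps_dy c))" and c = "pval (dps_dx (dps_dy c))" and d = "pval (dps_dy (dps_dy c))"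
     and a' = "pval (dps_dx (dps_dx ?t))" and b' = "pval (dps_dx (dps_dy ?t))" and c' = "pval (dps_dx (dps_dy ?t))" and d' = "pval (dps_dy (dps_dy ?t))"
     and \<kappa> = \<kappa> and ?\<rho>0.0 = \<rho>0 and L = "2 * L" and e = e])
    show "C1_pair (2 * L) (box2 (R/16)) (\<lambda>z. grad c z - q) (pval (dps_dx (dps_dx c))) (pval (dps_dx (dps_dy c))) (pval (dps_dx (dps_dy c))) (pval (dps_dy (dps_dy c)))"
     using G unfolding C1_pair_def by (auto intro!: has_derivative_diff[where g' = "\<lambda>_. 0", simplified])
    show "((\<lambda>z. grad ?t z - q) has_derivative lin2 (pval (dps_dx (dps_dx ?t)) z) (pval (dps_dx (dps_dy ?t)) z) (pval (dps_dx (dps_dy ?t)) z) (pval (dps_dy (dps_dy ?t)) z)) (at z)" if "z \<in> box2 (R/16)" for z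
     using has_derivative_diff[OF grad_derivative[OF bt that] has_derivative_const[of q]] by simp
    show "bipoly N (\<lambda>x y. fst (grad ?t (x,y) - q))" "bipoly N (\<lambda>x y. snd (grad ?t (x,y) - q))"
     by (simp_all add: grad_def pval_def bipoly_diff bipoly_const bipoly_trunc)
    fix z assume z: "z \<in> box2 (R/16)"
    have "norm ((grad c z - q) - (grad ?t z - q)) <= \<bar>pval (dps_dx c) z - pval (dps_dx ?t) z\<bar> + \<bar>pval (dps_dy c) z - pval (dps_dy ?t) z\<bar>"
     using norm_pair_le[of "pval (dps_dx c) z - pval (dps_dx ?t) z" "pval (dps_dy c) z - pval (dps_dy ?t) z"] by (simp add: grad_def)
    also have "... <= 2 * e" using ap(2)[OF ops(2) z] ap(2)[OF ops(3) z] by linarith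
    finally show "norm ((grad c z - q) - (grad ?t z - q)) <= 2 * e \<and>
     \<bar>pval (dps_dx (dps_dx c)) z - pval (dps_dx (dps_dx ?t)) z\<bar> <= e \<and> \<bar>pval (dps_dx (dps_dy c)) z - pval (dps_dx (dps_dy ?t)) z\<bar> <= e \<and>
     \<bar>pval (dps_dx (dps_dy c)) z - pval (dps_dx (dps_dy ?t)) z\<bar> <= e \<and> \<bar>pval (dps_dy (dps_dy c)) z - pval (dps_dy (dps_dy ?t)) z\<bar> <= e"
     using ap(2)[OF ops(4) z] ap(2)[OF ops(5) z] ap(2)[OF ops(6) z] by blast
   next
    fix z assume "z \<in> (grad_fibre c R \<kappa> q)"
    then show "cball z \<rho>0 \<subseteq> box2 (R/16) \<and> grad c z - q = 0 \<and> \<kappa> <= \<bar>pval (dps_dx (dps_dx c)) z * pval (dps_dy (dps_dy c)) z - pval (dps_dx (dps_dy c)) z * pval (dps_dx (dps_dy c)) z\<bar>"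
     using cball_box2[of z "R/32" \<rho>0 "R/16"] \<rho>0 by (auto simp: hess_def power2_eq_square)
   qed (use \<kappa> \<rho>0 e in auto)
   have 2: "finite (chord_fibre c R \<kappa> a b q) \<and>
      card (chord_fibre c R \<kappa> a b q) <= ?n" for a b q
   proof (rule card_quantitative_zeros_le[where g = "\<lambda>z. chord_map c a b z - q" and p = "\<lambda>z. chord_map ?t a b z - q"
     and D = "{z. z \<in> box2 (R/16) \<and> z - a \<in> box2 (R/16) \<and> z - b \<in> box2 (R/16)}"
     and a = "\<lambda>z. pval (dps_dx c) z - pval (dps_dx c) (z - a)" and b = "\<lambda>z. pval (dps_dy c) z - pval (dps_dy c) (z - a)"
     and c = "\<lambda>z. pval (dps_dx c) z - pval (dps_dx c) (z - b)" and d = "\<lambda>z. pval (dps_dy c) z - pval (dps_dy c) (z - b)"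
     and a' = "\<lambda>z. pval (dps_dx ?t) z - pval (dps_dx ?t) (z - a)" and b' = "\<lambda>z. pval (dps_dy ?t) z - pval (dps_dy ?t) (z - a)"
     and c' = "\<lambda>z. pval (dps_dx ?t) z - pval (dps_dx ?t) (z - b)" and d' = "\<lambda>z. pval (dps_dy ?t) z - pval (dps_dy ?t) (z - b)"
     and \<kappa> = \<kappa> and ?\<rho>0.0 = \<rho>0 and L = "2 * L" and e = e])
    let ?D = "{z. z \<in> box2 (R/16) \<and> z - a \<in> box2 (R/16) \<and> z - b \<in> box2 (R/16)}"
    show "C1_pair (2 * L) ?D (\<lambda>z. chord_map c a b z - q)
      (\<lambda>z. pval (dps_dx c) z - pval (dps_dx c) (z - a)) (\<lambda>z. pval (dps_dy c) z - pval (dps_dy c) (z - a))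
      (\<lambda>z. pval (dps_dx c) z - pval (dps_dx c) (z - b)) (\<lambda>z. pval (dps_dy c) z - pval (dps_dy c) (z - b))"
     using Ch[of a b] unfolding C1_pair_def by (auto intro!: has_derivative_diff[where g' = "\<lambda>_. 0", simplified])
    show "((\<lambda>z. chord_map ?t a b z - q) has_derivative
      lin2 (pval (dps_dx ?t) z - pval (dps_dx ?t) (z - a)) (pval (dps_dy ?t) z - pval (dps_dy ?t) (z - a))
      (pval (dps_dx ?t) z - pval (dps_dx ?t) (z - b)) (pval (dps_dy ?t) z - pval (dps_dy ?t) (z - b))) (at z)" if "z \<in> ?D" for z
     using has_derivative_diff[OF chord_map_derivative[OF bt, of z a b] has_derivative_const[of q]] that b16 by auto
    show "bipoly N (\<lambda>x y. fst (chord_map ?t a b (x,y) - q))" "bipoly N (\<lambda>x y. snd (chord_map ?t a b (x,y) - q))"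
     by (auto simp: chord_map_def pval_def intro!: bipoly_diff bipoly_const bipoly_trunc bipoly_shift)
    fix z assume "z \<in> ?D"
    then have z: "z \<in> box2 (R/16)" "z - a \<in> box2 (R/16)" "z - b \<in> box2 (R/16)" by auto
    \<comment> \<open>Each difference contains two truncated values, so half of \<open>e\<close> is
      allotted to each.\<close>
    have half: "L / 2^N + L / 2^N = e" by (simp add: e_def)
    have d: "\<bar>pval (F c) z - pval (F c) w - (pval (F ?t) z - pval (F ?t) w)\<bar> <= e" if "F \<in> diff_ops" "w \<in> box2 (R/16)" for F w
     using ap(1)[OF that(1) z(1)] ap(1)[OF that] half by linarith
    have "norm ((chord_map c a b z - q) - (chord_map ?t a b z - q)) \<le>
      \<bar>pval c z - pval c (z - a) - (pval ?t z - pval ?t (z - a))\<bar> + \<bar>pval c z - pval c (z - b) - (pval ?t z - pval ?t (z - b))\<bar>"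
     using norm_pair_le[of "pval c z - pval c (z - a) - (pval ?t z - pval ?t (z - a))" "pval c z - pval c (z - b) - (pval ?t z - pval ?t (z - b))"]
     by (simp add: chord_map_def)
    also have "... <= 2 * e" using d[OF ops(1) z(2)] d[OF ops(1) z(3)] by simp
    finally show "norm ((chord_map c a b z - q) - (chord_map ?t a b z - q)) <= 2 * e \<and>
     \<bar>pval (dps_dx c) z - pval (dps_dx c) (z - a) - (pval (dps_dx ?t) z - pval (dps_dx ?t) (z - a))\<bar> <= e \<and>
     \<bar>pval (dps_dy c) z - pval (dps_dy c) (z - a) - (pval (dps_dy ?t) z - pval (dps_dy ?t) (z - a))\<bar> <= e \<and>
     \<bar>pval (dps_dx c) z - pval (dps_dx c) (z - b) - (pval (dps_dx ?t) z - pval (dps_dx ?t) (z - b))\<bar> <= e \<and>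
     \<bar>pval (dps_dy c) z - pval (dps_dy c) (z - b) - (pval (dps_dy ?t) z - pval (dps_dy ?t) (z - b))\<bar> <= e"
     using d[OF ops(2) z(2)] d[OF ops(3) z(2)] d[OF ops(2) z(3)] d[OF ops(3) z(3)] by blast
   next
    fix z assume z: "z \<in> (chord_fibre c R \<kappa> a b q)"
    have sh: "w - u \<in> box2 (R/16)" if "z - u \<in> box2 (R/32)" "w \<in> cball z \<rho>0" for w u
    proof -
     have "w - u \<in> cball (z - u) \<rho>0" using that by (simp add: dist_norm)
     then show ?thesis using cball_box2[OF that(1) \<rho>0(3)] by auto
    qed
    have "cball z \<rho>0 \<subseteq> {z. z \<in> box2 (R/16) \<and> z - a \<in> box2 (R/16) \<and> z - b \<in> box2 (R/16)}"
     using z sh[of a] sh[of b] cball_box2[of z "R/32" \<rho>0 "R/16"] \<rho>0(3) by blast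
    then show "cball z \<rho>0 \<subseteq> {z. z \<in> box2 (R/16) \<and> z - a \<in> box2 (R/16) \<and> z - b \<in> box2 (R/16)} \<and>
      chord_map c a b z - q = 0 \<and> \<kappa> <= \<bar>(pval (dps_dx c) z - pval (dps_dx c) (z - a)) * (pval (dps_dy c) z - pval (dps_dy c) (z - b)) -
      (pval (dps_dy c) z - pval (dps_dy c) (z - a)) * (pval (dps_dx c) z - pval (dps_dx c) (z - b))\<bar>"
     using z by (auto simp: det2_def grad_def)
   qed (use \<kappa> \<rho>0 e in auto)
   show "\<exists>n. real n <= M * \<kappa> powr (-\<epsilon>) \<and>
   (\<forall>q. finite (grad_fibre c R \<kappa> q) \<and>
      card (grad_fibre c R \<kappa> q) <= n) \<and>
   (\<forall>a b q. finite (chord_fibre c R \<kappa> a b q) \<and>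
      card (chord_fibre c R \<kappa> a b q) <= n)"
    using N(2) 1 2 by blast
  qed
 qed
 show ?thesis
  by (rule that[of "2 * L", OF _ G Ch count]) (use L in auto)
qed

section \<open>Area formula for maps of bounded multiplicity\<close>

text \<open>Product types carry the iterated integrals, while \<open>real^2\<close> carries the area
  formula and the theorem itself; \<open>vec2\<close> and \<open>unvec2\<close> pass between the two
  and preserve Lebesgue measure.\<close>

definition vec2 :: "plane => real^2" where "vec2 z = vector [fst z, snd z]"
definition unvec2 :: "real^2 => plane" where "unvec2 v = (v$1, v$2)"

lemma unvec2_vec2 [simp]: "unvec2 (vec2 z) = z" by (simp add: unvec2_def vec2_def)
lemma vec2_unvec2 [simp]: "vec2 (unvec2 v) = v" by (simp add: unvec2_def vec2_def vec_eq_iff forall_2)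

lemma vec2_nth [simp]: "vec2 z $ 1 = fst z" "vec2 z $ 2 = snd z" by (simp_all add: vec2_def)

lemma linear_vec2: "linear vec2" by (rule linearI) (simp_all add: vec_eq_iff forall_2)
lemma linear_unvec2: "linear unvec2" by (rule linearI) (simp_all add: unvec2_def)

lemma continuous_vec2 [continuous_intros]: "continuous_on S f ==> continuous_on S (\<lambda>x. vec2 (f x))"
 by (rule bounded_linear.continuous_on[OF linear_conv_bounded_linear[THEN iffD1, OF linear_vec2]])
lemma continuous_unvec2 [continuous_intros]: "continuous_on S f ==> continuous_on S (\<lambda>x. unvec2 (f x))"
 by (rule bounded_linear.continuous_on[OF linear_conv_bounded_linear[THEN iffD1, OF linear_unvec2]])

lemma vec2_measurable [measurable]: "vec2 \<in> borel_measurable borel"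
 by (intro borel_measurable_continuous_onI continuous_intros)
lemma unvec2_measurable [measurable]: "unvec2 \<in> borel_measurable borel"
 by (intro borel_measurable_continuous_onI continuous_intros)

lemma prod_Basis_vec2: "(\<Prod>b\<in>Basis. f b) = f (axis 1 1) * f (axis 2 1)" for f :: "real^2 => real"
proof -
 have B: "(Basis :: (real^2) set) = {axis 1 1, axis 2 1}"
  by (auto simp: Basis_vec_def UNIV_2)
 have "axis 1 1 ~= (axis 2 1 :: real^2)" by (simp add: axis_eq_axis)
 then show ?thesis unfolding B by simp
qed

lemma prod_Basis_pair: "(\<Prod>b\<in>Basis. f b) = f (1,0) * f (0,1)" for f :: "plane => real"
proof -
 have B: "(Basis :: (plane) set) = {(1,0), (0,1)}" by (auto simp: Basis_prod_def)
 show ?thesis unfolding B by simp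
qed

lemma lborel_vec2: "(lborel :: (real^2) measure) = distr lborel borel vec2"
proof (rule lborel_eqI)
 fix l u :: "real^2" assume le: "!!b. b \<in> Basis ==> l \<bullet> b <= u \<bullet> b"
 have le': "l$1 <= u$1" "l$2 <= u$2"
  using le[of "axis 1 1"] le[of "axis 2 1"] by (auto simp: inner_axis axis_in_Basis_iff)
 have "z \<in> box (unvec2 l) (unvec2 u) \<longleftrightarrow> l$1 < fst z \<and> fst z < u$1 \<and> l$2 < snd z \<and> snd z < u$2" for z
  by (cases z) (auto simp: mem_box Basis_prod_def unvec2_def)
 then have eq: "vec2 -` box l u = box (unvec2 l) (unvec2 u)"
  by (auto simp: mem_box_cart forall_2)
 have "emeasure (distr lborel borel vec2) (box l u) = vol (box (unvec2 l) (unvec2 u))"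
  by (subst emeasure_distr) (auto simp: eq)
 also have "... = ennreal (\<Prod>b\<in>Basis. (unvec2 u - unvec2 l) \<bullet> b)"
  by (rule emeasure_lborel_box) (use le' in \<open>auto simp: Basis_prod_def unvec2_def\<close>)
 also have "(\<Prod>b\<in>Basis. (unvec2 u - unvec2 l) \<bullet> b) = (\<Prod>b\<in>Basis. (u - l) \<bullet> b)"
  unfolding prod_Basis_vec2 prod_Basis_pair by (simp add: unvec2_def inner_axis)
 finally show "emeasure (distr lborel borel vec2) (box l u) = ennreal (\<Prod>b\<in>Basis. (u - l) \<bullet> b)" .
qed simp

lemma vec2_image_vimage: "vec2 ` X = unvec2 -` X"
 by (auto simp: image_iff intro!: bexI[of _ "unvec2 _"])

lemma vec2_image_borel: "X \<in> sets borel ==> vec2 ` X \<in> sets borel"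
 unfolding vec2_image_vimage using measurable_sets[OF unvec2_measurable, of X] by simp

lemma emeasure_vec2_image:
 assumes "X \<in> sets borel" shows "vol (vec2 ` X) = vol X"
proof -
 have "vec2 -` vec2 ` X = X" by (auto simp: vec2_image_vimage)
 then show ?thesis using vec2_image_borel[OF assms]
  by (subst lborel_vec2, subst emeasure_distr) auto
qed

lemma nn_integral_vec2:
 assumes "f \<in> borel_measurable borel"
 shows "(\<integral>\<^sup>+v. f v \<partial>(lborel :: (real^2) measure)) = (LI z. f (vec2 z))"
 by (subst lborel_vec2, subst nn_integral_distr) (use assms in auto)

text \<open>The sum of the indicators is the overlap count, which is at most \<open>n\<close> and
  supported in \<open>B\<close>.\<close>

lemma bounded_overlap_emeasure:
 assumes T: "!!i::nat. T i \<in> sets M" "!!i. T i \<subseteq> B" "B \<in> sets M"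
  and n: "!!x. finite {i. x \<in> T i} \<and> card {i. x \<in> T i} <= n"
 shows "(\<Sum>i. emeasure M (T i)) <= of_nat n * emeasure M B"
proof -
 have "(\<Sum>i. emeasure M (T i)) = (\<Sum>i. \<integral>\<^sup>+x. indicator (T i) x \<partial>M)" using T by simp
 also have "... = (\<integral>\<^sup>+x. (\<Sum>i. indicator (T i) x) \<partial>M)"
  by (rule nn_integral_suminf[symmetric]) (use T in auto)
 also have "... <= (\<integral>\<^sup>+x. of_nat n * indicator B x \<partial>M)"
 proof (rule nn_integral_mono)
  fix x
  have "(\<Sum>i. indicator (T i) x) = (\<Sum>i\<in>{i. x \<in> T i}. indicator (T i) x :: ennreal)"
   using n[of x] by (intro suminf_finite) auto
  also have "... = of_nat (card {i. x \<in> T i})" by simp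
  also have "... <= of_nat n * indicator B x"
  proof (cases "x \<in> B")
   case True
   then show ?thesis using n[of x] by simp
  next
   case False
   then have "{i. x \<in> T i} = {}" using T by auto
   then show ?thesis by simp
  qed
  finally show "(\<Sum>i. indicator (T i) x) <= of_nat n * (indicator B x :: ennreal)" .
 qed
 also have "... = of_nat n * emeasure M B" using T by (simp add: nn_integral_cmult)
 finally show ?thesis .
qed

lemma injective_piece_measure:
 fixes f :: "real^2 => real^2"
 assumes S: "S \<in> sets borel" "bounded S" and der: "!!x. x \<in> S ==> (f has_derivative f' x) (at x)"
  and inj: "inj_on f S" and det: "!!x. x \<in> S ==> \<kappa> <= \<bar>det (matrix (f' x))\<bar>" and \<kappa>: "\<kappa> >= 0"
 shows "f ` S \<in> sets lebesgue" "ennreal \<kappa> * vol S <= emeasure lebesgue (f ` S)"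
proof -
 have SL: "S \<in> sets lebesgue" using S by simp
 have der': "(f has_derivative f' x) (at x within S)" if "x \<in> S" for x
  using der that has_derivative_at_withinI by blast
 show img: "f ` S \<in> sets lebesgue"
  by (rule differentiable_image_in_sets_lebesgue[OF SL])
    (use der' in \<open>auto simp: differentiable_on_def differentiable_def\<close>)
 have Sm: "S \<in> lmeasurable" using bounded_set_imp_lmeasurable[OF S(2) SL] .
 show "ennreal \<kappa> * vol S <= emeasure lebesgue (f ` S)"
 proof (cases "emeasure lebesgue (f ` S) = \<infinity>")
  case False
  then have T: "f ` S \<in> lmeasurable" using img by (intro fmeasurableI) (auto simp: less_top)
  then have hi: "((\<lambda>x. \<bar>det (matrix (f' x))\<bar>) has_integral measure lebesgue (f ` S)) S"
   using has_measure_differentiable_image[OF SL der' inj] by blast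
  have "((\<lambda>x. \<kappa> * 1) has_integral \<kappa> * measure lebesgue S) S"
   using Sm by (intro has_integral_mult_right) (metis integrable_integral lmeasurable_iff_integrable_on lmeasure_integral)
  then have "\<kappa> * measure lebesgue S <= measure lebesgue (f ` S)"
   by (rule has_integral_le[OF _ hi]) (use det in auto)
  then have "ennreal (\<kappa> * measure lebesgue S) <= ennreal (measure lebesgue (f ` S))" by (rule ennreal_leI)
  moreover have "vol S = ennreal (measure lebesgue S)"
  proof -
   have "vol S = emeasure lebesgue S" using S(1) by simp
   also have "... = ennreal (measure lebesgue S)"
    by (rule emeasure_eq_ennreal_measure) (use fmeasurableD2[OF Sm] in \<open>simp only: not_False_eq_True\<close>)
   finally show ?thesis .
  qed
  moreover have "emeasure lebesgue (f ` S) = ennreal (measure lebesgue (f ` S))"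
   by (rule emeasure_eq_ennreal_measure) (use fmeasurableD2[OF T] in \<open>simp only: not_False_eq_True\<close>)
  ultimately show ?thesis using \<kappa> by (simp add: ennreal_mult)
 qed simp
qed

lemma det_matrix_lin2: "det (matrix (\<lambda>v. vec2 (lin2 a b c d (unvec2 v)))) = a * d - b * c"
 unfolding det_2 by (simp add: matrix_def lin2_def unvec2_def axis_def)

text \<open>A grid finer than the injectivity radius cuts the preimage into pieces to which the area
  formula for injective maps applies. The images overlap at most \<open>n\<close> times, since the
  pieces hitting a point are met by its preimages.\<close>

theorem multiplicity_change_of_variables:
 assumes g: "C1_pair L D g a b c d" and A: "A \<in> sets borel" and \<rho>0: "\<rho>0 > 0" "!!z. z \<in> A ==> cball z \<rho>0 \<subseteq> D"
  and \<kappa>: "\<kappa> > 0" "!!z. z \<in> A ==> \<kappa> <= \<bar>a z * d z - b z * c z\<bar>"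
  and mult: "!!q. finite {z\<in>A. g z = q} \<and> card {z\<in>A. g z = q} <= n"
  and B: "B \<in> sets borel"
 shows "A \<inter> g -` B \<in> sets borel" "ennreal \<kappa> * vol (A \<inter> g -` B) <= of_nat n * vol B"
proof -
 have L: "L >= 1" using g by (simp add: C1_pair_def)
 have AD: "A \<subseteq> D" using \<rho>0 by (metis centre_in_cball less_imp_le subsetD subsetI)
 have der: "(g has_derivative lin2 (a z) (b z) (c z) (d z)) (at z)" if "z \<in> A" for z
  using g AD that by (auto simp: C1_pair_def)
 have cont: "continuous_on A g"
  by (rule has_derivative_continuous_on) (use der has_derivative_at_withinI in blast)
 have "g \<in> borel_measurable (restrict_space borel A)"
  by (rule borel_measurable_continuous_on_restrict[OF cont])
 from measurable_sets[OF this B] have "A \<inter> g -` B \<in> sets (restrict_space borel A)"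
  by (simp add: space_restrict_space Int_commute)
 then show X: "A \<inter> g -` B \<in> sets borel"
  using A by (auto simp: sets_restrict_space_iff)
 define \<rho> where "\<rho> = min \<rho>0 (\<kappa> / (32 * L\<^sup>2))"
 have \<rho>: "\<rho> > 0" using \<rho>0 \<kappa> L by (simp add: \<rho>_def)
 \<comment> \<open>Two points of a cell differ by at most \<rho>/2 in each coordinate, hence by at
   most \<rho> in norm.\<close>
 define \<eta> where "\<eta> = \<rho> / 2"
 have \<eta>: "\<eta> > 0" using \<rho> by (simp add: \<eta>_def)
 define cell where "cell z = to_nat (\<lfloor>fst z / \<eta>\<rfloor>, \<lfloor>snd z / \<eta>\<rfloor>)" for z :: "plane"
 define P where "P i = (A \<inter> g -` B) \<inter> {z. cell z = i}" for i
 have near: "dist z w <= \<rho>" if "cell z = cell w" for z w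
 proof -
  have f: "\<lfloor>fst z / \<eta>\<rfloor> = \<lfloor>fst w / \<eta>\<rfloor>" "\<lfloor>snd z / \<eta>\<rfloor> = \<lfloor>snd w / \<eta>\<rfloor>"
   using that by (auto simp: cell_def)
  have *: "\<bar>u - v\<bar> <= \<eta>" if "\<lfloor>u / \<eta>\<rfloor> = \<lfloor>v / \<eta>\<rfloor>" for u v
  proof -
   have "\<bar>u / \<eta> - v / \<eta>\<bar> <= 1" using that by linarith
   then have "\<bar>u - v\<bar> / \<eta> <= 1" using \<eta> by (simp add: diff_divide_distrib[symmetric])
   then show ?thesis using \<eta> by (simp add: field_simps)
  qed
  have "dist z w <= \<bar>fst z - fst w\<bar> + \<bar>snd z - snd w\<bar>"
   using norm_pair_le[of "fst (z - w)" "snd (z - w)"] unfolding prod.collapse by (simp add: dist_norm)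
  then show ?thesis using *[OF f(1)] *[OF f(2)] by (simp add: \<eta>_def)
 qed
 have cellm: "{z. cell z = i} \<in> sets borel" for i
 proof -
  have "{z. cell z = i} = {z::real\<times>real. \<lfloor>fst z / \<eta>\<rfloor> = fst (from_nat i :: int \<times> int) \<and> \<lfloor>snd z / \<eta>\<rfloor> = snd (from_nat i :: int \<times> int) \<and> to_nat (from_nat i :: int \<times> int) = i}"
   unfolding cell_def by (auto simp: prod_eq_iff)
  moreover have "(\<lambda>z::real\<times>real. \<lfloor>fst z / \<eta>\<rfloor>) \<in> borel \<rightarrow>\<^sub>M count_space UNIV" "(\<lambda>z::real\<times>real. \<lfloor>snd z / \<eta>\<rfloor>) \<in> borel \<rightarrow>\<^sub>M count_space UNIV"
   by (rule measurable_compose[OF _ measurable_real_floor], rule borel_measurable_continuous_onI,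
     use \<eta> in \<open>intro continuous_intros; simp\<close>)+
  ultimately show ?thesis by simp
 qed
 have Pm: "P i \<in> sets borel" for i unfolding P_def using X cellm by auto
 define g2 where "g2 v = vec2 (g (unvec2 v))" for v
 define S where "S i = vec2 ` P i" for i
 have dg2: "(g2 has_derivative (\<lambda>h. vec2 (lin2 (a z) (b z) (c z) (d z) (unvec2 h)))) (at v)"
  if "v = vec2 z" "z \<in> A" for v z
 proof -
  have 1: "(unvec2 has_derivative unvec2) (at v)" using linear_unvec2 by (rule linear_imp_has_derivative)
  have 2: "(g has_derivative lin2 (a z) (b z) (c z) (d z)) (at (unvec2 v))" using der that by simp
  have 3: "(vec2 has_derivative vec2) (at (g (unvec2 v)))" using linear_vec2 by (rule linear_imp_has_derivative)
  show ?thesis unfolding g2_def[abs_def]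
   by (rule has_derivative_compose[OF has_derivative_compose[OF 1 2] 3])
 qed
 have S1: "g2 ` S i \<in> sets lebesgue" and S2: "ennreal \<kappa> * vol (P i) <= emeasure lebesgue (g2 ` S i)" for i
 proof -
  have *: "S i \<in> sets borel" unfolding S_def by (rule vec2_image_borel[OF Pm])
  have bdd: "bounded (S i)"
  proof (cases "P i = {}")
   case False
   then obtain w where "w \<in> P i" by auto
   then have "P i \<subseteq> cball w \<rho>" using near[of w] by (auto simp: P_def)
   then have "bounded (P i)" using bounded_cball bounded_subset by blast
   then show ?thesis unfolding S_def
    using bounded_linear_image linear_conv_bounded_linear linear_vec2 by blast
  qed (simp add: S_def)
  have inj: "inj_on g2 (S i)"
  proof (rule inj_onI)
   fix v w assume v: "v \<in> S i" "w \<in> S i" and eq: "g2 v = g2 w"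
   then obtain z z' where z: "z \<in> P i" "z' \<in> P i" "v = vec2 z" "w = vec2 z'" by (auto simp: S_def)
   have "vec2 (g z) = vec2 (g z')" using eq unfolding g2_def z(3,4) unvec2_vec2 .
   then have "g z = g z'" by (metis unvec2_vec2)
   moreover have "inj_on g (cball z \<rho>)"
   proof (rule C1_pair_inj_small[OF g])
    have zA: "z \<in> A" using z(1) by (simp add: P_def)
    have "cball z \<rho> \<subseteq> cball z \<rho>0" by (rule subset_cball) (simp add: \<rho>_def)
    then show "cball z \<rho> \<subseteq> D" using \<rho>0(2)[OF zA] by blast
    show "\<kappa> <= \<bar>a z * d z - b z * c z\<bar>" by (rule \<kappa>(2)[OF zA])
    show "\<rho> <= \<kappa> / (32 * L\<^sup>2)" by (simp add: \<rho>_def)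
   qed (use \<rho> \<kappa>(1) in auto)
   moreover have "z' \<in> cball z \<rho>" using near z by (auto simp: P_def)
   moreover have "z \<in> cball z \<rho>" using \<rho> by simp
   ultimately have "z = z'" by (metis inj_onD)
   then show "v = w" using z by simp
  qed
  have D: "(g2 has_derivative (\<lambda>h. vec2 (lin2 (a (unvec2 v)) (b (unvec2 v)) (c (unvec2 v)) (d (unvec2 v)) (unvec2 h)))) (at v)" if "v \<in> S i" for v
   using that by (intro dg2) (auto simp: S_def P_def)
  have K: "\<kappa> <= \<bar>det (matrix (\<lambda>h. vec2 (lin2 (a (unvec2 v)) (b (unvec2 v)) (c (unvec2 v)) (d (unvec2 v)) (unvec2 h))))\<bar>" if "v \<in> S i" for v
   using that \<kappa> unfolding det_matrix_lin2 by (auto simp: S_def P_def)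
  show "g2 ` S i \<in> sets lebesgue" "ennreal \<kappa> * vol (P i) <= emeasure lebesgue (g2 ` S i)"
   using injective_piece_measure[OF * bdd D inj K] \<kappa> emeasure_vec2_image[OF Pm] by (auto simp: S_def)
 qed
 have "ennreal \<kappa> * vol (A \<inter> g -` B) = ennreal \<kappa> * (\<Sum>i. vol (P i))"
 proof -
  have "disjoint_family P" by (auto simp: disjoint_family_on_def P_def)
  moreover have "(\<Union>i. P i) = A \<inter> g -` B" by (auto simp: P_def)
  moreover have "range P \<subseteq> sets lborel" using Pm by auto
  ultimately show ?thesis using suminf_emeasure[of P lborel] by simp
 qed
 also have "... = (\<Sum>i. ennreal \<kappa> * vol (P i))" by simp
 also have "... <= (\<Sum>i. emeasure lebesgue (g2 ` S i))" by (intro suminf_le S2) auto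
 also have "... <= of_nat n * emeasure lebesgue (vec2 ` B)"
 proof (rule bounded_overlap_emeasure)
  show "g2 ` S i \<subseteq> vec2 ` B" for i by (auto simp: S_def P_def g2_def)
  show "vec2 ` B \<in> sets lebesgue" using vec2_image_borel[OF B] by simp
  fix v
  let ?Z = "{z\<in>A. g z = unvec2 v}"
  have "{i. v \<in> g2 ` S i} \<subseteq> cell ` ?Z" by (auto simp: S_def P_def g2_def)
  then show "finite {i. v \<in> g2 ` S i} \<and> card {i. v \<in> g2 ` S i} <= n"
   using mult[of "unvec2 v"] by (meson card_image_le card_mono finite_imageI finite_subset le_trans)
 qed (rule S1)
 also have "emeasure lebesgue (vec2 ` B) = vol B"
  using emeasure_vec2_image[OF B] vec2_image_borel[OF B] by simp
 finally show "ennreal \<kappa> * vol (A \<inter> g -` B) <= of_nat n * vol B" .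
qed

section \<open>Iterated integrals, sections and reflections\<close>

lemma borel_measurable_fst' [measurable]: "fst \<in> borel_measurable (borel :: ('a::second_countable_topology \<times> 'b::second_countable_topology) measure)"
 by (intro borel_measurable_continuous_onI continuous_intros)
lemma borel_measurable_snd' [measurable]: "snd \<in> borel_measurable (borel :: ('a::second_countable_topology \<times> 'b::second_countable_topology) measure)"
 by (intro borel_measurable_continuous_onI continuous_intros)

lemma nn_integral_lborel_swap:
 fixes f :: "'a::euclidean_space \<times> 'b::euclidean_space => ennreal"
 assumes "f \<in> borel_measurable borel"
 shows "(LI x. LI y. f (x,y)) = (LI y. LI x. f (x,y))"
proof -
 have "case_prod (\<lambda>x y. f (x,y)) \<in> borel_measurable (lborel \<Otimes>\<^sub>M lborel)"
  using assms by (simp add: lborel_prod)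
 from lborel_pair.Fubini'[OF this] show ?thesis by simp
qed

lemma nn_integral_lborel_pair:
 fixes f :: "'a::euclidean_space \<times> 'b::euclidean_space => ennreal"
 assumes "f \<in> borel_measurable borel"
 shows "(LI z. f z) = (LI x. LI y. f (x,y))"
 using lborel.nn_integral_fst[of f "lborel :: 'a measure"] assms by (simp add: lborel_prod)

lemma nn_integral_lborel_measurable:
 fixes f :: "'a::euclidean_space \<times> 'b::euclidean_space => ennreal"
 assumes "f \<in> borel_measurable borel"
 shows "(\<lambda>x. \<integral>\<^sup>+y. f (x,y) \<partial>lborel) \<in> borel_measurable borel"
proof -
 have "f \<in> borel_measurable (lborel \<Otimes>\<^sub>M lborel)" using assms by (simp add: lborel_prod)
 from lborel.borel_measurable_nn_integral_fst[OF this] show ?thesis by simp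
qed

lemma emeasure_section_measurable:
 fixes X :: "('a::euclidean_space \<times> 'b::euclidean_space) set"
 assumes "X \<in> sets borel"
 shows "(\<lambda>x. vol {y. (x,y) \<in> X}) \<in> borel_measurable borel"
proof -
 have "(\<lambda>x. \<integral>\<^sup>+y. indicator X (x,y) \<partial>lborel) \<in> borel_measurable borel"
  by (rule nn_integral_lborel_measurable) (use assms in simp)
 moreover have "(LI y. indicator X (x,y)) = vol {y. (x,y) \<in> X}" for x
 proof -
  have "Pair x -` X \<in> sets borel" using measurable_sets[of "Pair x" borel borel X] assms by auto
  moreover have "Pair x -` X = {y. (x,y) \<in> X}" by auto
  moreover have "indicator X (x,y) = (indicator {y. (x,y) \<in> X} y :: ennreal)" for y by (auto simp: indicator_def)
  ultimately show ?thesis by simp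
 qed
 ultimately show ?thesis by simp
qed

lemma borel_section:
 fixes X :: "('a::euclidean_space \<times> 'b::euclidean_space) set"
 assumes "X \<in> sets borel" shows "{y. (x,y) \<in> X} \<in> sets borel"
 using measurable_sets[of "Pair x" borel borel X] assms by (auto simp: vimage_def)

lemma emeasure_lborel_sections:
 fixes X :: "('a::euclidean_space \<times> 'b::euclidean_space) set"
 assumes "X \<in> sets borel"
 shows "vol X = (LI x. vol {y. (x,y) \<in> X})"
proof -
 have "vol X = (LI z. indicator X z)" using assms by simp
 also have "... = (LI x. LI y. indicator X (x,y))"
  by (rule nn_integral_lborel_pair) (use assms in simp)
 also have "... = (LI x. vol {y. (x,y) \<in> X})"
 proof (rule nn_integral_cong)
  fix x
  have "indicator X (x,y) = (indicator {y. (x,y) \<in> X} y :: ennreal)" for y by (auto simp: indicator_def)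
  then show "(LI y. indicator X (x,y)) = vol {y. (x,y) \<in> X}"
   using borel_section[OF assms] by simp
 qed
 finally show ?thesis .
qed

lemma emeasure_lborel_Times:
 fixes A :: "'a::euclidean_space set" and B :: "'b::euclidean_space set"
 assumes "A \<in> sets borel" "B \<in> sets borel"
 shows "vol (A \<times> B) = vol A * vol B"
 using lborel.emeasure_pair_measure_Times[of A lborel B] assms by (simp add: lborel_prod)

lemma lborel_translate: "lborel = distr lborel borel (\<lambda>x. t + x :: 'a::euclidean_space)"
 using lborel_affine_euclidean[of "\<lambda>_. 1" t] by (simp add: euclidean_representation density_1)

lemma lborel_reflect: "lborel = distr lborel borel (\<lambda>x. t - x :: 'a::euclidean_space)"
 using lborel_affine_euclidean[of "\<lambda>_. -1" t]
 by (simp add: euclidean_representation density_1 sum_negf)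

lemma nn_integral_lborel_translate:
 fixes f :: "'a::euclidean_space => ennreal"
 assumes "f \<in> borel_measurable borel"
 shows "(LI x. f x) = (LI x. f (t + x))"
 by (subst lborel_translate[of t], subst nn_integral_distr) (use assms in auto)

lemma nn_integral_lborel_reflect:
 fixes f :: "'a::euclidean_space => ennreal"
 assumes "f \<in> borel_measurable borel"
 shows "(LI x. f x) = (LI x. f (t - x))"
 by (subst lborel_reflect[of t], subst nn_integral_distr) (use assms in auto)

section \<open>Incidences: triples of parameters with a large Jacobian\<close>

definition supn :: "plane => real" where "supn v = max \<bar>fst v\<bar> \<bar>snd v\<bar>"

text \<open>This is a strip around the line of \<open>v\<close>. Its width is of order \<kappa>
  divided by the size of \<open>v\<close>; its length is of the order of that size, because of the
  restriction on \<open>supn w\<close>. The product is independent of \<open>v\<close>. Slices are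
  indexed by the coordinate in which \<open>v\<close> is larger.\<close>

lemma strip_emeasure:
 assumes "\<kappa> > 0"
 shows "{w. supn w <= supn v \<and> \<bar>det2 v w\<bar> < \<kappa>} \<in> sets borel"
  "vol {w. supn w <= supn v \<and> \<bar>det2 v w\<bar> < \<kappa>} <= ennreal (4 * \<kappa>)"
proof -
 let ?X = "{w. supn w <= supn v \<and> \<bar>det2 v w\<bar> < \<kappa>}"
 show X: "?X \<in> sets borel"
  unfolding supn_def det2_def by measurable
 consider "supn v = 0" | "supn v > 0" "supn v = \<bar>fst v\<bar>" | "supn v > 0" "supn v = \<bar>snd v\<bar>"
  by (fastforce simp: supn_def)
 then show "vol ?X <= ennreal (4 * \<kappa>)"
 proof cases
  case 1
  then have "?X \<subseteq> {0}" by (auto simp: supn_def zero_prod_def)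
  then have "vol ?X <= vol {0 :: plane}" by (intro emeasure_mono) auto
  then show ?thesis by simp
 next
  case 2
  define m where "m = \<bar>fst v\<bar>"
  have m: "m > 0" using 2 by (simp add: m_def)
  have "vol ?X = (LI x. vol {y. (x,y) \<in> ?X})"
   by (rule emeasure_lborel_sections[OF X])
  also have "... <= (LI x. ennreal (2 * \<kappa> / m) * indicator {-m..m} x)"
  proof (rule nn_integral_mono)
   fix x
   let ?a = "snd v * x / fst v"
   have "{y. (x,y) \<in> ?X} \<subseteq> {?a - \<kappa>/m .. ?a + \<kappa>/m}"
   proof clarify
    fix y assume "\<bar>det2 v (x,y)\<bar> < \<kappa>"
    then have "\<bar>fst v * y - snd v * x\<bar> < \<kappa>" by (simp add: det2_def)
    moreover have "\<bar>fst v * y - snd v * x\<bar> = m * \<bar>y - ?a\<bar>"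
     using m unfolding m_def abs_mult[symmetric] by (simp add: right_diff_distrib)
    ultimately have "\<bar>y - ?a\<bar> <= \<kappa>/m" using m by (simp add: field_simps)
    then show "y \<in> {?a - \<kappa>/m .. ?a + \<kappa>/m}" by (simp add: abs_le_iff)
   qed
   then have "vol {y. (x,y) \<in> ?X} <= vol {?a - \<kappa>/m .. ?a + \<kappa>/m}"
    by (intro emeasure_mono) auto
   also have "... = ennreal (2 * \<kappa> / m)" using m assms by (simp add: field_simps)
   finally have *: "vol {y. (x,y) \<in> ?X} <= ennreal (2 * \<kappa> / m)" .
   show "vol {y. (x,y) \<in> ?X} <= ennreal (2 * \<kappa> / m) * indicator {-m..m} x"
   proof (cases "x \<in> {-m..m}")
    case False
    then have "{y. (x,y) \<in> ?X} = {}" using 2 by (auto simp: supn_def m_def)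
    then show ?thesis by (metis emeasure_empty zero_le)
   qed (use * in simp)
  qed
  also have "... = ennreal (2 * \<kappa> / m) * ennreal (2 * m)"
   using m by (simp add: nn_integral_cmult)
  also have "... = ennreal (4 * \<kappa>)" using m assms by (simp add: ennreal_mult[symmetric])
  finally show ?thesis .
 next
  case 3
  define m where "m = \<bar>snd v\<bar>"
  have m: "m > 0" using 3 by (simp add: m_def)
  have Xs: "{x. (x,y) \<in> ?X} \<in> sets borel" for y
   using measurable_sets[of "\<lambda>x. (x,y)" borel borel ?X] X by (auto simp: vimage_def)
  have "vol ?X = (LI z. indicator ?X z)" using X by simp
  also have "... = (LI y. LI x. indicator ?X (x,y))"
   using nn_integral_lborel_pair[of "indicator ?X"] nn_integral_lborel_swap[of "indicator ?X"] X by simp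
  also have "... <= (LI y. ennreal (2 * \<kappa> / m) * indicator {-m..m} y)"
  proof (rule nn_integral_mono)
   fix y
   let ?a = "fst v * y / snd v"
   have "{x. (x,y) \<in> ?X} \<subseteq> {?a - \<kappa>/m .. ?a + \<kappa>/m}"
   proof clarify
    fix x assume "\<bar>det2 v (x,y)\<bar> < \<kappa>"
    then have "\<bar>fst v * y - snd v * x\<bar> < \<kappa>" by (simp add: det2_def)
    moreover have "\<bar>fst v * y - snd v * x\<bar> = m * \<bar>x - ?a\<bar>"
     using m unfolding m_def abs_mult[symmetric] by (simp add: right_diff_distrib abs_minus_commute)
    ultimately have "\<bar>x - ?a\<bar> <= \<kappa>/m" using m by (simp add: field_simps)
    then show "x \<in> {?a - \<kappa>/m .. ?a + \<kappa>/m}" by (simp add: abs_le_iff)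
   qed
   then have "vol {x. (x,y) \<in> ?X} <= vol {?a - \<kappa>/m .. ?a + \<kappa>/m}"
    by (intro emeasure_mono) auto
   also have "... = ennreal (2 * \<kappa> / m)" using m assms by (simp add: field_simps)
   finally have *: "vol {x. (x,y) \<in> ?X} <= ennreal (2 * \<kappa> / m)" .
   have "(LI x. indicator ?X (x,y)) = vol {x. (x,y) \<in> ?X}"
   proof -
    have "indicator ?X (x,y) = (indicator {x. (x,y) \<in> ?X} x :: ennreal)" for x by (auto simp: indicator_def)
    then show ?thesis using Xs by simp
   qed
   moreover have "vol {x. (x,y) \<in> ?X} <= ennreal (2 * \<kappa> / m) * indicator {-m..m} y"
   proof (cases "y \<in> {-m..m}")
    case False
    then have "{x. (x,y) \<in> ?X} = {}" using 3 by (auto simp: supn_def m_def)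
    then show ?thesis by (metis emeasure_empty zero_le)
   qed (use * in simp)
   ultimately show "(LI x. indicator ?X (x,y)) <= ennreal (2 * \<kappa> / m) * indicator {-m..m} y" by simp
  qed
  also have "... = ennreal (2 * \<kappa> / m) * ennreal (2 * m)"
   using m by (simp add: nn_integral_cmult)
  also have "... = ennreal (4 * \<kappa>)" using m assms by (simp add: ennreal_mult[symmetric])
  finally show ?thesis .
 qed
qed


text \<open>All that the incidence argument uses of the surface. \<open>s\<close> is the height,
  \<open>G\<close> stands for the gradient and \<open>h\<close> for the Hessian determinant, but
  they enter through two measure bounds: one for \<open>G\<close> where \<open>h\<close> is large,
  one for the chord map where the triangle of gradients is large. The bound on the area of
  \<open>Q\<close> normalises all sets of parameters.\<close>

locale surf =
 fixes Q :: "(plane) set" and s :: "plane => real" and G :: "plane => plane"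
  and h :: "plane => real"
 assumes Q [measurable]: "Q \<in> sets borel" and Q1: "vol Q <= 1"
  and s [measurable]: "s \<in> borel_measurable borel" and G [measurable]: "G \<in> borel_measurable borel"
  and h [measurable]: "h \<in> borel_measurable borel"
  and mult: "!!\<epsilon>. \<epsilon> > 0 ==> \<exists>M. \<forall>\<kappa>. 0 < \<kappa> \<and> \<kappa> <= 1 --> (\<exists>n::nat. real n <= M * \<kappa> powr (-\<epsilon>) \<and>
   (\<forall>B\<in>sets borel. ennreal \<kappa> * vol {t\<in>Q. \<kappa> <= \<bar>h t\<bar> \<and> G t \<in> B} <= of_nat n * vol B) \<and>
   (\<forall>a b. \<forall>B\<in>sets borel. ennreal \<kappa> * vol {t\<in>Q. t - a \<in> Q \<and> t - b \<in> Q \<and>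
     \<kappa> <= \<bar>det2 (G t - G (t - a)) (G t - G (t - b))\<bar> \<and> (s t - s (t - a), s t - s (t - b)) \<in> B}
     <= of_nat n * vol B))"
begin

definition gam :: "plane => spc" where "gam t = (t, s t)"

lemma gam_measurable [measurable]: "gam \<in> borel_measurable borel"
 unfolding gam_def[abs_def] by measurable

text \<open>Its measure is the value at \<open>y\<close> of the averaging operator on the indicator
  of \<open>E\<close>, restricted to parameters whose Hessian is at least \<delta>.\<close>

definition Om :: "real => (spc) set => spc => (plane) set" where
 "Om \<delta> E y = {t\<in>Q. \<delta> <= \<bar>h t\<bar> \<and> y - gam t \<in> E}"

definition trip :: "real => (spc) set => ((spc) \<times> ((plane) \<times> (plane) \<times> (plane))) set" where
 "trip \<kappa> E = {p. fst (snd p) \<in> Q \<and> fst (snd (snd p)) \<in> Q \<and> snd (snd (snd p)) \<in> Q \<and>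
   fst p - gam (fst (snd p)) \<in> E \<and> fst p - gam (fst (snd (snd p))) \<in> E \<and> fst p - gam (snd (snd (snd p))) \<in> E \<and>
   \<kappa> <= \<bar>det2 (G (fst (snd p)) - G (fst (snd (snd p)))) (G (fst (snd p)) - G (snd (snd (snd p))))\<bar>}"

lemma trip_borel:
 assumes [measurable]: "E \<in> sets borel" shows "trip \<kappa> E \<in> sets borel"
proof -
 let ?B = "borel :: ((spc) \<times> ((plane) \<times> (plane) \<times> (plane))) measure"
 have [measurable]: "(\<lambda>p. fst (snd p)) \<in> borel_measurable ?B" "(\<lambda>p. fst (snd (snd p))) \<in> borel_measurable ?B"
  "(\<lambda>p. snd (snd (snd p))) \<in> borel_measurable ?B" "(\<lambda>p. fst p) \<in> borel_measurable ?B"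
  by (intro borel_measurable_continuous_onI continuous_intros)+
 have [measurable]: "(\<lambda>v. fst v) \<in> borel_measurable (borel :: (plane) measure)"
  "(\<lambda>v. snd v) \<in> borel_measurable (borel :: (plane) measure)"
  by (intro borel_measurable_continuous_onI continuous_intros)+
 define D where "D v w = fst v * snd w - snd v * fst w" for v w :: "plane"
 have D: "case_prod D \<in> borel_measurable borel"
  unfolding D_def case_prod_unfold by (intro borel_measurable_continuous_onI continuous_intros)
 have J: "(\<lambda>p. D (G (fst (snd p)) - G (fst (snd (snd p)))) (G (fst (snd p)) - G (snd (snd (snd p))))) \<in> borel_measurable ?B"
 proof -
  have "(\<lambda>p. (G (fst (snd p)) - G (fst (snd (snd p))), G (fst (snd p)) - G (snd (snd (snd p))))) \<in> borel_measurable ?B"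
   by measurable
  from measurable_compose[OF this D] show ?thesis by simp
 qed
 note [measurable] = J
 show ?thesis unfolding trip_def det2_def D_def[symmetric] by measurable
qed

text \<open>Two substitutions separate the variables. With x = y - \<gamma>(t) the first point is x.
  With t' = t - a and t'' = t - b the other two lie over known points of the plane, so their
  membership in \<open>E\<close> says that the chord map takes its value in a product of two
  vertical slices of \<open>E\<close>. The multiplicity bound then integrates to the cube of the
  measure of \<open>E\<close>.\<close>

lemma trilinear_upper:
 assumes E [measurable]: "E \<in> sets borel"
  and n: "!!a b B. B \<in> sets borel ==> ennreal \<kappa> * vol {t\<in>Q. t - a \<in> Q \<and> t - b \<in> Q \<and>
     \<kappa> <= \<bar>det2 (G t - G (t - a)) (G t - G (t - b))\<bar> \<and> (s t - s (t - a), s t - s (t - b)) \<in> B}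
     <= of_nat n * vol B"
 shows "ennreal \<kappa> * (LI y. LI \<tau>. indicator (trip \<kappa> E) (y,\<tau>)) <= of_nat n * vol E ^ 3"
proof -
 note [measurable] = trip_borel[OF E]
 define e where "e = vol E"
 \<comment> \<open>The part of \<open>E\<close> over the point \<open>fst x + a\<close>, with
   heights measured from \<open>snd x\<close>.\<close>
 define sl where "sl x a = {u. (fst x + a, snd x + u) \<in> E}" for x :: "spc" and a
 have sl_borel: "sl x a \<in> sets borel" for x a
  unfolding sl_def by measurable
 have slX: "{z. (fst x + fst z, snd x + snd z) \<in> E} \<in> sets borel" for x :: "spc"
  by measurable
 have sl_meas: "(\<lambda>a. vol (sl x a)) \<in> borel_measurable borel" for x
  using emeasure_section_measurable[OF slX[of x]] by (simp add: sl_def)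
 have sl_int: "(LI a. vol (sl x a)) = e" for x
 proof -
  have "(LI a. vol (sl x a)) = vol {z. (fst x + fst z, snd x + snd z) \<in> E}"
   using emeasure_lborel_sections[OF slX[of x]] by (simp add: sl_def)
  also have "... = (LI z. indicator E (x + z))"
  proof -
   have "indicator E (x + z) = (indicator {z. (fst x + fst z, snd x + snd z) \<in> E} z :: ennreal)" for z
    by (cases x; cases z) (auto simp: indicator_def)
   then show ?thesis using slX[of x] by simp
  qed
  also have "... = (LI z. indicator E z)"
   by (rule nn_integral_lborel_translate[symmetric]) simp
  finally show ?thesis by (simp add: e_def)
 qed
 have "(LI y. LI \<tau>. indicator (trip \<kappa> E) (y,\<tau>))
   = (LI \<tau>. LI y. indicator (trip \<kappa> E) (y,\<tau>))"
  by (rule nn_integral_lborel_swap) simp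
 also have "... = (LI \<tau>. LI x. indicator (trip \<kappa> E) (gam (fst \<tau>) + x, \<tau>))"
  by (intro nn_integral_cong nn_integral_lborel_translate) measurable
 also have "... = (LI x. LI \<tau>. indicator (trip \<kappa> E) (gam (fst \<tau>) + x, \<tau>))"
  using nn_integral_lborel_swap[of "\<lambda>(\<tau>,x). indicator (trip \<kappa> E) (gam (fst \<tau>) + x, \<tau>)"]
  by (simp add: case_prod_unfold)
 finally have swap: "(LI y. LI \<tau>. indicator (trip \<kappa> E) (y,\<tau>))
   = (LI x. LI \<tau>. indicator (trip \<kappa> E) (gam (fst \<tau>) + x, \<tau>))" .
 have fixed_x: "ennreal \<kappa> * (LI \<tau>. indicator (trip \<kappa> E) (gam (fst \<tau>) + x, \<tau>)) <= of_nat n * (e * e) * indicator E x" for x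
 proof -
  define f where "f \<tau> = (indicator (trip \<kappa> E) (gam (fst \<tau>) + x, \<tau>) :: ennreal)" for \<tau>
  have f [measurable]: "f \<in> borel_measurable borel" unfolding f_def[abs_def] by measurable
  have "(LI \<tau>. f \<tau>) = (LI t. LI \<sigma>. f (t,\<sigma>))"
   by (rule nn_integral_lborel_pair) measurable
  \<comment> \<open>The pair (t', t'') is replaced by the differences (a, b); \<open>t\<close> can
    then be integrated first.\<close>
  also have "... = (LI t. LI \<sigma>. f (t,(t,t) - \<sigma>))"
   by (intro nn_integral_cong nn_integral_lborel_reflect) measurable
  also have "... = (LI \<sigma>. LI t. f (t,(t,t) - \<sigma>))"
   using nn_integral_lborel_swap[of "\<lambda>(t,\<sigma>). f (t,(t,t) - \<sigma>)"] by (simp add: case_prod_unfold)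
  finally have "ennreal \<kappa> * (LI \<tau>. f \<tau>) = (LI \<sigma>. ennreal \<kappa> * (LI t. f (t,(t,t) - \<sigma>)))"
   using nn_integral_lborel_measurable[of "\<lambda>(\<sigma>,t). f (t,(t,t) - \<sigma>)"]
   by (simp add: nn_integral_cmult case_prod_unfold)
  also have "... <= (LI \<sigma>. (of_nat n * indicator E x) * (vol (sl x (fst \<sigma>)) * vol (sl x (snd \<sigma>))))"
  proof (rule nn_integral_mono)
   fix \<sigma> :: "(plane) \<times> (plane)"
   obtain a b where \<sigma>: "\<sigma> = (a,b)" by (cases \<sigma>)
   let ?T = "{t\<in>Q. t - a \<in> Q \<and> t - b \<in> Q \<and> \<kappa> <= \<bar>det2 (G t - G (t - a)) (G t - G (t - b))\<bar> \<and>
     (s t - s (t - a), s t - s (t - b)) \<in> sl x a \<times> sl x b}"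
   have T: "?T \<in> sets borel"
    using sl_borel[of x a] sl_borel[of x b] unfolding mem_Times_iff det2_def by measurable
   have "f (t,(t,t) - \<sigma>) = indicator E x * indicator ?T t" for t
    unfolding f_def trip_def \<sigma> sl_def
    by (cases x; cases a; cases b; cases t) (auto simp: indicator_def gam_def algebra_simps)
   then have "(LI t. f (t,(t,t) - \<sigma>)) = indicator E x * vol ?T"
    using T by (simp add: nn_integral_cmult)
   then have "ennreal \<kappa> * (LI t. f (t,(t,t) - \<sigma>)) = indicator E x * (ennreal \<kappa> * vol ?T)"
    by (simp add: mult_ac)
   also have "... <= indicator E x * (of_nat n * vol (sl x a \<times> sl x b))"
    by (intro mult_left_mono n borel_Times sl_borel) auto
   also have "... = (of_nat n * indicator E x) * (vol (sl x (fst \<sigma>)) * vol (sl x (snd \<sigma>)))"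
    by (simp add: emeasure_lborel_Times[OF sl_borel sl_borel] \<sigma> mult_ac)
   finally show "ennreal \<kappa> * (LI t. f (t,(t,t) - \<sigma>)) \<le>
    (of_nat n * indicator E x) * (vol (sl x (fst \<sigma>)) * vol (sl x (snd \<sigma>)))" .
  qed
  also have "... = (of_nat n * indicator E x) * (LI \<sigma>. vol (sl x (fst \<sigma>)) * vol (sl x (snd \<sigma>)))"
  proof (rule nn_integral_cmult)
   have "(\<lambda>\<sigma>::(plane) \<times> (plane). vol (sl x (fst \<sigma>))) \<in> borel_measurable borel"
    "(\<lambda>\<sigma>::(plane) \<times> (plane). vol (sl x (snd \<sigma>))) \<in> borel_measurable borel"
    by (rule measurable_compose[OF borel_measurable_fst' sl_meas] measurable_compose[OF borel_measurable_snd' sl_meas])+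
   then show "(\<lambda>\<sigma>. vol (sl x (fst \<sigma>)) * vol (sl x (snd \<sigma>))) \<in> borel_measurable lborel"
    by simp
  qed
  also have "(LI \<sigma>. vol (sl x (fst \<sigma>)) * vol (sl x (snd \<sigma>))) = e * e"
  proof -
   note [measurable] = sl_meas[of x]
   have "(LI \<sigma>. vol (sl x (fst \<sigma>)) * vol (sl x (snd \<sigma>)))
    = (LI a. LI b. vol (sl x a) * vol (sl x b))"
    using nn_integral_lborel_pair[of "\<lambda>\<sigma>. vol (sl x (fst \<sigma>)) * vol (sl x (snd \<sigma>))"] by simp
   also have "... = (LI a. vol (sl x a) * e)"
    by (simp add: nn_integral_cmult sl_int)
   also have "... = e * e" by (simp add: nn_integral_multc sl_int)
   finally show ?thesis .
  qed
  finally show ?thesis by (simp add: f_def mult_ac)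
 qed
 have m2: "(\<lambda>x. \<integral>\<^sup>+\<tau>. indicator (trip \<kappa> E) (gam (fst \<tau>) + x, \<tau>) \<partial>lborel :: ennreal) \<in> borel_measurable borel"
  using nn_integral_lborel_measurable[of "\<lambda>(x,\<tau>). indicator (trip \<kappa> E) (gam (fst \<tau>) + x, \<tau>)"]
  by (simp add: case_prod_unfold)
 have "ennreal \<kappa> * (LI y. LI \<tau>. indicator (trip \<kappa> E) (y,\<tau>))
   = (LI x. ennreal \<kappa> * (LI \<tau>. indicator (trip \<kappa> E) (gam (fst \<tau>) + x, \<tau>)))"
  unfolding swap using m2 by (simp add: nn_integral_cmult)
 also have "... <= (LI x. of_nat n * (e * e) * indicator E x)"
  by (rule nn_integral_mono) (rule fixed_x)
 also have "... = of_nat n * (e * e) * e" by (simp add: nn_integral_cmult e_def)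
 finally show ?thesis by (simp add: e_def power3_eq_cube mult_ac)
qed

text \<open>By symmetry the second vector may be taken as the shorter one. It then lies in a strip
  of measure at most 4 \<kappa>, which the multiplicity bound for \<open>G\<close> pulls back to the
  parameters. The two orders together give 8 \<kappa>.\<close>

lemma bad_pairs:
 assumes \<Omega> [measurable]: "\<Omega> \<in> sets borel" and sub: "\<Omega> \<subseteq> {t\<in>Q. \<delta> <= \<bar>h t\<bar>}" and \<kappa>: "\<kappa> > 0"
  and n: "!!B. B \<in> sets borel ==> ennreal \<delta> * vol {t\<in>Q. \<delta> <= \<bar>h t\<bar> \<and> G t \<in> B} <= of_nat n * vol B"
 shows "ennreal \<delta> * vol {\<sigma>\<in>\<Omega> \<times> \<Omega>. \<bar>det2 (p - G (fst \<sigma>)) (p - G (snd \<sigma>))\<bar> < \<kappa>}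
  <= of_nat n * ennreal (8 * \<kappa>) * vol \<Omega>"
proof -
 have Qd: "{t\<in>Q. \<delta> <= \<bar>h t\<bar>} \<in> sets borel" by measurable
 define st where "st v = {w. supn w <= supn v \<and> \<bar>det2 v w\<bar> < \<kappa>}" for v
 have one: "ennreal \<delta> * vol {t\<in>\<Omega>. p - G t \<in> st v} <= of_nat n * ennreal (4 * \<kappa>)" for v
 proof -
  let ?B = "{q. p - q \<in> st v}"
  have stb [measurable]: "st v \<in> sets borel" unfolding st_def by (rule strip_emeasure[OF \<kappa>])
  have B: "?B \<in> sets borel" by measurable
  have "vol ?B = (LI q. indicator (st v) (p - q))"
  proof -
   have "indicator (st v) (p - q) = (indicator ?B q :: ennreal)" for q by (auto simp: indicator_def)
   then show ?thesis using B by simp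
  qed
  also have "... = (LI q. indicator (st v) q)"
   by (rule nn_integral_lborel_reflect[symmetric]) simp
  also have "... <= ennreal (4 * \<kappa>)" using strip_emeasure[OF \<kappa>, of v] by (simp add: st_def)
  finally have eB: "vol ?B <= ennreal (4 * \<kappa>)" .
  have "vol {t\<in>\<Omega>. p - G t \<in> st v} <= vol {t\<in>Q. \<delta> <= \<bar>h t\<bar> \<and> G t \<in> ?B}"
   using sub by (intro emeasure_mono) auto
  then have "ennreal \<delta> * vol {t\<in>\<Omega>. p - G t \<in> st v} <= ennreal \<delta> * vol {t\<in>Q. \<delta> <= \<bar>h t\<bar> \<and> G t \<in> ?B}"
   by (rule mult_left_mono) simp
  also have "... <= of_nat n * vol ?B" by (rule n[OF B])
  also have "... <= of_nat n * ennreal (4 * \<kappa>)" using eB by (rule mult_left_mono) simp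
  finally show ?thesis .
 qed
 define X where "X = {\<sigma>\<in>\<Omega> \<times> \<Omega>. supn (p - G (snd \<sigma>)) <= supn (p - G (fst \<sigma>)) \<and> \<bar>det2 (p - G (fst \<sigma>)) (p - G (snd \<sigma>))\<bar> < \<kappa>}"
 have X [measurable]: "X \<in> sets borel" unfolding X_def supn_def det2_def mem_Times_iff by measurable
 have eX: "ennreal \<delta> * vol X <= of_nat n * ennreal (4 * \<kappa>) * vol \<Omega>"
 proof -
  have "ennreal \<delta> * vol X = (LI t. ennreal \<delta> * vol {t'. (t,t') \<in> X})"
   using emeasure_section_measurable[OF X] by (simp add: emeasure_lborel_sections[OF X] nn_integral_cmult)
  also have "... <= (LI t. of_nat n * ennreal (4 * \<kappa>) * indicator \<Omega> t)"
  proof (rule nn_integral_mono)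
   fix t
   have "{t'. (t,t') \<in> X} = (if t \<in> \<Omega> then {t'\<in>\<Omega>. p - G t' \<in> st (p - G t)} else {})"
    by (auto simp: X_def st_def)
   then show "ennreal \<delta> * vol {t'. (t,t') \<in> X} <= of_nat n * ennreal (4 * \<kappa>) * indicator \<Omega> t"
    using one[of "p - G t"] by (simp split: if_splits)
  qed
  also have "... = of_nat n * ennreal (4 * \<kappa>) * vol \<Omega>" by (simp add: nn_integral_cmult)
  finally show ?thesis .
 qed
 define X' where "X' = {\<sigma>. (snd \<sigma>, fst \<sigma>) \<in> X}"
 have X' [measurable]: "X' \<in> sets borel" unfolding X'_def by measurable
 have "vol X' = vol X"
 proof -
  have "vol X' = (LI \<sigma>. indicator X' \<sigma>)" by simp
  also have "... = (LI t. LI t'. indicator X' (t,t'))" by (rule nn_integral_lborel_pair) simp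
  also have "... = (LI t'. LI t. indicator X' (t,t'))" by (rule nn_integral_lborel_swap) simp
  also have "... = (LI t'. LI t. indicator X (t',t))"
   by (intro nn_integral_cong) (simp add: X'_def indicator_def)
  also have "... = (LI \<sigma>. indicator X \<sigma>)" by (rule nn_integral_lborel_pair[symmetric]) simp
  finally show ?thesis by simp
 qed
 have det_sym: "\<bar>det2 v w\<bar> = \<bar>det2 w v\<bar>" for v w by (simp add: det2_def abs_minus_commute mult.commute)
 have "{\<sigma>\<in>\<Omega> \<times> \<Omega>. \<bar>det2 (p - G (fst \<sigma>)) (p - G (snd \<sigma>))\<bar> < \<kappa>} \<subseteq> X \<union> X'"
  using det_sym by (auto simp: X_def X'_def)
 then have "vol {\<sigma>\<in>\<Omega> \<times> \<Omega>. \<bar>det2 (p - G (fst \<sigma>)) (p - G (snd \<sigma>))\<bar> < \<kappa>} <= vol (X \<union> X')"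
  by (rule emeasure_mono) simp
 also have "... <= vol X + vol X'" by (rule emeasure_subadditive) auto
 also have "... = 2 * vol X" using \<open>vol X' = _\<close> by (simp add: mult_2)
 finally have "ennreal \<delta> * vol {\<sigma>\<in>\<Omega> \<times> \<Omega>. \<bar>det2 (p - G (fst \<sigma>)) (p - G (snd \<sigma>))\<bar> < \<kappa>} <= ennreal \<delta> * (2 * vol X)"
  by (rule mult_left_mono) simp
 also have "... = 2 * (ennreal \<delta> * vol X)" by (simp add: mult_ac)
 also have "... <= 2 * (of_nat n * ennreal (4 * \<kappa>) * vol \<Omega>)" using eX by (rule mult_left_mono) simp
 also have "... = of_nat n * (2 * ennreal (4 * \<kappa>)) * vol \<Omega>" by (simp add: mult_ac)
 also have "2 * ennreal (4 * \<kappa>) = ennreal (8 * \<kappa>)" using \<kappa> by (simp add: ennreal_mult[symmetric] ennreal_numeral[symmetric] del: ennreal_numeral)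
 finally show ?thesis .
qed

lemma Om_borel:
 assumes [measurable]: "E \<in> sets borel" shows "Om \<delta> E y \<in> sets borel"
 unfolding Om_def by measurable

lemma Om_finite: "E \<in> sets borel ==> vol (Om \<delta> E y) = ennreal (measure lborel (Om \<delta> E y))"
 and Om_le1: "E \<in> sets borel ==> measure lborel (Om \<delta> E y) <= 1"
proof -
 assume E: "E \<in> sets borel"
 have "vol (Om \<delta> E y) <= vol Q" by (rule emeasure_mono) (auto simp: Om_def)
 then have le: "vol (Om \<delta> E y) <= 1" using Q1 by (rule order_trans)
 then show 1: "vol (Om \<delta> E y) = ennreal (measure lborel (Om \<delta> E y))"
  by (intro emeasure_eq_ennreal_measure) (auto simp: top_unique)
 show "measure lborel (Om \<delta> E y) <= 1" using le unfolding 1 by simp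
qed

text \<open>Let \<alpha> be the measure of \<open>Om\<close>. For every first parameter the bad
  pairs have measure at most 8 n \<kappa> \<alpha> / \<delta>, which the threshold \<open>le\<close>
  makes at most half of \<alpha>^2.\<close>

lemma good_triples:
 assumes E [measurable]: "E \<in> sets borel" and \<delta>: "\<delta> > 0" and \<kappa>: "\<kappa> > 0"
  and n: "!!B. B \<in> sets borel ==> ennreal \<delta> * vol {t\<in>Q. \<delta> <= \<bar>h t\<bar> \<and> G t \<in> B} <= of_nat n * vol B"
  and le: "16 * real n * \<kappa> <= \<delta> * measure lborel (Om \<delta> E y)"
 shows "ennreal (measure lborel (Om \<delta> E y) ^ 3 / 2) <= (LI \<tau>. indicator (trip \<kappa> E) (y,\<tau>))"
proof -
 define \<Omega> where "\<Omega> = Om \<delta> E y"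
 define \<alpha> where "\<alpha> = measure lborel \<Omega>"
 have \<Omega> [measurable]: "\<Omega> \<in> sets borel" unfolding \<Omega>_def by (rule Om_borel[OF E])
 have e\<Omega>: "vol \<Omega> = ennreal \<alpha>" unfolding \<alpha>_def \<Omega>_def by (rule Om_finite[OF E])
 have \<alpha>0: "\<alpha> >= 0" by (simp add: \<alpha>_def)
 note [measurable] = trip_borel[OF E]
 have inner: "ennreal (\<alpha>\<^sup>2 / 2) <= (LI \<sigma>. indicator (trip \<kappa> E) (y,(t,\<sigma>)))" if t: "t \<in> \<Omega>" for t
 proof -
  define bad where "bad = {\<sigma>\<in>\<Omega> \<times> \<Omega>. \<bar>det2 (G t - G (fst \<sigma>)) (G t - G (snd \<sigma>))\<bar> < \<kappa>}"
  define good where "good = {\<sigma>\<in>\<Omega> \<times> \<Omega>. \<kappa> <= \<bar>det2 (G t - G (fst \<sigma>)) (G t - G (snd \<sigma>))\<bar>}"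
  have [measurable]: "bad \<in> sets borel" "good \<in> sets borel"
   unfolding bad_def good_def det2_def mem_Times_iff by measurable
  have eOO: "vol (\<Omega> \<times> \<Omega>) = ennreal (\<alpha>\<^sup>2)"
   using \<alpha>0 by (simp add: emeasure_lborel_Times[OF \<Omega> \<Omega>] e\<Omega> ennreal_mult power2_eq_square)
  have OOb: "\<Omega> \<times> \<Omega> \<in> sets borel" by (rule borel_Times[OF \<Omega> \<Omega>])
  have fin: "vol X = ennreal (measure lborel X)" if "X \<subseteq> \<Omega> \<times> \<Omega>" for X
  proof -
   have "vol X <= ennreal (\<alpha>\<^sup>2)" using emeasure_mono[OF that, of lborel] OOb eOO by simp
   then show ?thesis by (intro emeasure_eq_ennreal_measure) (auto simp: top_unique)
  qed
  have fb: "vol bad = ennreal (measure lborel bad)" and fg: "vol good = ennreal (measure lborel good)"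
   by (rule fin, auto simp: bad_def good_def)+
  have "\<Omega> \<subseteq> {t\<in>Q. \<delta> <= \<bar>h t\<bar>}" by (auto simp: \<Omega>_def Om_def)
  from bad_pairs[OF \<Omega> this \<kappa> n, of "G t"] have "ennreal \<delta> * vol bad <= of_nat n * ennreal (8 * \<kappa>) * ennreal \<alpha>"
   by (simp add: bad_def e\<Omega>)
  then have "ennreal (\<delta> * measure lborel bad) <= ennreal (real n * (8 * \<kappa>) * \<alpha>)"
   unfolding fb using \<delta> \<kappa> \<alpha>0 by (simp add: ennreal_mult ennreal_of_nat_eq_real_of_nat)
  then have "\<delta> * measure lborel bad <= real n * (8 * \<kappa>) * \<alpha>"
   using \<kappa> \<alpha>0 by (subst (asm) ennreal_le_iff) auto
  also have "... <= (\<delta> * \<alpha> / 2) * \<alpha>"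
   using le \<alpha>0 by (intro mult_right_mono) (auto simp: \<alpha>_def \<Omega>_def)
  finally have "measure lborel bad <= \<alpha>\<^sup>2 / 2" using \<delta> by (simp add: power2_eq_square)
  moreover have "\<alpha>\<^sup>2 <= measure lborel good + measure lborel bad"
  proof -
   have "\<Omega> \<times> \<Omega> \<subseteq> good \<union> bad" by (auto simp: good_def bad_def)
   then have "vol (\<Omega> \<times> \<Omega>) <= vol (good \<union> bad)" by (rule emeasure_mono) simp
   also have "... <= vol good + vol bad" by (rule emeasure_subadditive) auto
   finally have "ennreal (\<alpha>\<^sup>2) <= ennreal (measure lborel good + measure lborel bad)"
    unfolding eOO fb fg by (simp add: ennreal_plus)
   then show ?thesis by (subst (asm) ennreal_le_iff) auto
  qed
  ultimately have "\<alpha>\<^sup>2 / 2 <= measure lborel good" by linarith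
  then have "ennreal (\<alpha>\<^sup>2 / 2) <= vol good" unfolding fg by (rule ennreal_leI)
  also have "... = (LI \<sigma>. indicator good \<sigma>)" by simp
  also have "... <= (LI \<sigma>. indicator (trip \<kappa> E) (y,(t,\<sigma>)))"
   using t by (intro nn_integral_mono) (auto simp: indicator_def good_def trip_def \<Omega>_def Om_def)
  finally show ?thesis .
 qed
 have "ennreal (\<alpha>^3 / 2) = ennreal (\<alpha>\<^sup>2 / 2) * ennreal \<alpha>"
  using \<alpha>0 by (simp add: ennreal_mult[symmetric] power2_eq_square power3_eq_cube)
 also have "... = (LI t. ennreal (\<alpha>\<^sup>2 / 2) * indicator \<Omega> t)" by (simp add: nn_integral_cmult e\<Omega>)
 also have "... <= (LI t. LI \<sigma>. indicator (trip \<kappa> E) (y,(t,\<sigma>)))"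
  by (rule nn_integral_mono) (use inner in \<open>auto simp: indicator_def\<close>)
 also have "... = (LI \<tau>. indicator (trip \<kappa> E) (y,\<tau>))"
  using nn_integral_lborel_pair[of "\<lambda>\<tau>. indicator (trip \<kappa> E) (y,\<tau>)"] by simp
 finally show ?thesis by (simp add: \<alpha>_def \<Omega>_def)
qed

definition incid :: "real => (spc) set => (spc) set => ennreal" where
 "incid \<delta> E F = (LI y. vol (Om \<delta> E y) * indicator F y)"

lemma Om_emeasure_measurable [measurable]:
 assumes [measurable]: "E \<in> sets borel"
 shows "(\<lambda>y. vol (Om \<delta> E y)) \<in> borel_measurable borel"
proof -
 let ?X = "{p :: (spc) \<times> (plane). snd p \<in> Q \<and> \<delta> <= \<bar>h (snd p)\<bar> \<and> fst p - gam (snd p) \<in> E}"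
 have "?X \<in> sets borel" by measurable
 from emeasure_section_measurable[OF this] show ?thesis by (simp add: Om_def)
qed

text \<open>Points where \<open>Om\<close> has measure below \<beta> contribute at most \<beta>
  times the measure of \<open>F\<close>. At the other points this \<kappa> is just small enough for
  \<open>good_triples\<close>, and the measure u of \<open>Om\<close> satisfies u <= u^3 /
  \<beta>^2, which the triples control.\<close>

lemma incid_two_term_bound:
 assumes E [measurable]: "E \<in> sets borel" and F [measurable]: "F \<in> sets borel"
  and \<delta>: "\<delta> > 0" and \<beta>: "\<beta> > 0" and n1: "n1 > 0"
  and n: "!!B. B \<in> sets borel ==> ennreal \<delta> * vol {t\<in>Q. \<delta> <= \<bar>h t\<bar> \<and> G t \<in> B} <= of_nat n1 * vol B"
  and \<kappa>: "\<kappa> = \<delta> * \<beta> / (16 * real n1)"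
  and n2: "!!a b B. B \<in> sets borel ==> ennreal \<kappa> * vol {t\<in>Q. t - a \<in> Q \<and> t - b \<in> Q \<and>
     \<kappa> <= \<bar>det2 (G t - G (t - a)) (G t - G (t - b))\<bar> \<and> (s t - s (t - a), s t - s (t - b)) \<in> B}
     <= of_nat n2 * vol B"
 shows "incid \<delta> E F <= ennreal \<beta> * vol F + ennreal (2 * real n2 / (\<kappa> * \<beta>\<^sup>2)) * vol E ^ 3"
proof -
 have \<kappa>0: "\<kappa> > 0" using \<delta> \<beta> n1 by (simp add: \<kappa>)
 note [measurable] = trip_borel[OF E]
 define J where "J y = (\<integral>\<^sup>+\<tau>. indicator (trip \<kappa> E) (y,\<tau>) \<partial>lborel :: ennreal)" for y
 have J [measurable]: "J \<in> borel_measurable borel"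
  unfolding J_def[abs_def] by (rule nn_integral_lborel_measurable) simp
 have pt: "vol (Om \<delta> E y) * indicator F y <= ennreal \<beta> * indicator F y + ennreal (2 / \<beta>\<^sup>2) * J y" for y
 proof (cases "measure lborel (Om \<delta> E y) >= \<beta>")
  case True
  define u where "u = measure lborel (Om \<delta> E y)"
  have u: "u >= \<beta>" using True by (simp add: u_def)
  have "16 * real n1 * \<kappa> = \<delta> * \<beta>" using n1 by (simp add: \<kappa>)
  also have "... <= \<delta> * u" using u \<delta> by simp
  finally have "ennreal (u^3 / 2) <= J y"
   unfolding u_def J_def using good_triples[OF E \<delta> \<kappa>0 n, of y] by blast
  then have "ennreal (2 / \<beta>\<^sup>2) * ennreal (u^3 / 2) <= ennreal (2 / \<beta>\<^sup>2) * J y" by (rule mult_left_mono) simp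
  moreover have "ennreal u <= ennreal (2 / \<beta>\<^sup>2) * ennreal (u^3 / 2)"
  proof -
   have "u * \<beta>\<^sup>2 <= u * u\<^sup>2" using u \<beta> by (intro mult_left_mono power_mono) auto
   then have "u <= 2 / \<beta>\<^sup>2 * (u^3 / 2)" using \<beta> by (simp add: field_simps power3_eq_cube power2_eq_square)
   then have "ennreal u <= ennreal (2 / \<beta>\<^sup>2 * (u^3 / 2))" by (rule ennreal_leI)
   then show ?thesis using u \<beta> by (simp add: ennreal_mult[symmetric])
  qed
  ultimately have "ennreal u <= ennreal (2 / \<beta>\<^sup>2) * J y" by (rule order_trans[rotated])
  then have "vol (Om \<delta> E y) <= ennreal (2 / \<beta>\<^sup>2) * J y" by (simp add: Om_finite[OF E] u_def)
  then show ?thesis by (auto simp: indicator_def intro: order_trans add_increasing)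
 next
  case False
  then have "vol (Om \<delta> E y) <= ennreal \<beta>" unfolding Om_finite[OF E] by (intro ennreal_leI) auto
  then show ?thesis by (auto simp: indicator_def intro: add_increasing2)
 qed
 have tl: "ennreal \<kappa> * (LI y. J y) <= of_nat n2 * vol E ^ 3"
  unfolding J_def by (rule trilinear_upper[OF E n2])
 have "(LI y. J y) = ennreal (1 / \<kappa>) * (ennreal \<kappa> * (LI y. J y))"
  using \<kappa>0 by (simp add: mult.assoc[symmetric] ennreal_mult[symmetric])
 also have "... <= ennreal (1 / \<kappa>) * (of_nat n2 * vol E ^ 3)"
  using tl by (rule mult_left_mono) simp
 finally have Jb: "(LI y. J y) <= ennreal (1 / \<kappa>) * (of_nat n2 * vol E ^ 3)" .
 have "incid \<delta> E F <= (LI y. ennreal \<beta> * indicator F y + ennreal (2 / \<beta>\<^sup>2) * J y)"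
  unfolding incid_def by (rule nn_integral_mono) (rule pt)
 also have "... = ennreal \<beta> * vol F + ennreal (2 / \<beta>\<^sup>2) * (LI y. J y)"
  by (simp add: nn_integral_add nn_integral_cmult)
 also have "... <= ennreal \<beta> * vol F + ennreal (2 / \<beta>\<^sup>2) * (ennreal (1 / \<kappa>) * (of_nat n2 * vol E ^ 3))"
  using Jb by (intro add_mono mult_left_mono) auto
 also have "ennreal (2 / \<beta>\<^sup>2) * (ennreal (1 / \<kappa>) * (of_nat n2 * vol E ^ 3))
   = ennreal (2 * real n2 / (\<kappa> * \<beta>\<^sup>2)) * vol E ^ 3"
 proof -
  have "ennreal (2 * real n2 / (\<kappa> * \<beta>\<^sup>2)) = ennreal (2 / \<beta>\<^sup>2 * (1 / \<kappa>) * real n2)" by (simp add: field_simps)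
  also have "... = ennreal (2 / \<beta>\<^sup>2) * ennreal (1 / \<kappa>) * ennreal (real n2)"
   by (subst ennreal_mult'', simp, subst ennreal_mult'') (use \<kappa>0 in auto)
  finally show ?thesis by (simp add: mult_ac ennreal_of_nat_eq_real_of_nat)
 qed
 finally show ?thesis .
qed

end

section \<open>The incidence bound after optimisation\<close>

context surf
begin

text \<open>The multiplicity for \<open>G\<close> costs \<delta>^-e1, so 1/\<kappa> is of order
  \<delta>^(-1-e1) / \<beta>; the multiplicity for the chord map raises this to the power 1 +
  e1.\<close>

lemma incid_beta_bound:
 assumes "0 < \<epsilon>" "\<epsilon> <= 1"
 shows "\<exists>K>0. \<forall>\<delta> \<beta> E F. 0 < \<delta> \<and> \<delta> <= 1 \<and> 0 < \<beta> \<and> E \<in> sets borel \<and> F \<in> sets borel -->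
   incid \<delta> E F <= ennreal \<beta> * vol F + ennreal (K * \<delta> powr (-1-\<epsilon>) * \<beta> powr (-3-\<epsilon>)) * vol E ^ 3"
proof -
 \<comment> \<open>Chosen so that (1 + e1)^2 <= 1 + 3 e1 = 1 + \<epsilon>, using e1 <= 1.\<close>
 define e1 where "e1 = \<epsilon> / 3"
 have e1: "e1 > 0" "e1 <= 1" "3 * e1 = \<epsilon>" using assms by (auto simp: e1_def)
 obtain M0 where M0: "!!\<kappa>. 0 < \<kappa> \<and> \<kappa> <= 1 ==> (\<exists>n::nat. real n <= M0 * \<kappa> powr (-e1) \<and>
   (\<forall>B\<in>sets borel. ennreal \<kappa> * vol {t\<in>Q. \<kappa> <= \<bar>h t\<bar> \<and> G t \<in> B} <= of_nat n * vol B) \<and>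
   (\<forall>a b. \<forall>B\<in>sets borel. ennreal \<kappa> * vol {t\<in>Q. t - a \<in> Q \<and> t - b \<in> Q \<and>
     \<kappa> <= \<bar>det2 (G t - G (t - a)) (G t - G (t - b))\<bar> \<and> (s t - s (t - a), s t - s (t - b)) \<in> B}
     <= of_nat n * vol B))"
  using mult[OF e1(1)] by blast
 define M where "M = max 1 M0"
 have M: "M >= 1" "M0 <= M" by (auto simp: M_def)
 define K where "K = 2 * M * (16 * M) powr (1 + e1)"
 have K: "K > 0" using M by (simp add: K_def)
 show ?thesis
 proof (intro exI[of _ K] conjI K allI impI)
  fix \<delta> \<beta> :: real and E F :: "(spc) set"
  assume a: "0 < \<delta> \<and> \<delta> <= 1 \<and> 0 < \<beta> \<and> E \<in> sets borel \<and> F \<in> sets borel"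
  show "incid \<delta> E F <= ennreal \<beta> * vol F + ennreal (K * \<delta> powr (-1-\<epsilon>) * \<beta> powr (-3-\<epsilon>)) * vol E ^ 3"
  proof (cases "\<beta> <= 1")
   \<comment> \<open>For \<beta> > 1 the first term suffices, as every \<open>Om\<close> has measure
     at most 1.\<close>
   case False
   have "incid \<delta> E F <= (LI y. ennreal \<beta> * indicator F y)"
    unfolding incid_def
   proof (rule nn_integral_mono)
    fix y
    have "vol (Om \<delta> E y) <= ennreal \<beta>"
     using Om_finite[of E \<delta> y] Om_le1[of E \<delta> y] a False by (simp add: ennreal_leI)
    then show "vol (Om \<delta> E y) * indicator F y <= ennreal \<beta> * indicator F y"
     by (rule mult_right_mono) simp
   qed
   also have "... = ennreal \<beta> * vol F" by (rule nn_integral_cmult_indicator) (use a in auto)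
   finally show ?thesis by (rule add_increasing2[rotated]) simp
  next
   case True
   have d1: "1 <= \<delta> powr (-e1)" using powr_mono'[of "-e1" 0 \<delta>] a e1 by simp
   obtain n0 where n0: "real n0 <= M0 * \<delta> powr (-e1)"
    "!!B. B\<in>sets borel ==> ennreal \<delta> * vol {t\<in>Q. \<delta> <= \<bar>h t\<bar> \<and> G t \<in> B} <= of_nat n0 * vol B"
    using M0[of \<delta>] a by blast
   define n1 where "n1 = max 1 n0"
   have n1: "n1 > 0" "real n1 <= M * \<delta> powr (-e1)"
   proof -
    have "1 * 1 <= M * \<delta> powr (-e1)" using M d1 by (intro mult_mono) auto
    moreover have "M0 * \<delta> powr (-e1) <= M * \<delta> powr (-e1)" using M by (intro mult_right_mono) auto
    ultimately show "real n1 <= M * \<delta> powr (-e1)" using n0(1) by (simp add: n1_def)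
   qed (simp add: n1_def)
   have n1B: "ennreal \<delta> * vol {t\<in>Q. \<delta> <= \<bar>h t\<bar> \<and> G t \<in> B} <= of_nat n1 * vol B" if "B \<in> sets borel" for B
   proof -
    have "of_nat n0 * vol B <= of_nat n1 * vol B"
     by (intro mult_right_mono) (auto simp: n1_def)
    then show ?thesis using n0(2)[OF that] by (rule order_trans[rotated])
   qed
   define \<kappa> where "\<kappa> = \<delta> * \<beta> / (16 * real n1)"
   have \<kappa>: "0 < \<kappa>" "\<kappa> <= 1"
   proof -
    show "0 < \<kappa>" using a n1 by (simp add: \<kappa>_def)
    have "\<delta> * \<beta> <= 1" using a True by (simp add: mult_le_one)
    moreover have "1 <= 16 * real n1" using n1 by linarith
    ultimately show "\<kappa> <= 1" unfolding \<kappa>_def by (subst pos_divide_le_eq) auto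
   qed
   obtain n2 where n2: "real n2 <= M0 * \<kappa> powr (-e1)"
    "!!a b B. B\<in>sets borel ==> ennreal \<kappa> * vol {t\<in>Q. t - a \<in> Q \<and> t - b \<in> Q \<and>
     \<kappa> <= \<bar>det2 (G t - G (t - a)) (G t - G (t - b))\<bar> \<and> (s t - s (t - a), s t - s (t - b)) \<in> B}
     <= of_nat n2 * vol B"
    using M0[of \<kappa>] \<kappa> by blast
   have main: "incid \<delta> E F <= ennreal \<beta> * vol F + ennreal (2 * real n2 / (\<kappa> * \<beta>\<^sup>2)) * vol E ^ 3"
    by (rule incid_two_term_bound[OF _ _ _ _ n1(1) n1B \<kappa>_def n2(2)]) (use a in auto)
   have k1: "1 / \<kappa> <= 16 * M * \<delta> powr (-1-e1) * \<beta> powr (-1)"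
   proof -
    have "1 / \<kappa> = 16 * real n1 * (1 / \<delta>) * (1 / \<beta>)" by (simp add: \<kappa>_def)
    also have "... <= 16 * (M * \<delta> powr (-e1)) * (1 / \<delta>) * (1 / \<beta>)"
     using n1 a by (intro mult_right_mono mult_left_mono) auto
    also have "... = 16 * M * (\<delta> powr (-e1) * \<delta> powr (-1)) * \<beta> powr (-1)"
     using a by (simp add: powr_minus_divide)
    also have "... = 16 * M * \<delta> powr (-1-e1) * \<beta> powr (-1)"
     by (subst powr_add[symmetric], subst add.commute) simp
    finally show ?thesis .
   qed
   have "real n2 / \<kappa> <= M * (1/\<kappa>) powr (1 + e1)"
   proof -
    have "real n2 / \<kappa> <= (M * \<kappa> powr (-e1)) * (1 / \<kappa>)"
    proof -
     have "M0 * \<kappa> powr (-e1) <= M * \<kappa> powr (-e1)" using M by (intro mult_right_mono) auto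
     then have "real n2 <= M * \<kappa> powr (-e1)" using n2(1) by linarith
     from divide_right_mono[OF this, of \<kappa>] show ?thesis using \<kappa> by simp
    qed
    also have "... = M * ((1/\<kappa>) powr e1 * (1/\<kappa>) powr 1)"
    proof -
     have "(1/\<kappa>) powr e1 = \<kappa> powr (-e1)" using \<kappa> by (simp add: powr_minus_divide powr_divide)
     then show ?thesis using \<kappa> by simp
    qed
    also have "... = M * (1/\<kappa>) powr (1 + e1)" by (simp only: powr_add[symmetric] add.commute)
    finally show ?thesis .
   qed
   also have "... <= M * (16 * M * \<delta> powr (-1-e1) * \<beta> powr (-1)) powr (1 + e1)"
    using k1 \<kappa> e1 M by (intro mult_left_mono powr_mono2) auto
   also have "... = M * (16 * M) powr (1+e1) * \<delta> powr ((-1-e1) * (1+e1)) * \<beta> powr (-1-e1)"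
   proof -
    have "(16 * M * \<delta> powr (-1-e1) * \<beta> powr (-1)) powr (1 + e1)
      = (16 * M) powr (1+e1) * (\<delta> powr (-1-e1)) powr (1+e1) * (\<beta> powr (-1)) powr (1+e1)"
     using M by (subst powr_mult, simp, simp, subst powr_mult) auto
    moreover have "(\<beta> powr (-1)) powr (1+e1) = \<beta> powr (-1-e1)"
     unfolding powr_powr by (rule arg_cong[where f = "\<lambda>z. \<beta> powr z"]) simp
    ultimately show ?thesis by (simp only: powr_powr mult.assoc)
   qed
   also have "... <= M * (16 * M) powr (1+e1) * \<delta> powr (-1-\<epsilon>) * \<beta> powr (-1-\<epsilon>)"
   proof (intro mult_mono mult_left_mono)
    have "e1 * e1 <= e1" using e1 mult_left_mono[of e1 1 e1] by simp
    then have "(1 + e1) * (1 + e1) <= 1 + \<epsilon>" using e1(3) by (simp add: algebra_simps)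
    then have "-1-\<epsilon> <= (-1-e1) * (1+e1)" by (simp add: algebra_simps)
    then show "\<delta> powr ((-1-e1) * (1+e1)) <= \<delta> powr (-1-\<epsilon>)" using a by (intro powr_mono') auto
    show "\<beta> powr (-1-e1) <= \<beta> powr (-1-\<epsilon>)" using a True e1 by (intro powr_mono') auto
   qed (use M in auto)
   finally have "2 * real n2 / \<kappa> <= K * \<delta> powr (-1-\<epsilon>) * \<beta> powr (-1-\<epsilon>)" by (simp add: K_def)
   then have "(2 * real n2 / \<kappa>) / \<beta>\<^sup>2 <= (K * \<delta> powr (-1-\<epsilon>) * \<beta> powr (-1-\<epsilon>)) / \<beta>\<^sup>2"
    by (rule divide_right_mono) simp
   also have "... = K * \<delta> powr (-1-\<epsilon>) * (\<beta> powr (-1-\<epsilon>) * \<beta> powr (-2))"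
    using a by (simp add: powr_minus_divide powr_numeral)
   also have "\<beta> powr (-1-\<epsilon>) * \<beta> powr (-2) = \<beta> powr (-3-\<epsilon>)" by (simp add: powr_add[symmetric])
   finally have "2 * real n2 / (\<kappa> * \<beta>\<^sup>2) <= K * \<delta> powr (-1-\<epsilon>) * \<beta> powr (-3-\<epsilon>)" by simp
   then have "ennreal (2 * real n2 / (\<kappa> * \<beta>\<^sup>2)) * vol E ^ 3 <= ennreal (K * \<delta> powr (-1-\<epsilon>) * \<beta> powr (-3-\<epsilon>)) * vol E ^ 3"
    by (intro mult_right_mono ennreal_leI) auto
   then show ?thesis using main by (meson add_left_mono order_trans)
  qed
 qed
qed

text \<open>\<beta> is chosen to make the two terms equal: \<beta>^(4+\<epsilon>) = K
  \<delta>^(-1-\<epsilon>) |E|^3 / |F|. This is the origin of the denominators 4 +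
  \<epsilon>.\<close>

theorem incid_bilinear_bound:
 assumes \<epsilon>: "0 < \<epsilon>" "\<epsilon> <= 1"
 shows "\<exists>K>0. \<forall>\<delta> E F. 0 < \<delta> \<and> \<delta> <= 1 \<and> fin_sets E F -->
   incid \<delta> E F <= ennreal (K * \<delta> powr (-(1+\<epsilon>)/(4+\<epsilon>)) * measure lborel E powr (3/(4+\<epsilon>)) * measure lborel F powr (1 - 1/(4+\<epsilon>)))"
proof -
 obtain K where K: "K > 0" and b: "!!\<delta> \<beta> E F. 0 < \<delta> \<and> \<delta> <= 1 \<and> 0 < \<beta> \<and> E \<in> sets borel \<and> F \<in> sets borel ==>
   incid \<delta> E F <= ennreal \<beta> * vol F + ennreal (K * \<delta> powr (-1-\<epsilon>) * \<beta> powr (-3-\<epsilon>)) * vol E ^ 3"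
  using incid_beta_bound[OF \<epsilon>] by blast
 define q where "q = 4 + \<epsilon>"
 have q: "q > 4" using \<epsilon> by (simp add: q_def)
 show ?thesis
 proof (intro exI[of _ "2 * K powr (1/q)"] conjI allI impI)
  show "0 < 2 * K powr (1/q)" using K by simp
  fix \<delta> :: real and E F :: "(spc) set"
  assume a: "0 < \<delta> \<and> \<delta> <= 1 \<and> fin_sets E F"
  define e f where "e = measure lborel E" and "f = measure lborel F"
  have ef: "vol E = ennreal e" "vol F = ennreal f" "e >= 0" "f >= 0"
   unfolding e_def f_def using a by (auto simp: emeasure_eq_ennreal_measure)
  have bb: "incid \<delta> E F <= ennreal (\<beta> * f + K * \<delta> powr (-1-\<epsilon>) * \<beta> powr (-3-\<epsilon>) * e^3)" if "\<beta> > 0" for \<beta>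
   using b[of \<delta> \<beta> E F] a that ef K by (simp add: ennreal_mult ennreal_plus ennreal_power)
  have "incid \<delta> E F <= ennreal (2 * K powr (1/q) * \<delta> powr (-(1+\<epsilon>)/q) * e powr (3/q) * f powr (1 - 1/q))"
  proof (cases "e = 0 \<or> f = 0")
   case True
   have "incid \<delta> E F <= 0"
   proof (cases "f = 0")
    case True
    then have "F \<in> null_sets lborel" using ef a by (auto simp: null_sets_def)
    then have "AE y in lborel. y \<notin> F" by (rule AE_not_in)
    then have "incid \<delta> E F = (\<integral>\<^sup>+y. 0 \<partial>(lborel :: (spc) measure))"
     unfolding incid_def by (intro nn_integral_cong_AE) auto
    then show ?thesis by simp
   next
    case False
    then have "e = 0" using True by simp
    \<comment> \<open>For a null set \<open>E\<close> only the term with \<beta> is left, and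
      \<beta> may be arbitrarily small.\<close>
    have "incid \<delta> E F <= ennreal \<gamma>" if "\<gamma> > 0" for \<gamma>
     using bb[of "\<gamma> / f"] False ef that \<open>e = 0\<close> by simp
    then show ?thesis by (metis ennreal_le_epsilon add_0 zero_less_numeral)
   qed
   then show ?thesis by (meson order_trans zero_le)
  next
   case False
   then have pos: "e > 0" "f > 0" using ef by auto
   define X where "X = K * \<delta> powr (-1-\<epsilon>) * e^3 / f"
   have X: "X > 0" using pos K a by (simp add: X_def)
   define \<beta> where "\<beta> = X powr (1/q)"
   have \<beta>: "\<beta> > 0" using X by (simp add: \<beta>_def)
   have bq: "\<beta> powr q = X" using X q by (simp add: \<beta>_def powr_powr)
   have "K * \<delta> powr (-1-\<epsilon>) * \<beta> powr (-3-\<epsilon>) * e^3 = X * f * \<beta> powr (-3-\<epsilon>)" using pos by (simp add: X_def)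
   also have "... = \<beta> powr q * \<beta> powr (-3-\<epsilon>) * f" by (simp add: bq)
   also have "... = \<beta> * f" using \<beta> by (simp add: powr_add[symmetric] q_def)
   finally have "incid \<delta> E F <= ennreal (2 * \<beta> * f)" using bb[OF \<beta>] by (simp add: mult.assoc)
   also have "2 * \<beta> * f = 2 * K powr (1/q) * \<delta> powr (-(1+\<epsilon>)/q) * e powr (3/q) * f powr (1 - 1/q)"
   proof -
    have "(e^3) powr (1/q) = e powr (3/q)"
     unfolding powr_realpow[OF pos(1), symmetric] powr_powr by simp
    then have b: "\<beta> = K powr (1/q) * \<delta> powr (-(1+\<epsilon>)/q) * e powr (3/q) / f powr (1/q)"
     unfolding \<beta>_def X_def using pos K a by (simp add: powr_divide powr_mult powr_powr)
    have "f / f powr (1/q) = f powr (1 - 1/q)" using pos by (simp add: powr_diff)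
    moreover have "2 * \<beta> * f = 2 * K powr (1/q) * \<delta> powr (-(1+\<epsilon>)/q) * e powr (3/q) * (f / f powr (1/q))"
     unfolding b by simp
    ultimately show ?thesis by simp
   qed
   finally show ?thesis .
  qed
  then show "incid \<delta> E F <= ennreal (2 * K powr (1/q) * \<delta> powr (-(1+\<epsilon>)/(4+\<epsilon>)) * measure lborel E powr (3/(4+\<epsilon>)) * measure lborel F powr (1 - 1/(4+\<epsilon>)))"
   by (simp add: q_def e_def f_def)
 qed
qed

end

section \<open>Functions holomorphic in two complex variables\<close>

text \<open>Joint continuity is what lets contour integrals be interchanged; separate holomorphy is
  what Cauchy's formula uses.\<close>

definition hol2 :: "real => (complex => complex => complex) => bool" where
 "hol2 r h \<longleftrightarrow> continuous_on (ball 0 r \<times> ball 0 r) (\<lambda>(s,t). h s t) \<and>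
   (\<forall>s\<in>ball 0 r. h s holomorphic_on ball 0 r) \<and> (\<forall>t\<in>ball 0 r. (\<lambda>s. h s t) holomorphic_on ball 0 r)"

lemma circlepath_integral_param_continuous:
 fixes F :: "'a::topological_space => complex => complex"
 assumes "continuous_on (U \<times> sphere 0 \<rho>) (\<lambda>(s,u). F s u)" "\<rho> >= 0"
 shows "continuous_on U (\<lambda>s. contour_integral (circlepath 0 \<rho>) (F s))"
proof -
 have "continuous_on (U \<times> cbox 0 1) (\<lambda>(s,x). F s (circlepath 0 \<rho> x) * (2 * pi * \<i> * \<rho> * exp (2 * of_real pi * \<i> * x)))"
 proof -
  have c: "continuous_on UNIV (circlepath 0 \<rho>)"
   unfolding circlepath_def part_circlepath_def linepath_def by (intro continuous_intros)
  have "continuous_on (U \<times> cbox 0 1) (\<lambda>p. (fst p, circlepath 0 \<rho> (snd p)))"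
   by (intro continuous_intros continuous_on_compose2[OF c]) auto
  moreover have "(\<lambda>p. (fst p, circlepath 0 \<rho> (snd p))) ` (U \<times> cbox 0 1) \<subseteq> U \<times> sphere 0 \<rho>"
   using assms(2) by (auto simp: circlepath norm_mult norm_exp_eq_Re)
  ultimately have "continuous_on (U \<times> cbox 0 1) (\<lambda>p. (\<lambda>(s,u). F s u) (fst p, circlepath 0 \<rho> (snd p)))"
   by (rule continuous_on_compose2[OF assms(1)])
  then show ?thesis unfolding case_prod_unfold by (intro continuous_intros) auto
 qed
 from integral_continuous_on_param[OF this] show ?thesis
  by (simp add: contour_integral_integral vector_derivative_circlepath)
qed

text \<open>Morera's theorem: the integral over a triangle is moved inside the contour integral,
  where it vanishes by Cauchy's theorem.\<close>

lemma circlepath_integral_param_holomorphic: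
 assumes cont: "continuous_on (U \<times> sphere 0 \<rho>) (\<lambda>(s,u). F s u)" and U: "open U" and \<rho>: "\<rho> > 0"
  and hol: "!!u. u \<in> sphere 0 \<rho> ==> (\<lambda>s. F s u) holomorphic_on U"
 shows "(\<lambda>s. contour_integral (circlepath 0 \<rho>) (F s)) holomorphic_on U"
proof -
 have pi: "path_image (circlepath 0 \<rho>) = sphere 0 \<rho>" using \<rho> by (simp add: sphere_def)
 have "(\<lambda>s. contour_integral (circlepath 0 \<rho>) (F s)) analytic_on U"
 proof (rule Morera_triangle[OF _ U], safe)
  show "continuous_on U (\<lambda>s. contour_integral (circlepath 0 \<rho>) (F s))"
   by (rule circlepath_integral_param_continuous[OF cont]) (use \<rho> in auto)
  fix a b c assume abc: "convex hull {a,b,c} \<subseteq> U"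
  have swap: "contour_integral (linepath x y) (\<lambda>s. contour_integral (circlepath 0 \<rho>) (F s))
    = contour_integral (circlepath 0 \<rho>) (\<lambda>u. contour_integral (linepath x y) (\<lambda>s. F s u))"
   and int: "(\<lambda>u. contour_integral (linepath x y) (\<lambda>s. F s u)) contour_integrable_on (circlepath 0 \<rho>)"
   if sub: "closed_segment x y \<subseteq> U" for x y
  proof -
   have c1: "continuous_on (closed_segment x y \<times> sphere 0 \<rho>) (\<lambda>(s,u). F s u)"
    by (rule continuous_on_subset[OF cont]) (use sub in auto)
   show "contour_integral (linepath x y) (\<lambda>s. contour_integral (circlepath 0 \<rho>) (F s))
    = contour_integral (circlepath 0 \<rho>) (\<lambda>u. contour_integral (linepath x y) (\<lambda>s. F s u))"
    by (rule contour_integral_swap)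
      (use c1 pi in \<open>auto simp: vector_derivative_circlepath intro!: continuous_intros\<close>)
   have "continuous_on (sphere 0 \<rho> \<times> cbox 0 1) (\<lambda>(u,x'). F (linepath x y x') u * (y - x))"
   proof -
    have c: "continuous_on UNIV (linepath x y)" unfolding linepath_def by (intro continuous_intros)
    have "continuous_on (sphere 0 \<rho> \<times> cbox 0 1) (\<lambda>p::complex \<times> real. (linepath x y (snd p), fst p))"
     by (intro continuous_intros continuous_on_compose2[OF c]) auto
    moreover have "(\<lambda>p::complex \<times> real. (linepath x y (snd p), fst p)) ` (sphere 0 \<rho> \<times> cbox 0 1) \<subseteq> U \<times> sphere 0 \<rho>"
    proof (rule image_subsetI)
     fix p :: "complex \<times> real" assume "p \<in> sphere 0 \<rho> \<times> cbox 0 1"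
     then show "(linepath x y (snd p), fst p) \<in> U \<times> sphere 0 \<rho>"
      using sub linepath_in_path[of "snd p" x y] by (auto simp: mem_Times_iff)
    qed
    ultimately have "continuous_on (sphere 0 \<rho> \<times> cbox 0 1) (\<lambda>p. (\<lambda>(s,u). F s u) (linepath x y (snd p), fst p))"
     by (rule continuous_on_compose2[OF cont])
    then show ?thesis unfolding case_prod_unfold by (intro continuous_intros) auto
   qed
   from integral_continuous_on_param[OF this]
   have "continuous_on (sphere 0 \<rho>) (\<lambda>u. contour_integral (linepath x y) (\<lambda>s. F s u))"
    by (simp add: contour_integral_integral)
   then show "(\<lambda>u. contour_integral (linepath x y) (\<lambda>s. F s u)) contour_integrable_on (circlepath 0 \<rho>)"
    by (intro contour_integrable_continuous_circlepath) (simp only: pi)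
  qed
  have seg: "closed_segment a b \<subseteq> U" "closed_segment b c \<subseteq> U" "closed_segment c a \<subseteq> U"
   by (meson abc order_trans segments_subset_convex_hull)+
  have tri: "contour_integral (linepath a b) (\<lambda>s. F s u) + contour_integral (linepath b c) (\<lambda>s. F s u)
    + contour_integral (linepath c a) (\<lambda>s. F s u) = 0" if "u \<in> sphere 0 \<rho>" for u
  proof -
   have h: "(\<lambda>s. F s u) holomorphic_on convex hull {a,b,c}" using hol[OF that] abc by (rule holomorphic_on_subset)
   have z: "((\<lambda>s. F s u) has_contour_integral 0) (linepath a b +++ linepath b c +++ linepath c a)"
    by (rule Cauchy_theorem_triangle[OF h])
   have ci: "(\<lambda>s. F s u) contour_integrable_on linepath x y" if "closed_segment x y \<subseteq> U" for x y
    using that hol[OF \<open>u \<in> _\<close>] by (intro contour_integrable_continuous_linepath)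
     (meson continuous_on_subset holomorphic_on_imp_continuous_on)
   show ?thesis
    using contour_integral_unique[OF z] ci[OF seg(1)] ci[OF seg(2)] ci[OF seg(3)] by (simp add: add.assoc)
  qed
  have "contour_integral (circlepath 0 \<rho>) (\<lambda>u. contour_integral (linepath a b) (\<lambda>s. F s u) + contour_integral (linepath b c) (\<lambda>s. F s u)
    + contour_integral (linepath c a) (\<lambda>s. F s u)) = contour_integral (circlepath 0 \<rho>) (\<lambda>u. 0)"
   by (rule contour_integral_eq) (use tri in \<open>unfold pi, blast\<close>)
  then show "contour_integral (linepath a b) (\<lambda>s. contour_integral (circlepath 0 \<rho>) (F s)) +
   contour_integral (linepath b c) (\<lambda>s. contour_integral (circlepath 0 \<rho>) (F s)) +
   contour_integral (linepath c a) (\<lambda>s. contour_integral (circlepath 0 \<rho>) (F s)) = 0"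
   using int[OF seg(1)] int[OF seg(2)] int[OF seg(3)]
   by (simp add: swap[OF seg(1)] swap[OF seg(2)] swap[OF seg(3)] contour_integral_add contour_integrable_add)
 qed
 then show ?thesis by (rule analytic_imp_holomorphic)
qed

text \<open>Cauchy's formula writes the derivative as a contour integral that depends well on both
  variables. The circle has to enclose \<open>t\<close> and stay in the disc, so its radius \<rho>
  is chosen locally and the discs are glued.\<close>

lemma hol2_deriv:
 assumes h: "hol2 r h" shows "hol2 r (\<lambda>s t. deriv (h s) t)"
proof -
 define D where "D \<rho> s t = 1 / (2 * of_real pi * \<i>) * contour_integral (circlepath 0 \<rho>) (\<lambda>u. h s u / (u - t)^2)" for \<rho> s t
 have D: "deriv (h s) t = D \<rho> s t" if "s \<in> ball 0 r" "t \<in> ball 0 \<rho>" "\<rho> < r" for s t \<rho>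
 proof -
  have hs: "h s holomorphic_on ball 0 r" using h that by (auto simp: hol2_def)
  have 1: "continuous_on (cball 0 \<rho>) (h s)"
   using that by (intro continuous_on_subset[OF holomorphic_on_imp_continuous_on[OF hs]]) auto
  have 2: "h s holomorphic_on ball 0 \<rho>" using that by (intro holomorphic_on_subset[OF hs]) auto
  show ?thesis unfolding D_def
   by (rule DERIV_imp_deriv, rule Cauchy_derivative_integral_circlepath(2)[OF 1 2 that(2)])
 qed
 have contF: "continuous_on ((ball 0 r \<times> ball 0 \<rho>) \<times> sphere 0 \<rho>) (\<lambda>(p,u). h (fst p) u / (u - snd p)^2)" if "\<rho> < r" for \<rho>
 proof -
  have hc: "continuous_on (ball 0 r \<times> ball 0 r) (\<lambda>(s,t). h s t)" using h by (simp add: hol2_def)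
  have "continuous_on ((ball 0 r \<times> ball 0 \<rho>) \<times> sphere 0 \<rho>) (\<lambda>q. (\<lambda>(s,t). h s t) (fst (fst q), snd q))"
   by (rule continuous_on_compose2[OF hc]) (use that in \<open>auto intro!: continuous_intros\<close>)
  then show ?thesis unfolding case_prod_unfold
   by (intro continuous_intros) auto
 qed
 have ex: "\<exists>\<rho>. norm t < \<rho> \<and> \<rho> < r" if "t \<in> ball 0 r" for t :: complex using that dense[of "norm t" r] by auto
 show ?thesis unfolding hol2_def
 proof (intro conjI ballI)
  show "continuous_on (ball 0 r \<times> ball 0 r) (\<lambda>(s,t). deriv (h s) t)"
  proof (rule continuous_on_open_UN[where A = "\<lambda>\<rho>. ball 0 r \<times> ball 0 \<rho>" and S = "{..<r}", THEN continuous_on_subset])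
   show "open (ball (0::complex) r \<times> ball (0::complex) \<rho>)" for \<rho> by (intro open_Times) auto
   show "continuous_on (ball 0 r \<times> ball 0 \<rho>) (\<lambda>(s,t). deriv (h s) t)" if "\<rho> \<in> {..<r}" for \<rho>
   proof (cases "\<rho> > 0")
    case True
    have "continuous_on (ball 0 r \<times> ball 0 \<rho>) (\<lambda>p. D \<rho> (fst p) (snd p))"
     unfolding D_def
     by (intro continuous_intros circlepath_integral_param_continuous) (use contF[of \<rho>] that True in auto)
    then show ?thesis
     by (rule continuous_on_eq) (use that D in auto)
   next
    case False
    then have "ball (0::complex) \<rho> = {}" by (simp add: ball_eq_empty)
    show ?thesis unfolding \<open>ball (0::complex) \<rho> = {}\<close> by simp
   qed
   show "ball (0::complex) r \<times> ball (0::complex) r \<subseteq> (\<Union>\<rho>\<in>{..<r}. ball 0 r \<times> ball 0 \<rho>)"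
    using ex by fastforce
  qed
  show "(\<lambda>t. deriv (h s) t) holomorphic_on ball 0 r" if "s \<in> ball 0 r" for s
   using h that by (auto simp: hol2_def intro: holomorphic_deriv)
  show "(\<lambda>s. deriv (h s) t) holomorphic_on ball 0 r" if t: "t \<in> ball 0 r" for t
  proof -
   obtain \<rho> where \<rho>: "norm t < \<rho>" "\<rho> < r" using ex[OF t] by auto
   have \<rho>0: "\<rho> > 0" using \<rho>(1) norm_ge_zero[of t] by linarith
   have "(\<lambda>s. D \<rho> s t) holomorphic_on ball 0 r"
    unfolding D_def
   proof (rule holomorphic_on_mult[OF holomorphic_on_const circlepath_integral_param_holomorphic])
    have "continuous_on (ball 0 r \<times> sphere 0 \<rho>) (\<lambda>q. (\<lambda>(p,u). h (fst p) u / (u - snd p)^2) ((fst q, t), snd q))"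
     by (rule continuous_on_compose2[OF contF[OF \<rho>(2)]]) (use \<rho> in \<open>auto intro!: continuous_intros\<close>)
    then show "continuous_on (ball 0 r \<times> sphere 0 \<rho>) (\<lambda>(s,u). h s u / (u - t)^2)" by (simp add: case_prod_unfold)
    show "(\<lambda>s. h s u / (u - t)\<^sup>2) holomorphic_on ball 0 r" if "u \<in> sphere 0 \<rho>" for u
     using h that \<rho> by (intro holomorphic_intros) (auto simp: hol2_def)
   qed (use \<rho>0 in auto)
   then show ?thesis by (rule holomorphic_transform) (use D[OF _ _ \<rho>(2)] \<rho> in auto)
  qed
 qed
qed

section \<open>Newton's identities and the persistence of common zeros\<close>

text \<open>Logarithmic differentiation of the product: each factor 1 - w X contributes minus its
  multiplicity times w / (1 - w X), the generating series of the powers of w.\<close>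

lemma newton_fps:
 fixes w :: "'i => complex" and m :: "'i => nat"
 assumes "finite Z"
 defines "P \<equiv> (\<Prod>p\<in>Z. (1 - fps_const (w p) * fps_X) ^ m p)"
 shows "fps_deriv P = - P * Abs_fps (\<lambda>q. \<Sum>p\<in>Z. of_nat (m p) * w p ^ (q+1))"
 unfolding P_def using assms(1)
proof (induction Z rule: finite_induct)
 case empty
 have "Abs_fps (\<lambda>q. 0 :: complex) = 0" by (simp add: fps_eq_iff)
 then show ?case by simp
next
 case (insert p Z)
 define A where "A = (1 - fps_const (w p) * fps_X :: complex fps)"
 \<comment> \<open>\<open>G\<close> is the geometric series of w / (1 - w X).\<close>
 define G where "G = Abs_fps (\<lambda>q. w p ^ (q+1))"
 define R where "R = (\<Prod>p\<in>Z. (1 - fps_const (w p) * fps_X) ^ m p)"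
 define S where "S = Abs_fps (\<lambda>q. \<Sum>p\<in>Z. of_nat (m p) * w p ^ (q+1))"
 have AG: "A * G = fps_const (w p)"
 proof (rule fps_ext)
  fix n
  have "A * G = G - fps_const (w p) * (fps_X * G)" by (simp add: A_def algebra_simps)
  then show "(A * G) $ n = fps_const (w p) $ n"
   by (cases n) (auto simp: G_def)
 qed
 have dA: "fps_deriv (A ^ k) = - (A ^ k) * (of_nat k * G)" for k
 proof (induction k)
  case (Suc k)
  have "fps_deriv A = - fps_const (w p)" by (simp add: A_def)
  then have "fps_deriv (A ^ Suc k) = A * fps_deriv (A ^ k) - fps_const (w p) * A ^ k"
   by (simp add: fps_const_neg[symmetric] del: fps_const_neg)
  also have "... = - (A ^ Suc k) * (of_nat k * G) - (A * G) * A ^ k" by (simp add: Suc AG algebra_simps)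
  also have "... = - (A ^ Suc k) * (of_nat (Suc k) * G)" by (simp add: algebra_simps)
  finally show ?case .
 qed simp
 have eq: "Abs_fps (\<lambda>q. \<Sum>p\<in>insert p Z. of_nat (m p) * w p ^ (q+1)) = of_nat (m p) * G + S"
  using insert by (simp add: fps_eq_iff G_def S_def fps_of_nat[symmetric] del: fps_of_nat)
 have pr: "(\<Prod>p\<in>insert p Z. (1 - fps_const (w p) * fps_X) ^ m p) = A ^ m p * R"
  using insert by (simp add: A_def R_def)
 have IH: "fps_deriv R = - R * S" using insert.IH by (simp add: R_def S_def)
 show ?case unfolding eq pr by (simp add: dA IH algebra_simps)
qed

text \<open>Up to the sign (-1)^m this is the m-th elementary symmetric function of numbers whose
  power sums are \<open>p q s\<close>, computed by Newton's recursion. In this form it inherits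
  holomorphy in \<open>s\<close> from the power sums.\<close>

fun esym :: "(nat => complex => complex) => nat => complex => complex" where
 "esym p 0 s = 1"
| "esym p (Suc m) s = - (\<Sum>l\<le>m. esym p l s * p (m - l + 1) s) / of_nat (Suc m)"

lemma esym_holomorphic:
 assumes "!!q. p q holomorphic_on U"
 shows "esym p m holomorphic_on U"
proof (induction m rule: less_induct)
 case (less m)
 show ?case
 proof (cases m)
  case 0
  then show ?thesis by (simp add: fun_eq_iff[symmetric] holomorphic_on_const)
 next
  case (Suc k)
  have "(\<lambda>s. - (\<Sum>l\<le>k. esym p l s * p (k - l + 1) s) / of_nat (Suc k)) holomorphic_on U"
   using less assms Suc by (intro holomorphic_intros) auto
  then show ?thesis by (simp add: Suc)
 qed
qed

text \<open>The values \<open>esym p k s\<close> are the coefficients of the product of the factors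
  1 - w X; its root 1/w, multiplied through by w^D, gives the relation. \<open>D\<close> may exceed
  the degree, as the further coefficients are 0.\<close>

lemma esym_relation:
 fixes w :: "complex => complex"
 assumes fin: "finite Z" and p: "!!q. p q s = (\<Sum>z\<in>Z. of_nat (m z) * w z ^ q)"
  and z: "z \<in> Z" "m z > 0" "w z ~= 0" and D: "(\<Sum>z\<in>Z. m z) <= D"
 shows "(\<Sum>k\<le>D. esym p k s * w z ^ (D - k)) = 0"
proof -
 define P where "P = (\<Prod>z\<in>Z. [:1, - w z:] ^ m z)"
 have fp: "fps_of_poly P = (\<Prod>p\<in>Z. (1 - fps_const (w p) * fps_X) ^ m p)"
  unfolding P_def fps_of_poly_prod fps_of_poly_power
  by (intro prod.cong refl arg_cong2[where f = "(^)"]) (simp add: fps_of_poly_pCons fps_of_poly_const algebra_simps)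
 have ck: "esym p k s = coeff P k" for k
 proof (induction k rule: less_induct)
  case (less k)
  show ?case
  proof (cases k)
   case 0
   have "poly P 0 = 1" by (simp add: P_def poly_prod)
   then show ?thesis by (simp add: 0 poly_0_coeff_0)
  next
   case (Suc j)
   have "of_nat (Suc j) * coeff P (Suc j) = fps_deriv (fps_of_poly P) $ j" by simp
   also have "... = - (\<Sum>l\<le>j. coeff P l * p (j - l + 1) s)"
    unfolding fp newton_fps[OF fin] unfolding fp[symmetric]
    by (simp add: fps_mult_nth p sum_negf atLeast0AtMost)
   also have "... = - (\<Sum>l\<le>j. esym p l s * p (j - l + 1) s)"
    using less Suc by simp
   finally show ?thesis by (simp add: Suc field_simps del: of_nat_Suc)
  qed
 qed
 have "degree P <= D"
 proof -
  have "degree P <= (\<Sum>z\<in>Z. degree ([:1, - w z:] ^ m z))" unfolding P_def using degree_prod_sum_le[OF fin, of "\<lambda>z. [:1, - w z:] ^ m z"] by (simp add: o_def)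
  also have "... <= (\<Sum>z\<in>Z. m z)"
  proof (rule sum_mono)
   fix z
   have "degree ([:1, - w z:] ^ m z) <= degree [:1, - w z:] * m z" by (rule degree_power_le)
   also have "... <= 1 * m z" by (intro mult_right_mono) auto
   finally show "degree ([:1, - w z:] ^ m z) <= m z" by simp
  qed
  finally show ?thesis using D by simp
 qed
 have "poly P (1 / w z) = 0"
  unfolding P_def poly_prod using fin z by (intro prod_zero) (auto intro!: bexI[of _ z])
 moreover have "poly P (1 / w z) = (\<Sum>k\<le>D. coeff P k * (1 / w z) ^ k)"
  unfolding poly_altdef using \<open>degree P <= D\<close> by (intro sum.mono_neutral_left) (auto simp: coeff_eq_0)
 ultimately have "(\<Sum>k\<le>D. coeff P k * (1 / w z) ^ k) = 0" by simp
 then have "w z ^ D * (\<Sum>k\<le>D. coeff P k * (1 / w z) ^ k) = 0" by simp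
 then have "(\<Sum>k\<le>D. w z ^ D * (coeff P k * (1 / w z) ^ k)) = 0" by (simp add: sum_distrib_left)
 moreover have "w z ^ D * (coeff P k * (1 / w z) ^ k) = esym p k s * w z ^ (D - k)" if "k <= D" for k
  using z that by (simp add: ck power_diff power_divide)
 ultimately show ?thesis by (metis (no_types, lifting) atMost_iff sum.cong)
qed


text \<open>Consider the values of \<open>f\<close> at the zeros of \<open>g s\<close> in the disc.
  Their power sums are holomorphic in \<open>s\<close>, hence so are the coefficients of the
  polynomial having these values as roots. The last coefficient that is not identically 0 has at
  most an isolated zero at the origin. Hence for \<open>s\<close> near a given nonzero
  \<open>s0\<close> the nonzero values stay away from 0, and a value 0 at (s0, t0) cannot turn into
  a small nonzero one.\<close>

theorem common_zeros_persist:
 assumes f: "hol2 r f" and g: "hol2 r g" and \<rho>: "0 < \<rho>" "\<rho> < r" and \<sigma>: "0 < \<sigma>" "\<sigma> < r"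
  and nz: "!!s t. norm s <= \<sigma> ==> norm t = \<rho> ==> g s t ~= 0"
 shows "\<exists>\<sigma>'>0. \<sigma>' <= \<sigma> \<and> (\<forall>s0 t0. 0 < norm s0 \<and> norm s0 < \<sigma>' \<and> norm t0 < \<rho> \<and> g s0 t0 = 0 \<and> f s0 t0 = 0 -->
   (\<exists>e>0. \<forall>s t. dist s s0 < e \<and> dist t t0 < e \<and> g s t = 0 --> f s t = 0))"
proof -
 have fs: "f s holomorphic_on ball 0 r" and gs: "g s holomorphic_on ball 0 r" if "norm s < r" for s
  using f g that by (auto simp: hol2_def)
 have g': "hol2 r (\<lambda>s t. deriv (g s) t)" by (rule hol2_deriv[OF g])
 define F where "F q s u = deriv (g s) u * f s u ^ q / g s u" for q s u
 \<comment> \<open>By the argument principle this is the sum of the q-th powers of the values of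
   \<open>f\<close> at the zeros of \<open>g s\<close>, counted with multiplicity.\<close>
 define p where "p q s = 1 / (2 * of_real pi * \<i>) * contour_integral (circlepath 0 \<rho>) (F q s)" for q :: nat and s
 have p_hol: "p q holomorphic_on ball 0 \<sigma>" for q
  unfolding p_def[abs_def]
 proof (intro holomorphic_intros circlepath_integral_param_holomorphic)
  have sub: "ball 0 \<sigma> \<times> sphere 0 \<rho> \<subseteq> ball 0 r \<times> ball (0::complex) r" using \<rho> \<sigma> by auto
  have c: "continuous_on (ball 0 \<sigma> \<times> sphere 0 \<rho>) (\<lambda>(s,t). k s t)" if "hol2 r k" for k
   using that unfolding hol2_def by (blast intro: continuous_on_subset[OF _ sub])
  show "continuous_on (ball 0 \<sigma> \<times> sphere 0 \<rho>) (\<lambda>(s,u). F q s u)"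
   using c[OF f] c[OF g] c[OF g'] nz unfolding F_def case_prod_unfold
   by (intro continuous_intros) auto
  show "(\<lambda>s. F q s u) holomorphic_on ball 0 \<sigma>" if u: "u \<in> sphere 0 \<rho>" for u
  proof -
   have h: "(\<lambda>s. k s u) holomorphic_on ball 0 \<sigma>" if "hol2 r k" for k
   proof -
    have "u \<in> ball 0 r" using u \<rho> by simp
    then have "(\<lambda>s. k s u) holomorphic_on ball 0 r" using that by (simp add: hol2_def)
    then show ?thesis by (rule holomorphic_on_subset) (use \<sigma> in auto)
   qed
   show ?thesis unfolding F_def using h[OF f] h[OF g] h[OF g'] nz u by (intro holomorphic_intros) auto
  qed
 qed (use \<rho> in auto)
 define Z where "Z s = {t. norm t < \<rho> \<and> g s t = 0}" for s
 define m where "m s t = nat (zorder (g s) t)" for s t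
 have Zm: "finite (Z s) \<and> (\<forall>t\<in>Z s. m s t > 0) \<and> (\<forall>q. p q s = (\<Sum>t\<in>Z s. of_nat (m s t) * f s t ^ q))" if s: "norm s <= \<sigma>" for s
 proof -
  have sr: "norm s < r" using s \<sigma> by simp
  \<comment> \<open>The argument principle needs a domain around the closed disc; zeros between the
    two circles have winding number 0.\<close>
  obtain r' where r': "\<rho> < r'" "r' < r" using \<rho> dense by blast
  define pz where "pz = {t\<in>ball 0 r'. g s t = 0}"
  have nconst: "\<not> g s constant_on ball 0 r" if "\<exists>t\<in>ball 0 r. g s t = 0"
  proof
   assume "g s constant_on ball 0 r"
   then obtain c where "!!t. t \<in> ball 0 r ==> g s t = c" by (auto simp: constant_on_def)
   moreover have "g s (of_real \<rho>) ~= 0" using nz[OF s, of "of_real \<rho>"] \<rho> by simp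
   ultimately show False using that \<rho> by auto
  qed
  have finpz: "finite pz"
  proof (cases "\<exists>t\<in>ball 0 r. g s t = 0")
   case True
   have "finite {z\<in>cball 0 r'. g s z = 0}"
    by (rule holomorphic_compact_finite_zeros[OF gs[OF sr] _ _ _ _ nconst[OF True]]) (use r' in auto)
   then show ?thesis by (rule rev_finite_subset) (auto simp: pz_def)
  next
   case False
   then have "pz = {}" using r' by (auto simp: pz_def)
   then show ?thesis by simp
  qed
  have Zpz: "Z s = {t\<in>pz. norm t < \<rho>}" using r' by (auto simp: Z_def pz_def)
  have finZ: "finite (Z s)" unfolding Zpz using finpz by simp
  have ord: "zorder (g s) t > 0" if "t \<in> Z s" for t
  proof -
   have "\<exists>w\<in>ball 0 r. g s w ~= 0" using nz[OF s, of "of_real \<rho>"] \<rho> by (intro bexI[of _ "of_real \<rho>"]) auto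
   moreover have "t \<in> ball 0 r" "g s t = 0" using that \<rho> by (auto simp: Z_def)
   ultimately show ?thesis using zorder_exist_zero[OF gs[OF sr], of t] by auto
  qed
  have "p q s = (\<Sum>t\<in>Z s. of_nat (m s t) * f s t ^ q)" for q
  proof -
   have "contour_integral (circlepath 0 \<rho>) (\<lambda>x. deriv (g s) x * (f s x ^ q) / g s x) =
    2 * pi * \<i> * (\<Sum>w\<in>{w\<in>ball 0 r'. g s w = 0 \<or> w \<in> {}}. winding_number (circlepath 0 \<rho>) w * (f s w ^ q) * zorder (g s) w)"
   proof (rule argument_principle)
    show "g s holomorphic_on ball 0 r' - {}" using gs[OF sr] r' by (auto intro: holomorphic_on_subset)
    have "f s holomorphic_on ball 0 r'" by (rule holomorphic_on_subset[OF fs[OF sr]]) (use r' in auto)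
    then show "(\<lambda>x. f s x ^ q) holomorphic_on ball 0 r'" by (intro holomorphic_intros)
    show "path_image (circlepath 0 \<rho>) \<subseteq> ball 0 r' - {w\<in>ball 0 r'. g s w = 0 \<or> w \<in> {}}"
     using \<rho> r' nz[OF s] by auto
    show "\<forall>z. z \<notin> ball 0 r' --> winding_number (circlepath 0 \<rho>) z = 0"
     using \<rho> r' by (auto intro!: winding_number_zero_outside[of _ "ball 0 r'"])
    show "finite {w\<in>ball 0 r'. g s w = 0 \<or> w \<in> {}}" using finpz by (simp add: pz_def)
   qed auto
   also have "{w\<in>ball 0 r'. g s w = 0 \<or> w \<in> {}} = pz" by (simp add: pz_def)
   also have "(\<Sum>w\<in>pz. winding_number (circlepath 0 \<rho>) w * (f s w ^ q) * zorder (g s) w) = (\<Sum>w\<in>Z s. of_nat (m s w) * f s w ^ q)"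
   proof (rule sum.mono_neutral_cong_right)
    show "\<forall>i\<in>pz - Z s. winding_number (circlepath 0 \<rho>) i * (f s i ^ q) * zorder (g s) i = 0"
    proof
     fix w assume "w \<in> pz - Z s"
     then have "norm w >= \<rho>" "g s w = 0" by (auto simp: Zpz pz_def)
     then have "norm w > \<rho>" using nz[OF s, of w] by force
     then have "winding_number (circlepath 0 \<rho>) w = 0"
      using \<rho> by (intro winding_number_zero_outside[of _ "cball 0 \<rho>"]) auto
     then show "winding_number (circlepath 0 \<rho>) w * (f s w ^ q) * zorder (g s) w = 0" by simp
    qed
    fix w assume w: "w \<in> Z s"
    then have "winding_number (circlepath 0 \<rho>) w = 1" by (intro winding_number_circlepath) (auto simp: Z_def)
    moreover have "of_int (zorder (g s) w) = (of_nat (m s w) :: complex)" using ord[OF w] by (simp add: m_def)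
    ultimately show "winding_number (circlepath 0 \<rho>) w * (f s w ^ q) * zorder (g s) w = of_nat (m s w) * f s w ^ q" by simp
   qed (auto simp: Zpz finpz)
   finally show ?thesis unfolding p_def F_def by simp
  qed
  moreover have "\<forall>t\<in>Z s. m s t > 0" using ord by (auto simp: m_def)
  ultimately show ?thesis using finZ by blast
 qed
 define \<sigma>1 where "\<sigma>1 = \<sigma> / 2"
 have \<sigma>1: "0 < \<sigma>1" "\<sigma>1 < \<sigma>" using \<sigma> by (auto simp: \<sigma>1_def)
 \<comment> \<open>The power sum with exponent 0 counts the zeros with multiplicity; being
   continuous, it bounds their number uniformly on the smaller disc.\<close>
 obtain D :: nat where D: "!!s. norm s <= \<sigma>1 ==> (\<Sum>t\<in>Z s. m s t) <= D"
 proof -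
  have "continuous_on (cball 0 \<sigma>1) (p 0)"
   using holomorphic_on_imp_continuous_on[OF p_hol[of 0]] by (rule continuous_on_subset) (use \<sigma>1 in auto)
  then have "bounded (p 0 ` cball 0 \<sigma>1)" by (intro compact_imp_bounded compact_continuous_image) auto
  then obtain B where B: "!!s. norm s <= \<sigma>1 ==> norm (p 0 s) <= B" by (force simp: bounded_iff)
  have "(\<Sum>t\<in>Z s. m s t) <= nat \<lceil>B\<rceil>" if "norm s <= \<sigma>1" for s
  proof -
   have "norm s <= \<sigma>" using that \<sigma>1 by linarith
   then have "p 0 s = of_nat (\<Sum>t\<in>Z s. m s t)" using Zm[of s] by simp
   then have "real (\<Sum>t\<in>Z s. m s t) <= B" using B[OF that] by (metis norm_of_nat)
   then show ?thesis by linarith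
  qed
  then show ?thesis using that by blast
 qed
 define E where "E = esym p"
 have E_hol: "E k holomorphic_on ball 0 \<sigma>" for k unfolding E_def by (rule esym_holomorphic[OF p_hol])
 have E0: "E 0 s = 1" for s by (simp add: E_def)
 \<comment> \<open>Beyond the index \<open>n\<close> all coefficients vanish identically, so the
   polynomial relation only acquires further roots 0.\<close>
 define n where "n = Max {k. k <= D \<and> (\<exists>s\<in>ball 0 \<sigma>1. E k s ~= 0)}"
 have "\<exists>s\<in>ball 0 \<sigma>1. E 0 s ~= 0" using \<sigma>1 E0 by (intro bexI[of _ 0]) auto
 then have "0 \<in> {k. k <= D \<and> (\<exists>s\<in>ball 0 \<sigma>1. E k s ~= 0)}" by simp
 then have n: "n \<in> {k. k <= D \<and> (\<exists>s\<in>ball 0 \<sigma>1. E k s ~= 0)}" unfolding n_def by (intro Max_in) auto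
 have Egt: "E k s = 0" if "k > n" "k <= D" "norm s < \<sigma>1" for k s
 proof (rule ccontr)
  assume "E k s ~= 0"
  then have "k \<in> {k. k <= D \<and> (\<exists>s\<in>ball 0 \<sigma>1. E k s ~= 0)}" using that by (auto intro!: bexI[of _ s])
  then have "k <= n" unfolding n_def by (intro Max_ge) auto
  then show False using that by simp
 qed
 have En: "E n holomorphic_on ball 0 \<sigma>1" using E_hol by (rule holomorphic_on_subset) (use \<sigma>1 in auto)
 obtain \<sigma>' where \<sigma>': "0 < \<sigma>'" "\<sigma>' <= \<sigma>1" "!!s. 0 < norm s ==> norm s < \<sigma>' ==> E n s ~= 0"
 proof (cases "E n 0 = 0")
  case False
  have "continuous (at 0) (E n)"
   using holomorphic_on_imp_continuous_on[OF En] continuous_on_eq_continuous_at[OF open_ball[of 0 \<sigma>1], of "E n"] \<sigma>1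
   by auto
  from continuous_at_avoid[OF this False] obtain e where e: "e > 0" "!!s. dist 0 s < e ==> E n s ~= 0" by auto
  show ?thesis by (rule that[of "min e \<sigma>1"]) (use e \<sigma>1 in auto)
 next
  case True
  obtain s1 where s1: "s1 \<in> ball 0 \<sigma>1" "E n s1 ~= 0" using n by auto
  have c0: "0 \<in> ball 0 \<sigma>1" using \<sigma>1 by simp
  show ?thesis
  proof (rule isolated_zeros[OF En open_ball connected_ball c0 True s1(1) s1(2)])
   fix e assume e: "0 < e" "ball 0 e \<subseteq> ball 0 \<sigma>1" "!!z. z \<in> ball 0 e - {0} ==> E n z ~= 0"
   show ?thesis by (rule that[of "min e \<sigma>1"]) (use e \<sigma>1 in auto)
  qed
 qed
 \<comment> \<open>After cancelling a power of \<open>w\<close>, solving for \<open>E n s\<close>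
   exhibits a factor \<open>w\<close>; small nonzero values are therefore impossible where
   \<open>E n s\<close> is bounded below.\<close>
 have rel: "E n s = - w * (\<Sum>k<n. E k s * w ^ (n - 1 - k))" if "norm s < \<sigma>1" "t \<in> Z s" "w = f s t" "w ~= 0" for s t w
 proof -
  have sle: "norm s <= \<sigma>" using that \<sigma>1 by linarith
  have "(\<Sum>k\<le>D. E k s * w ^ (D - k)) = 0"
   unfolding E_def that(3)
   by (rule esym_relation[where Z = "Z s" and m = "m s" and w = "f s"]) (use Zm[OF sle] D[of s] that in auto)
  moreover have "(\<Sum>k\<le>D. E k s * w ^ (D - k)) = (\<Sum>k\<le>n. E k s * w ^ (D - k))"
   using n Egt that by (intro sum.mono_neutral_right) auto
  moreover have "(\<Sum>k\<le>n. E k s * w ^ (D - k)) = w ^ (D - n) * (\<Sum>k\<le>n. E k s * w ^ (n - k))"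
   unfolding sum_distrib_left
  proof (rule sum.cong[OF refl])
   fix k assume "k \<in> {..n}"
   then have "D - k = (D - n) + (n - k)" using n by auto
   then show "E k s * w ^ (D - k) = w ^ (D - n) * (E k s * w ^ (n - k))" by (simp add: power_add)
  qed
  ultimately have "(\<Sum>k\<le>n. E k s * w ^ (n - k)) = 0" using that(4) by simp
  moreover have "(\<Sum>k\<le>n. E k s * w ^ (n - k)) = (\<Sum>k<n. E k s * w ^ (n - k)) + E n s"
   by (simp add: lessThan_Suc_atMost[symmetric])
  moreover have "(\<Sum>k<n. E k s * w ^ (n - k)) = w * (\<Sum>k<n. E k s * w ^ (n - 1 - k))"
   unfolding sum_distrib_left
  proof (rule sum.cong[OF refl])
   fix k assume "k \<in> {..<n}"
   then have "n - k = Suc (n - 1 - k)" by auto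
   then show "E k s * w ^ (n - k) = w * (E k s * w ^ (n - 1 - k))" by (simp add: mult_ac)
  qed
  ultimately show ?thesis by (simp add: add_eq_0_iff)
 qed
 show ?thesis
 proof (rule exI[of _ \<sigma>'], intro conjI allI impI)
  show "\<sigma>' > 0" "\<sigma>' <= \<sigma>" using \<sigma>' \<sigma>1 by auto
  fix s0 t0
  assume a: "0 < norm s0 \<and> norm s0 < \<sigma>' \<and> norm t0 < \<rho> \<and> g s0 t0 = 0 \<and> f s0 t0 = 0"
  define c where "c = norm (E n s0)"
  have c: "c > 0" using \<sigma>'(3) a by (simp add: c_def)
  have s0: "norm s0 < \<sigma>1" using a \<sigma>' by auto
  have Ec: "continuous (at s0) (E k)" for k
   using holomorphic_on_imp_continuous_on[OF E_hol[of k]] continuous_on_eq_continuous_at[OF open_ball[of 0 \<sigma>], of "E k"] s0 \<sigma>1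
   by auto
  define b where "b s = (\<Sum>k<n. norm (E k s))" for s
  have bc: "continuous (at s0) b" unfolding b_def by (intro continuous_intros Ec)
  define B where "B = b s0 + 1"
  have B: "B > 0" by (auto simp: B_def b_def intro!: add_nonneg_pos sum_nonneg)
  have "\<forall>\<^sub>F s in nhds s0. norm (E n s) > c / 2"
   using Ec[of n] c by (intro order_tendstoD(1)[of _ c]) (auto simp: c_def continuous_at tendsto_at_iff_tendsto_nhds[symmetric] intro!: tendsto_norm)
  moreover have "\<forall>\<^sub>F s in nhds s0. b s < B"
   using bc by (intro order_tendstoD(2)[of _ "b s0"]) (auto simp: B_def continuous_at tendsto_at_iff_tendsto_nhds[symmetric])
  moreover have "\<forall>\<^sub>F s in nhds s0. norm s < \<sigma>1"
   using s0 by (intro eventually_nhds_in_open[of "ball 0 \<sigma>1" s0, THEN eventually_mono]) auto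
  ultimately have "\<forall>\<^sub>F s in nhds s0. norm (E n s) > c / 2 \<and> b s < B \<and> norm s < \<sigma>1" by eventually_elim auto
  then obtain e1 where e1: "e1 > 0" "!!s. dist s s0 < e1 ==> norm (E n s) > c / 2 \<and> b s < B \<and> norm s < \<sigma>1"
   by (auto simp: eventually_nhds_metric)
  \<comment> \<open>A nonzero value below this size would force the norm of \<open>E n s\<close>
    down to \<open>c / 2\<close>, contrary to the choice of \<open>e1\<close>.\<close>
  define \<omega> where "\<omega> = min 1 (c / (2 * B))"
  have \<omega>: "\<omega> > 0" using c B by (simp add: \<omega>_def)
  have "continuous_on (ball 0 r \<times> ball 0 r) (\<lambda>(s,t). f s t)" using f by (simp add: hol2_def)
  moreover have "(s0,t0) \<in> ball 0 r \<times> ball 0 r" using s0 \<sigma>1 \<sigma> \<rho> a by auto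
  ultimately have "continuous (at (s0,t0)) (\<lambda>(s,t). f s t)"
   by (simp add: continuous_on_eq_continuous_at open_Times)
  then obtain e2 where e2: "e2 > 0" "!!x. dist x (s0,t0) < e2 ==> dist ((\<lambda>(s,t). f s t) x) ((\<lambda>(s,t). f s t) (s0,t0)) < \<omega>"
   using \<omega> unfolding continuous_within_eps_delta by blast
  define e where "e = min (min e1 (e2 / 2)) (\<rho> - norm t0)"
  have e: "e > 0" using e1 e2 a by (simp add: e_def)
  show "\<exists>e>0. \<forall>s t. dist s s0 < e \<and> dist t t0 < e \<and> g s t = 0 --> f s t = 0"
  proof (intro exI[of _ e] conjI e allI impI)
   fix s t assume st: "dist s s0 < e \<and> dist t t0 < e \<and> g s t = 0"
   show "f s t = 0"
   proof (rule ccontr)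
    assume w0: "f s t ~= 0"
    define w where "w = f s t"
    have "dist (s,t) (s0,t0) <= dist s s0 + dist t t0"
     by (simp add: dist_Pair_Pair sqrt_sum_squares_le_sum)
    then have "dist (s,t) (s0,t0) < e2" using st by (simp add: e_def)
    from e2(2)[OF this] have w\<omega>: "norm w < \<omega>" using a by (simp add: w_def)
    have "norm t < \<rho>" using st norm_triangle_sub[of t t0] by (simp add: e_def dist_norm)
    then have tZ: "t \<in> Z s" using st by (simp add: Z_def)
    have es: "norm (E n s) > c / 2" "b s < B" "norm s < \<sigma>1" using e1(2)[of s] st by (auto simp: e_def)
    have "norm (E n s) = norm w * norm (\<Sum>k<n. E k s * w ^ (n - 1 - k))"
     using rel[OF es(3) tZ w_def] w0 by (simp add: w_def norm_mult)
    also have "norm (\<Sum>k<n. E k s * w ^ (n - 1 - k)) <= b s"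
     unfolding b_def
    proof (rule sum_norm_le)
     fix k
     have "norm w ^ (n - 1 - k) <= 1" using w\<omega> by (intro power_le_one) (auto simp: \<omega>_def)
     then show "norm (E k s * w ^ (n - 1 - k)) <= norm (E k s)"
      by (simp add: norm_mult norm_power mult_left_le)
    qed
    finally have "norm (E n s) <= norm w * b s" by (simp add: mult_left_mono)
    also have "... <= norm w * B" using es by (intro mult_left_mono) auto
    also have "... <= c / (2 * B) * B" using w\<omega> B by (intro mult_right_mono) (auto simp: \<omega>_def)
    finally show False using es(1) B by simp
   qed
  qed
 qed
qed

section \<open>Sublevel sets of functions of one real variable\<close>

lemma emeasure_diam_le:
 fixes X :: "real set"
 assumes "!!x y. x \<in> X ==> y \<in> X ==> \<bar>x - y\<bar> <= d"
 shows "vol X <= ennreal (2 * d)"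
proof (cases "X = {}")
 case False
 then obtain x where x: "x \<in> X" by auto
 have "d >= 0" using assms[OF x x] by simp
 have "X \<subseteq> {x - d .. x + d}" using assms[OF x] by force
 then have "vol X <= vol {x - d .. x + d}" by (rule emeasure_mono) simp
 then show ?thesis using \<open>d >= 0\<close> by simp
qed simp

lemma deriv_ge_expansive:
 fixes f :: "real => real"
 assumes I: "is_interval I" and d: "!!t. t \<in> I ==> (f has_real_derivative f' t) (at t within I)"
  and c: "!!t. t \<in> I ==> c <= f' t" and xy: "x \<in> I" "y \<in> I" "x <= y"
 shows "c * (y - x) <= f y - f x"
proof (cases "x = y")
 case False
 then have "x < y" using xy by simp
 have sub: "{x..y} \<subseteq> I" using I xy by (meson atLeastAtMost_iff mem_is_interval_1_I subsetI)
 have "\<exists>z\<in>{x<..<y}. f y - f x = (\<lambda>h. f' z * h) (y - x)"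
 proof (rule mvt_simple[OF \<open>x < y\<close>])
  fix t assume "x <= t" "t <= y"
  then have "t \<in> I" using subsetD[OF sub, of t] by simp
  from has_derivative_subset[OF d[OF this, unfolded has_field_derivative_def] sub]
  show "(f has_derivative (\<lambda>h. f' t * h)) (at t within {x..y})" .
 qed
 then obtain z where z: "z \<in> {x<..<y}" "f y - f x = f' z * (y - x)" by auto
 have "c * (y - x) <= f' z * (y - x)" using c[OF subsetD[OF sub, of z]] z(1) xy by (intro mult_right_mono) auto
 then show ?thesis using z by simp
qed simp

text \<open>Induction on the order. The derivative one below the top is monotone, so the sets where
  it is at least \<open>c * \<eta>\<close>, or at most its negative, are intervals to which the
  induction hypothesis applies, and the set in between is short.\<close>

lemma sublevel_1d:
 fixes \<phi> :: "nat => real => real"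
 assumes "is_interval I" "!!i t. i <= k ==> t \<in> I ==> (\<phi> i has_real_derivative \<phi> (Suc i) t) (at t within I)"
  "c > 0" "\<delta> > 0" "(\<forall>t\<in>I. c <= \<phi> (Suc k) t) \<or> (\<forall>t\<in>I. \<phi> (Suc k) t <= - c)"
 shows "vol {t\<in>I. \<bar>\<phi> 0 t\<bar> < \<delta>} <= ennreal (4^Suc k * (\<delta>/c) powr (1 / real (Suc k)))"
 using assms
proof (induction k arbitrary: I c)
 case 0
 have exp: "c * \<bar>y - x\<bar> <= \<bar>\<phi> 0 y - \<phi> 0 x\<bar>" if "x \<in> I" "y \<in> I" for x y
 proof -
  have "c * \<bar>y - x\<bar> <= \<bar>\<phi> 0 y - \<phi> 0 x\<bar>" if "x \<in> I" "y \<in> I" "x <= y" for x y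
  proof (cases "\<forall>t\<in>I. c <= \<phi> (Suc 0) t")
   case True
   then have "c * (y - x) <= \<phi> 0 y - \<phi> 0 x"
    by (intro deriv_ge_expansive[OF "0.prems"(1)]) (use "0.prems"(2) that in auto)
   then show ?thesis using that by simp
  next
   case False
   have "c * (y - x) <= (- \<phi> 0 y) - (- \<phi> 0 x)"
    by (rule deriv_ge_expansive[OF "0.prems"(1), where f' = "\<lambda>t. - \<phi> (Suc 0) t"])
      (use "0.prems"(2,5) False that in \<open>auto intro!: DERIV_minus simp: le_minus_iff\<close>)
   then show ?thesis using that by simp
  qed
  from this[of x y] this[of y x] that show ?thesis by (metis abs_minus_commute linorder_linear)
 qed
 have "vol {t\<in>I. \<bar>\<phi> 0 t\<bar> < \<delta>} <= ennreal (2 * (2 * \<delta> / c))"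
 proof (rule emeasure_diam_le)
  fix x y assume "x \<in> {t\<in>I. \<bar>\<phi> 0 t\<bar> < \<delta>}" "y \<in> {t\<in>I. \<bar>\<phi> 0 t\<bar> < \<delta>}"
  then have "c * \<bar>x - y\<bar> <= 2 * \<delta>" using exp[of y x] by auto
  then show "\<bar>x - y\<bar> <= 2 * \<delta> / c" using "0.prems" by (simp add: field_simps)
 qed
 then show ?case using "0.prems" by simp
next
 case (Suc k)
 \<comment> \<open>This value balances the contributions: with lower bound \<open>c * \<eta>\<close>
   for the next derivative, the induction hypothesis again yields a multiple of \<eta>.\<close>
 define \<eta> where "\<eta> = (\<delta>/c) powr (1 / real (Suc (Suc k)))"
 have \<eta>: "\<eta> > 0" using Suc.prems by (simp add: \<eta>_def)
 define I1 where "I1 = {t\<in>I. c * \<eta> <= \<phi> (Suc k) t}"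
 define I2 where "I2 = {t\<in>I. \<phi> (Suc k) t <= - (c * \<eta>)}"
 define X where "X J = {t\<in>J. \<bar>\<phi> 0 t\<bar> < \<delta>}" for J
 have mono: "\<exists>\<sigma>\<in>{1,-1}. \<forall>x\<in>I. \<forall>y\<in>I. x <= y --> c * (y - x) <= \<sigma> * (\<phi> (Suc k) y - \<phi> (Suc k) x)"
 proof (cases "\<forall>t\<in>I. c <= \<phi> (Suc (Suc k)) t")
  case True
  have "c * (y - x) <= \<phi> (Suc k) y - \<phi> (Suc k) x" if "x \<in> I" "y \<in> I" "x <= y" for x y
   by (rule deriv_ge_expansive[OF Suc.prems(1), where f' = "\<phi> (Suc (Suc k))"])
     (use Suc.prems(2) True that in auto)
  then show ?thesis by auto
 next
  case False
  have "c * (y - x) <= (- \<phi> (Suc k) y) - (- \<phi> (Suc k) x)" if "x \<in> I" "y \<in> I" "x <= y" for x y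
   by (rule deriv_ge_expansive[OF Suc.prems(1), where f' = "\<lambda>t. - \<phi> (Suc (Suc k)) t"])
     (use Suc.prems(2,5) False that in \<open>auto intro!: DERIV_minus simp: le_minus_iff\<close>)
  then show ?thesis by (intro bexI[of _ "-1"]) auto
 qed
 then obtain \<sigma> where \<sigma>: "\<sigma> = 1 \<or> \<sigma> = -1" "!!x y. x \<in> I ==> y \<in> I ==> x <= y ==> c * (y - x) <= \<sigma> * (\<phi> (Suc k) y - \<phi> (Suc k) x)"
  by blast
 have \<sigma>0: "\<sigma> * \<phi> (Suc k) x <= \<sigma> * \<phi> (Suc k) y" if "x \<in> I" "y \<in> I" "x <= y" for x y
  using \<sigma>(2)[OF that] Suc.prems(3) that by (smt (verit) mult_nonneg_nonneg right_diff_distrib)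
 have between: "t \<in> I" if "x \<in> I" "y \<in> I" "x <= t" "t <= y" for x y t
  using Suc.prems(1) that by (meson mem_is_interval_1_I)
 have mid: "\<phi> (Suc k) a <= \<phi> (Suc k) x \<and> \<phi> (Suc k) x <= \<phi> (Suc k) b \<or> \<phi> (Suc k) x <= \<phi> (Suc k) a \<and> \<phi> (Suc k) b <= \<phi> (Suc k) x"
  if "a \<in> I" "b \<in> I" "a <= x" "x <= b" for a b x
  using \<sigma>0[of a x] \<sigma>0[of x b] \<sigma>(1) that between[OF that] by auto
 have int: "is_interval I1" "is_interval I2"
  unfolding is_interval_1
 proof safe
  fix a b x assume "a \<in> I1" "b \<in> I1" "a <= x" "x <= b"
  then show "x \<in> I1" using mid[of a b x] between[of a b x] by (auto simp: I1_def)
 next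
  fix a b x assume "a \<in> I2" "b \<in> I2" "a <= x" "x <= b"
  then show "x \<in> I2" using mid[of a b x] between[of a b x] by (auto simp: I2_def)
 qed
 have der: "(\<phi> i has_real_derivative \<phi> (Suc i) t) (at t within J)" if "i <= k" "t \<in> J" "J \<subseteq> I" for i t J
  using Suc.prems(2)[of i t] that by (auto intro: DERIV_subset)
 have c\<eta>: "c * \<eta> > 0" using \<eta> Suc.prems by simp
 have pw: "(\<delta> / (c * \<eta>)) powr (1 / real (Suc k)) = \<eta>"
 proof -
  have "\<delta> / c = \<eta> powr (real (Suc (Suc k)))" using Suc.prems by (simp add: \<eta>_def powr_powr del: of_nat_Suc)
  then have "\<delta> / (c * \<eta>) = \<eta> powr (real (Suc (Suc k))) / \<eta> powr 1" using \<eta> by (simp add: divide_divide_eq_left[symmetric])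
  also have "... = \<eta> powr (real (Suc k))" by (subst powr_diff[symmetric]) simp
  finally show ?thesis using \<eta> by (simp add: powr_powr del: of_nat_Suc)
 qed
 have b1: "vol (X I1) <= ennreal (4^Suc k * \<eta>)"
  using Suc.IH[of I1 "c * \<eta>"] int der[of _ _ I1] c\<eta> Suc.prems(4) unfolding X_def pw
  by (auto simp: I1_def)
 have b2: "vol (X I2) <= ennreal (4^Suc k * \<eta>)"
  using Suc.IH[of I2 "c * \<eta>"] int der[of _ _ I2] c\<eta> Suc.prems(4) unfolding X_def pw
  by (auto simp: I2_def)
 define M where "M = {t\<in>I. \<bar>\<phi> (Suc k) t\<bar> < c * \<eta>}"
 have b3: "vol M <= ennreal (2 * (2 * \<eta>))"
 proof (rule emeasure_diam_le)
  have *: "\<bar>x - y\<bar> <= 2 * \<eta>" if "x \<in> M" "y \<in> M" "x <= y" for x y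
  proof -
   have "c * (y - x) <= c * (2 * \<eta>)"
    using \<sigma>(2)[of x y] \<sigma>(1) that by (auto simp: M_def abs_less_iff)
   then show ?thesis using Suc.prems(3) that by simp
  qed
  show "\<bar>x - y\<bar> <= 2 * \<eta>" if "x \<in> M" "y \<in> M" for x y
   using *[OF that] *[OF that(2,1)] by linarith
 qed
 have cont: "continuous_on I (\<phi> i)" if "i <= Suc k" for i
  by (rule DERIV_continuous_on) (use Suc.prems(2) that in auto)
 have Ib: "I \<in> sets borel" by (rule real_interval_borel_measurable[OF Suc.prems(1)])
 have lev: "{t\<in>I. \<phi> i t \<in> B} \<in> sets borel" if "i <= Suc k" "B \<in> sets borel" for i B
 proof -
  have "\<phi> i \<in> borel_measurable (restrict_space borel I)"
   by (rule borel_measurable_continuous_on_restrict[OF cont[OF that(1)]])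
  from measurable_sets[OF this that(2)] have "I \<inter> \<phi> i -` B \<in> sets (restrict_space borel I)"
   by (simp add: space_restrict_space Int_commute)
  then show ?thesis using Ib by (auto simp: sets_restrict_space_iff vimage_def Int_def)
 qed
 have XIm: "X I \<in> sets borel" using lev[of 0 "{-\<delta><..<\<delta>}"] by (simp add: X_def abs_less_iff minus_less_iff conj_commute)
 have I12: "I1 \<in> sets borel" "I2 \<in> sets borel" "M \<in> sets borel"
  using lev[of "Suc k" "{c*\<eta>..}"] lev[of "Suc k" "{..-(c*\<eta>)}"] lev[of "Suc k" "{-(c*\<eta>)<..<c*\<eta>}"]
  by (simp_all add: I1_def I2_def M_def abs_less_iff minus_less_iff conj_commute)
 have XJ: "X I1 \<in> sets borel" "X I2 \<in> sets borel"
 proof -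
  have "X I1 = X I \<inter> I1" "X I2 = X I \<inter> I2" by (auto simp: X_def I1_def I2_def)
  then show "X I1 \<in> sets borel" "X I2 \<in> sets borel" using XIm I12 by auto
 qed
 have "X I \<subseteq> (X I1 \<union> X I2) \<union> M" by (auto simp: X_def I1_def I2_def M_def)
 then have "vol (X I) <= vol ((X I1 \<union> X I2) \<union> M)"
  using XJ I12 by (intro emeasure_mono) auto
 also have "... <= vol (X I1 \<union> X I2) + vol M" using XJ I12 by (intro emeasure_subadditive) auto
 also have "... <= (vol (X I1) + vol (X I2)) + vol M"
  using XJ by (intro add_right_mono emeasure_subadditive) auto
 also have "... <= (ennreal (4^Suc k * \<eta>) + ennreal (4^Suc k * \<eta>)) + ennreal (2 * (2 * \<eta>))"
  by (intro add_mono b1 b2 b3)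
 also have "... = ennreal ((4^Suc k * \<eta> + 4^Suc k * \<eta>) + 4 * \<eta>)" using \<eta> by (subst ennreal_plus, simp, simp, subst ennreal_plus) auto
 \<comment> \<open>Two outer intervals and the middle part: 2 * 4^(k+1) + 4 <= 4^(k+2).\<close>
 also have "... <= ennreal (4^Suc (Suc k) * \<eta>)"
 proof (rule ennreal_leI)
  have "(1::real) <= 4^k" by simp
  then have "\<eta> * 1 <= \<eta> * 4^k" using \<eta> by (intro mult_left_mono) auto
  moreover have "4^Suc k * \<eta> = 4 * (\<eta> * 4^k)" "4^Suc (Suc k) * \<eta> = 16 * (\<eta> * 4^k)" by simp_all
  ultimately show "4^Suc k * \<eta> + 4^Suc k * \<eta> + 4 * \<eta> <= 4^Suc (Suc k) * \<eta>" using \<eta> by linarith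
 qed
 finally show ?case by (simp add: X_def \<eta>_def)
qed

text \<open>Each mean value step starting from the common zero \<tau> gains a factor |t -
  \<tau>|.\<close>

lemma iterated_zero_power_bound:
 fixes \<phi> :: "nat => real => real"
 assumes I: "is_interval I" and d: "!!i t. i < k ==> t \<in> I ==> (\<phi> i has_real_derivative \<phi> (Suc i) t) (at t within I)"
  and B: "!!t. t \<in> I ==> \<bar>\<phi> k t\<bar> <= B" and \<tau>: "\<tau> \<in> I" "!!i. i < k ==> \<phi> i \<tau> = 0" and t: "t \<in> I"
 shows "\<bar>\<phi> 0 t\<bar> <= B * \<bar>t - \<tau>\<bar> ^ k"
proof -
 have "\<forall>t\<in>I. \<bar>\<phi> (k - j) t\<bar> <= B * \<bar>t - \<tau>\<bar> ^ j" if "j <= k" for j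
  using that
 proof (induction j)
  case (Suc j)
  define i where "i = k - Suc j"
  have i: "i < k" "Suc i = k - j" using Suc.prems by (auto simp: i_def)
  have B0: "B >= 0" using B[OF \<tau>(1)] by linarith
  show ?case unfolding i_def[symmetric]
  proof
   fix t assume t: "t \<in> I"
   define J where "J = {min t \<tau>..max t \<tau>}"
   have sub: "J \<subseteq> I"
   proof
    fix z assume "z \<in> J"
    then have "t <= z \<and> z <= \<tau> \<or> \<tau> <= z \<and> z <= t" by (auto simp: J_def)
    then show "z \<in> I" using mem_is_interval_1_I[OF I t \<tau>(1), of z] mem_is_interval_1_I[OF I \<tau>(1) t, of z] by blast
   qed
   have "norm (\<phi> i t - \<phi> i \<tau>) <= (B * \<bar>t - \<tau>\<bar> ^ j) * norm (t - \<tau>)"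
   proof (rule field_differentiable_bound[of J])
    show "(\<phi> i has_field_derivative \<phi> (Suc i) z) (at z within J)" if "z \<in> J" for z
     using d[OF i(1), of z] that sub by (auto intro: DERIV_subset)
    show "norm (\<phi> (Suc i) z) <= B * \<bar>t - \<tau>\<bar> ^ j" if "z \<in> J" for z
    proof -
     have "\<bar>\<phi> (Suc i) z\<bar> <= B * \<bar>z - \<tau>\<bar> ^ j" using Suc that sub i(2) by auto
     also have "... <= B * \<bar>t - \<tau>\<bar> ^ j"
      using that B0 by (intro mult_left_mono power_mono) (auto simp: J_def)
     finally show ?thesis by simp
    qed
   qed (auto simp: J_def)
   then show "\<bar>\<phi> i t\<bar> <= B * \<bar>t - \<tau>\<bar> ^ Suc j" using \<tau>(2)[OF i(1)] by (simp add: mult_ac)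
  qed
 qed (use B in simp)
 from this[of k] t show ?thesis by simp
qed

section \<open>Local sublevel exponents from the multiplicity of zeros in one variable\<close>

fun tder :: "(complex => complex => complex) => nat => complex => complex => complex" where
 "tder h 0 = h"
| "tder h (Suc k) = (\<lambda>s t. deriv (tder h k s) t)"

lemma tder_higher_deriv: "tder h k s = (deriv ^^ k) (h s)"
 by (induction k) simp_all

text \<open>The exponents for which this holds near the origin are the working form of the
  integrability exponent: such bounds restrict to smaller sets, combine over finite unions and are
  carried along by linear maps.\<close>

definition SL :: "(plane => real) => real => (plane) set => bool" where
 "SL g \<epsilon> V \<longleftrightarrow> (\<exists>C\<ge>0. \<forall>\<delta>>0. vol {z\<in>V. \<bar>g z\<bar> < \<delta>} <= ennreal (C * \<delta> powr \<epsilon>))"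

text \<open>The imaginary part of \<open>F\<close> is constantly 0 along the real axis, hence so is
  its derivative there.\<close>

lemma deriv_real_on_reals:
 assumes F: "F holomorphic_on ball 0 r" and re: "!!t::real. \<bar>t\<bar> < r ==> F (of_real t) \<in> \<real>" and x: "\<bar>x\<bar> < r"
 shows "deriv F (of_real x) \<in> \<real>" "((\<lambda>t. Re (F (of_real t))) has_real_derivative Re (deriv F (of_real x))) (at x)"
proof -
 have "(F has_field_derivative deriv F (of_real x)) (at (of_real x))"
  using F x by (intro holomorphic_derivI[OF F]) auto
 then have v: "((\<lambda>t. F (of_real t)) has_vector_derivative deriv F (of_real x)) (at x)"
  by (rule has_vector_derivative_real_field)
 show "((\<lambda>t. Re (F (of_real t))) has_real_derivative Re (deriv F (of_real x))) (at x)"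
  using bounded_linear.has_vector_derivative[OF bounded_linear_Re v] by (simp add: has_real_derivative_iff_has_vector_derivative)
 have "((\<lambda>t. Im (F (of_real t))) has_real_derivative Im (deriv F (of_real x))) (at x)"
  using bounded_linear.has_vector_derivative[OF bounded_linear_Im v] by (simp add: has_real_derivative_iff_has_vector_derivative)
 moreover have "((\<lambda>t. Im (F (of_real t))) has_real_derivative 0) (at x)"
 proof (rule DERIV_cong_ev[OF refl _ refl, THEN iffD1, OF _ DERIV_const[of 0]])
  show "\<forall>\<^sub>F t in nhds x. 0 = Im (F (of_real t))"
   using x re by (intro eventually_nhds_in_open[of "{-r<..<r}" x, THEN eventually_mono])
    (auto simp: complex_is_Real_iff abs_less_iff)
 qed
 ultimately have "Im (deriv F (of_real x)) = 0" by (rule DERIV_unique)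
 then show "deriv F (of_real x) \<in> \<real>" by (simp add: complex_is_Real_iff)
qed

lemma powr_at_right_0: "0 < a ==> ((\<lambda>x::real. x powr a) \<longlongrightarrow> 0) (at_right 0)"
proof -
 assume a: "0 < a"
 have "continuous_on {0..} (\<lambda>x::real. x powr a)" using a by (intro continuous_on_powr' continuous_intros) auto
 then have "((\<lambda>x::real. x powr a) \<longlongrightarrow> 0 powr a) (at 0 within {0..})" unfolding continuous_on_def by (rule bspec) simp
 then show ?thesis by (rule tendsto_within_subset[THEN tendsto_eq_rhs]) auto
qed

text \<open>A complexified germ: the real function \<open>g\<close> is estimated slice by slice in
  the second variable, while the behaviour of its zeros is read off from the holomorphic
  \<open>h\<close>.\<close>

locale real_hol2 =
 fixes r :: real and h :: "complex => complex => complex"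
 assumes r: "r > 0" and h: "hol2 r h"
  and re: "!!s t::real. \<bar>s\<bar> < r ==> \<bar>t\<bar> < r ==> h (of_real s) (of_real t) \<in> \<real>"
begin

definition rd :: "nat => real => real => real" where
 "rd k s t = Re (tder h k (of_real s) (of_real t))"

definition g :: "plane => real" where "g z = rd 0 (fst z) (snd z)"

lemma tder_hol2: "hol2 r (tder h k)"
 by (induction k) (auto simp: h hol2_deriv)

lemma tder_real: "\<bar>s\<bar> < r ==> \<bar>t\<bar> < r ==> tder h k (of_real s) (of_real t) \<in> \<real>"
proof (induction k arbitrary: t)
 case (Suc k)
 have "tder h k (of_real s) holomorphic_on ball 0 r" using tder_hol2[of k] Suc.prems by (auto simp: hol2_def)
 from deriv_real_on_reals(1)[OF this _ Suc.prems(2)] Suc show ?case by simp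
qed (use re in simp)

lemma tder_rd: "\<bar>s\<bar> < r ==> \<bar>t\<bar> < r ==> tder h k (of_real s) (of_real t) = of_real (rd k s t)"
 using tder_real[of s t k] by (simp add: rd_def)

lemma rd_deriv:
 assumes "\<bar>s\<bar> < r" "\<bar>t\<bar> < r" shows "(rd k s has_real_derivative rd (Suc k) s t) (at t within X)"
proof -
 have "tder h k (of_real s) holomorphic_on ball 0 r" using tder_hol2[of k] assms by (auto simp: hol2_def)
 from deriv_real_on_reals(2)[OF this _ assms(2)] tder_real[OF assms(1)]
 have "(rd k s has_real_derivative rd (Suc k) s t) (at t)" by (simp add: rd_def[abs_def])
 then show ?thesis by (rule has_field_derivative_at_within)
qed

lemma rd_continuous: "continuous_on (box2 r) (\<lambda>z. rd k (fst z) (snd z))"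
proof -
 have c: "continuous_on (ball 0 r \<times> ball 0 r) (\<lambda>(s,t). tder h k s t)" using tder_hol2[of k] by (simp add: hol2_def)
 have "continuous_on (box2 r) (\<lambda>z. (\<lambda>(s,t). tder h k s t) (complex_of_real (fst z), complex_of_real (snd z)))"
  by (rule continuous_on_compose2[OF c]) (auto intro!: continuous_intros simp: box2_def)
 then show ?thesis unfolding rd_def by (auto intro!: continuous_intros)
qed

lemma g_continuous: "continuous_on (box2 r) g"
 using rd_continuous[of 0] unfolding g_def[abs_def] .

lemma g_sub_open: "open V ==> V \<subseteq> box2 r ==> open {z\<in>V. \<bar>g z\<bar> < \<delta>}"
proof -
 assume V: "open V" "V \<subseteq> box2 r"
 have "open (V \<inter> g -` {-\<delta><..<\<delta>})"
  by (rule continuous_open_preimage[OF continuous_on_subset[OF g_continuous V(2)] V(1)]) auto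
 moreover have "V \<inter> g -` {-\<delta><..<\<delta>} = {z\<in>V. \<bar>g z\<bar> < \<delta>}" by (auto simp: abs_less_iff)
 ultimately show ?thesis by simp
qed

lemma rd_near:
 assumes z: "z0 \<in> box2 r" and e: "e > 0"
 obtains \<eta> where "\<eta> > 0" "!!z. \<bar>fst z - fst z0\<bar> <= \<eta> ==> \<bar>snd z - snd z0\<bar> <= \<eta> ==> z \<in> box2 r \<and> \<bar>rd k (fst z) (snd z) - rd k (fst z0) (snd z0)\<bar> < e"
proof -
 have "continuous (at z0) (\<lambda>z. rd k (fst z) (snd z))"
  using rd_continuous[of k] z open_box2[of r] by (simp add: continuous_on_eq_continuous_at)
 then obtain d where d: "d > 0" "!!z. dist z z0 < d ==> dist (rd k (fst z) (snd z)) (rd k (fst z0) (snd z0)) < e"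
  using e unfolding continuous_within_eps_delta by blast
 obtain d' where d': "d' > 0" "ball z0 d' \<subseteq> box2 r" using open_box2 z open_contains_ball by metis
 show ?thesis
 proof (rule that[of "min d d' / 3"])
  fix z assume a: "\<bar>fst z - fst z0\<bar> <= min d d' / 3" "\<bar>snd z - snd z0\<bar> <= min d d' / 3"
  have "dist z z0 <= \<bar>fst z - fst z0\<bar> + \<bar>snd z - snd z0\<bar>"
   using norm_pair_le[of "fst (z - z0)" "snd (z - z0)"] unfolding prod.collapse by (simp add: dist_norm)
  then have "dist z z0 < min d d'" using a d d' by (auto simp: min_def split: if_splits)
  then show "z \<in> box2 r \<and> \<bar>rd k (fst z) (snd z) - rd k (fst z0) (snd z0)\<bar> < e"
   using d(2)[of z] d'(2) by (auto simp: dist_real_def dist_commute)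
 qed (use d d' in auto)
qed

lemma SL_mono: "SL g \<epsilon> V ==> W \<subseteq> V ==> open V ==> V \<subseteq> box2 r ==> SL g \<epsilon> W"
 unfolding SL_def
proof (elim exE conjE)
 fix C :: real assume a: "W \<subseteq> V" "open V" "V \<subseteq> box2 r" "C >= 0" "\<forall>\<delta>>0. vol {z\<in>V. \<bar>g z\<bar> < \<delta>} <= ennreal (C * \<delta> powr \<epsilon>)"
 have "vol {z\<in>W. \<bar>g z\<bar> < \<delta>} <= vol {z\<in>V. \<bar>g z\<bar> < \<delta>}" for \<delta>
  using a g_sub_open[OF a(2,3)] by (intro emeasure_mono) auto
 then show "\<exists>C\<ge>0. \<forall>\<delta>>0. vol {z\<in>W. \<bar>g z\<bar> < \<delta>} <= ennreal (C * \<delta> powr \<epsilon>)"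
  using a(4,5) order_trans by blast
qed

definition rect :: "plane => real => (plane) set" where
 "rect z0 \<eta> = {z. \<bar>fst z - fst z0\<bar> < \<eta> \<and> \<bar>snd z - snd z0\<bar> < \<eta>}"

lemma open_rect: "open (rect z0 \<eta>)"
 unfolding rect_def by (intro open_Collect_conj open_Collect_less continuous_intros)

lemma emeasure_rect: "\<eta> > 0 ==> vol (rect z0 \<eta>) = ennreal (4 * \<eta>\<^sup>2)"
proof -
 assume \<eta>: "\<eta> > 0"
 have "rect z0 \<eta> = {fst z0 - \<eta><..<fst z0 + \<eta>} \<times> {snd z0 - \<eta><..<snd z0 + \<eta>}"
  by (auto simp: rect_def abs_less_iff)
 then show ?thesis using \<eta> by (simp add: emeasure_lborel_Times ennreal_mult[symmetric] power2_eq_square)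
qed

text \<open>The derivative of order k+1 in the second variable stays away from 0 on a square, so
  \<open>sublevel_1d\<close> applies to every slice with one constant.\<close>

lemma local_upper:
 assumes z0: "z0 \<in> box2 r" and nz: "rd (Suc k) (fst z0) (snd z0) ~= 0"
 shows "\<exists>\<eta>>0. rect z0 \<eta> \<subseteq> box2 r \<and> SL g (1 / real (Suc k)) (rect z0 \<eta>)"
proof -
 define c where "c = \<bar>rd (Suc k) (fst z0) (snd z0)\<bar> / 2"
 have c: "c > 0" using nz by (simp add: c_def)
 obtain \<eta> where \<eta>: "\<eta> > 0" "!!z. \<bar>fst z - fst z0\<bar> <= \<eta> ==> \<bar>snd z - snd z0\<bar> <= \<eta> ==> z \<in> box2 r \<and> \<bar>rd (Suc k) (fst z) (snd z) - rd (Suc k) (fst z0) (snd z0)\<bar> < c"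
  using rd_near[OF z0 c] by metis
 have sub: "rect z0 \<eta> \<subseteq> box2 r" using \<eta>(2) by (force simp: rect_def)
 define I where "I = {snd z0 - \<eta><..<snd z0 + \<eta>}"
 define K where "K = 4^Suc k * (1/c) powr (1 / real (Suc k))"
 have K: "K >= 0" by (simp add: K_def)
 have slice: "vol {t\<in>I. \<bar>rd 0 s t\<bar> < \<delta>} <= ennreal (K * \<delta> powr (1 / real (Suc k)))"
  if s: "\<bar>s - fst z0\<bar> < \<eta>" and \<delta>: "\<delta> > 0" for s \<delta>
 proof -
  have bx: "\<bar>s\<bar> < r \<and> \<bar>t\<bar> < r \<and> \<bar>rd (Suc k) s t - rd (Suc k) (fst z0) (snd z0)\<bar> < c" if "t \<in> I" for t
  proof -
   have "\<bar>s - fst z0\<bar> <= \<eta>" "\<bar>t - snd z0\<bar> <= \<eta>" using s that unfolding I_def by auto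
   then show ?thesis using \<eta>(2)[of "(s,t)"] by (simp add: box2_def)
  qed
  have "vol {t\<in>I. \<bar>rd 0 s t\<bar> < \<delta>} <= ennreal (4^Suc k * (\<delta>/c) powr (1 / real (Suc k)))"
  proof (rule sublevel_1d[where \<phi> = "\<lambda>k. rd k s"])
   show "is_interval I" by (simp add: I_def)
   show "(\<forall>t\<in>I. c <= rd (Suc k) s t) \<or> (\<forall>t\<in>I. rd (Suc k) s t <= - c)"
   proof (cases "rd (Suc k) (fst z0) (snd z0) > 0")
    case True
    have "\<forall>t\<in>I. c <= rd (Suc k) s t"
    proof
     fix t assume "t \<in> I"
     from bx[OF this] True show "c <= rd (Suc k) s t" unfolding c_def by linarith
    qed
    then show ?thesis by simp
   next
    case False
    have "\<forall>t\<in>I. rd (Suc k) s t <= - c"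
    proof
     fix t assume "t \<in> I"
     from bx[OF this] False show "rd (Suc k) s t <= - c" unfolding c_def by linarith
    qed
    then show ?thesis by simp
   qed
  qed (use bx c \<delta> rd_deriv in auto)
  also have "4^Suc k * (\<delta>/c) powr (1 / real (Suc k)) = K * \<delta> powr (1 / real (Suc k))"
   using c \<delta> by (simp add: K_def powr_divide)
  finally show ?thesis .
 qed
 have "SL g (1 / real (Suc k)) (rect z0 \<eta>)"
  unfolding SL_def
 proof (intro exI[of _ "2 * \<eta> * K"] conjI allI impI)
  show "0 <= 2 * \<eta> * K" using \<eta> K by simp
  fix \<delta> :: real assume \<delta>: "\<delta> > 0"
  let ?X = "{z\<in>rect z0 \<eta>. \<bar>g z\<bar> < \<delta>}"
  have X: "?X \<in> sets borel" using g_sub_open[OF open_rect sub] by simp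
  have "vol ?X = (LI s. vol {t. (s,t) \<in> ?X})"
   by (rule emeasure_lborel_sections[OF X])
  also have "... <= (LI s. ennreal (K * \<delta> powr (1 / real (Suc k))) * indicator {fst z0 - \<eta><..<fst z0 + \<eta>} s)"
  proof (rule nn_integral_mono)
   fix s
   have eq: "{t. (s,t) \<in> ?X} = (if \<bar>s - fst z0\<bar> < \<eta> then {t\<in>I. \<bar>rd 0 s t\<bar> < \<delta>} else {})"
    by (auto simp: rect_def I_def g_def abs_less_iff)
   show "vol {t. (s,t) \<in> ?X} <= ennreal (K * \<delta> powr (1 / real (Suc k))) * indicator {fst z0 - \<eta><..<fst z0 + \<eta>} s"
    unfolding eq using slice[of s \<delta>] \<delta> by (auto simp: indicator_def abs_less_iff)
  qed
  also have "... = ennreal (K * \<delta> powr (1 / real (Suc k))) * ennreal (2 * \<eta>)"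
   using \<eta> by (simp add: nn_integral_cmult)
  also have "... = ennreal (2 * \<eta> * K * \<delta> powr (1 / real (Suc k)))"
   using \<eta> K by (simp add: ennreal_mult[symmetric] mult_ac)
  finally show "vol ?X <= ennreal (2 * \<eta> * K * \<delta> powr (1 / real (Suc k)))" .
 qed
 then show ?thesis using \<eta> sub by blast
qed

text \<open>The hypothesis on \<open>e\<close> says that near \<open>z0\<close> zeros of the k-th
  derivative are zeros of all lower ones. So every nearby slice has a zero \<tau> of multiplicity at
  least k+1, around which |g| <= B |t - \<tau>|^(k+1), and the sublevel set has measure at least a
  constant times \<delta>^(1/(k+1)). This is the converse to \<open>local_upper\<close>.\<close>

lemma local_lower:
 assumes z0: "z0 \<in> box2 r" and k0: "rd k (fst z0) (snd z0) = 0" and k1: "rd (Suc k) (fst z0) (snd z0) ~= 0"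
  and e: "e > 0" "!!i s t. i < k ==> dist s (of_real (fst z0)) < e ==> dist t (of_real (snd z0)) < e ==>
    tder h k s t = 0 ==> tder h i s t = 0"
  and V: "open V" "z0 \<in> V" "V \<subseteq> box2 r" and SL: "SL g \<epsilon> V"
 shows "\<epsilon> <= 1 / real (Suc k)"
proof (rule ccontr)
 assume "\<not> ?thesis"
 then have \<epsilon>: "\<epsilon> > 1 / real (Suc k)" by simp
 define s0 t0 where "s0 = fst z0" and "t0 = snd z0"
 have st0: "\<bar>s0\<bar> < r" "\<bar>t0\<bar> < r" using z0 by (auto simp: box2_def s0_def t0_def)
 define B where "B = \<bar>rd (Suc k) s0 t0\<bar> + 1"
 obtain \<eta>1 where \<eta>1: "\<eta>1 > 0" "!!z. \<bar>fst z - fst z0\<bar> <= \<eta>1 ==> \<bar>snd z - snd z0\<bar> <= \<eta>1 ==> z \<in> box2 r \<and> \<bar>rd (Suc k) (fst z) (snd z) - rd (Suc k) (fst z0) (snd z0)\<bar> < 1"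
  using rd_near[OF z0, of 1] by (metis zero_less_one)
 obtain \<eta>2 where \<eta>2: "\<eta>2 > 0" "ball z0 \<eta>2 \<subseteq> V" using V open_contains_ball by metis
 define \<eta> where "\<eta> = min (min \<eta>1 (\<eta>2 / 3)) (e / 2)"
 have \<eta>: "\<eta> > 0" "\<eta> <= \<eta>1" "\<eta> <= \<eta>2 / 3" "\<eta> < e" using \<eta>1 \<eta>2 e by (auto simp: \<eta>_def)
 have inV: "(s,t) \<in> V" if "\<bar>s - s0\<bar> <= \<eta>" "\<bar>t - t0\<bar> <= \<eta>" for s t
 proof -
  have "dist (s,t) z0 <= \<bar>s - s0\<bar> + \<bar>t - t0\<bar>"
   using norm_pair_le[of "s - s0" "t - t0"] by (cases z0) (simp add: dist_norm s0_def t0_def)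
  then show ?thesis using that \<eta> \<eta>2 by (auto simp: dist_commute)
 qed
 have inB: "\<bar>s\<bar> < r \<and> \<bar>t\<bar> < r \<and> \<bar>rd (Suc k) s t\<bar> <= B" if "\<bar>s - s0\<bar> <= \<eta>" "\<bar>t - t0\<bar> <= \<eta>" for s t
  using \<eta>1(2)[of "(s,t)"] that \<eta> by (auto simp: box2_def s0_def t0_def B_def)
 have B: "B > 0" by (simp add: B_def)
 \<comment> \<open>\<open>rd k s0\<close> changes sign at \<open>t0\<close>, so nearby slices have a real zero, which is then a zero of all lower derivatives.\<close>
 obtain a b where ab: "t0 - \<eta>/2 < a" "a < t0" "t0 < b" "b < t0 + \<eta>/2" "rd k s0 a * rd k s0 b < 0"
 proof -
  have D: "(rd k s0 has_real_derivative rd (Suc k) s0 t0) (at t0)" using rd_deriv[of s0 t0 k UNIV] st0 by simp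
  have z: "rd k s0 t0 = 0" using k0 by (simp add: s0_def t0_def)
  show ?thesis
  proof (cases "rd (Suc k) s0 t0 > 0")
   case True
   obtain d1 where d1: "d1 > 0" "!!x. 0 < x ==> x < d1 ==> rd k s0 t0 < rd k s0 (t0 + x)"
    using DERIV_pos_inc_right[OF D True] by blast
   obtain d2 where d2: "d2 > 0" "!!x. 0 < x ==> x < d2 ==> rd k s0 (t0 - x) < rd k s0 t0"
    using DERIV_pos_inc_left[OF D True] by blast
   define x where "x = min (min d1 d2) (\<eta>/2) / 2"
   have x: "0 < x" "x < d1" "x < d2" "x < \<eta>/2" using d1 d2 \<eta> by (auto simp: x_def min_def)
   show ?thesis by (rule that[of "t0 - x" "t0 + x"]) (use x d1(2)[of x] d2(2)[of x] z in \<open>auto simp: mult_neg_pos\<close>)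
  next
   case False
   then have neg: "rd (Suc k) s0 t0 < 0" using k1 by (simp add: s0_def t0_def)
   obtain d1 where d1: "d1 > 0" "!!x. 0 < x ==> x < d1 ==> rd k s0 t0 > rd k s0 (t0 + x)"
    using DERIV_neg_dec_right[OF D neg] by blast
   obtain d2 where d2: "d2 > 0" "!!x. 0 < x ==> x < d2 ==> rd k s0 (t0 - x) > rd k s0 t0"
    using DERIV_neg_dec_left[OF D neg] by blast
   define x where "x = min (min d1 d2) (\<eta>/2) / 2"
   have x: "0 < x" "x < d1" "x < d2" "x < \<eta>/2" using d1 d2 \<eta> by (auto simp: x_def min_def)
   show ?thesis by (rule that[of "t0 - x" "t0 + x"]) (use x d1(2)[of x] d2(2)[of x] z in \<open>auto simp: mult_pos_neg\<close>)
  qed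
 qed
 have abr: "(s0,a) \<in> box2 r" "(s0,b) \<in> box2 r" using inB[of s0 a] inB[of s0 b] ab \<eta> by (auto simp: box2_def)
 have nzab: "\<bar>rd k s0 a\<bar> > 0" "\<bar>rd k s0 b\<bar> > 0" using ab(5) by auto
 obtain \<eta>3 where \<eta>3: "\<eta>3 > 0" "!!z. \<bar>fst z - s0\<bar> <= \<eta>3 ==> \<bar>snd z - a\<bar> <= \<eta>3 ==> \<bar>rd k (fst z) (snd z) - rd k s0 a\<bar> < \<bar>rd k s0 a\<bar>"
  using rd_near[OF abr(1) nzab(1), of k] by (metis fst_conv snd_conv)
 obtain \<eta>4 where \<eta>4: "\<eta>4 > 0" "!!z. \<bar>fst z - s0\<bar> <= \<eta>4 ==> \<bar>snd z - b\<bar> <= \<eta>4 ==> \<bar>rd k (fst z) (snd z) - rd k s0 b\<bar> < \<bar>rd k s0 b\<bar>"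
  using rd_near[OF abr(2) nzab(2), of k] by (metis fst_conv snd_conv)
 define \<omega> where "\<omega> = min \<eta> (min \<eta>3 \<eta>4)"
 have \<omega>: "\<omega> > 0" "\<omega> <= \<eta>" "\<omega> <= \<eta>3" "\<omega> <= \<eta>4" using \<eta> \<eta>3 \<eta>4 by (auto simp: \<omega>_def)
 have zero: "\<exists>\<tau>. \<bar>\<tau> - t0\<bar> < \<eta>/2 \<and> (\<forall>i<Suc k. rd i s \<tau> = 0)" if s: "\<bar>s - s0\<bar> <= \<omega>" for s
 proof -
  have sa: "\<bar>rd k s a - rd k s0 a\<bar> < \<bar>rd k s0 a\<bar>" "\<bar>rd k s b - rd k s0 b\<bar> < \<bar>rd k s0 b\<bar>"
   using \<eta>3(2)[of "(s,a)"] \<eta>4(2)[of "(s,b)"] s \<omega> \<eta>3 \<eta>4 by auto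
  have sgn: "rd k s a < 0 \<and> 0 < rd k s b \<or> rd k s b < 0 \<and> 0 < rd k s a"
   using sa ab(5) by (auto simp: mult_less_0_iff abs_if split: if_splits)
  have cont: "continuous_on {a..b} (rd k s)"
  proof (rule DERIV_continuous_on)
   fix t assume "t \<in> {a..b}"
   then have "\<bar>s\<bar> < r \<and> \<bar>t\<bar> < r" using inB[of s t] s \<omega> ab by auto
   then show "(rd k s has_real_derivative rd (Suc k) s t) (at t within {a..b})" using rd_deriv by blast
  qed
  have "\<exists>\<tau>. a <= \<tau> \<and> \<tau> <= b \<and> rd k s \<tau> = 0"
   using sgn
  proof
   assume "rd k s a < 0 \<and> 0 < rd k s b"
   then show ?thesis by (intro IVT'[OF _ _ _ cont]) (use ab in auto)
  next
   assume "rd k s b < 0 \<and> 0 < rd k s a"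
   then show ?thesis by (intro IVT2'[OF _ _ _ cont]) (use ab in auto)
  qed
  then obtain \<tau> where \<tau>: "a <= \<tau>" "\<tau> <= b" "rd k s \<tau> = 0" by blast
  have tau: "\<bar>\<tau> - t0\<bar> < \<eta>/2" using \<tau> ab by linarith
  have sr: "\<bar>s\<bar> < r" "\<bar>\<tau>\<bar> < r" using inB[of s \<tau>] s \<omega> tau \<eta> by auto
  have "rd i s \<tau> = 0" if "i < Suc k" for i
  proof (cases "i = k")
   case False
   have "tder h k (of_real s) (of_real \<tau>) = 0" using tder_rd[OF sr, of k] \<tau> by simp
   moreover have "dist (of_real s :: complex) (of_real (fst z0)) < e" "dist (of_real \<tau> :: complex) (of_real (snd z0)) < e"
    using s \<omega> \<eta> tau by (simp_all add: dist_of_real dist_real_def s0_def t0_def)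
   ultimately have "tder h i (of_real s) (of_real \<tau>) = 0" using e(2)[of i] that False by auto
   then show ?thesis by (simp add: rd_def)
  qed (use \<tau> in simp)
  then show ?thesis using tau by blast
 qed
 define p where "p = 1 / real (Suc k)"
 have p: "p > 0" by (simp add: p_def)
 obtain C where C: "C >= 0" "!!\<delta>. \<delta> > 0 ==> vol {z\<in>V. \<bar>g z\<bar> < \<delta>} <= ennreal (C * \<delta> powr \<epsilon>)"
  using SL unfolding SL_def by blast
 \<comment> \<open>Each slice with |s - s0| <= \<omega> contains an interval of half length
   (\<delta>/B)^p around its zero. Comparing the total with the assumed bound and letting \<delta>
   tend to 0 contradicts \<epsilon> > p.\<close>
 have main: "4 * \<omega> * (\<delta>/B) powr p <= C * \<delta> powr \<epsilon>" if \<delta>: "\<delta> > 0" "(\<delta>/B) powr p <= \<eta>/2" for \<delta>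
 proof -
  define w where "w = (\<delta>/B) powr p"
  have w: "w > 0" using \<delta> B by (simp add: w_def)
  let ?X = "{z\<in>V. \<bar>g z\<bar> < \<delta>}"
  have X: "?X \<in> sets borel" using g_sub_open[OF V(1,3)] by simp
  have "(LI s. ennreal (2 * w) * indicator {s0 - \<omega>..s0 + \<omega>} s) <= (LI s. vol {t. (s,t) \<in> ?X})"
  proof (rule nn_integral_mono)
   fix s
   show "ennreal (2 * w) * indicator {s0 - \<omega>..s0 + \<omega>} s <= vol {t. (s,t) \<in> ?X}"
   proof (cases "\<bar>s - s0\<bar> <= \<omega>")
    case True
    obtain \<tau> where \<tau>: "\<bar>\<tau> - t0\<bar> < \<eta>/2" "!!i. i < Suc k ==> rd i s \<tau> = 0" using zero[OF True] by auto
    have sub: "{\<tau> - w<..<\<tau> + w} \<subseteq> {t. (s,t) \<in> ?X}"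
    proof
     fix t assume t: "t \<in> {\<tau> - w<..<\<tau> + w}"
     then have tw: "\<bar>t - \<tau>\<bar> < w" by (auto simp: abs_less_iff)
     have tt: "\<bar>t - t0\<bar> <= \<eta>" using tw \<tau>(1) \<delta>(2) unfolding w_def by linarith
     have tI: "t \<in> {t0 - \<eta>..t0 + \<eta>}" "\<tau> \<in> {t0 - \<eta>..t0 + \<eta>}"
      using tt \<tau>(1) \<eta>(1) unfolding atLeastAtMost_iff by linarith+
     have "\<bar>rd 0 s t\<bar> <= B * \<bar>t - \<tau>\<bar> ^ Suc k"
     proof (rule iterated_zero_power_bound[where I = "{t0 - \<eta>..t0 + \<eta>}" and \<phi> = "\<lambda>i. rd i s"])
      show "(rd i s has_real_derivative rd (Suc i) s u) (at u within {t0 - \<eta>..t0 + \<eta>})" if "u \<in> {t0 - \<eta>..t0 + \<eta>}" for i u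
       using rd_deriv inB[of s u] True \<omega> that by (auto simp: abs_le_iff)
      show "\<bar>rd (Suc k) s u\<bar> <= B" if "u \<in> {t0 - \<eta>..t0 + \<eta>}" for u
       using inB[of s u] True \<omega> that by (auto simp: abs_le_iff)
     qed (use \<tau>(2) tI in auto)
     also have "... < B * w ^ Suc k" using tw B by (intro mult_strict_left_mono power_strict_mono) auto
     also have "w ^ Suc k = \<delta> / B"
      using \<delta> B by (simp add: w_def p_def powr_realpow[symmetric] powr_powr del: of_nat_Suc power_Suc)
     finally have "\<bar>rd 0 s t\<bar> < \<delta>" using B by simp
     then show "t \<in> {t. (s,t) \<in> ?X}" using inV[of s t] True \<omega> tt by (simp add: g_def)
    qed
    have "ennreal (2 * w) = vol {\<tau> - w<..<\<tau> + w}" using w by simp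
    also have "... <= vol {t. (s,t) \<in> ?X}"
     by (rule emeasure_mono[OF sub]) (use borel_section[OF X] in simp)
    finally show ?thesis by (auto simp: indicator_def)
   next
    case False
    then have "s \<notin> {s0 - \<omega>..s0 + \<omega>}" by (auto simp: abs_le_iff)
    then show ?thesis by simp
   qed
  qed
  then have "ennreal (2 * w) * ennreal (2 * \<omega>) <= vol ?X"
   using \<omega> unfolding emeasure_lborel_sections[OF X] by (simp add: nn_integral_cmult)
  also have "... <= ennreal (C * \<delta> powr \<epsilon>)" by (rule C(2)[OF \<delta>(1)])
  also have "ennreal (2 * w) * ennreal (2 * \<omega>) = ennreal (2 * w * (2 * \<omega>))"
   by (subst ennreal_mult) (use w \<omega> in auto)
  finally have "ennreal (2 * w * (2 * \<omega>)) <= ennreal (C * \<delta> powr \<epsilon>)" .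
  then have "2 * w * (2 * \<omega>) <= C * \<delta> powr \<epsilon>" using C(1) by (subst (asm) ennreal_le_iff) auto
  then show ?thesis by (simp add: w_def mult_ac)
 qed
 define A where "A = 4 * \<omega> * (1/B) powr p"
 have A: "A > 0" using \<omega> B by (simp add: A_def)
 have "\<forall>\<^sub>F \<delta> in at_right 0. C * \<delta> powr (\<epsilon> - p) < A"
 proof -
  have "((\<lambda>\<delta>. C * \<delta> powr (\<epsilon> - p)) \<longlongrightarrow> C * 0) (at_right 0)"
   using \<epsilon> by (intro tendsto_intros powr_at_right_0) (auto simp: p_def)
  then show ?thesis using A by (intro order_tendstoD(2)[of _ 0]) auto
 qed
 moreover have "\<forall>\<^sub>F \<delta> in at_right 0. (\<delta>/B) powr p < \<eta>/2"
 proof -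
  have "((\<lambda>\<delta>. (1/B) powr p * \<delta> powr p) \<longlongrightarrow> (1/B) powr p * 0) (at_right 0)"
   using p by (intro tendsto_intros powr_at_right_0)
  then have "\<forall>\<^sub>F \<delta> in at_right 0. (1/B) powr p * \<delta> powr p < \<eta>/2" using \<eta> by (intro order_tendstoD(2)[of _ 0]) auto
  moreover have "\<forall>\<^sub>F \<delta>::real in at_right 0. \<delta> > 0" by (rule eventually_at_right_less)
  ultimately show ?thesis by eventually_elim (use B in \<open>simp add: powr_divide\<close>)
 qed
 moreover have "\<forall>\<^sub>F \<delta>::real in at_right 0. \<delta> > 0" by (rule eventually_at_right_less)
 ultimately have "\<forall>\<^sub>F \<delta>::real in at_right 0. False"
 proof eventually_elim
  case (elim \<delta>)
  have "A * \<delta> powr p <= C * \<delta> powr \<epsilon>" using main[of \<delta>] elim B by (simp add: A_def powr_divide)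
  also have "... = (C * \<delta> powr (\<epsilon> - p)) * \<delta> powr p" by (simp add: powr_add[symmetric])
  finally have "A <= C * \<delta> powr (\<epsilon> - p)" using elim by simp
  then show False using elim by simp
 qed
 then show False by (simp add: trivial_limit_at_right_real)
qed

lemma SL_Un:
 assumes "SL g \<epsilon> V" "SL g \<epsilon> W" "open V" "open W" "V \<subseteq> box2 r" "W \<subseteq> box2 r"
 shows "SL g \<epsilon> (V \<union> W)"
proof -
 obtain C where C: "C >= 0" "!!\<delta>. \<delta> > 0 ==> vol {z\<in>V. \<bar>g z\<bar> < \<delta>} <= ennreal (C * \<delta> powr \<epsilon>)"
  using assms(1) unfolding SL_def by blast
 obtain D where D: "D >= 0" "!!\<delta>. \<delta> > 0 ==> vol {z\<in>W. \<bar>g z\<bar> < \<delta>} <= ennreal (D * \<delta> powr \<epsilon>)"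
  using assms(2) unfolding SL_def by blast
 show ?thesis unfolding SL_def
 proof (intro exI[of _ "C + D"] conjI allI impI)
  fix \<delta> :: real assume \<delta>: "\<delta> > 0"
  have "{z\<in>V \<union> W. \<bar>g z\<bar> < \<delta>} = {z\<in>V. \<bar>g z\<bar> < \<delta>} \<union> {z\<in>W. \<bar>g z\<bar> < \<delta>}" by auto
  then have "vol {z\<in>V \<union> W. \<bar>g z\<bar> < \<delta>} <= vol {z\<in>V. \<bar>g z\<bar> < \<delta>} + vol {z\<in>W. \<bar>g z\<bar> < \<delta>}"
   using g_sub_open assms by (auto intro!: emeasure_subadditive)
  also have "... <= ennreal (C * \<delta> powr \<epsilon>) + ennreal (D * \<delta> powr \<epsilon>)" by (intro add_mono C(2) D(2) \<delta>)
  also have "... = ennreal ((C + D) * \<delta> powr \<epsilon>)" using C(1) D(1) by (simp add: ennreal_plus distrib_right)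
  finally show "vol {z\<in>V \<union> W. \<bar>g z\<bar> < \<delta>} <= ennreal ((C + D) * \<delta> powr \<epsilon>)" .
 qed (use C D in simp)
qed

text \<open>For \<delta> <= 1 a smaller exponent gives a weaker bound; for \<delta> > 1 the area of
  the square is used instead.\<close>

lemma SL_weaken:
 assumes "SL g \<epsilon>' (rect z0 \<eta>)" "rect z0 \<eta> \<subseteq> box2 r" "\<eta> > 0" "0 < \<epsilon>" "\<epsilon> <= \<epsilon>'"
 shows "SL g \<epsilon> (rect z0 \<eta>)"
proof -
 obtain C where C: "C >= 0" "!!\<delta>. \<delta> > 0 ==> vol {z\<in>rect z0 \<eta>. \<bar>g z\<bar> < \<delta>} <= ennreal (C * \<delta> powr \<epsilon>')"
  using assms(1) unfolding SL_def by blast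
 define A where "A = 4 * \<eta>\<^sup>2"
 show ?thesis unfolding SL_def
 proof (intro exI[of _ "max C A"] conjI allI impI)
  show "0 <= max C A" using C by simp
  fix \<delta> :: real assume \<delta>: "\<delta> > 0"
  show "vol {z\<in>rect z0 \<eta>. \<bar>g z\<bar> < \<delta>} <= ennreal (max C A * \<delta> powr \<epsilon>)"
  proof (cases "\<delta> <= 1")
   case True
   have "C * \<delta> powr \<epsilon>' <= max C A * \<delta> powr \<epsilon>"
    using True \<delta> assms C by (intro mult_mono powr_mono') auto
   then show ?thesis using C(2)[OF \<delta>] by (meson ennreal_leI order_trans)
  next
   case False
   have "vol {z\<in>rect z0 \<eta>. \<bar>g z\<bar> < \<delta>} <= vol (rect z0 \<eta>)"
    using open_rect by (intro emeasure_mono) auto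
   also have "... = ennreal A" using emeasure_rect[OF assms(3)] by (simp add: A_def)
   also have "... <= ennreal (max C A * \<delta> powr \<epsilon>)"
   proof (rule ennreal_leI)
    have "1 <= \<delta> powr \<epsilon>" using False assms by (intro ge_one_powr_ge_zero) auto
    then have "A * 1 <= max C A * \<delta> powr \<epsilon>" by (intro mult_mono) (auto simp: A_def le_max_iff_disj)
    then show "A <= max C A * \<delta> powr \<epsilon>" by simp
   qed
   finally show ?thesis .
  qed
 qed
qed

lemma SL_nonzero:
 assumes "z0 \<in> box2 r" "g z0 ~= 0" "\<epsilon> > 0"
 shows "\<exists>\<eta>>0. rect z0 \<eta> \<subseteq> box2 r \<and> SL g \<epsilon> (rect z0 \<eta>)"
proof -
 define c where "c = \<bar>g z0\<bar> / 2"
 have c: "c > 0" using assms by (simp add: c_def)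
 obtain \<eta> where \<eta>: "\<eta> > 0" "!!z. \<bar>fst z - fst z0\<bar> <= \<eta> ==> \<bar>snd z - snd z0\<bar> <= \<eta> ==> z \<in> box2 r \<and> \<bar>rd 0 (fst z) (snd z) - rd 0 (fst z0) (snd z0)\<bar> < c"
  using rd_near[OF assms(1) c] by metis
 have sub: "rect z0 \<eta> \<subseteq> box2 r" using \<eta>(2) by (auto simp: rect_def)
 have low: "c <= \<bar>g z\<bar>" if "z \<in> rect z0 \<eta>" for z
 proof -
  have "\<bar>fst z - fst z0\<bar> <= \<eta>" "\<bar>snd z - snd z0\<bar> <= \<eta>" using that by (auto simp: rect_def)
  then have "\<bar>g z - g z0\<bar> < c" using \<eta>(2)[of z] by (simp add: g_def)
  then show ?thesis unfolding c_def by linarith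
 qed
 have "SL g \<epsilon> (rect z0 \<eta>)" unfolding SL_def
 proof (intro exI[of _ "4 * \<eta>\<^sup>2 / c powr \<epsilon>"] conjI allI impI)
  fix \<delta> :: real assume \<delta>: "\<delta> > 0"
  show "vol {z\<in>rect z0 \<eta>. \<bar>g z\<bar> < \<delta>} <= ennreal (4 * \<eta>\<^sup>2 / c powr \<epsilon> * \<delta> powr \<epsilon>)"
  proof (cases "\<delta> <= c")
   case True
   then have "{z\<in>rect z0 \<eta>. \<bar>g z\<bar> < \<delta>} = {}" using low by force
   then show ?thesis by (metis emeasure_empty zero_le)
  next
   case False
   have "vol {z\<in>rect z0 \<eta>. \<bar>g z\<bar> < \<delta>} <= vol (rect z0 \<eta>)"
    using open_rect by (intro emeasure_mono) auto
   also have "... = ennreal (4 * \<eta>\<^sup>2)" using emeasure_rect[OF \<eta>(1)] .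
   also have "... <= ennreal (4 * \<eta>\<^sup>2 / c powr \<epsilon> * \<delta> powr \<epsilon>)"
   proof (rule ennreal_leI)
    have "c powr \<epsilon> <= \<delta> powr \<epsilon>" using False c assms by (intro powr_mono2) auto
    then have "4 * \<eta>\<^sup>2 * c powr \<epsilon> <= 4 * \<eta>\<^sup>2 * \<delta> powr \<epsilon>" by (intro mult_left_mono) auto
    then show "4 * \<eta>\<^sup>2 <= 4 * \<eta>\<^sup>2 / c powr \<epsilon> * \<delta> powr \<epsilon>" using c by (simp add: pos_le_divide_eq)
   qed
   finally show ?thesis .
  qed
 qed (use c in simp)
 then show ?thesis using \<eta> sub by blast
qed

end

section \<open>One square on which all local exponents remain valid\<close>

text \<open>Finitely many conditions, each valid below its own threshold, hold together below the
  smallest one.\<close>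

lemma uniform_pos:
 fixes P :: "nat => real => bool"
 assumes "!!k. k < d ==> \<exists>x>0. \<forall>y. 0 < y \<and> y <= x --> P k y"
 shows "\<exists>x>0. \<forall>k<d. \<forall>y. 0 < y \<and> y <= x --> P k y"
 using assms
proof (induction d)
 case (Suc d)
 have "\<exists>x>0. \<forall>k<d. \<forall>y. 0 < y \<and> y <= x --> P k y" by (rule Suc.IH) (rule Suc.prems, simp)
 then obtain x where x: "x > 0" "!!k y. k < d ==> 0 < y ==> y <= x ==> P k y" by blast
 obtain x' where x': "x' > 0" "!!y. 0 < y ==> y <= x' ==> P d y" using Suc.prems[OF lessI] by blast
 show ?case using x x' by (intro exI[of _ "min x x'"]) (auto simp: less_Suc_eq)
qed (auto intro: exI[of _ 1])

context real_hol2
begin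

text \<open>In the second claim \<eta> is fixed before \<epsilon>. If the square contains a zero of
  multiplicity k+1 off the origin, then such zeros accumulate at the origin, where
  \<open>local_lower\<close> forces \<epsilon> <= 1/(k+1); at the zero itself
  \<open>local_upper\<close> provides the exponent 1/(k+1). Points with nonzero value satisfy every
  exponent, and compactness combines the local estimates.\<close>

theorem uniform_sublevel:
 assumes h00: "h 0 0 = 0" and nz: "\<exists>t\<in>ball 0 r. h 0 t ~= 0"
 shows "\<exists>k \<eta>. \<eta> > 0 \<and> rect 0 \<eta> \<subseteq> box2 r \<and> SL g (1 / real (Suc k)) (rect 0 \<eta>)"
  and "\<exists>\<eta>>0. \<eta> <= r \<and> (\<forall>\<epsilon>>0. (\<exists>V. open V \<and> 0 \<in> V \<and> V \<subseteq> box2 r \<and> SL g \<epsilon> V) --> SL g \<epsilon> (box2 \<eta>))"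
proof -
 have hs: "tder h k s holomorphic_on ball 0 r" if "norm s < r" for k s using tder_hol2[of k] that by (auto simp: hol2_def)
 have hc: "continuous_on (ball 0 r \<times> ball 0 r) (\<lambda>(s,t). tder h k s t)" for k using tder_hol2[of k] by (simp add: hol2_def)
 have z0b: "(0::complex) \<in> ball 0 r" using r by simp
 have "\<exists>n. tder h n 0 0 ~= 0"
 proof (rule ccontr)
  assume a: "\<not> ?thesis"
  obtain t where t: "t \<in> ball 0 r" "h 0 t ~= 0" using nz by blast
  have "h 0 t = 0"
   by (rule holomorphic_fun_eq_0_on_ball[OF _ t(1)]) (use hs[of 0 0] r a in \<open>auto simp: tder_higher_deriv\<close>)
  then show False using t by simp
 qed
 \<comment> \<open>The order of vanishing of \<open>h 0\<close> at 0. Near the origin the d-th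
   derivative has no zeros, so multiplicities there are at most \<open>d\<close> and only finitely
   many orders have to be considered.\<close>
 define d where "d = (LEAST n. tder h n 0 0 ~= 0)"
 have d: "tder h d 0 0 ~= 0" "!!k. k < d ==> tder h k 0 0 = 0"
  unfolding d_def using LeastI_ex[OF \<open>\<exists>n. _\<close>] not_less_Least by blast+
 have d0: "d > 0" using d(1) h00 by (cases d) auto
 have zb: "0 \<in> box2 r" using r by (simp add: box2_def)
 have rd0: "rd d 0 0 ~= 0" using tder_rd[of 0 0 d] r d(1) by simp
 show "\<exists>k \<eta>. \<eta> > 0 \<and> rect 0 \<eta> \<subseteq> box2 r \<and> SL g (1 / real (Suc k)) (rect 0 \<eta>)"
 proof -
  obtain d' where d': "d = Suc d'" using d0 by (cases d) auto
  have "\<exists>\<eta>>0. rect 0 \<eta> \<subseteq> box2 r \<and> SL g (1 / real (Suc d')) (rect 0 \<eta>)"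
   by (rule local_upper[OF zb]) (use rd0 d' in simp)
  then show ?thesis by blast
 qed
 obtain e0 where e0: "e0 > 0" "!!s t. norm s < e0 ==> norm t < e0 ==> tder h d s t ~= 0"
 proof -
  have "continuous (at (0,0)) (\<lambda>(s,t). tder h d s t)"
   using hc[of d] z0b by (simp add: continuous_on_eq_continuous_at open_Times)
  then obtain e where e: "e > 0" "!!x. dist (0,0) x < e ==> (\<lambda>(s,t). tder h d s t) x ~= 0"
   using continuous_at_avoid[of "(0,0)" "\<lambda>(s,t). tder h d s t" 0] d(1) by auto
  show ?thesis
  proof (rule that[of "e/2"])
   fix s t :: complex assume "norm s < e/2" "norm t < e/2"
   moreover have "dist (0,0) (s,t) <= norm s + norm t" by (simp add: dist_Pair_Pair sqrt_sum_squares_le_sum)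
   ultimately show "tder h d s t ~= 0" using e(2)[of "(s,t)"] by simp
  qed (use e in simp)
 qed
 have ex\<rho>: "\<exists>x>0. \<forall>y. 0 < y \<and> y <= x --> (\<forall>t. 0 < norm t \<and> norm t <= y --> tder h k 0 t ~= 0)" if k: "k < d" for k
 proof -
  \<comment> \<open>If the k-th derivative vanished on the whole disc, so would all higher ones,
    among them the d-th.\<close>
  have nz0: "\<exists>t\<in>ball 0 r. tder h k 0 t ~= 0"
  proof (rule ccontr)
   assume "\<not> ?thesis"
   then have z: "\<forall>t\<in>ball 0 r. tder h (k + j) 0 t = 0" for j
   proof (induction j)
    case (Suc j)
    show ?case
    proof
     fix t assume t: "t \<in> ball (0::complex) r"
     have "(tder h (k + j) 0 has_field_derivative 0) (at t)"
      using Suc t by (intro has_field_derivative_transform_within_open[OF DERIV_const open_ball t]) auto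
     then show "tder h (k + Suc j) 0 t = 0" by (simp add: DERIV_imp_deriv)
    qed
   qed simp
   from z[of "d - k"] have "tder h d 0 0 = 0" using k z0b by auto
   then show False using d by simp
  qed
  then obtain b where b: "b \<in> ball 0 r" "tder h k 0 b ~= 0" by blast
  have n0: "norm (0::complex) < r" using r by simp
  show ?thesis
  proof (rule isolated_zeros[OF hs[OF n0] open_ball connected_ball z0b d(2)[OF k] b])
   fix e assume e: "0 < e" "ball 0 e \<subseteq> ball 0 r" "!!z. z \<in> ball 0 e - {0} ==> tder h k 0 z ~= 0"
   show ?thesis by (rule exI[of _ "e/2"]) (use e in auto)
  qed
 qed
 obtain \<rho>1 where \<rho>1: "\<rho>1 > 0" "!!k t. k < d ==> 0 < norm t ==> norm t <= \<rho>1 ==> tder h k 0 t ~= 0"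
 proof -
  have "\<exists>x>0. \<forall>k<d. \<forall>y. 0 < y \<and> y <= x --> (\<forall>t. 0 < norm t \<and> norm t <= y --> tder h k 0 t ~= 0)" by (rule uniform_pos) (rule ex\<rho>)
  then obtain x where x: "x > 0 \<and> (\<forall>k<d. \<forall>y. 0 < y \<and> y <= x --> (\<forall>t. 0 < norm t \<and> norm t <= y --> tder h k 0 t ~= 0))" ..
  show ?thesis by (rule that[of x]) (use x in auto)
 qed
 define \<rho> where "\<rho> = min \<rho>1 (min e0 r) / 2"
 have \<rho>: "0 < \<rho>" "\<rho> <= \<rho>1" "\<rho> < e0" "\<rho> < r" using \<rho>1 e0 r by (auto simp: \<rho>_def)
 \<comment> \<open>By compactness, the zeros of the k-th derivative with |t| = \<rho> have
   \<open>s\<close> bounded away from 0, as there are none for s = 0.\<close>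
 have ex\<sigma>: "\<exists>x>0. \<forall>y. 0 < y \<and> y <= x --> (\<forall>s t. norm s <= y \<and> norm t = \<rho> --> tder h k s t ~= 0)" if k: "k < d" for k
 proof -
  define K where "K = cball (0::complex) (r/2) \<times> sphere (0::complex) \<rho>"
  have Ksub: "K \<subseteq> ball 0 r \<times> ball 0 r" using \<rho> r by (auto simp: K_def)
  have "compact K" unfolding K_def by (intro compact_Times) auto
  moreover have "closedin (top_of_set K) (K \<inter> (\<lambda>(s,t). tder h k s t) -` {0})"
   by (rule continuous_closedin_preimage[OF continuous_on_subset[OF hc Ksub]]) auto
  ultimately have "compact (K \<inter> (\<lambda>(s,t). tder h k s t) -` {0})" by (meson closedin_compact)
  then have "compact (fst ` (K \<inter> (\<lambda>(s,t). tder h k s t) -` {0}))"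
   by (intro compact_continuous_image continuous_intros)
  then have cl: "closed (fst ` (K \<inter> (\<lambda>(s,t). tder h k s t) -` {0}))" by (rule compact_imp_closed)
  have "0 \<notin> fst ` (K \<inter> (\<lambda>(s,t). tder h k s t) -` {0})"
   using \<rho>1(2)[OF k] \<rho> by (auto simp: K_def)
  then obtain e where e: "e > 0" "ball 0 e \<inter> fst ` (K \<inter> (\<lambda>(s,t). tder h k s t) -` {0}) = {}"
   using cl by (metis closed_Compl open_contains_ball disjoint_eq_subset_Compl open_Compl Compl_iff)
  show ?thesis
  proof (intro exI[of _ "min (e/2) (r/2)"] conjI allI impI)
   show "0 < min (e/2) (r/2)" using e r by simp
   fix y :: real and s t :: complex assume y: "0 < y \<and> y <= min (e/2) (r/2)" and st: "norm s <= y \<and> norm t = \<rho>"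
   show "tder h k s t ~= 0"
   proof
    assume "tder h k s t = 0"
    then have "(s,t) \<in> K \<inter> (\<lambda>(s,t). tder h k s t) -` {0}" using y st by (auto simp: K_def)
    then have "s \<in> fst ` (K \<inter> (\<lambda>(s,t). tder h k s t) -` {0})" by force
    moreover have "s \<in> ball 0 e" using y st e by auto
    ultimately show False using e(2) by blast
   qed
  qed
 qed
 obtain \<sigma>1 where \<sigma>1: "\<sigma>1 > 0" "!!k s t. k < d ==> norm s <= \<sigma>1 ==> norm t = \<rho> ==> tder h k s t ~= 0"
 proof -
  have "\<exists>x>0. \<forall>k<d. \<forall>y. 0 < y \<and> y <= x --> (\<forall>s t. norm s <= y \<and> norm t = \<rho> --> tder h k s t ~= 0)" by (rule uniform_pos) (rule ex\<sigma>)
  then obtain x where x: "x > 0 \<and> (\<forall>k<d. \<forall>y. 0 < y \<and> y <= x --> (\<forall>s t. norm s <= y \<and> norm t = \<rho> --> tder h k s t ~= 0))" ..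
  show ?thesis by (rule that[of x]) (use x in auto)
 qed
 define \<sigma> where "\<sigma> = min \<sigma>1 (min e0 r) / 2"
 have \<sigma>: "0 < \<sigma>" "\<sigma> <= \<sigma>1" "\<sigma> < e0" "\<sigma> < r" using \<sigma>1 e0 r by (auto simp: \<sigma>_def)
 \<comment> \<open>The conclusion of \<open>common_zeros_persist\<close> for two derivatives; the
   line s = 0 is excluded as it is there.\<close>
 define pers where "pers i k y \<longleftrightarrow> (\<forall>s0 t0. 0 < norm s0 \<and> norm s0 < y \<and> norm t0 < \<rho> \<and> tder h k s0 t0 = 0 \<and> tder h i s0 t0 = 0 -->
   (\<exists>e>0. \<forall>s t. dist s s0 < e \<and> dist t t0 < e \<and> tder h k s t = 0 --> tder h i s t = 0))" for i k and y :: real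
 have ex\<sigma>': "\<exists>x>0. \<forall>y. 0 < y \<and> y <= x --> (\<forall>i<k. pers i k y)" if k: "k < d" for k
 proof -
  have "\<exists>x>0. \<forall>y. 0 < y \<and> y <= x --> pers i k y" for i
  proof -
   have "\<exists>\<sigma>'>0. \<sigma>' <= \<sigma> \<and> pers i k \<sigma>'" unfolding pers_def
    by (rule common_zeros_persist[OF tder_hol2 tder_hol2 \<rho>(1,4) \<sigma>(1,4)]) (use \<sigma>1(2)[OF k] \<sigma>(2) in auto)
   then obtain \<sigma>' where s': "\<sigma>' > 0" "pers i k \<sigma>'" by blast
   have "pers i k y" if "y <= \<sigma>'" for y using s'(2) that unfolding pers_def by (meson less_le_trans)
   then show ?thesis using s'(1) by blast
  qed
  then have "\<exists>x>0. \<forall>i<k. \<forall>y. 0 < y \<and> y <= x --> pers i k y" by (intro uniform_pos) blast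
  then show ?thesis by blast
 qed
 obtain \<sigma>2 where \<sigma>2: "\<sigma>2 > 0" "!!i k. i < k ==> k < d ==> pers i k \<sigma>2"
 proof -
  have "\<exists>x>0. \<forall>k<d. \<forall>y. 0 < y \<and> y <= x --> (\<forall>i<k. pers i k y)" by (rule uniform_pos) (rule ex\<sigma>')
  then obtain x where x: "x > 0 \<and> (\<forall>k<d. \<forall>y. 0 < y \<and> y <= x --> (\<forall>i<k. pers i k y))" ..
  show ?thesis by (rule that[of x]) (use x in auto)
 qed
 \<comment> \<open>\<open>Mu k z\<close> says that the slice through \<open>z\<close> has there a
   zero of multiplicity exactly k+1.\<close>
 define Mu where "Mu k z \<longleftrightarrow> (\<forall>j\<le>k. rd j (fst z) (snd z) = 0) \<and> rd (Suc k) (fst z) (snd z) ~= 0" for k and z :: "plane"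
 define near where "near k y z \<longleftrightarrow> 0 < \<bar>fst z\<bar> \<and> \<bar>fst z\<bar> < y \<and> \<bar>snd z\<bar> < y \<and> Mu k z" for k y and z :: "plane"
 \<comment> \<open>A dichotomy for each order: off the line s = 0, points of this multiplicity
   either occur arbitrarily close to the origin or are absent from a whole square.\<close>
 have exK: "\<exists>x>0. \<forall>y. 0 < y \<and> y <= x --> ((\<forall>y'>0. \<exists>z. near k y' z) \<or> \<not> (\<exists>z. near k y z))" for k
 proof (cases "\<forall>y'>0. \<exists>z. near k y' z")
  case False
  then obtain x where x: "x > 0" "\<not> (\<exists>z. near k x z)" by blast
  have "\<not> (\<exists>z. near k y z)" if "y <= x" for y using x(2) that unfolding near_def by (meson less_le_trans)
  then show ?thesis using x(1) by blast
 qed (auto intro: exI[of _ 1])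
 obtain \<eta>K where \<eta>K: "\<eta>K > 0" "!!k y. k < d ==> 0 < y ==> y <= \<eta>K ==> (\<forall>y'>0. \<exists>z. near k y' z) \<or> \<not> (\<exists>z. near k y z)"
  using uniform_pos[of d "\<lambda>k y. (\<forall>y'>0. \<exists>z. near k y' z) \<or> \<not> (\<exists>z. near k y z)", OF exK] by blast
 define m where "m = min (min (min \<sigma> \<sigma>2) \<rho>) (min \<eta>K r)"
 have m: "m > 0" "m <= \<sigma>" "m <= \<sigma>2" "m <= \<rho>" "m <= \<eta>K" "m <= r"
  using \<sigma> \<sigma>2 \<rho> \<eta>K r by (auto simp: m_def)
 define \<eta> where "\<eta> = m / 2"
 have \<eta>: "\<eta> > 0" "\<eta> < m" using m by (auto simp: \<eta>_def)
 \<comment> \<open>A point of multiplicity k+1 is taken so close to the origin that it lies in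
   \<open>V\<close>, where the exponent \<epsilon> is valid; persistence supplies the hypothesis of
   \<open>local_lower\<close>.\<close>
 have mult_bound: "\<epsilon> <= 1 / real (Suc k)"
  if k: "k < d" "\<forall>y'>0. \<exists>z. near k y' z" and V: "open V" "0 \<in> V" "V \<subseteq> box2 r" "SL g \<epsilon> V" for k \<epsilon> V
 proof -
  obtain e1 where e1: "e1 > 0" "ball 0 e1 \<subseteq> V" using V open_contains_ball by metis
  define y where "y = min (e1/2) m"
  have y: "y > 0" "y <= m" "y <= e1/2" using e1 m by (auto simp: y_def)
  obtain z where z: "near k y z" using k(2) y(1) by blast
  have zr: "z \<in> box2 r" using z y m by (auto simp: near_def box2_def)
  have zV: "z \<in> V"
  proof -
   have "norm z <= \<bar>fst z\<bar> + \<bar>snd z\<bar>" using norm_pair_le[of "fst z" "snd z"] by simp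
   then have "norm z < e1" using z y by (auto simp: near_def)
   then show ?thesis using e1 by auto
  qed
  have st: "\<bar>fst z\<bar> < r" "\<bar>snd z\<bar> < r" using zr by (auto simp: box2_def)
  have tz: "tder h j (of_real (fst z)) (of_real (snd z)) = 0" if "j <= k" for j
   using tder_rd[OF st, of j] z that by (auto simp: near_def Mu_def)
  define Pe where "Pe i e \<longleftrightarrow> (\<forall>s t. dist s (of_real (fst z)) < e \<and> dist t (of_real (snd z)) < e \<and> tder h k s t = 0 --> tder h i s t = 0)" for i and e :: real
  have "\<exists>x>0. \<forall>y. 0 < y \<and> y <= x --> Pe i y" if ik: "i < k" for i
  proof -
   have "norm (complex_of_real (fst z)) < \<sigma>2" "0 < norm (complex_of_real (fst z))" "norm (complex_of_real (snd z)) < \<rho>"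
    using z y m by (auto simp: near_def)
   then obtain e where e: "e > 0" "Pe i e"
    using \<sigma>2(2)[OF ik k(1)] tz[of k] tz[of i] ik unfolding pers_def Pe_def by (meson less_imp_le order_refl)
   have "Pe i y" if "y <= e" for y using e(2) that unfolding Pe_def by (meson less_le_trans)
   then show ?thesis using e(1) by blast
  qed
  then have "\<exists>x>0. \<forall>i<k. \<forall>y. 0 < y \<and> y <= x --> Pe i y" by (rule uniform_pos)
  then obtain e where e: "e > 0" "!!i. i < k ==> Pe i e" by (meson order_refl)
  show ?thesis
  proof (rule local_lower[OF zr _ _ e(1) _ V(1) zV V(3,4)])
   show "rd k (fst z) (snd z) = 0" "rd (Suc k) (fst z) (snd z) ~= 0" using z by (auto simp: near_def Mu_def)
  qed (use e(2) in \<open>auto simp: Pe_def\<close>)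
 qed
 have loc: "\<exists>W. open W \<and> z \<in> W \<and> W \<subseteq> box2 r \<and> SL g \<epsilon> W"
  if \<epsilon>: "\<epsilon> > 0" and V: "open V" "0 \<in> V" "V \<subseteq> box2 r" "SL g \<epsilon> V" and z: "\<bar>fst z\<bar> <= \<eta>" "\<bar>snd z\<bar> <= \<eta>" for \<epsilon> V z
 proof -
  have zr: "z \<in> box2 r" using z \<eta> m by (auto simp: box2_def)
  have rectz: "z \<in> rect z x" if "x > 0" for x using that by (simp add: rect_def)
  consider "z = 0" | "g z ~= 0" | "z ~= 0" "g z = 0" by blast
  then show ?thesis
  proof cases
   case 1
   then show ?thesis using V by blast
  next
   case 2
   then show ?thesis using SL_nonzero[OF zr 2 \<epsilon>] open_rect rectz by metis
  next
   case 3
   have st: "\<bar>fst z\<bar> < r" "\<bar>snd z\<bar> < r" using zr by (auto simp: box2_def)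
   \<comment> \<open>On the line s = 0 the only nearby zero is the origin, so any other zero has a
     nonzero first coordinate and persistence applies to it.\<close>
   have s0: "fst z ~= 0"
   proof
    assume "fst z = 0"
    then have "snd z ~= 0" using 3(1) by (auto simp: prod_eq_iff)
    moreover have "\<bar>snd z\<bar> <= \<rho>1" using z \<eta> m \<rho> by linarith
    ultimately have "tder h 0 0 (of_real (snd z)) ~= 0" using \<rho>1(2)[OF d0, of "of_real (snd z)"] by simp
    then show False using tder_rd[OF st, of 0] 3(2) \<open>fst z = 0\<close> by (simp add: g_def)
   qed
   have dn: "rd d (fst z) (snd z) ~= 0"
   proof -
    have "tder h d (of_real (fst z)) (of_real (snd z)) ~= 0"
     by (rule e0(2)) (use z \<eta> m \<rho> \<sigma> in auto)
    then show ?thesis using tder_rd[OF st, of d] by auto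
   qed
   define n where "n = (LEAST n. rd n (fst z) (snd z) ~= 0)"
   have n1: "rd n (fst z) (snd z) ~= 0" unfolding n_def using dn by (rule LeastI)
   have n2: "rd j (fst z) (snd z) = 0" if "j < n" for j
    using not_less_Least[OF that[unfolded n_def]] by simp
   have n3: "n <= d" unfolding n_def using dn by (rule Least_le)
   note n = n1 n2 n3
   have "n ~= 0"
   proof
    assume "n = 0"
    then show False using n1 3(2) by (simp add: g_def)
   qed
   then obtain k where k: "n = Suc k" by (cases n) auto
   have kd: "k < d" using n(3) k by simp
   have Mu: "Mu k z" using n k by (auto simp: Mu_def)
   have "near k m z" using s0 Mu z \<eta> by (auto simp: near_def)
   then have "\<forall>y'>0. \<exists>z. near k y' z" using \<eta>K(2)[OF kd m(1) m(5)] by blast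
   then have le: "\<epsilon> <= 1 / real (Suc k)" using mult_bound[OF kd _ V] by blast
   obtain x where x: "x > 0" "rect z x \<subseteq> box2 r" "SL g (1 / real (Suc k)) (rect z x)"
    using local_upper[OF zr, of k] Mu by (auto simp: Mu_def)
   have "SL g \<epsilon> (rect z x)" by (rule SL_weaken[OF x(3,2,1) \<epsilon> le])
   then show ?thesis using x rectz open_rect by blast
  qed
 qed
 show "\<exists>\<eta>>0. \<eta> <= r \<and> (\<forall>\<epsilon>>0. (\<exists>V. open V \<and> 0 \<in> V \<and> V \<subseteq> box2 r \<and> SL g \<epsilon> V) --> SL g \<epsilon> (box2 \<eta>))"
 proof (intro exI[of _ \<eta>] conjI allI impI)
  show "0 < \<eta>" "\<eta> <= r" using \<eta> m by auto
  fix \<epsilon> :: real assume \<epsilon>: "\<epsilon> > 0" and "\<exists>V. open V \<and> 0 \<in> V \<and> V \<subseteq> box2 r \<and> SL g \<epsilon> V"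
  then obtain V where V: "open V" "0 \<in> V" "V \<subseteq> box2 r" "SL g \<epsilon> V" by blast
  define K where "K = cbox (-\<eta>,-\<eta>) (\<eta>,\<eta>)"
  have K: "z \<in> K \<longleftrightarrow> \<bar>fst z\<bar> <= \<eta> \<and> \<bar>snd z\<bar> <= \<eta>" for z
   by (cases z) (auto simp: K_def abs_le_iff)
  define \<C> where "\<C> = {W. open W \<and> W \<subseteq> box2 r \<and> SL g \<epsilon> W}"
  have "compact K" by (simp add: K_def)
  moreover have "K \<subseteq> \<Union>\<C>" using loc[OF \<epsilon> V] K unfolding \<C>_def by blast
  moreover have "\<forall>W\<in>\<C>. open W" by (simp add: \<C>_def)
  ultimately obtain D where D: "D \<subseteq> \<C>" "finite D" "K \<subseteq> \<Union>D" by (meson compactE)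
  have "open (\<Union>D) \<and> \<Union>D \<subseteq> box2 r \<and> SL g \<epsilon> (\<Union>D)"
   using D(2,1)
  proof (induction D rule: finite_induct)
   case empty
   have "SL g \<epsilon> {}" unfolding SL_def by (intro exI[of _ 0]) auto
   then show ?case by simp
  next
   case (insert W D)
   then have "SL g \<epsilon> (W \<union> \<Union>D)" by (intro SL_Un) (auto simp: \<C>_def)
   then show ?case using insert by (auto simp: \<C>_def)
  qed
  moreover have "box2 \<eta> \<subseteq> \<Union>D"
  proof (rule order_trans[OF _ D(3)], rule subsetI)
   fix z assume "z \<in> box2 \<eta>"
   then show "z \<in> K" by (simp add: K box2_def)
  qed
  ultimately show "SL g \<epsilon> (box2 \<eta>)" using SL_mono[of \<epsilon> "\<Union>D" "box2 \<eta>"] by simp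
 qed
qed

end

section \<open>Interpolation on dyadic layers of the Hessian\<close>

text \<open>\<open>b\<close> is the product of its powers with exponents \<alpha>, \<beta>,
  \<gamma>, and each factor is bounded separately.\<close>

lemma geometric_interpolation:
 fixes b :: real
 assumes "0 <= b" "b <= X" "b <= Y" "b <= Z" "0 <= \<alpha>" "0 <= \<beta>" "0 <= \<gamma>" "\<alpha> + \<beta> + \<gamma> = 1"
 shows "b <= X powr \<alpha> * Y powr \<beta> * Z powr \<gamma>"
proof (cases "b = 0")
 case False
 then have b: "b > 0" using assms by simp
 have "b = b powr (\<alpha> + \<beta> + \<gamma>)" using assms b by simp
 also have "... = b powr \<alpha> * b powr \<beta> * b powr \<gamma>" by (simp add: powr_add)
 also have "... <= X powr \<alpha> * Y powr \<beta> * Z powr \<gamma>"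
  using assms b by (intro mult_mono powr_mono2) auto
 finally show ?thesis .
qed auto

lemma term_le_suminf: "f j <= (\<Sum>n. f n :: ennreal)"
 using sum_le_suminf[of f "{j}"] by simp

lemma suminf_ennreal_geometric:
 assumes "0 <= K" "0 <= c" "c < 1"
 shows "(\<Sum>n. ennreal (K * c ^ n)) = ennreal (K / (1 - c))"
proof (rule suminf_ennreal_eq)
 show "(\<lambda>n. K * c ^ n) sums (K / (1 - c))"
  using sums_mult[OF geometric_sums[of c], of K] assms by simp
qed (use assms in auto)

text \<open>Dyadic levels run over the integers but series over the naturals; this bound turns decay
  in the level into geometric decay in its code.\<close>

lemma abs_int_decode_ge: "real n / 2 <= \<bar>real_of_int (int_decode n)\<bar>"
proof (cases "even n")
 case True
 then show ?thesis by (simp add: int_decode_def sum_decode_def real_of_nat_div)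
next
 case False
 then obtain m where "n = Suc (2 * m)" by (metis oddE Suc_eq_plus1)
 then show ?thesis by (simp add: int_decode_def sum_decode_def)
qed

lemma powr_int_decode_le:
 assumes "0 < c" shows "2 powr (- (c * \<bar>real_of_int (int_decode n)\<bar>)) <= (2 powr (- (c/2))) ^ n"
proof -
 have "2 powr (- (c * \<bar>real_of_int (int_decode n)\<bar>)) <= 2 powr (- (c/2) * real n)"
  using mult_left_mono[OF abs_int_decode_ge[of n], of c] assms by (intro powr_mono) auto
 also have "... = (2 powr (- (c/2))) ^ n" by (simp add: powr_power mult.commute)
 finally show ?thesis .
qed

text \<open>The level with 2^k <= v < 2^(k+1) dominates alone, since its weight is taken at the
  upper end of the dyadic interval.\<close>

lemma dyadic_pointwise:
 fixes v :: real
 assumes "0 <= v" "0 < q"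
 shows "ennreal (v powr q) <= (\<Sum>n. ennreal (2 powr ((real_of_int (int_decode n) + 1) * q)) * indicator {v. 2 powr real_of_int (int_decode n) <= v} v)"
proof (cases "v = 0")
 case False
 then have v: "v > 0" using assms by simp
 define k where "k = \<lfloor>log 2 v\<rfloor>"
 have k: "real_of_int k <= log 2 v" "log 2 v <= real_of_int k + 1" by (auto simp: k_def)
 have k1: "2 powr real_of_int k <= v" "v <= 2 powr (real_of_int k + 1)"
  using k v by (simp_all add: le_log_iff log_le_iff)
 define n where "n = int_encode k"
 have n: "int_decode n = k" by (simp add: n_def)
 have "v powr q <= (2 powr (real_of_int k + 1)) powr q" using k1 v assms by (intro powr_mono2) auto
 then have "ennreal (v powr q) <= ennreal (2 powr ((real_of_int (int_decode n) + 1) * q)) * indicator {v. 2 powr real_of_int (int_decode n) <= v} v"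
  using k1 by (auto simp: n powr_powr intro!: ennreal_leI)
 also have "... <= (\<Sum>n. ennreal (2 powr ((real_of_int (int_decode n) + 1) * q)) * indicator {v. 2 powr real_of_int (int_decode n) <= v} v)"
  by (rule term_le_suminf)
 finally show ?thesis .
qed simp

context surf
begin

text \<open>The incidence form as a double integral with parameters in \<open>A\<close>, so that
  either variable can be integrated first.\<close>

definition inc :: "(plane) set => (spc) set => (spc) set => ennreal" where
 "inc A E F = (LI y. LI t. indicator A t * indicator E (y - gam t) * indicator F y)"

lemma inc_integrand_measurable [measurable]:
 assumes [measurable]: "A \<in> sets borel" "E \<in> sets borel" "F \<in> sets borel"
 shows "(\<lambda>p. indicator A (snd p) * indicator E (fst p - gam (snd p)) * indicator F (fst p) :: ennreal) \<in> borel_measurable borel"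
 by measurable

lemma inc_le_snd:
 assumes [measurable]: "A \<in> sets borel" "E \<in> sets borel" "F \<in> sets borel"
 shows "inc A E F <= vol A * vol F"
proof -
 have "inc A E F <= (LI y. LI t. indicator A t * indicator F y)"
  unfolding inc_def by (intro nn_integral_mono) (auto simp: indicator_def)
 also have "... = vol A * vol F"
  by (simp add: nn_integral_multc nn_integral_cmult)
 finally show ?thesis .
qed

lemma inc_le_fst:
 assumes [measurable]: "A \<in> sets borel" "E \<in> sets borel" "F \<in> sets borel"
 shows "inc A E F <= vol A * vol E"
proof -
 have "inc A E F <= (LI y. LI t. indicator A t * indicator E (y - gam t))"
  unfolding inc_def by (intro nn_integral_mono) (auto simp: indicator_def)
 also have "... = (LI t. LI y. indicator A t * indicator E (y - gam t))"
  using nn_integral_lborel_swap[of "\<lambda>p. indicator A (snd p) * indicator E (fst p - gam (snd p))"] by simp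
 also have "... = (LI t. indicator A t * vol E)"
 proof (rule nn_integral_cong)
  fix t
  have "(LI y. indicator E (y - gam t)) = (\<integral>\<^sup>+y. indicator E y \<partial>lborel :: ennreal)"
   using nn_integral_lborel_translate[of "\<lambda>y. indicator E (y - gam t)" "gam t"] by simp
  then show "(LI y. indicator A t * indicator E (y - gam t)) = indicator A t * vol E"
   by (simp add: nn_integral_cmult)
 qed
 also have "... = vol A * vol E" by (simp add: nn_integral_multc)
 finally show ?thesis .
qed

lemma inc_le_incid:
 assumes [measurable]: "A \<in> sets borel" "E \<in> sets borel" "F \<in> sets borel" and A: "A \<subseteq> {t\<in>Q. \<delta> <= \<bar>h t\<bar>}"
 shows "inc A E F <= incid \<delta> E F"
 unfolding inc_def incid_def
proof (rule nn_integral_mono)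
 fix y
 have [measurable]: "Om \<delta> E y \<in> sets borel" by (rule Om_borel) simp
 have "(LI t. indicator A t * indicator E (y - gam t) * indicator F y) <= (LI t. indicator (Om \<delta> E y) t * indicator F y)"
  using A by (intro nn_integral_mono) (auto simp: indicator_def Om_def)
 then show "(LI t. indicator A t * indicator E (y - gam t) * indicator F y) <= vol (Om \<delta> E y) * indicator F y"
  by (simp add: nn_integral_multc)
qed

text \<open>Layer 0 has no upper limit and takes all parameters with |h| >= 1.\<close>

definition layer :: "nat => (plane) set" where
 "layer j = {t\<in>Q. (1/2)^j <= \<bar>h t\<bar> \<and> (j = 0 \<or> \<bar>h t\<bar> < 2 * (1/2)^j)}"

lemma layer_borel [measurable]: "layer j \<in> sets borel"
 unfolding layer_def by measurable

lemma in_some_layer: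
 assumes "t \<in> Q" "h t ~= 0" shows "\<exists>j. t \<in> layer j"
proof -
 have "\<exists>j. (1/2)^j <= \<bar>h t\<bar>"
  using real_arch_pow_inv[of "\<bar>h t\<bar>" "1/2"] assms by (auto intro: less_imp_le)
 then obtain j where j: "(1/2)^j <= \<bar>h t\<bar>" "!!i. i < j ==> \<not> (1/2)^i <= \<bar>h t\<bar>"
  using LeastI_ex[of "\<lambda>j. (1/2)^j <= \<bar>h t\<bar>"] not_less_Least[of _ "\<lambda>j. (1/2)^j <= \<bar>h t\<bar>"] by blast
 have "j = 0 \<or> \<bar>h t\<bar> < 2 * (1/2)^j"
 proof (cases j)
  case (Suc i)
  then show ?thesis using j(2)[of i] by simp
 qed simp
 then show ?thesis using j assms by (auto simp: layer_def)
qed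

lemma inc_le_suminf_layer:
 assumes [measurable]: "E \<in> sets borel" "F \<in> sets borel" and null: "vol {t\<in>Q. h t = 0} = 0"
 shows "inc Q E F <= (\<Sum>j. inc (layer j) E F)"
proof -
 have "{t\<in>Q. h t = 0} \<in> null_sets lborel" using null by (intro null_setsI) auto
 from AE_not_in[OF this] have ae: "AE t in lborel. t \<in> Q --> h t ~= 0" by eventually_elim auto
 have "inc Q E F <= (LI y. LI t. (\<Sum>j. indicator (layer j) t * indicator E (y - gam t) * indicator F y))"
  unfolding inc_def
 proof (rule nn_integral_mono, rule nn_integral_mono_AE)
  fix y
  show "AE t in lborel. indicator Q t * indicator E (y - gam t) * indicator F y <= (\<Sum>j. indicator (layer j) t * indicator E (y - gam t) * indicator F y :: ennreal)"
   using ae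
  proof eventually_elim
   case (elim t)
   show ?case
   proof (cases "t \<in> Q")
    case True
    then obtain j where j: "t \<in> layer j" using in_some_layer elim by blast
    have "indicator Q t * indicator E (y - gam t) * indicator F y = (indicator (layer j) t * indicator E (y - gam t) * indicator F y :: ennreal)"
     using True j by simp
    also have "... <= (\<Sum>j. indicator (layer j) t * indicator E (y - gam t) * indicator F y)"
     by (rule term_le_suminf)
    finally show ?thesis .
   qed simp
  qed
 qed
 also have "... = (\<integral>\<^sup>+y. (\<Sum>j. \<integral>\<^sup>+t. indicator (layer j) t * indicator E (y - gam t) * indicator F y \<partial>lborel) \<partial>lborel)"
  by (intro nn_integral_cong nn_integral_suminf) measurable
 also have "... = (\<Sum>j. inc (layer j) E F)"
  unfolding inc_def
 proof (rule nn_integral_suminf)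
  fix j
  show "(\<lambda>y. \<integral>\<^sup>+t. indicator (layer j) t * indicator E (y - gam t) * indicator F y \<partial>lborel) \<in> borel_measurable lborel"
   using nn_integral_lborel_measurable[OF inc_integrand_measurable[of "layer j" E F]] by simp
 qed
 finally show ?thesis .
qed

text \<open>On the layer of size d = 2^-j the incidence bound loses d to the power
  (1+\<epsilon>)/(4+\<epsilon>), while the two trivial bounds gain d to the power
  \<open>\<epsilon>\<^sub>0\<close>. Their weighted geometric mean decays geometrically in j by the
  strict inequality in the last hypothesis.\<close>

lemma inc_power_bound:
 assumes \<epsilon>: "0 < \<epsilon>" "\<epsilon> <= 1" and "0 <= \<alpha>" "0 <= \<beta>" "0 <= \<gamma>" "\<alpha> + \<beta> + \<gamma> = 1"
  and \<epsilon>0: "0 < \<epsilon>\<^sub>0" and C: "!!\<delta>. \<delta> > 0 ==> vol {t\<in>Q. \<bar>h t\<bar> < \<delta>} <= ennreal (C * \<delta> powr \<epsilon>\<^sub>0)"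
  and \<tau>: "\<alpha> * (1 + \<epsilon>) / (4 + \<epsilon>) < \<epsilon>\<^sub>0 * (\<beta> + \<gamma>)"
 shows "\<exists>K>0. \<forall>E F. fin_sets E F -->
   inc Q E F <= ennreal (K * measure lborel E powr (3 * \<alpha> / (4 + \<epsilon>) + \<beta>) * measure lborel F powr (\<alpha> * (1 - 1 / (4 + \<epsilon>)) + \<gamma>))"
proof -
 obtain K where K: "K > 0" and bil: "!!\<delta> E F. 0 < \<delta> \<and> \<delta> <= 1 \<and> fin_sets E F -->
   incid \<delta> E F <= ennreal (K * \<delta> powr (-(1+\<epsilon>)/(4+\<epsilon>)) * measure lborel E powr (3/(4+\<epsilon>)) * measure lborel F powr (1 - 1/(4+\<epsilon>)))"
  using incid_bilinear_bound[OF \<epsilon>] by blast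
 define C' where "C' = max 1 (C * 2 powr \<epsilon>\<^sub>0)"
 have C': "C' >= 1" by (simp add: C'_def)
 have lay: "vol (layer j) <= ennreal (C' * ((1/2)^j) powr \<epsilon>\<^sub>0)" for j
 proof (cases "j = 0")
  case True
  have "vol (layer j) <= vol Q" by (intro emeasure_mono) (auto simp: layer_def)
  also have "... <= ennreal 1" using Q1 by simp
  also have "... <= ennreal C'" using C' by (intro ennreal_leI)
  finally show ?thesis using True by simp
 next
  case False
  have "vol (layer j) <= vol {t\<in>Q. \<bar>h t\<bar> < 2 * (1/2)^j}"
   using False by (intro emeasure_mono) (auto simp: layer_def)
  also have "... <= ennreal (C * (2 * (1/2)^j) powr \<epsilon>\<^sub>0)" by (rule C) simp
  also have "... <= ennreal (C' * ((1/2)^j) powr \<epsilon>\<^sub>0)"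
  proof (rule ennreal_leI)
   have "C * (2 * (1/2)^j) powr \<epsilon>\<^sub>0 = C * 2 powr \<epsilon>\<^sub>0 * ((1/2)^j) powr \<epsilon>\<^sub>0" by (simp add: powr_mult)
   also have "... <= C' * ((1/2)^j) powr \<epsilon>\<^sub>0" by (intro mult_right_mono) (auto simp: C'_def)
   finally show "C * (2 * (1/2)^j) powr \<epsilon>\<^sub>0 <= C' * ((1/2)^j) powr \<epsilon>\<^sub>0" .
  qed
  finally show ?thesis .
 qed
 \<comment> \<open>The zero set of \<open>h\<close> lies in no layer, and the sublevel bound shows
   that it is null.\<close>
 have null: "vol {t\<in>Q. h t = 0} = 0"
 proof (rule antisym)
  show "vol {t\<in>Q. h t = 0} <= 0"
  proof (rule tendsto_lowerbound)
   show "((\<lambda>\<delta>. ennreal (C * \<delta> powr \<epsilon>\<^sub>0)) \<longlongrightarrow> 0) (at_right 0)"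
    using tendsto_ennrealI[OF tendsto_mult_left[OF powr_at_right_0[OF \<epsilon>0], of C]] by simp
   show "\<forall>\<^sub>F \<delta> in at_right 0. vol {t\<in>Q. h t = 0} <= ennreal (C * \<delta> powr \<epsilon>\<^sub>0)"
    using eventually_at_right_less
   proof eventually_elim
    case (elim \<delta>)
    have "vol {t\<in>Q. h t = 0} <= vol {t\<in>Q. \<bar>h t\<bar> < \<delta>}"
     using elim by (intro emeasure_mono) auto
    then show ?case using C[OF elim] by (rule order_trans)
   qed
  qed simp
 qed simp
 define \<tau> where "\<tau> = \<epsilon>\<^sub>0 * (\<beta> + \<gamma>) - \<alpha> * (1 + \<epsilon>) / (4 + \<epsilon>)"
 have \<tau>0: "\<tau> > 0" using \<tau> by (simp add: \<tau>_def)
 define K' where "K' = K powr \<alpha> * C' powr (\<beta> + \<gamma>)"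
 have K': "K' > 0" using K C' by (simp add: K'_def)
 define c where "c = (1/2) powr \<tau>"
 have c: "0 < c" "c < 1" using \<tau>0 by (auto simp: c_def powr_divide)
 show ?thesis
 proof (intro exI[of _ "K' / (1 - c)"] conjI allI impI)
  show "K' / (1 - c) > 0" using K' c by simp
  fix E F :: "(spc) set"
  assume EF: "fin_sets E F"
  then have [measurable]: "E \<in> sets borel" "F \<in> sets borel" by auto
  define e where "e = measure lborel E"
  define f where "f = measure lborel F"
  have e: "vol E = ennreal e" "e >= 0" using EF by (auto simp: e_def emeasure_eq_ennreal_measure)
  have f: "vol F = ennreal f" "f >= 0" using EF by (auto simp: f_def emeasure_eq_ennreal_measure)
  define W where "W = e powr (3 * \<alpha> / (4 + \<epsilon>) + \<beta>) * f powr (\<alpha> * (1 - 1 / (4 + \<epsilon>)) + \<gamma>)"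
  have piece: "inc (layer j) E F <= ennreal (K' * W * c ^ j)" for j
  proof -
   define d where "d = (1/2::real)^j"
   have d: "0 < d" "d <= 1" by (auto simp: d_def power_le_one)
   have "inc (layer j) E F <= vol (layer j) * vol E" by (rule inc_le_fst) auto
   also have "... <= ennreal (C' * d powr \<epsilon>\<^sub>0) * ennreal e" unfolding e by (intro mult_right_mono) (use lay[of j] in \<open>auto simp: d_def\<close>)
   finally have Y: "inc (layer j) E F <= ennreal (C' * d powr \<epsilon>\<^sub>0 * e)" using C' e d by (simp add: ennreal_mult[symmetric])
   have "inc (layer j) E F <= vol (layer j) * vol F" by (rule inc_le_snd) auto
   also have "... <= ennreal (C' * d powr \<epsilon>\<^sub>0) * ennreal f" unfolding f by (intro mult_right_mono) (use lay[of j] in \<open>auto simp: d_def\<close>)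
   finally have Z: "inc (layer j) E F <= ennreal (C' * d powr \<epsilon>\<^sub>0 * f)" using C' f d by (simp add: ennreal_mult[symmetric])
   have "inc (layer j) E F <= incid d E F" by (rule inc_le_incid) (auto simp: layer_def d_def)
   also have "... <= ennreal (K * d powr (-(1+\<epsilon>)/(4+\<epsilon>)) * e powr (3/(4+\<epsilon>)) * f powr (1 - 1/(4+\<epsilon>)))"
    using bil[of d E F] EF d unfolding e_def f_def by simp
   finally have X: "inc (layer j) E F <= ennreal (K * d powr (-(1+\<epsilon>)/(4+\<epsilon>)) * e powr (3/(4+\<epsilon>)) * f powr (1 - 1/(4+\<epsilon>)))" .
   define b where "b = enn2real (inc (layer j) E F)"
   have "inc (layer j) E F < top" using Y by (rule le_less_trans) simp
   then have b: "inc (layer j) E F = ennreal b" "b >= 0" by (auto simp: b_def)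
   have nn: "0 <= K * d powr (-(1+\<epsilon>)/(4+\<epsilon>)) * e powr (3/(4+\<epsilon>)) * f powr (1 - 1/(4+\<epsilon>))"
    "0 <= C' * d powr \<epsilon>\<^sub>0 * e" "0 <= C' * d powr \<epsilon>\<^sub>0 * f" using K C' e f by auto
   have "b <= (K * d powr (-(1+\<epsilon>)/(4+\<epsilon>)) * e powr (3/(4+\<epsilon>)) * f powr (1 - 1/(4+\<epsilon>))) powr \<alpha>
     * (C' * d powr \<epsilon>\<^sub>0 * e) powr \<beta> * (C' * d powr \<epsilon>\<^sub>0 * f) powr \<gamma>"
    using X Y Z unfolding b(1) by (intro geometric_interpolation) (use b(2) assms nn in \<open>auto simp: ennreal_le_iff\<close>)
   also have "... = K powr \<alpha> * (C' powr \<beta> * C' powr \<gamma>)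
     * (d powr (-(1+\<epsilon>)/(4+\<epsilon>)*\<alpha>) * d powr (\<epsilon>\<^sub>0*\<beta>) * d powr (\<epsilon>\<^sub>0*\<gamma>))
     * ((e powr (3/(4+\<epsilon>)*\<alpha>) * e powr \<beta>) * (f powr ((1 - 1/(4+\<epsilon>))*\<alpha>) * f powr \<gamma>))"
    using K C' d e f by (simp add: powr_mult powr_powr mult_ac)
   also have "... = K powr \<alpha> * C' powr (\<beta> + \<gamma>) * d powr (-(1+\<epsilon>)/(4+\<epsilon>)*\<alpha> + \<epsilon>\<^sub>0*\<beta> + \<epsilon>\<^sub>0*\<gamma>)
     * (e powr (3/(4+\<epsilon>)*\<alpha> + \<beta>) * f powr ((1 - 1/(4+\<epsilon>))*\<alpha> + \<gamma>))"
    by (simp only: powr_add)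
   also have "-(1+\<epsilon>)/(4+\<epsilon>)*\<alpha> + \<epsilon>\<^sub>0*\<beta> + \<epsilon>\<^sub>0*\<gamma> = \<tau>" using \<epsilon> by (simp add: \<tau>_def field_simps)
   also have "d powr \<tau> = c ^ j" by (simp add: d_def c_def powr_realpow[symmetric] powr_powr mult.commute)
   also have "K powr \<alpha> * C' powr (\<beta> + \<gamma>) * c ^ j * (e powr (3/(4+\<epsilon>)*\<alpha> + \<beta>) * f powr ((1 - 1/(4+\<epsilon>))*\<alpha> + \<gamma>)) = K' * W * c ^ j"
    by (simp add: K'_def W_def mult_ac)
   finally show ?thesis unfolding b(1) by (rule ennreal_leI)
  qed
  have "inc Q E F <= (\<Sum>j. inc (layer j) E F)" by (rule inc_le_suminf_layer) (use null in auto)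
  also have "... <= (\<Sum>j. ennreal (K' * W * c ^ j))" by (intro suminf_le piece) auto
  also have "... = ennreal (K' * W / (1 - c))" using K' c by (intro suminf_ennreal_geometric) (auto simp: W_def)
  finally show "inc Q E F <= ennreal (K' / (1 - c) * measure lborel E powr (3 * \<alpha> / (4 + \<epsilon>) + \<beta>) * measure lborel F powr (\<alpha> * (1 - 1 / (4 + \<epsilon>)) + \<gamma>))"
   by (simp add: W_def e_def f_def mult_ac)
 qed
qed

text \<open>The points reached by admissible weights. With d = x - y and \<epsilon> = 0 the weights
  are \<alpha> = 2d, \<beta> = (3y - x)/2, \<gamma> = (2 - 3x + y)/2, and the condition on d says
  that \<alpha>/4 < \<eta> (1 - \<alpha>), that is, that the layers are summable.\<close>

definition pyramid :: "real => real => real => bool" where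
 "pyramid \<eta> x y \<longleftrightarrow> y < x \<and> (x - y) * (1 + 4 * \<eta>) < 2 * \<eta> \<and> x / 3 < y \<and> 3 * x - 2 < y"

text \<open>All conditions are strict, which leaves room for a sublevel exponent below \<eta> and
  for a positive \<epsilon> in the incidence bound. The weights solve the linear equations that make
  the exponents \<open>x\<close> and \<open>1 - y\<close>.\<close>

lemma inc_restricted_bound:
 assumes \<eta>: "\<eta> > 0" and SL: "!!\<epsilon>. 0 < \<epsilon> ==> \<epsilon> < \<eta> ==> \<exists>C. \<forall>\<delta>>0. vol {t\<in>Q. \<bar>h t\<bar> < \<delta>} <= ennreal (C * \<delta> powr \<epsilon>)"
  and xy: "pyramid \<eta> x y"
 shows "\<exists>K>0. \<forall>E F. fin_sets E F -->
   inc Q E F <= ennreal (K * measure lborel E powr x * measure lborel F powr (1 - y))"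
proof -
 define d where "d = x - y"
 have d: "d > 0" "d * (1 + 4 * \<eta>) < 2 * \<eta>" using xy by (auto simp: d_def pyramid_def)
 have "d < 1/2"
 proof (rule ccontr)
  assume "\<not> d < 1/2"
  then have "1/2 * (1 + 4 * \<eta>) <= d * (1 + 4 * \<eta>)" using \<eta> by (intro mult_right_mono) auto
  then show False using d by (simp add: algebra_simps)
 qed
 then have d2: "2 - 4 * d > 0" by simp
 \<comment> \<open>The midpoint between d / (2 - 4d), above which the layers become summable, and
   \<eta>.\<close>
 define \<epsilon>0 where "\<epsilon>0 = (d / (2 - 4 * d) + \<eta>) / 2"
 have "d / (2 - 4 * d) < \<eta>" using d d2 by (simp add: divide_less_eq algebra_simps)
 then have \<epsilon>0: "d / (2 - 4 * d) < \<epsilon>0" "\<epsilon>0 < \<eta>"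
  unfolding \<epsilon>0_def using field_less_half_sum[of "d / (2 - 4 * d)" \<eta>] field_sum_of_halves[of \<eta>] by (simp_all del: field_less_half_sum)
 have "0 < d / (2 - 4 * d)" using d d2 by simp
 then have \<epsilon>0p: "0 < \<epsilon>0" using \<epsilon>0 by simp
 have gap: "2 * \<epsilon>0 - d * (1 + 4 * \<epsilon>0) > 0" using \<epsilon>0(1) d2 by (simp add: divide_less_eq algebra_simps)
 obtain C where C: "!!\<delta>. \<delta> > 0 ==> vol {t\<in>Q. \<bar>h t\<bar> < \<delta>} <= ennreal (C * \<delta> powr \<epsilon>0)"
  using SL[OF \<epsilon>0p \<epsilon>0(2)] by blast
 \<comment> \<open>The second entry keeps \<gamma> nonnegative, the third keeps the exponent of the
   layer size positive.\<close>
 define \<epsilon> where "\<epsilon> = min 1 (min ((2 - 3 * x + y) / d) ((2 * \<epsilon>0 - d * (1 + 4 * \<epsilon>0)) / (2 * d * (\<epsilon>0 + 1))))"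
 have xyl: "2 - 3 * x + y > 0" using xy by (simp add: pyramid_def)
 have \<epsilon>: "0 < \<epsilon>" "\<epsilon> <= 1" using xyl d gap \<epsilon>0p by (auto simp: \<epsilon>_def)
 have "\<epsilon> <= (2 - 3 * x + y) / d" by (auto simp: \<epsilon>_def)
 then have e1: "\<epsilon> * d <= 2 - 3 * x + y" using d by (simp add: le_divide_eq)
 have "\<epsilon> <= (2 * \<epsilon>0 - d * (1 + 4 * \<epsilon>0)) / (2 * d * (\<epsilon>0 + 1))" by (auto simp: \<epsilon>_def)
 then have "\<epsilon> * (2 * d * (\<epsilon>0 + 1)) <= 2 * \<epsilon>0 - d * (1 + 4 * \<epsilon>0)" using d \<epsilon>0p by (simp add: le_divide_eq)
 moreover have "0 < \<epsilon> * (d * (\<epsilon>0 + 1))" using d \<epsilon>0p \<epsilon> by simp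
 ultimately have e2: "\<epsilon> * (d * (\<epsilon>0 + 1)) < 2 * \<epsilon>0 - d * (1 + 4 * \<epsilon>0)" by (simp add: algebra_simps)
 define \<alpha> where "\<alpha> = d * (4 + \<epsilon>) / 2"
 define \<beta> where "\<beta> = (3 * y - x) / 2"
 define \<gamma> where "\<gamma> = 1 - \<alpha> - \<beta>"
 have "\<gamma> = (2 - 3 * x + y - \<epsilon> * d) / 2" by (simp add: \<gamma>_def \<alpha>_def \<beta>_def d_def field_simps)
 then have \<gamma>: "\<gamma> >= 0" using e1 by simp
 have \<alpha>4: "\<alpha> / (4 + \<epsilon>) = d / 2" using \<epsilon> unfolding \<alpha>_def by (simp add: divide_eq_eq)
 have "\<exists>K>0. \<forall>E F. fin_sets E F -->
   inc Q E F <= ennreal (K * measure lborel E powr (3 * \<alpha> / (4 + \<epsilon>) + \<beta>) * measure lborel F powr (\<alpha> * (1 - 1 / (4 + \<epsilon>)) + \<gamma>))"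
 proof (rule inc_power_bound[OF \<epsilon> _ _ \<gamma> _ \<epsilon>0p C])
  show "0 <= \<alpha>" using d \<epsilon> by (simp add: \<alpha>_def)
  show "0 <= \<beta>" using xy by (simp add: \<beta>_def pyramid_def)
  show "\<alpha> + \<beta> + \<gamma> = 1" by (simp add: \<gamma>_def)
  have "\<alpha> * (1 + \<epsilon>) / (4 + \<epsilon>) = (1 + \<epsilon>) * (\<alpha> / (4 + \<epsilon>))" by simp
  also have "... = (1 + \<epsilon>) * (d / 2)" by (simp only: \<alpha>4)
  also have "... < \<epsilon>0 * (1 - \<alpha>)" using e2 by (simp add: \<alpha>_def field_simps)
  also have "1 - \<alpha> = \<beta> + \<gamma>" by (simp add: \<gamma>_def)
  finally show "\<alpha> * (1 + \<epsilon>) / (4 + \<epsilon>) < \<epsilon>0 * (\<beta> + \<gamma>)" .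
 qed
 moreover have "3 * \<alpha> / (4 + \<epsilon>) + \<beta> = x"
 proof -
  have "3 * \<alpha> / (4 + \<epsilon>) = 3 * (\<alpha> / (4 + \<epsilon>))" by simp
  then show ?thesis unfolding \<alpha>4 by (simp add: \<beta>_def d_def field_simps)
 qed
 moreover have "\<alpha> * (1 - 1 / (4 + \<epsilon>)) + \<gamma> = 1 - y"
 proof -
  have "\<alpha> * (1 - 1 / (4 + \<epsilon>)) = \<alpha> - \<alpha> / (4 + \<epsilon>)" by (simp add: right_diff_distrib)
  then show ?thesis unfolding \<alpha>4 by (simp add: \<gamma>_def \<beta>_def d_def field_simps)
 qed
 ultimately show ?thesis by simp
qed


section \<open>From sets to functions: strong bounds by dyadic summation\<close>

lemma level_emeasure_le:
 fixes f :: "spc => real"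
 assumes f [measurable]: "f \<in> borel_measurable borel" and p: "p > 0" and N: "(LI z. ennreal (f z powr p)) <= 1"
 shows "vol {z. 2 powr k <= f z} <= ennreal (2 powr (-(k * p)))"
proof -
 have "vol {z. 2 powr k <= f z} = (LI z. indicator {z. 2 powr k <= f z} z)"
  by simp
 also have "... <= (LI z. ennreal (2 powr (-(k * p))) * ennreal (f z powr p))"
 proof (rule nn_integral_mono)
  fix z
  show "indicator {z. 2 powr k <= f z} z <= ennreal (2 powr (-(k * p))) * ennreal (f z powr p)"
  proof (cases "2 powr k <= f z")
   case True
   have "1 = 2 powr (-(k * p)) * (2 powr k) powr p" by (simp add: powr_powr powr_add[symmetric])
   also have "... <= 2 powr (-(k * p)) * f z powr p" using True p by (intro mult_left_mono powr_mono2) auto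
   finally have "ennreal 1 <= ennreal (2 powr (-(k * p)) * f z powr p)" by (rule ennreal_leI)
   then show ?thesis using True by (simp add: ennreal_mult)
  qed simp
 qed
 also have "... = ennreal (2 powr (-(k * p))) * (LI z. ennreal (f z powr p))" by (rule nn_integral_cmult) measurable
 also have "... <= ennreal (2 powr (-(k * p))) * 1" using N by (rule mult_left_mono) simp
 finally show ?thesis by simp
qed

text \<open>The positive operator that dominates the given one, with the density replaced by the
  indicator of \<open>Q\<close>; extended values postpone questions of integrability.\<close>

definition avg :: "(spc => real) => spc => ennreal" where
 "avg f y = (LI t. indicator Q t * ennreal (f (y - gam t)))"

lemma avg_measurable [measurable]:
 assumes [measurable]: "f \<in> borel_measurable borel" shows "avg f \<in> borel_measurable borel"
proof -
 have "(\<lambda>p. indicator Q (snd p) * ennreal (f (fst p - gam (snd p)))) \<in> borel_measurable borel" by measurable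
 from nn_integral_lborel_measurable[OF this] show ?thesis by (simp add: avg_def[abs_def])
qed

text \<open>\<open>f\<close> is dominated by its dyadic level sets, of measure at most 2^(-k p).
  Using the exponent 1/p + \<mu> for levels k >= 0 and 1/p - \<mu> for k < 0 leaves the summable
  factor 2^(-p \<mu> |k|).\<close>

lemma avg_restricted_bound:
 assumes p: "p > 0" and \<mu>: "\<mu> > 0" "1/p - \<mu> > 0"
  and bd: "!!x. x = 1/p - \<mu> \<or> x = 1/p + \<mu> ==> \<exists>K>0. \<forall>E F. fin_sets E F -->
   inc Q E F <= ennreal (K * measure lborel E powr x * measure lborel F powr a)"
 shows "\<exists>K>0. \<forall>f F. unit_fun p f
   \<and> F \<in> sets borel \<and> vol F < \<infinity> -->
   (LI y. avg f y * indicator F y) <= ennreal (K * measure lborel F powr a)"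
proof -
 obtain K1 where K1: "K1 > 0" "!!E F. fin_sets E F ==>
   inc Q E F <= ennreal (K1 * measure lborel E powr (1/p - \<mu>) * measure lborel F powr a)" using bd[of "1/p - \<mu>"] by blast
 obtain K2 where K2: "K2 > 0" "!!E F. fin_sets E F ==>
   inc Q E F <= ennreal (K2 * measure lborel E powr (1/p + \<mu>) * measure lborel F powr a)" using bd[of "1/p + \<mu>"] by blast
 define K where "K = 2 * max K1 K2"
 define c where "c = 2 powr (-(p * \<mu> / 2))"
 have c: "0 < c" "c < 1" using p \<mu> powr_less_mono[of "-(p * \<mu> / 2)" 0 2] by (auto simp: c_def)
 show ?thesis
 proof (intro exI[of _ "K / (1 - c)"] conjI allI impI)
  show "K / (1 - c) > 0" using K1 c by (simp add: K_def)
  fix f :: "spc => real" and F :: "(spc) set"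
  assume a: "unit_fun p f
   \<and> F \<in> sets borel \<and> vol F < \<infinity>"
  then have f [measurable]: "f \<in> borel_measurable borel" and f0: "!!z. 0 <= f z" and N: "(LI z. ennreal (f z powr p)) <= 1"
   and F [measurable]: "F \<in> sets borel" and Ff: "vol F < \<infinity>" by auto
  define k where "k n = real_of_int (int_decode n)" for n
  define E where "E n = {z. 2 powr k n <= f z}" for n
  define w where "w n = 2 powr (k n + 1)" for n
  define m where "m = measure lborel F powr a"
  have m: "m >= 0" by (simp add: m_def)
  have E [measurable]: "E n \<in> sets borel" for n unfolding E_def by measurable
  have Em: "vol (E n) <= ennreal (2 powr (-(k n * p)))" for n
   unfolding E_def by (rule level_emeasure_le[OF f p N])
  have Efin: "vol (E n) < \<infinity>" for n using Em[of n] by (rule le_less_trans) simp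
  have Er: "measure lborel (E n) <= 2 powr (-(k n * p))" for n
   using Em[of n] by (simp add: measure_def enn2real_leI)
  have piece: "ennreal (w n) * inc Q (E n) F <= ennreal (K * m * c ^ n)" for n
  proof -
   obtain K' x where K': "K' > 0" "2 * K' <= K" "x > 0" "inc Q (E n) F <= ennreal (K' * measure lborel (E n) powr x * m)"
    "k n - k n * p * x = - (p * \<mu> * \<bar>k n\<bar>)"
   proof (cases "k n >= 0")
    case True
    show thesis
    proof (rule that[of K2 "1/p + \<mu>"])
     show "inc Q (E n) F <= ennreal (K2 * measure lborel (E n) powr (1/p + \<mu>) * m)"
      unfolding m_def by (rule K2(2)) (use Efin Ff in auto)
     have "k n * p * (1/p + \<mu>) = k n + p * \<mu> * k n" using p by (simp add: distrib_left)
     then show "k n - k n * p * (1/p + \<mu>) = - (p * \<mu> * \<bar>k n\<bar>)" using True by simp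
    qed (use K2 \<mu> in \<open>auto simp: K_def\<close>)
   next
    case False
    show thesis
    proof (rule that[of K1 "1/p - \<mu>"])
     show "inc Q (E n) F <= ennreal (K1 * measure lborel (E n) powr (1/p - \<mu>) * m)"
      unfolding m_def by (rule K1(2)) (use Efin Ff in auto)
     have "k n * p * (1/p - \<mu>) = k n - p * \<mu> * k n" using p by (simp add: right_diff_distrib)
     then show "k n - k n * p * (1/p - \<mu>) = - (p * \<mu> * \<bar>k n\<bar>)" using False by simp
    qed (use K1 \<mu> in \<open>auto simp: K_def\<close>)
   qed
   have "w n * (K' * measure lborel (E n) powr x * m) <= w n * (K' * (2 powr (-(k n * p))) powr x * m)"
    using K' m Er[of n] by (intro mult_left_mono mult_right_mono powr_mono2) (auto simp: w_def)
   also have "... = 2 * K' * m * 2 powr (k n - k n * p * x)"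
   proof -
    have "2 powr (k n + 1) = 2 * 2 powr k n" by (simp add: powr_add)
    moreover have "2 powr (k n - k n * p * x) = 2 powr k n * (2 powr (-(k n * p))) powr x"
     unfolding powr_powr powr_add[symmetric] by simp
    ultimately show ?thesis by (simp add: w_def)
   qed
   also have "... <= K * m * 2 powr (k n - k n * p * x)" using K' m by (intro mult_right_mono) auto
   also have "... <= K * m * c ^ n"
    unfolding K'(5) unfolding c_def k_def using powr_int_decode_le[of "p * \<mu>" n] p \<mu> m K1(1) by (intro mult_left_mono) (auto simp: K_def)
   finally have le: "w n * (K' * measure lborel (E n) powr x * m) <= K * m * c ^ n" .
   have "ennreal (w n) * inc Q (E n) F <= ennreal (w n) * ennreal (K' * measure lborel (E n) powr x * m)"
    using K'(4) by (rule mult_left_mono) simp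
   also have "... = ennreal (w n * (K' * measure lborel (E n) powr x * m))"
    using K' m by (intro ennreal_mult[symmetric]) (auto simp: w_def)
   also have "... <= ennreal (K * m * c ^ n)" using le by (rule ennreal_leI)
   finally show ?thesis .
  qed
  have pw: "ennreal (f z) <= (\<Sum>n. ennreal (w n) * indicator (E n) z)" for z
   using dyadic_pointwise[OF f0[of z], of 1] f0[of z] by (simp add: w_def E_def k_def indicator_def)
  have "(LI y. avg f y * indicator F y) = (LI y. LI t. indicator Q t * ennreal (f (y - gam t)) * indicator F y)"
   unfolding avg_def by (intro nn_integral_cong nn_integral_multc[symmetric]) measurable
  also have "... <= (LI y. LI t. (\<Sum>n. ennreal (w n) * (indicator Q t * indicator (E n) (y - gam t) * indicator F y)))"
  proof (rule nn_integral_mono, rule nn_integral_mono)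
   fix y t
   have "indicator Q t * ennreal (f (y - gam t)) * indicator F y
     <= indicator Q t * (\<Sum>n. ennreal (w n) * indicator (E n) (y - gam t)) * indicator F y"
    by (intro mult_left_mono mult_right_mono pw) auto
   also have "... = (\<Sum>n. ennreal (w n) * (indicator Q t * indicator (E n) (y - gam t) * indicator F y))"
    by (auto simp: indicator_def)
   finally show "indicator Q t * ennreal (f (y - gam t)) * indicator F y
     <= (\<Sum>n. ennreal (w n) * (indicator Q t * indicator (E n) (y - gam t) * indicator F y))" .
  qed
  also have "... = (LI y. (\<Sum>n. ennreal (w n) * (LI t. indicator Q t * indicator (E n) (y - gam t) * indicator F y)))"
  proof (rule nn_integral_cong)
   fix y
   show "(LI t. (\<Sum>n. ennreal (w n) * (indicator Q t * indicator (E n) (y - gam t) * indicator F y)))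
     = (\<Sum>n. ennreal (w n) * (LI t. indicator Q t * indicator (E n) (y - gam t) * indicator F y))"
    by (subst nn_integral_suminf) (simp_all add: nn_integral_cmult)
  qed
  also have "... = (\<Sum>n. ennreal (w n) * inc Q (E n) F)"
  proof -
   have [measurable]: "(\<lambda>y. \<integral>\<^sup>+t. indicator Q t * indicator (E n) (y - gam t) * indicator F y \<partial>lborel) \<in> borel_measurable borel" for n
    using nn_integral_lborel_measurable[OF inc_integrand_measurable[of Q "E n" F]] by simp
   show ?thesis unfolding inc_def by (subst nn_integral_suminf) (simp_all add: nn_integral_cmult)
  qed
  also have "... <= (\<Sum>n. ennreal (K * m * c ^ n))" by (intro suminf_le piece) auto
  also have "... = ennreal (K * m / (1 - c))" using K1 c m by (intro suminf_ennreal_geometric) (auto simp: K_def)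
  finally show "(LI y. avg f y * indicator F y) <= ennreal (K / (1 - c) * measure lborel F powr a)"
   by (simp add: m_def)
 qed
qed

text \<open>A weak type bound at two exponents on either side of \<open>q\<close> is summed over the dyadic levels of \<open>u\<close>.\<close>

lemma avg_strong_bound:
 assumes q: "q > 0" and \<mu>: "\<mu> > 0" "1/q - \<mu> > 0"
  and bd: "!!y. y = 1/q - \<mu> \<or> y = 1/q + \<mu> ==> \<exists>K>0. \<forall>f F. unit_fun p f
   \<and> F \<in> sets borel \<and> vol F < \<infinity> -->
   (LI y. avg f y * indicator F y) <= ennreal (K * measure lborel F powr (1 - y))"
 shows "\<exists>K>0. \<forall>f u. unit_fun p f
   \<and> u \<in> borel_measurable borel \<and> (\<forall>z. 0 <= u z) \<and> (\<forall>z. ennreal (u z) <= avg f z) -->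
   (LI z. ennreal (u z powr q)) <= ennreal K"
proof -
 define x1 where "x1 = 1/q - \<mu>"
 define x2 where "x2 = 1/q + \<mu>"
 have x: "0 < x1" "0 < x2" using \<mu> q by (auto simp: x1_def x2_def intro: add_pos_pos)
 obtain K1 where K1: "K1 > 0" "!!f F. unit_fun p f
   \<and> F \<in> sets borel \<and> vol F < \<infinity> ==> (LI y. avg f y * indicator F y) <= ennreal (K1 * measure lborel F powr (1 - x1))"
  using bd[of x1] unfolding x1_def by blast
 obtain K2 where K2: "K2 > 0" "!!f F. unit_fun p f
   \<and> F \<in> sets borel \<and> vol F < \<infinity> ==> (LI y. avg f y * indicator F y) <= ennreal (K2 * measure lborel F powr (1 - x2))"
  using bd[of x2] unfolding x2_def by blast
 \<comment> \<open>The two weak exponents satisfy 1/x2 < q < 1/x1; the smaller gap gives decay 2^(-c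
   |k|) over the levels.\<close>
 define c where "c = min (1/x1 - q) (q - 1/x2)"
 have "x1 < 1/q" "1/q < x2" using \<mu> by (auto simp: x1_def x2_def)
 then have "q < 1/x1" "1/x2 < q" using x q by (simp_all add: field_simps)
 then have c: "c > 0" by (simp add: c_def)
 define K where "K = max (K1 powr (1/x1)) (K2 powr (1/x2))"
 have K: "K > 0" using K1 by (simp add: K_def less_max_iff_disj)
 define d where "d = 2 powr (-(c/2))"
 have d: "0 < d" "d < 1" using c powr_less_mono[of "-(c/2)" 0 2] by (auto simp: d_def)
 \<comment> \<open>Testing with a set on which the average is at least s gives s |F| <= K'
   |F|^(1-y); dividing requires |F| to be finite and positive.\<close>
 have level: "measure lborel F <= (K' / s) powr (1/y)"
  if "s > 0" "F \<in> sets borel" "vol F < \<infinity>" "!!z. z \<in> F ==> ennreal s <= avg f z" "0 < y" "0 < K'"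
   "(LI y. avg f y * indicator F y) <= ennreal (K' * measure lborel F powr (1 - y))" for s F f K' y
 proof (cases "measure lborel F = 0")
  case False
  then have m: "measure lborel F > 0" by (simp add: zero_less_measure_iff)
  have "ennreal (s * measure lborel F) = (LI y. ennreal s * indicator F y)"
   using that by (simp add: nn_integral_cmult emeasure_eq_ennreal_measure ennreal_mult)
  also have "... <= (LI y. avg f y * indicator F y)"
   using that by (intro nn_integral_mono) (auto simp: indicator_def)
  also note that(7)
  finally have "s * measure lborel F <= K' * measure lborel F powr (1 - y)" using that m by (simp add: ennreal_le_iff)
  then have "s * measure lborel F <= K' * (measure lborel F / measure lborel F powr y)" using m by (simp add: powr_diff)
  then have "measure lborel F powr y <= K' / s" using m that by (simp add: field_simps)
  then have "(measure lborel F powr y) powr (1/y) <= (K' / s) powr (1/y)" using that by (intro powr_mono2) auto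
  then show ?thesis using that m by (simp add: powr_powr)
 qed simp
 show ?thesis
 proof (intro exI[of _ "2 powr q * K / (1 - d)"] conjI allI impI)
  show "2 powr q * K / (1 - d) > 0" using K d by simp
  fix f u :: "spc => real"
  assume a: "unit_fun p f
   \<and> u \<in> borel_measurable borel \<and> (\<forall>z. 0 <= u z) \<and> (\<forall>z. ennreal (u z) <= avg f z)"
  then have u [measurable]: "u \<in> borel_measurable borel" and u0: "!!z. 0 <= u z" and uf: "!!z. ennreal (u z) <= avg f z" by auto
  define k where "k n = real_of_int (int_decode n)" for n
  define F where "F n = {z. 2 powr k n <= u z}" for n
  have F [measurable]: "F n \<in> sets borel" for n unfolding F_def by measurable
  have piece: "ennreal (2 powr ((k n + 1) * q)) * vol (F n) <= ennreal (2 powr q * K * d ^ n)" for n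
  proof -
   have fb: "vol (F n) <= ennreal ((K' / 2 powr k n) powr (1/y))"
    if K': "0 < K'" "0 < y" "!!f F. unit_fun p f
   \<and> F \<in> sets borel \<and> vol F < \<infinity> ==> (LI y. avg f y * indicator F y) <= ennreal (K' * measure lborel F powr (1 - y))"
    for K' y
   proof -
    \<comment> \<open>Level sets are cut to balls because the weak bound concerns sets of finite
      measure; the bound does not depend on the ball and passes to the limit.\<close>
    define X where "X j = F n \<inter> ball 0 (real j)" for j
    have X [measurable]: "X j \<in> sets borel" for j unfolding X_def by measurable
    have Xf: "vol (X j) < \<infinity>" for j
    proof -
     have "vol (X j) <= vol (ball (0 :: spc) (real j))"
      by (intro emeasure_mono) (auto simp: X_def)
     also have "... < \<infinity>" by (rule emeasure_bounded_finite) simp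
     finally show ?thesis .
    qed
    have XF: "(\<Union>j. X j) = F n"
    proof -
     have "\<exists>j. z \<in> ball 0 (real j)" for z :: "spc" using reals_Archimedean2[of "norm z"] by auto
     then show ?thesis by (auto simp: X_def)
    qed
    have "vol (X j) <= ennreal ((K' / 2 powr k n) powr (1/y))" for j
    proof -
     have "measure lborel (X j) <= (K' / 2 powr k n) powr (1/y)"
     proof (rule level[OF _ X Xf _ K'(2,1) K'(3)])
      show "unit_fun p f \<and> X j \<in> sets borel \<and> vol (X j) < \<infinity>"
       using a X[of j] Xf[of j] by simp
      show "ennreal (2 powr k n) <= avg f z" if "z \<in> X j" for z
       using that uf[of z] by (intro order_trans[OF ennreal_leI uf[of z]]) (auto simp: X_def F_def)
     qed simp
     then show ?thesis using Xf[of j] by (simp add: emeasure_eq_ennreal_measure ennreal_leI)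
    qed
    moreover have "(SUP j. vol (X j)) = vol (F n)"
     unfolding XF[symmetric] by (intro SUP_emeasure_incseq) (auto simp: X_def incseq_def)
    ultimately show ?thesis by (metis SUP_least)
   qed
   have "2 powr ((k n + 1) * q) * (K' / 2 powr k n) powr (1/y) <= 2 powr q * K * d ^ n"
    if "0 < K'" "0 < y" "K' powr (1/y) <= K" "k n * (q - 1/y) <= - (c * \<bar>k n\<bar>)" for K' y
   proof -
    have "2 powr ((k n + 1) * q) * (K' / 2 powr k n) powr (1/y) = 2 powr q * K' powr (1/y) * 2 powr (k n * (q - 1/y))"
     using that by (simp add: powr_divide powr_powr distrib_right right_diff_distrib powr_add powr_diff)
    also have "... <= 2 powr q * K * 2 powr (- (c * \<bar>k n\<bar>))" using that K by (intro mult_mono powr_mono) auto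
    also have "... <= 2 powr q * K * d ^ n" unfolding d_def k_def using powr_int_decode_le[OF c, of n] K by (intro mult_left_mono) auto
    finally show ?thesis .
   qed
   then have fin: ?thesis
    if "0 < K'" "0 < y" "K' powr (1/y) <= K" "k n * (q - 1/y) <= - (c * \<bar>k n\<bar>)" "vol (F n) <= ennreal ((K' / 2 powr k n) powr (1/y))" for K' y
   proof -
    have "ennreal (2 powr ((k n + 1) * q)) * vol (F n) <= ennreal (2 powr ((k n + 1) * q)) * ennreal ((K' / 2 powr k n) powr (1/y))"
     using that(5) by (rule mult_left_mono) simp
    also have "... = ennreal (2 powr ((k n + 1) * q) * (K' / 2 powr k n) powr (1/y))" by (simp add: ennreal_mult)
    also have "... <= ennreal (2 powr q * K * d ^ n)" using \<open>!!y K'. 0 < K' ==> 0 < y ==> K' powr (1/y) <= K ==> k n * (q - 1/y) <= - (c * \<bar>k n\<bar>) ==> _\<close>[OF that(1-4)] by (rule ennreal_leI)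
    finally show ?thesis .
   qed
   show ?thesis
   proof (cases "k n >= 0")
    case True
    have "c <= 1/x1 - q" by (simp add: c_def)
    then have "k n * c <= k n * (1/x1 - q)" using True by (rule mult_left_mono)
    then have "k n * (q - 1/x1) <= - (c * \<bar>k n\<bar>)" using True by (simp add: algebra_simps)
    then show ?thesis by (intro fin[OF K1(1) x(1)] fb[OF K1(1) x(1) K1(2)]) (auto simp: K_def)
   next
    case False
    have "c <= q - 1/x2" by (simp add: c_def)
    then have "(- k n) * c <= (- k n) * (q - 1/x2)" using False by (intro mult_left_mono) auto
    then have "k n * (q - 1/x2) <= - (c * \<bar>k n\<bar>)" using False by (simp add: algebra_simps)
    then show ?thesis by (intro fin[OF K2(1) x(2)] fb[OF K2(1) x(2) K2(2)]) (auto simp: K_def)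
   qed
  qed
  have "(LI z. ennreal (u z powr q)) <= (LI z. (\<Sum>n. ennreal (2 powr ((k n + 1) * q)) * indicator (F n) z))"
   using dyadic_pointwise[OF u0 q] by (intro nn_integral_mono) (simp add: F_def k_def indicator_def)
  also have "... = (\<Sum>n. ennreal (2 powr ((k n + 1) * q)) * vol (F n))"
   by (subst nn_integral_suminf) (simp_all add: nn_integral_cmult)
  also have "... <= (\<Sum>n. ennreal (2 powr q * K * d ^ n))" by (intro suminf_le piece) auto
  also have "... = ennreal (2 powr q * K / (1 - d))" using K d by (intro suminf_ennreal_geometric) auto
  finally show "(LI z. ennreal (u z powr q)) <= ennreal (2 powr q * K / (1 - d))" .
 qed
qed

text \<open>The region is open, so the four points (1/p +- \<mu>, 1/q +- \<mu>) used in summing over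
  the levels of \<open>f\<close> and of its average still belong to it.\<close>

theorem avg_Lp_bound:
 assumes \<eta>: "\<eta> > 0" and SL: "!!\<epsilon>. 0 < \<epsilon> ==> \<epsilon> < \<eta> ==> \<exists>C. \<forall>\<delta>>0. vol {t\<in>Q. \<bar>h t\<bar> < \<delta>} <= ennreal (C * \<delta> powr \<epsilon>)"
  and xy: "pyramid \<eta> (1/p) (1/q)"
 shows "\<exists>K>0. \<forall>f u. unit_fun p f
   \<and> u \<in> borel_measurable borel \<and> (\<forall>z. 0 <= u z) \<and> (\<forall>z. ennreal (u z) <= avg f z) -->
   (LI z. ennreal (u z powr q)) <= ennreal K"
proof -
 define x where "x = 1/p"
 define y where "y = 1/q"
 have py: "y < x" "(x - y) * (1 + 4 * \<eta>) < 2 * \<eta>" "x / 3 < y" "3 * x - 2 < y" using xy by (auto simp: pyramid_def x_def y_def)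
 \<comment> \<open>One eighth of the smallest slack: moving both coordinates by \<mu> uses up at
   most half of the slack in each condition.\<close>
 define \<mu> where "\<mu> = Min {x - y, (2 * \<eta> - (x - y) * (1 + 4 * \<eta>)) / (1 + 4 * \<eta>), y - x/3, y - (3 * x - 2), x, y} / 8"
 define \<nu> where "\<nu> = Min {x - y, (2 * \<eta> - (x - y) * (1 + 4 * \<eta>)) / (1 + 4 * \<eta>), y - x/3, y - (3 * x - 2), x, y}"
 have x0: "x > 0" "y > 0" using py by linarith+
 have \<nu>: "\<nu> > 0" "\<nu> <= x - y" "\<nu> <= (2 * \<eta> - (x - y) * (1 + 4 * \<eta>)) / (1 + 4 * \<eta>)" "\<nu> <= y - x/3" "\<nu> <= y - (3 * x - 2)" "\<nu> <= x" "\<nu> <= y"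
  using py x0 \<eta> by (auto simp: \<nu>_def)
 have \<mu>\<nu>: "\<mu> = \<nu> / 8" by (simp add: \<mu>_def \<nu>_def)
 have \<nu>3: "\<nu> * (1 + 4 * \<eta>) <= 2 * \<eta> - (x - y) * (1 + 4 * \<eta>)" using \<nu>(3) \<eta> by (simp add: le_divide_eq)
 have pyr: "pyramid \<eta> x' y'" if "x' = x - \<mu> \<or> x' = x + \<mu>" "y' = y - \<mu> \<or> y' = y + \<mu>" for x' y'
 proof -
  have d: "\<bar>x' - x\<bar> <= \<nu>/8" "\<bar>y' - y\<bar> <= \<nu>/8" using that \<nu>(1) unfolding \<mu>\<nu> by auto
  have "x' - y' <= (x - y) + \<nu>/2" using d \<nu>(1) unfolding abs_le_iff by linarith
  then have "(x' - y') * (1 + 4 * \<eta>) <= ((x - y) + \<nu>/2) * (1 + 4 * \<eta>)" using \<eta> by (intro mult_right_mono) auto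
  also have "... = (x - y) * (1 + 4 * \<eta>) + \<nu> * (1 + 4 * \<eta>) / 2" by (simp add: algebra_simps)
  also have "... < (x - y) * (1 + 4 * \<eta>) + \<nu> * (1 + 4 * \<eta>)" using \<nu>(1) \<eta> by (simp add: zero_less_mult_iff)
  also have "... <= 2 * \<eta>" using \<nu>3 by simp
  finally have "(x' - y') * (1 + 4 * \<eta>) < 2 * \<eta>" .
  moreover have "y' < x'" "x' / 3 < y'" "3 * x' - 2 < y'"
   using d \<nu>(1,2,4,5) unfolding abs_le_iff by linarith+
  ultimately show ?thesis unfolding pyramid_def by simp
 qed
 have pq: "p > 0" "q > 0" using x0 by (auto simp: x_def y_def)
 have \<mu>: "\<mu> > 0" "1/p - \<mu> > 0" "1/q - \<mu> > 0" using \<nu> unfolding \<mu>\<nu> x_def y_def by auto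
 show ?thesis
 proof (rule avg_strong_bound[OF pq(2) \<mu>(1,3)])
  fix y' assume y': "y' = 1/q - \<mu> \<or> y' = 1/q + \<mu>"
  show "\<exists>K>0. \<forall>f F. unit_fun p f
   \<and> F \<in> sets borel \<and> vol F < \<infinity> -->
   (LI y. avg f y * indicator F y) <= ennreal (K * measure lborel F powr (1 - y'))"
  proof (rule avg_restricted_bound[OF pq(1) \<mu>(1,2)])
   fix x' assume x': "x' = 1/p - \<mu> \<or> x' = 1/p + \<mu>"
   have "pyramid \<eta> x' y'" by (rule pyr) (use x' y' in \<open>simp_all add: x_def y_def\<close>)
   from inc_restricted_bound[OF \<eta> SL this] show "\<exists>K>0. \<forall>E F. fin_sets E F -->
    inc Q E F <= ennreal (K * measure lborel E powr x' * measure lborel F powr (1 - y'))"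
    by simp
  qed
 qed
qed

end

section \<open>Linear changes of coordinates\<close>

text \<open>Cauchy's formula in the second variable turns the composition into a contour integral
  with parameter; this is why \<open>B\<close> has to stay inside a circle of radius \<rho> <
  r.\<close>

lemma hol2_compose:
 assumes k: "hol2 r k" and U: "open U" and A: "A holomorphic_on U" and B: "B holomorphic_on U"
  and \<rho>: "0 < \<rho>" "\<rho> < r" and Ar: "!!s. s \<in> U ==> norm (A s) < r" and B\<rho>: "!!s. s \<in> U ==> norm (B s) < \<rho>"
 shows "(\<lambda>s. k (A s) (B s)) holomorphic_on U"
proof -
 have kc: "continuous_on (ball 0 r \<times> ball 0 r) (\<lambda>(s,t). k s t)"
  and k1: "!!s. s \<in> ball 0 r ==> k s holomorphic_on ball 0 r"
  and k2: "!!t. t \<in> ball 0 r ==> (\<lambda>s. k s t) holomorphic_on ball 0 r" using k by (auto simp: hol2_def)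
 have Ac: "continuous_on U A" and Bc: "continuous_on U B" using A B by (auto intro: holomorphic_on_imp_continuous_on)
 have "(\<lambda>s. contour_integral (circlepath 0 \<rho>) (\<lambda>u. k (A s) u / (u - B s))) holomorphic_on U"
 proof (rule circlepath_integral_param_holomorphic[OF _ U \<rho>(1)])
  have "continuous_on (U \<times> sphere 0 \<rho>) (\<lambda>p. (\<lambda>(s,t). k s t) (A (fst p), snd p))"
   using Ar \<rho> by (intro continuous_on_compose2[OF kc]) (auto intro!: continuous_intros continuous_on_compose2[OF Ac])
  moreover have "continuous_on (U \<times> sphere 0 \<rho>) (\<lambda>p. snd p - B (fst p))"
   by (auto intro!: continuous_intros continuous_on_compose2[OF Bc])
  ultimately show "continuous_on (U \<times> sphere 0 \<rho>) (\<lambda>(s, u). k (A s) u / (u - B s))"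
   unfolding case_prod_unfold using B\<rho> by (intro continuous_on_divide) (auto, fastforce)
  fix u :: complex assume u: "u \<in> sphere 0 \<rho>"
  have "(\<lambda>s. k (A s) u) holomorphic_on U"
   using holomorphic_on_compose_gen[OF A k2[of u]] Ar u \<rho> by (force simp: o_def)
  then show "(\<lambda>s. k (A s) u / (u - B s)) holomorphic_on U"
   using B B\<rho> u by (intro holomorphic_intros) auto
 qed
 then have "(\<lambda>s. contour_integral (circlepath 0 \<rho>) (\<lambda>u. k (A s) u / (u - B s)) / (2 * of_real pi * \<i>)) holomorphic_on U"
  by (intro holomorphic_intros) auto
 moreover have "contour_integral (circlepath 0 \<rho>) (\<lambda>u. k (A s) u / (u - B s)) / (2 * of_real pi * \<i>) = k (A s) (B s)" if "s \<in> U" for s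
 proof -
  have "((\<lambda>u. k (A s) u/(u - B s)) has_contour_integral (2 * of_real pi * \<i> * k (A s) (B s))) (circlepath 0 \<rho>)"
   by (rule Cauchy_integral_circlepath_simple[OF holomorphic_on_subset[OF k1]]) (use that Ar B\<rho> \<rho> in auto)
  from contour_integral_unique[OF this] show ?thesis by simp
 qed
 ultimately show ?thesis by (rule holomorphic_transform)
qed

text \<open>The area formula with constant Jacobian and multiplicity 1.\<close>

lemma emeasure_lin2_vimage:
 assumes det: "a * d - b * c ~= 0" and B: "B \<in> sets borel"
 shows "lin2 a b c d -` B \<in> sets borel" "vol (lin2 a b c d -` B) <= ennreal (1 / \<bar>a * d - b * c\<bar>) * vol B"
proof -
 let ?L = "lin2 a b c d" and ?\<kappa> = "\<bar>a * d - b * c\<bar>"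
 define M where "M = 1 + \<bar>a\<bar> + \<bar>b\<bar> + \<bar>c\<bar> + \<bar>d\<bar>"
 have C1: "C1_pair M UNIV ?L (\<lambda>_. a) (\<lambda>_. b) (\<lambda>_. c) (\<lambda>_. d)"
  unfolding C1_pair_def by (auto simp: M_def linear_imp_has_derivative[OF linear_lin2])
 have inj: "inj ?L"
 proof (rule injI)
  fix v w assume eq: "?L v = ?L w"
  obtain v1 v2 w1 w2 where vw: "v = (v1,v2)" "w = (w1,w2)" by (cases v, cases w)
  have e: "a * (v1 - w1) + b * (v2 - w2) = 0" "c * (v1 - w1) + d * (v2 - w2) = 0"
   using eq by (auto simp: vw lin2_def algebra_simps)
  have "(a * d - b * c) * (v1 - w1) = d * (a * (v1 - w1) + b * (v2 - w2)) - b * (c * (v1 - w1) + d * (v2 - w2))"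
   "(a * d - b * c) * (v2 - w2) = a * (c * (v1 - w1) + d * (v2 - w2)) - c * (a * (v1 - w1) + b * (v2 - w2))"
   by (simp_all add: algebra_simps)
  then show "v = w" unfolding e using det by (simp add: vw)
 qed
 have mult: "finite {z \<in> UNIV. ?L z = q} \<and> card {z \<in> UNIV. ?L z = q} <= 1" for q
 proof (cases "\<exists>z. ?L z = q")
  case True
  then obtain z where "?L z = q" by blast
  then have "{z \<in> UNIV. ?L z = q} \<subseteq> {z}" by (intro subsetI) (simp, rule injD[OF inj], simp)
  then show ?thesis using finite_subset card_mono[of "{z}"] by fastforce
 next
  case False
  then have "{z \<in> UNIV. ?L z = q} = {}" by blast
  then show ?thesis by (simp only: card.empty finite.emptyI) simp
 qed
 note * = multiplicity_change_of_variables[OF C1, of UNIV 1 ?\<kappa> 1 B, OF _ _ _ _ _ mult B]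
 show "?L -` B \<in> sets borel" using *(1) det by simp
 have "ennreal ?\<kappa> * vol (?L -` B) <= vol B" using *(2) det by simp
 then have "ennreal (1 / ?\<kappa>) * (ennreal ?\<kappa> * vol (?L -` B)) <= ennreal (1 / ?\<kappa>) * vol B"
  by (rule mult_left_mono) simp
 then show "vol (?L -` B) <= ennreal (1 / ?\<kappa>) * vol B"
  using det by (simp add: mult.assoc[symmetric] ennreal_mult[symmetric])
qed

lemma SL_lin2:
 assumes SL: "SL g \<epsilon> V" and det: "a * d - b * c ~= 0" and m: "!!\<delta>. {z\<in>V. \<bar>g z\<bar> < \<delta>} \<in> sets borel"
 shows "SL (\<lambda>z. g (lin2 a b c d z)) \<epsilon> (lin2 a b c d -` V)"
proof -
 let ?L = "lin2 a b c d" and ?\<kappa> = "\<bar>a * d - b * c\<bar>"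
 obtain C where C: "C >= 0" "!!\<delta>. \<delta> > 0 ==> vol {z\<in>V. \<bar>g z\<bar> < \<delta>} <= ennreal (C * \<delta> powr \<epsilon>)"
  using SL unfolding SL_def by blast
 show ?thesis unfolding SL_def
 proof (intro exI[of _ "1 / ?\<kappa> * C"] conjI allI impI)
  fix \<delta> :: real assume \<delta>: "\<delta> > 0"
  have "{z\<in>?L -` V. \<bar>g (?L z)\<bar> < \<delta>} = ?L -` {z\<in>V. \<bar>g z\<bar> < \<delta>}" by auto
  then have "vol {z\<in>?L -` V. \<bar>g (?L z)\<bar> < \<delta>} <= ennreal (1 / ?\<kappa>) * vol {z\<in>V. \<bar>g z\<bar> < \<delta>}"
   using emeasure_lin2_vimage(2)[OF det m] by simp
  also have "... <= ennreal (1 / ?\<kappa>) * ennreal (C * \<delta> powr \<epsilon>)" by (intro mult_left_mono C(2) \<delta>) simp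
  also have "... = ennreal (1 / ?\<kappa> * C * \<delta> powr \<epsilon>)" using C(1) by (simp add: ennreal_mult[symmetric])
  finally show "vol {z\<in>?L -` V. \<bar>g (?L z)\<bar> < \<delta>} <= ennreal (1 / ?\<kappa> * C * \<delta> powr \<epsilon>)" .
 qed (use C in simp)
qed

context real_hol2
begin

lemma g_Re: "g z = Re (h (of_real (fst z)) (of_real (snd z)))"
 by (simp add: g_def rd_def)

text \<open>The rotated coordinates are adapted to a direction in which \<open>h\<close> does not vanish identically.\<close>

lemma uniform_sublevel_nonzero:
 assumes h00: "h 0 0 = 0" and nz: "\<exists>z\<in>box2 r. g z ~= 0"
 shows "\<exists>\<epsilon>>0. \<exists>V. open V \<and> 0 \<in> V \<and> V \<subseteq> box2 r \<and> SL g \<epsilon> V"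
  and "\<exists>\<eta>>0. \<eta> <= r \<and> (\<forall>\<epsilon>>0. (\<exists>V. open V \<and> 0 \<in> V \<and> V \<subseteq> box2 r \<and> SL g \<epsilon> V) --> SL g \<epsilon> (box2 \<eta>))"
proof -
 obtain w where w: "w \<in> box2 r" "g w ~= 0" using nz by blast
 define a where "a = fst w"
 define b where "b = snd w"
 have ab: "\<bar>a\<bar> < r" "\<bar>b\<bar> < r" "h (of_real a) (of_real b) ~= 0"
  using w by (auto simp: a_def b_def box2_def g_Re)
 have ab0: "\<bar>a\<bar> + \<bar>b\<bar> > 0"
 proof (rule ccontr)
  assume "\<not> ?thesis"
  then have "a = 0" "b = 0" by auto
  then show False using ab h00 by simp
 qed
 define m where "m = \<bar>a\<bar> + \<bar>b\<bar>"
 have m: "m > 0" using ab0 by (simp add: m_def)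
 \<comment> \<open>Small enough for the linear map to send the complex polydisc of radius
   \<open>r'\<close> into that of radius \<open>r/2\<close>.\<close>
 define r' where "r' = r / (2 * m)"
 have r': "r' > 0" using r m by (simp add: r'_def)
 \<comment> \<open>The axis s = 0 is sent to the line through (a, b), and t = 1 to the point (a, b),
   where \<open>h\<close> does not vanish.\<close>
 define H where "H s t = h (- of_real b * s + of_real a * t) (of_real a * s + of_real b * t)" for s t
 have in1: "norm (- of_real b * s + of_real a * t) < r/2" "norm (of_real a * s + of_real b * t) < r/2"
  if "norm s < r'" "norm t < r'" for s t :: complex
 proof -
  have *: "norm x * \<bar>p\<bar> + norm y * \<bar>q\<bar> < r/2" if "p = a \<and> q = b \<or> p = b \<and> q = a" "norm x < r'" "norm y < r'" for x y :: complex and p q :: real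
  proof -
   have "norm x * \<bar>p\<bar> + norm y * \<bar>q\<bar> <= max (norm x) (norm y) * \<bar>p\<bar> + max (norm x) (norm y) * \<bar>q\<bar>"
    by (intro add_mono mult_right_mono) auto
   also have "... = max (norm x) (norm y) * m" using that by (auto simp: m_def algebra_simps)
   also have "... < r' * m" using that m by (intro mult_strict_right_mono) auto
   finally show ?thesis using m by (simp add: r'_def)
  qed
  have "norm (- of_real b * s + of_real a * t) <= norm s * \<bar>b\<bar> + norm t * \<bar>a\<bar>"
   by (rule order_trans[OF norm_triangle_ineq]) (simp add: norm_mult mult.commute)
  then show "norm (- of_real b * s + of_real a * t) < r/2" using *[of b a s t] that by simp
  have "norm (of_real a * s + of_real b * t) <= norm s * \<bar>a\<bar> + norm t * \<bar>b\<bar>"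
   by (rule order_trans[OF norm_triangle_ineq]) (simp add: norm_mult mult.commute)
  then show "norm (of_real a * s + of_real b * t) < r/2" using *[of a b s t] that by simp
 qed
 have hr: "r/2 < r" "0 < r/2" using r by auto
 have hol2H: "hol2 r' H" unfolding hol2_def
 proof (intro conjI ballI)
  have hc: "continuous_on (ball 0 r \<times> ball 0 r) (\<lambda>(s,t). h s t)" using h by (simp add: hol2_def)
  have "continuous_on (ball 0 r' \<times> ball 0 r') (\<lambda>p. (\<lambda>(s,t). h s t) (- of_real b * fst p + of_real a * snd p, of_real a * fst p + of_real b * snd p))"
  proof (rule continuous_on_compose2[OF hc])
   show "(\<lambda>p::complex \<times> complex. (- of_real b * fst p + of_real a * snd p, of_real a * fst p + of_real b * snd p)) ` (ball 0 r' \<times> ball 0 r') \<subseteq> ball 0 r \<times> ball 0 r"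
   proof (rule image_subsetI)
    fix p :: "complex \<times> complex" assume "p \<in> ball 0 r' \<times> ball 0 r'"
    then have p: "norm (fst p) < r'" "norm (snd p) < r'" by auto
    have "norm (- of_real b * fst p + of_real a * snd p) < r" "norm (of_real a * fst p + of_real b * snd p) < r"
     using in1[OF p] hr(1) by linarith+
    then show "(- of_real b * fst p + of_real a * snd p, of_real a * fst p + of_real b * snd p) \<in> ball 0 r \<times> ball 0 r"
     by simp
   qed
  qed (intro continuous_intros)
  then show "continuous_on (ball 0 r' \<times> ball 0 r') (\<lambda>(s,t). H s t)" by (simp add: H_def case_prod_unfold)
  fix x :: complex assume x: "x \<in> ball 0 r'"
  show "H x holomorphic_on ball 0 r'"
   unfolding H_def by (rule hol2_compose[OF h _ _ _ hr(2,1)]) (use in1 x hr in \<open>auto intro!: holomorphic_intros less_trans[OF _ hr(1)]\<close>)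
  show "(\<lambda>s. H s x) holomorphic_on ball 0 r'"
   unfolding H_def by (rule hol2_compose[OF h _ _ _ hr(2,1)]) (use in1 x hr in \<open>auto intro!: holomorphic_intros less_trans[OF _ hr(1)]\<close>)
 qed
 interpret R: real_hol2 r' H
 proof
  show "r' > 0" by (rule r')
  show "hol2 r' H" by (rule hol2H)
  fix s t :: real assume st: "\<bar>s\<bar> < r'" "\<bar>t\<bar> < r'"
  have "\<bar>- b * s + a * t\<bar> < r" "\<bar>a * s + b * t\<bar> < r"
   using in1[of "of_real s" "of_real t"] st hr(1)
   by (simp_all add: norm_of_real flip: of_real_mult of_real_add of_real_minus of_real_diff)
  from re[OF this] show "H (of_real s) (of_real t) \<in> \<real>" by (simp add: H_def)
 qed
 have H00: "H 0 0 = 0" using h00 by (simp add: H_def)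
 \<comment> \<open>The point t = 1 may lie outside the disc of radius \<open>r'\<close>. Analytic
   continuation in t, on a disc of radius \<rho>/\<mu> > 1, carries vanishing near 0 to t =
   1.\<close>
 have Hnz: "\<exists>t\<in>ball 0 r'. H 0 t ~= 0"
 proof (rule ccontr)
  assume "\<not> ?thesis"
  then have zero: "H 0 t = 0" if "norm t < r'" for t using that by auto
  define \<mu> where "\<mu> = max \<bar>a\<bar> \<bar>b\<bar>"
  have \<mu>: "0 < \<mu>" "\<mu> < r" using ab ab0 by (auto simp: \<mu>_def)
  define \<rho> where "\<rho> = (\<mu> + r) / 2"
  have \<rho>: "\<mu> < \<rho>" "\<rho> < r" "0 < \<rho>" using \<mu> by (auto simp: \<rho>_def)
  have in2: "norm (of_real p * t) < \<rho>" if "\<bar>p\<bar> <= \<mu>" "norm t < \<rho> / \<mu>" for p :: real and t :: complex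
  proof -
   have "norm (of_real p * t) <= \<mu> * norm t" using that by (simp add: norm_mult mult_right_mono)
   also have "... < \<rho>" using that \<mu> by (simp add: pos_less_divide_eq mult.commute)
   finally show ?thesis .
  qed
  have hol: "(\<lambda>t. h (of_real a * t) (of_real b * t)) holomorphic_on ball 0 (\<rho>/\<mu>)"
  proof (rule hol2_compose[OF h _ _ _ \<rho>(3,2)])
   fix s :: complex assume "s \<in> ball 0 (\<rho>/\<mu>)"
   then show "norm (of_real b * s) < \<rho>" "norm (of_real a * s) < r"
    using in2[of b s] in2[of a s] \<rho> by (auto simp: \<mu>_def)
  qed (auto intro!: holomorphic_intros)
  have one: "1 < \<rho>/\<mu>" using \<rho> \<mu> by simp
  have "h (of_real a * 1) (of_real b * 1) = 0"
  proof (rule analytic_continuation_open[of "ball 0 (min r' (\<rho>/\<mu>))" "ball 0 (\<rho>/\<mu>)" "\<lambda>t. h (of_real a * t) (of_real b * t)" "\<lambda>_. 0" 1])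
   show "ball 0 (min r' (\<rho>/\<mu>)) ~= ({} :: complex set)" using r' one by simp
   show "h (of_real a * t) (of_real b * t) = 0" if "t \<in> ball 0 (min r' (\<rho>/\<mu>))" for t
    using zero[of t] that by (simp add: H_def)
  qed (use hol one in \<open>auto simp: subset_ball\<close>)
  then show False using ab by simp
 qed
 note us = R.uniform_sublevel[OF H00 Hnz]
 define D where "D = a\<^sup>2 + b\<^sup>2"
 have D: "D > 0" using ab0 unfolding D_def by (metis abs_0 add.right_neutral less_irrefl sum_power2_gt_zero_iff)
 define L where "L = lin2 (-b) a a b"
 \<comment> \<open>The inverse of \<open>L\<close>: the matrix of \<open>L\<close> is symmetric and
   its square is \<open>D\<close> times the identity.\<close>
 define M where "M = lin2 (-b/D) (a/D) (a/D) (b/D)"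
 have LM: "L (M z) = z" "M (L z) = z" for z
 proof -
  obtain x y where z: "z = (x, y)" by (cases z)
  have "b * b + a * a = D" by (simp add: D_def power2_eq_square add.commute)
  then have e: "(b * b + a * a) * u / D = u" for u using D by simp
  have "- b * (- b/D * x + a/D * y) + a * (a/D * x + b/D * y) = (b * b + a * a) * x / D"
   "a * (- b/D * x + a/D * y) + b * (a/D * x + b/D * y) = (b * b + a * a) * y / D"
   "- b/D * (- b * x + a * y) + a/D * (a * x + b * y) = (b * b + a * a) * x / D"
   "a/D * (- b * x + a * y) + b/D * (a * x + b * y) = (b * b + a * a) * y / D"
   by (simp_all add: add_divide_distrib diff_divide_distrib algebra_simps)
  then show "L (M z) = z" "M (L z) = z" unfolding e by (simp_all add: z L_def M_def lin2_def)
 qed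
 have gL: "R.g z = g (L z)" for z
  by (cases z) (simp add: R.g_Re g_Re H_def L_def lin2_def)
 have detL: "(-b) * b - a * a ~= 0" using D by (simp add: D_def power2_eq_square)
 have detM: "(-b/D) * (b/D) - (a/D) * (a/D) ~= 0"
 proof -
  have "(-b/D) * (b/D) - (a/D) * (a/D) = - (D / (D * D))" by (simp add: D_def power2_eq_square add_divide_distrib diff_divide_distrib)
  then show ?thesis using D by simp
 qed
 have Lc: "continuous_on UNIV L" "continuous_on UNIV M"
  unfolding L_def M_def by (rule linear_continuous_on[OF linear_conv_bounded_linear[THEN iffD1, OF linear_lin2]])+
 have Lv: "open (L -` V)" "open (M -` V)" if "open V" for V
  using that Lc by (auto intro: open_vimage)
 have L0: "L 0 = 0" "M 0 = 0" by (auto simp: L_def M_def lin2_def zero_prod_def)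
 have Lb: "L z \<in> box2 r" if "z \<in> box2 r'" for z
 proof -
  have "\<bar>- b * fst z + a * snd z\<bar> < r" "\<bar>a * fst z + b * snd z\<bar> < r"
   using in1[of "of_real (fst z)" "of_real (snd z)"] that hr(1)
   by (simp_all add: box2_def norm_of_real flip: of_real_mult of_real_add of_real_minus of_real_diff)
  then show ?thesis by (cases z) (simp add: L_def lin2_def box2_def)
 qed
 have pull: "SL g \<epsilon> (M -` V)" "(M -` V) \<subseteq> box2 r"
  if "SL R.g \<epsilon> V" "open V" "V \<subseteq> box2 r'" for \<epsilon> V
 proof -
  have "SL (\<lambda>z. R.g (M z)) \<epsilon> (M -` V)" unfolding M_def
   by (rule SL_lin2[OF that(1) detM]) (use R.g_sub_open[OF that(2,3)] in auto)
  then show "SL g \<epsilon> (M -` V)" by (simp add: gL LM)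
  show "M -` V \<subseteq> box2 r" using Lb that(3) LM by (metis subsetI vimageE subsetD)
 qed
 show "\<exists>\<epsilon>>0. \<exists>V. open V \<and> 0 \<in> V \<and> V \<subseteq> box2 r \<and> SL g \<epsilon> V"
 proof -
  obtain k \<eta> where k: "\<eta> > 0" "R.rect 0 \<eta> \<subseteq> box2 r'" "SL R.g (1 / real (Suc k)) (R.rect 0 \<eta>)" using us(1) by blast
  show ?thesis
  proof (rule exI[of _ "1 / real (Suc k)"], rule conjI, simp, rule exI[of _ "M -` R.rect 0 \<eta>"], intro conjI)
   show "open (M -` R.rect 0 \<eta>)" by (rule Lv[OF R.open_rect])
   show "0 \<in> M -` R.rect 0 \<eta>" using k L0 by (simp add: R.rect_def)
  qed (use pull[OF k(3) R.open_rect k(2)] in auto)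
 qed
 show "\<exists>\<eta>>0. \<eta> <= r \<and> (\<forall>\<epsilon>>0. (\<exists>V. open V \<and> 0 \<in> V \<and> V \<subseteq> box2 r \<and> SL g \<epsilon> V) --> SL g \<epsilon> (box2 \<eta>))"
 proof -
  obtain \<eta> where \<eta>: "\<eta> > 0" "\<eta> <= r'" "!!\<epsilon>. \<epsilon> > 0 ==> (\<exists>V. open V \<and> 0 \<in> V \<and> V \<subseteq> box2 r' \<and> SL R.g \<epsilon> V) ==> SL R.g \<epsilon> (box2 \<eta>)"
   using us(2) by blast
  have sub: "box2 \<eta> \<subseteq> box2 r'" using \<eta>(2) by (rule box2_mono)
  have "open (M -` box2 \<eta>)" by (rule Lv[OF open_box2])
  moreover have "0 \<in> M -` box2 \<eta>" using \<eta>(1) L0 by (simp add: box2_def)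
  ultimately obtain e where e: "e > 0" "ball 0 e \<subseteq> M -` box2 \<eta>" using open_contains_ball by blast
  have eb: "box2 (e/2) \<subseteq> ball 0 e"
  proof
   fix z assume "z \<in> box2 (e/2)"
   then have "\<bar>fst z\<bar> + \<bar>snd z\<bar> < e" by (auto simp: box2_def)
   then show "z \<in> ball 0 e" using norm_pair_le[of "fst z" "snd z"] by simp
  qed
  show ?thesis
  proof (rule exI[of _ "min r (e/2)"], intro conjI allI impI)
   show "min r (e/2) > 0" "min r (e/2) <= r" using r e by auto
   fix \<epsilon> :: real assume \<epsilon>: "\<epsilon> > 0" and "\<exists>V. open V \<and> 0 \<in> V \<and> V \<subseteq> box2 r \<and> SL g \<epsilon> V"
   then obtain V where V: "open V" "0 \<in> V" "V \<subseteq> box2 r" "SL g \<epsilon> V" by blast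
   have SLV: "SL R.g \<epsilon> (L -` V \<inter> box2 r')"
   proof -
    have "SL (\<lambda>z. g (L z)) \<epsilon> (L -` V)" unfolding L_def
     by (rule SL_lin2[OF V(4) detL]) (use g_sub_open[OF V(1,3)] in auto)
    then obtain C where C: "C >= 0" "!!\<delta>. \<delta> > 0 ==> vol {z\<in>L -` V. \<bar>g (L z)\<bar> < \<delta>} <= ennreal (C * \<delta> powr \<epsilon>)"
     unfolding SL_def by blast
    show ?thesis unfolding SL_def
    proof (intro exI[of _ C] conjI allI impI)
     fix \<delta> :: real assume \<delta>: "\<delta> > 0"
     have "{z\<in>L -` V. \<bar>g (L z)\<bar> < \<delta>} = L -` {z\<in>V. \<bar>g z\<bar> < \<delta>}" by auto
     then have "open {z\<in>L -` V. \<bar>g (L z)\<bar> < \<delta>}" using Lv(1)[OF g_sub_open[OF V(1,3)]] by simp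
     then have "vol {z\<in>L -` V \<inter> box2 r'. \<bar>R.g z\<bar> < \<delta>} <= vol {z\<in>L -` V. \<bar>g (L z)\<bar> < \<delta>}"
      by (intro emeasure_mono) (auto simp: gL)
     then show "vol {z\<in>L -` V \<inter> box2 r'. \<bar>R.g z\<bar> < \<delta>} <= ennreal (C * \<delta> powr \<epsilon>)"
      using C(2)[OF \<delta>] by (rule order_trans)
    qed (rule C)
   qed
   have "SL R.g \<epsilon> (box2 \<eta>)"
   proof (rule \<eta>(3)[OF \<epsilon>], rule exI[of _ "L -` V \<inter> box2 r'"], intro conjI SLV)
    show "open (L -` V \<inter> box2 r')" by (intro open_Int Lv V open_box2)
    show "0 \<in> L -` V \<inter> box2 r'" using V(2) L0 r' by (simp add: box2_def)
   qed simp
   note b = pull[OF this open_box2 sub]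
   have "box2 (min r (e/2)) \<subseteq> M -` box2 \<eta>"
    by (rule order_trans[OF box2_mono[OF min.cobounded2] order_trans[OF eb e(2)]])
   then show "SL g \<epsilon> (box2 (min r (e/2)))" by (rule SL_mono[OF b(1) _ Lv(2)[OF open_box2] b(2)])
  qed
 qed
qed


section \<open>The integrability exponent in terms of sublevel sets\<close>

lemma SL_null:
 assumes "SL g \<epsilon> V" "\<epsilon> > 0" "open V" "V \<subseteq> box2 r"
 shows "vol {z\<in>V. g z = 0} = 0" "{z\<in>V. g z = 0} \<in> sets borel"
proof -
 obtain C where C: "C >= 0" "!!\<delta>. \<delta> > 0 ==> vol {z\<in>V. \<bar>g z\<bar> < \<delta>} <= ennreal (C * \<delta> powr \<epsilon>)"
  using assms(1) unfolding SL_def by blast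
 have "vol {z\<in>V. g z = 0} <= 0"
 proof (rule tendsto_lowerbound)
  show "((\<lambda>\<delta>. ennreal (C * \<delta> powr \<epsilon>)) \<longlongrightarrow> 0) (at_right 0)"
   using tendsto_ennrealI[OF tendsto_mult_left[OF powr_at_right_0[OF assms(2)], of C]] by simp
  show "\<forall>\<^sub>F \<delta> in at_right 0. vol {z\<in>V. g z = 0} <= ennreal (C * \<delta> powr \<epsilon>)"
   using eventually_at_right_less
  proof eventually_elim
   case (elim \<delta>)
   have "vol {z\<in>V. g z = 0} <= vol {z\<in>V. \<bar>g z\<bar> < \<delta>}"
    using elim g_sub_open[OF assms(3,4)] by (intro emeasure_mono) auto
   then show ?case using C(2)[OF elim] by (rule order_trans)
  qed
 qed simp
 then show "vol {z\<in>V. g z = 0} = 0" by simp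
 have "{z\<in>V. g z = 0} = (\<Inter>n. {z\<in>V. \<bar>g z\<bar> < 1 / real (Suc n)})"
 proof (intro equalityI subsetI)
  fix z assume z: "z \<in> (\<Inter>n. {z\<in>V. \<bar>g z\<bar> < 1 / real (Suc n)})"
  have "g z = 0"
  proof (rule ccontr)
   assume "g z ~= 0"
   then obtain n where "1 / real (Suc n) < \<bar>g z\<bar>" using nat_approx_posE[of "\<bar>g z\<bar>"] by auto
   moreover have "\<bar>g z\<bar> < 1 / real (Suc n)" using z by blast
   ultimately show False by simp
  qed
  then show "z \<in> {z\<in>V. g z = 0}" using z by auto
 qed auto
 then show "{z\<in>V. g z = 0} \<in> sets borel" using g_sub_open[OF assms(3,4)] by (auto intro!: sets.countable_INT)
qed

lemma g_cut_measurable: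
 assumes "open V" "V \<subseteq> box2 r" shows "(\<lambda>z. if z \<in> V then g z else 0) \<in> borel_measurable borel"
 using assms by (intro borel_measurable_continuous_on_if continuous_on_subset[OF g_continuous]) (auto intro: borel_open)

definition loc_exps :: "real set" where
 "loc_exps = {\<epsilon>. \<epsilon> > 0 \<and> (\<exists>V. open V \<and> 0 \<in> V \<and> V \<subseteq> box2 r \<and> SL g \<epsilon> V)}"

lemma box2_rect: "box2 \<eta> = rect 0 \<eta>" by (simp add: box2_def rect_def)

lemma emeasure_box2: "\<eta> > 0 ==> vol (box2 \<eta>) = ennreal (4 * \<eta>\<^sup>2)"
 unfolding box2_rect by (rule emeasure_rect)

lemma box2_in_open:
 assumes "open V" "(0 :: plane) \<in> V" obtains e where "e > 0" "box2 e \<subseteq> V"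
proof -
 obtain e where e: "e > 0" "ball 0 e \<subseteq> V" using assms open_contains_ball by blast
 have "box2 (e/2) \<subseteq> ball 0 e"
 proof
  fix z assume "z \<in> box2 (e/2)"
  then have "\<bar>fst z\<bar> + \<bar>snd z\<bar> < e" by (auto simp: box2_def)
  then show "z \<in> ball 0 e" using norm_pair_le[of "fst z" "snd z"] by simp
 qed
 then show thesis using e by (intro that[of "e/2"]) auto
qed

text \<open>The square of half side \<rho> lies in the sublevel set at height 2 M \<rho>, so
  \<rho>^2 is at most a constant times \<rho>^\<epsilon>. This makes the set behind the supremum in
  \<open>int_exp\<close> bounded.\<close>

lemma loc_exps_le:
 assumes M: "M > 0" "!!z \<rho>. z \<in> box2 \<rho>1 ==> z \<in> box2 \<rho> ==> \<bar>g z\<bar> <= M * \<rho>" and \<rho>1: "\<rho>1 > 0" and \<epsilon>: "\<epsilon> \<in> loc_exps"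
 shows "\<epsilon> <= 2"
proof (rule ccontr)
 assume "\<not> \<epsilon> <= 2"
 then have \<epsilon>2: "\<epsilon> - 2 > 0" by simp
 obtain V where V: "open V" "0 \<in> V" "V \<subseteq> box2 r" "SL g \<epsilon> V" using \<epsilon> by (auto simp: loc_exps_def)
 obtain C where C: "C >= 0" "!!\<delta>. \<delta> > 0 ==> vol {z\<in>V. \<bar>g z\<bar> < \<delta>} <= ennreal (C * \<delta> powr \<epsilon>)"
  using V(4) unfolding SL_def by blast
 obtain e where e: "e > 0" "box2 e \<subseteq> V" using box2_in_open[OF V(1,2)] .
 have bd: "4 <= C * (2 * M) powr \<epsilon> * \<rho> powr (\<epsilon> - 2)" if \<rho>: "0 < \<rho>" "\<rho> < min e \<rho>1" for \<rho>
 proof -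
  have "box2 \<rho> \<subseteq> {z\<in>V. \<bar>g z\<bar> < 2 * M * \<rho>}"
  proof
   fix z assume z: "z \<in> box2 \<rho>"
   then have "z \<in> box2 e" "z \<in> box2 \<rho>1" using box2_mono[of \<rho> e] box2_mono[of \<rho> \<rho>1] \<rho> by auto
   then have "z \<in> V" "\<bar>g z\<bar> <= M * \<rho>" using e M(2)[of z \<rho>] z by auto
   moreover have "M * \<rho> < 2 * M * \<rho>" using M \<rho> by simp
   ultimately show "z \<in> {z\<in>V. \<bar>g z\<bar> < 2 * M * \<rho>}" by simp
  qed
  then have "vol (box2 \<rho>) <= vol {z\<in>V. \<bar>g z\<bar> < 2 * M * \<rho>}"
   using g_sub_open[OF V(1,3)] by (intro emeasure_mono) auto
  also have "... <= ennreal (C * (2 * M * \<rho>) powr \<epsilon>)" using M \<rho> by (intro C(2)) simp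
  finally have "ennreal (4 * \<rho>\<^sup>2) <= ennreal (C * (2 * M * \<rho>) powr \<epsilon>)" using emeasure_box2[OF \<rho>(1)] by simp
  then have "4 * \<rho>\<^sup>2 <= C * (2 * M * \<rho>) powr \<epsilon>" using C by (simp add: ennreal_le_iff)
  also have "... = C * (2 * M) powr \<epsilon> * \<rho> powr \<epsilon>" using M \<rho> by (simp add: powr_mult)
  also have "\<rho> powr \<epsilon> = \<rho> powr (\<epsilon> - 2) * \<rho>\<^sup>2" using \<rho> powr_add[of \<rho> "\<epsilon> - 2" 2] by (simp add: powr_numeral)
  finally have "4 * \<rho>\<^sup>2 <= (C * (2 * M) powr \<epsilon> * \<rho> powr (\<epsilon> - 2)) * \<rho>\<^sup>2" by (simp add: mult_ac)
  then show ?thesis using \<rho> by (simp add: mult_le_cancel_right)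
 qed
 have "((\<lambda>\<rho>. C * (2 * M) powr \<epsilon> * \<rho> powr (\<epsilon> - 2)) \<longlongrightarrow> 0) (at_right 0)"
  using tendsto_mult_left[OF powr_at_right_0[OF \<epsilon>2], of "C * (2 * M) powr \<epsilon>"] by simp
 then have "(4::real) <= 0"
 proof (rule tendsto_lowerbound)
  show "\<forall>\<^sub>F \<rho> in at_right 0. 4 <= C * (2 * M) powr \<epsilon> * \<rho> powr (\<epsilon> - 2)"
   using eventually_at_right_real[of 0 "min e \<rho>1"] e \<rho>1 by (auto elim!: eventually_mono intro!: bd)
 qed simp
 then show False by simp
qed

text \<open>Chebyshev's inequality. As 0 to a negative power is 0 here, the zeros of
  \<open>g\<close> are invisible to the integral and have to be removed as a null set; that is the
  purpose of the preliminary exponent \<epsilon>0.\<close>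

lemma integrable_imp_loc_exp:
 fixes G :: "real^2 => real"
 assumes G: "!!z. z \<in> box2 r ==> G (vec2 z) = g z" and V0: "open V0" "0 \<in> V0" "V0 \<subseteq> box2 r" "SL g \<epsilon>0 V0" "\<epsilon>0 > 0"
  and V: "open V" "0 \<in> V" and int: "set_integrable lborel V (\<lambda>t. \<bar>G t\<bar> powr (-\<epsilon>))" and \<epsilon>: "\<epsilon> > 0"
 shows "\<epsilon> \<in> loc_exps"
proof -
 define W where "W = vec2 -` V \<inter> V0"
 have "continuous_on UNIV vec2" using continuous_vec2[of UNIV "\<lambda>x. x"] by simp
 then have "open (vec2 -` V)" using V by (intro open_vimage) auto
 then have W: "open W" "0 \<in> W" "W \<subseteq> box2 r" "W \<subseteq> V0"
  using V V0 linear_0[OF linear_vec2] by (auto simp: W_def)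
 define I where "I = (LI t. ennreal (norm (indicat_real V t *\<^sub>R \<bar>G t\<bar> powr (-\<epsilon>))))"
 have Im: "(\<lambda>t. indicat_real V t *\<^sub>R \<bar>G t\<bar> powr (-\<epsilon>)) \<in> borel_measurable borel" and If: "I < \<infinity>"
  using int unfolding set_integrable_def integrable_iff_bounded by (auto simp: I_def)
 have I2: "I = (LI z. ennreal (norm (indicat_real V (vec2 z) *\<^sub>R \<bar>G (vec2 z)\<bar> powr (-\<epsilon>))))"
  unfolding I_def using measurable_compose[OF Im, of "\<lambda>y. ennreal (norm y)" borel] by (intro nn_integral_vec2) simp
 define K where "K = enn2real I"
 have K: "I = ennreal K" "K >= 0" using If by (auto simp: K_def)
 have N: "vol {z\<in>V0. g z = 0} = 0" "{z\<in>V0. g z = 0} \<in> sets borel" by (rule SL_null[OF V0(4,5,1,3)])+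
 have "SL g \<epsilon> W" unfolding SL_def
 proof (intro exI[of _ K] conjI allI impI)
  fix \<delta> :: real assume \<delta>: "\<delta> > 0"
  define X where "X = {z\<in>W. \<bar>g z\<bar> < \<delta>} - {z\<in>V0. g z = 0}"
  have Wo: "open {z\<in>W. \<bar>g z\<bar> < \<delta>}" by (rule g_sub_open[OF W(1,3)])
  have X [measurable]: "X \<in> sets borel" unfolding X_def using Wo N(2) by auto
  have "vol {z\<in>W. \<bar>g z\<bar> < \<delta>} <= vol (X \<union> {z\<in>V0. g z = 0})"
   by (rule emeasure_mono) (use W(4) in \<open>force simp: X_def\<close>, use sets.Un[OF X N(2)] in simp)
  also have "... <= vol X + vol {z\<in>V0. g z = 0}" using X N(2) by (intro emeasure_subadditive) auto
  finally have 1: "vol {z\<in>W. \<bar>g z\<bar> < \<delta>} <= vol X" using N by simp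
  have "ennreal (\<delta> powr (-\<epsilon>)) * vol X = (LI z. ennreal (\<delta> powr (-\<epsilon>)) * indicator X z)"
   by (simp add: nn_integral_cmult)
  also have "... <= I" unfolding I2
  proof (rule nn_integral_mono)
   fix z
   show "ennreal (\<delta> powr (-\<epsilon>)) * indicator X z <= ennreal (norm (indicat_real V (vec2 z) *\<^sub>R \<bar>G (vec2 z)\<bar> powr (-\<epsilon>)))"
   proof (cases "z \<in> X")
    case True
    then have z: "vec2 z \<in> V" "z \<in> box2 r" "g z ~= 0" "\<bar>g z\<bar> < \<delta>" using V0(3) by (auto simp: X_def W_def)
    have "\<delta> powr (-\<epsilon>) <= \<bar>g z\<bar> powr (-\<epsilon>)" using z \<epsilon> by (intro powr_mono2') auto
    then show ?thesis using True z by (simp add: G ennreal_leI)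
   qed simp
  qed
  finally have "ennreal (\<delta> powr \<epsilon>) * (ennreal (\<delta> powr (-\<epsilon>)) * vol X) <= ennreal (\<delta> powr \<epsilon>) * ennreal K"
   unfolding K by (rule mult_left_mono) simp
  then have "vol X <= ennreal (K * \<delta> powr \<epsilon>)"
   using \<delta> K by (simp add: mult.assoc[symmetric] ennreal_mult[symmetric] powr_add[symmetric]) (simp add: mult.commute)
  then show "vol {z\<in>W. \<bar>g z\<bar> < \<delta>} <= ennreal (K * \<delta> powr \<epsilon>)" using 1 by (rule order_trans[rotated])
 qed (rule K)
 then show ?thesis using W \<epsilon> by (auto simp: loc_exps_def)
qed

text \<open>Dyadic summation over the values of |g|; halving the exponent makes the series
  geometric. It serves to show that the set behind the supremum in \<open>int_exp\<close> is
  nonempty.\<close>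

lemma loc_exp_imp_integrable:
 fixes G :: "real^2 => real"
 assumes G: "!!z. z \<in> box2 r ==> G (vec2 z) = g z" and \<epsilon>: "\<epsilon> \<in> loc_exps"
 shows "\<exists>V. open V \<and> 0 \<in> V \<and> set_integrable lborel V (\<lambda>t. \<bar>G t\<bar> powr (-(\<epsilon>/2)))"
proof -
 have \<epsilon>0: "\<epsilon> > 0" using \<epsilon> by (simp add: loc_exps_def)
 obtain V0 where V0: "open V0" "0 \<in> V0" "V0 \<subseteq> box2 r" "SL g \<epsilon> V0" using \<epsilon> by (auto simp: loc_exps_def)
 obtain e where e: "e > 0" "box2 e \<subseteq> V0" using box2_in_open[OF V0(1,2)] .
 have er: "box2 e \<subseteq> box2 r" using e V0 by blast
 have "SL g \<epsilon> (box2 e)" by (rule SL_mono[OF V0(4) e(2) V0(1,3)])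
 then obtain C where C: "C >= 0" "!!\<delta>. \<delta> > 0 ==> vol {z\<in>box2 e. \<bar>g z\<bar> < \<delta>} <= ennreal (C * \<delta> powr \<epsilon>)"
  unfolding SL_def by blast
 define V where "V = unvec2 -` box2 e"
 have "continuous_on UNIV unvec2" using continuous_unvec2[of UNIV "\<lambda>x. x"] by simp
 then have V: "open V" unfolding V_def by (intro open_vimage open_box2)
 have V0': "0 \<in> V" using e linear_0[OF linear_unvec2] by (simp add: V_def box2_def)
 define gc where "gc z = (if z \<in> box2 e then g z else 0)" for z
 have gc [measurable]: "gc \<in> borel_measurable borel"
  unfolding gc_def[abs_def] by (rule g_cut_measurable[OF open_box2 er])
 define F where "F t = indicat_real V t *\<^sub>R \<bar>G t\<bar> powr (-(\<epsilon>/2))" for t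
 have F: "F t = \<bar>gc (unvec2 t)\<bar> powr (-(\<epsilon>/2))" for t
  using G[of "unvec2 t"] er by (auto simp: F_def gc_def V_def indicator_def)
 have [measurable]: "F \<in> borel_measurable borel" unfolding F[abs_def] by measurable
 define q where "q = \<epsilon>/2"
 have q: "q > 0" using \<epsilon>0 by (simp add: q_def)
 define k where "k n = real_of_int (int_decode n)" for n
 \<comment> \<open>The condition |g| <= 2^-k is relaxed to a strict one with the next power of 2, to
   match the sublevel sets in \<open>SL\<close>.\<close>
 define E where "E n = {z\<in>box2 e. \<bar>gc z\<bar> < 2 powr (1 - k n)}" for n
 have [measurable]: "box2 e \<in> sets borel" using open_box2 by simp
 have E [measurable]: "E n \<in> sets borel" for n unfolding E_def by measurable
 define K where "K = C * 2 powr \<epsilon> + 4 * e\<^sup>2"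
 have K: "K >= 0" using C by (simp add: K_def)
 define d where "d = 2 powr (-(q/2))"
 have d: "0 < d" "d < 1" using q powr_less_mono[of "-(q/2)" 0 2] by (auto simp: d_def)
 have piece: "ennreal (2 powr ((k n + 1) * q)) * vol (E n) <= ennreal (2 powr q * K * d ^ n)" for n
 proof -
  have "vol (E n) <= ennreal (K * 2 powr (-(k n * q) - q * \<bar>k n\<bar>))"
  proof (cases "k n >= 0")
   case True
   have "E n = {z\<in>box2 e. \<bar>g z\<bar> < 2 powr (1 - k n)}" by (auto simp: E_def gc_def)
   then have "vol (E n) <= ennreal (C * (2 powr (1 - k n)) powr \<epsilon>)" using C(2)[of "2 powr (1 - k n)"] by simp
   also have "C * (2 powr (1 - k n)) powr \<epsilon> = C * 2 powr \<epsilon> * 2 powr (-(k n * q) - q * \<bar>k n\<bar>)"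
    using True by (simp add: powr_powr powr_add[symmetric] q_def algebra_simps)
   also have "ennreal ... <= ennreal (K * 2 powr (-(k n * q) - q * \<bar>k n\<bar>))"
    by (intro ennreal_leI mult_right_mono) (auto simp: K_def)
   finally show ?thesis .
  next
   case False
   have "vol (E n) <= vol (box2 e)" by (intro emeasure_mono) (auto simp: E_def)
   also have "... = ennreal (4 * e\<^sup>2 * 2 powr (-(k n * q) - q * \<bar>k n\<bar>))" using False emeasure_box2[OF e(1)] by simp
   also have "... <= ennreal (K * 2 powr (-(k n * q) - q * \<bar>k n\<bar>))"
    using C by (intro ennreal_leI mult_right_mono) (auto simp: K_def)
   finally show ?thesis .
  qed
  then have "ennreal (2 powr ((k n + 1) * q)) * vol (E n) <= ennreal (2 powr ((k n + 1) * q)) * ennreal (K * 2 powr (-(k n * q) - q * \<bar>k n\<bar>))"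
   by (rule mult_left_mono) simp
  also have "... = ennreal (2 powr q * K * 2 powr (- (q * \<bar>k n\<bar>)))"
  proof -
   have "2 powr ((k n + 1) * q) * 2 powr (-(k n * q) - q * \<bar>k n\<bar>) = 2 powr q * 2 powr (- (q * \<bar>k n\<bar>))"
    unfolding powr_add[symmetric] by (simp add: algebra_simps)
   then show ?thesis using K by (simp add: ennreal_mult[symmetric] mult_ac)
  qed
  also have "... <= ennreal (2 powr q * K * d ^ n)"
   unfolding d_def k_def using powr_int_decode_le[OF q, of n] K by (intro ennreal_leI mult_left_mono) auto
  finally show ?thesis .
 qed
 have pw: "ennreal (\<bar>gc z\<bar> powr (-q)) <= (\<Sum>n. ennreal (2 powr ((k n + 1) * q)) * indicator (E n) z)" for z
 proof (cases "gc z = 0")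
  case False
  then have z: "z \<in> box2 e" by (auto simp: gc_def split: if_splits)
  have "ennreal (\<bar>gc z\<bar> powr (-q)) = ennreal ((1 / \<bar>gc z\<bar>) powr q)" by (simp add: powr_minus_divide powr_divide)
  also have "... <= (\<Sum>n. ennreal (2 powr ((k n + 1) * q)) * indicator {v. 2 powr k n <= v} (1 / \<bar>gc z\<bar>))"
   unfolding k_def by (rule dyadic_pointwise) (use q in auto)
  also have "... <= (\<Sum>n. ennreal (2 powr ((k n + 1) * q)) * indicator (E n) z)"
  proof (intro suminf_le mult_left_mono)
   fix n
   have "z \<in> E n" if "2 powr k n <= 1 / \<bar>gc z\<bar>"
   proof -
    have "\<bar>gc z\<bar> <= 2 powr (- k n)" using that False by (simp add: powr_minus field_simps)
    also have "... < 2 powr (1 - k n)" by simp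
    finally show ?thesis using z by (simp add: E_def)
   qed
   then show "indicator {v. 2 powr k n <= v} (1 / \<bar>gc z\<bar>) <= (indicator (E n) z :: ennreal)" by (auto simp: indicator_def)
  qed auto
  finally show ?thesis .
 qed simp
 have "(LI t. ennreal (norm (F t))) = (LI z. ennreal (norm (F (vec2 z))))" by (rule nn_integral_vec2) measurable
 also have "... = (LI z. ennreal (\<bar>gc z\<bar> powr (-q)))" by (simp add: F q_def)
 also have "... <= (LI z. (\<Sum>n. ennreal (2 powr ((k n + 1) * q)) * indicator (E n) z))" by (intro nn_integral_mono pw)
 also have "... = (\<Sum>n. ennreal (2 powr ((k n + 1) * q)) * vol (E n))"
  by (subst nn_integral_suminf) (simp_all add: nn_integral_cmult)
 also have "... <= (\<Sum>n. ennreal (2 powr q * K * d ^ n))" by (intro suminf_le piece) auto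
 also have "... = ennreal (2 powr q * K / (1 - d))" using K d by (intro suminf_ennreal_geometric) auto
 also have "... < \<infinity>" by simp
 finally have "integrable lborel F" unfolding integrable_iff_bounded by simp
 then have "set_integrable lborel V (\<lambda>t. \<bar>G t\<bar> powr (-(\<epsilon>/2)))" by (simp add: set_integrable_def F_def[abs_def])
 then show ?thesis using V V0' by blast
qed

text \<open>An \<epsilon> below the supremum lies below an exponent of integrability. The latter is
  a sublevel exponent near the origin, hence valid on the fixed square, and weakening returns to
  \<epsilon>.\<close>

theorem int_exp_sublevel:
 fixes G :: "real^2 => real"
 assumes h00: "h 0 0 = 0" and nz: "\<exists>z\<in>box2 r. g z ~= 0" and G: "!!z. z \<in> box2 r ==> G (vec2 z) = g z"
  and M: "M > 0" "!!z \<rho>. z \<in> box2 \<rho>1 ==> z \<in> box2 \<rho> ==> \<bar>g z\<bar> <= M * \<rho>" and \<rho>1: "\<rho>1 > 0"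
 shows "int_exp G > 0"
  and "\<exists>\<eta>>0. \<eta> <= r \<and> (\<forall>\<epsilon>. 0 < \<epsilon> \<and> \<epsilon> < int_exp G --> SL g \<epsilon> (box2 \<eta>))"
proof -
 define A where "A = {\<epsilon>. \<epsilon> > 0 \<and> (\<exists>V. open V \<and> 0 \<in> V \<and> set_integrable lborel V (\<lambda>t. \<bar>G t\<bar> powr (-\<epsilon>)))}"
 have iA: "int_exp G = Sup A" by (simp add: int_exp_def A_def)
 obtain \<epsilon>0 V0 where V0: "\<epsilon>0 > 0" "open V0" "0 \<in> V0" "V0 \<subseteq> box2 r" "SL g \<epsilon>0 V0"
  using uniform_sublevel_nonzero(1)[OF h00 nz] by blast
 have Al: "\<epsilon> \<in> loc_exps" if \<epsilon>A: "\<epsilon> \<in> A" for \<epsilon>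
 proof -
  obtain V where V: "\<epsilon> > 0" "open V" "0 \<in> V" "set_integrable lborel V (\<lambda>t. \<bar>G t\<bar> powr (-\<epsilon>))"
   using \<epsilon>A by (auto simp: A_def)
  show ?thesis by (rule integrable_imp_loc_exp[OF G V0(2-5,1) V(2,3,4,1)])
 qed
 have "\<epsilon>0 \<in> loc_exps" using V0 by (auto simp: loc_exps_def)
 from loc_exp_imp_integrable[OF G this] have ne: "\<epsilon>0/2 \<in> A" using V0(1) by (simp add: A_def)
 have bdd: "bdd_above A" using loc_exps_le[OF M \<rho>1] Al by (intro bdd_aboveI[of _ 2]) auto
 have "\<epsilon>0/2 <= Sup A" by (rule cSup_upper[OF ne bdd])
 then show "int_exp G > 0" using V0(1) iA by simp
 obtain \<eta> where \<eta>: "\<eta> > 0" "\<eta> <= r" "!!\<epsilon>. \<epsilon> > 0 ==> (\<exists>V. open V \<and> 0 \<in> V \<and> V \<subseteq> box2 r \<and> SL g \<epsilon> V) ==> SL g \<epsilon> (box2 \<eta>)"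
  using uniform_sublevel_nonzero(2)[OF h00 nz] by blast
 show "\<exists>\<eta>>0. \<eta> <= r \<and> (\<forall>\<epsilon>. 0 < \<epsilon> \<and> \<epsilon> < int_exp G --> SL g \<epsilon> (box2 \<eta>))"
 proof (intro exI[of _ \<eta>] conjI allI impI \<eta>(1,2))
  fix \<epsilon> assume \<epsilon>: "0 < \<epsilon> \<and> \<epsilon> < int_exp G"
  then obtain \<epsilon>1 where \<epsilon>1: "\<epsilon>1 \<in> A" "\<epsilon> < \<epsilon>1" using less_cSupD[of A \<epsilon>] ne iA by auto
  have "SL g \<epsilon>1 (box2 \<eta>)" using Al[OF \<epsilon>1(1)] by (intro \<eta>(3)) (auto simp: loc_exps_def)
  then show "SL g \<epsilon> (box2 \<eta>)"
   using SL_weaken[of \<epsilon>1 0 \<eta> \<epsilon>] box2_mono[OF \<eta>(2)] \<eta>(1) \<epsilon> \<epsilon>1(2) unfolding box2_rect by simp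
 qed
qed

end

section \<open>Real analytic functions and their local complex extensions\<close>

text \<open>Coordinates are centred at \<open>a\<close>; base points other than the origin serve the
  identity theorem on the ball.\<close>

definition cext :: "(real^2 => real) => real^2 => real => (complex => complex => complex) => bool" where
 "cext g a R k \<longleftrightarrow> R > 0 \<and> hol2 R k \<and> (\<forall>z\<in>box2 R. k (of_real (fst z)) (of_real (snd z)) = of_real (g (a + vec2 z)))"

lemma hol2_mult: "hol2 R k ==> hol2 R l ==> hol2 R (\<lambda>s t. k s t * l s t)"
 unfolding hol2_def by (auto simp: case_prod_unfold intro!: continuous_intros holomorphic_intros)

lemma hol2_diff: "hol2 R k ==> hol2 R l ==> hol2 R (\<lambda>s t. k s t - l s t)"
 unfolding hol2_def by (auto simp: case_prod_unfold intro!: continuous_intros holomorphic_intros)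

lemma hol2_dval:
 assumes bd: "dps_bd c R C" shows "hol2 (R/4) (dval c)"
proof -
 have R: "R > 0" using bd by (rule dps_bd_pos)
 have lt: "norm x < R" if "x \<in> ball 0 (R/4)" for x :: complex
 proof -
  have "norm x < R/4" using that by simp
  then show ?thesis using R by linarith
 qed
 show ?thesis unfolding hol2_def
 proof (intro conjI ballI)
  show "continuous_on (ball 0 (R/4) \<times> ball 0 (R/4)) (\<lambda>(s,t). dval c s t)"
   by (rule continuous_on_subset[OF dval_continuous[OF bd]]) auto
  fix x :: complex assume x: "x \<in> ball 0 (R/4)"
  show "dval c x holomorphic_on ball 0 (R/4)"
   unfolding holomorphic_on_open[OF open_ball] using dval_deriv_y[OF bd lt[OF x] lt] by blast
  show "(\<lambda>s. dval c s x) holomorphic_on ball 0 (R/4)"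
   unfolding holomorphic_on_open[OF open_ball] using dval_deriv_x[OF bd lt lt[OF x]] by blast
 qed
qed

lemma dps_bd_of_real: "dps_bd c R C ==> dps_bd (\<lambda>i j. complex_of_real (c i j)) R C"
 by (simp add: dps_bd_def)

lemma norm_vec2_le: "norm (vec2 z) <= \<bar>fst z\<bar> + \<bar>snd z\<bar>"
 using norm_le_l1_cart[of "vec2 z"] by (simp add: sum_2)

text \<open>Convergence at the corner (R, R) is absolute, so the terms are bounded there, and this
  is the estimate required by \<open>dps_bd\<close>.\<close>

lemma analytic_local:
 assumes g: "real_analytic_on g W" and a: "a \<in> W"
 shows "\<exists>c R C. dps_bd c R C \<and> (\<forall>z\<in>box2 R. g (a + vec2 z) = pval c z)"
proof -
 obtain r c where r: "r > 0" and c: "!!x. x \<in> ball a r ==> ((\<lambda>(i,j). c i j * (x$1 - a$1)^i * (x$2 - a$2)^j) has_sum g x) UNIV"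
  using g a unfolding real_analytic_on_def by blast
 \<comment> \<open>The norm is at most the sum of the coordinates, and 2r/3 < r keeps the closed
   square inside the ball.\<close>
 define R where "R = r / 3"
 have c': "((\<lambda>(i,j). c i j * fst z^i * snd z^j) has_sum g (a + vec2 z)) UNIV" if "\<bar>fst z\<bar> <= R" "\<bar>snd z\<bar> <= R" for z
 proof -
  have "norm (vec2 z) < r" using norm_vec2_le[of z] that r unfolding R_def by linarith
  then have "a + vec2 z \<in> ball a r" by (simp add: dist_norm)
  from c[OF this] show ?thesis by simp
 qed
 let ?f = "\<lambda>(i,j). c i j * R^i * R^j"
 have R: "R > 0" using r by (simp add: R_def)
 have "?f summable_on UNIV" using c'[of "(R,R)"] R by (auto simp: summable_on_def)
 then have ab: "(\<lambda>p. norm (?f p)) summable_on UNIV" using Infinite_Sum.summable_on_iff_abs_summable_on_real by blast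
 have "dps_bd c R (infsum (\<lambda>p. norm (?f p)) UNIV)"
  unfolding dps_bd_def
 proof (intro conjI allI R)
  fix i j
  have "norm (c i j) * R^(i+j) = sum (\<lambda>p. norm (?f p)) {(i,j)}" using R by (simp add: abs_mult power_add)
  also have "... <= infsum (\<lambda>p. norm (?f p)) UNIV" by (rule finite_sum_le_infsum[OF ab]) auto
  finally show "norm (c i j) * R^(i+j) <= infsum (\<lambda>p. norm (?f p)) UNIV" .
 qed
 moreover have "g (a + vec2 z) = pval c z" if "z \<in> box2 R" for z
  using infsumI[OF c'[of z]] that by (simp add: box2_def pval_def dval_def)
 ultimately show ?thesis by blast
qed

lemma partial_local:
 assumes bd: "dps_bd c R C" and g: "!!z. z \<in> box2 \<rho> ==> g (a + vec2 z) = pval c z" and \<rho>: "\<rho> <= R" and z: "z \<in> box2 \<rho>"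
 shows "partial 1 g (a + vec2 z) = pval (dps_dx c) z" "partial 2 g (a + vec2 z) = pval (dps_dy c) z"
proof -
 have zR: "norm (fst z) < R" "norm (snd z) < R" using z \<rho> by (auto simp: box2_def)
 have "((\<lambda>s. dval c (s + fst z) (snd z)) has_field_derivative dval (dps_dx c) (fst z) (snd z)) (at 0)"
  using dval_deriv_x[OF bd zR] DERIV_shift[of "\<lambda>x. dval c x (snd z)" _ 0 "fst z"] by simp
 then have "((\<lambda>s. g (a + vec2 z + s *\<^sub>R axis 1 1)) has_vector_derivative dval (dps_dx c) (fst z) (snd z)) (at 0)"
  unfolding has_real_derivative_iff_has_vector_derivative
 proof (rule has_vector_derivative_transform_within_open[of _ _ _ "{-(\<rho> - \<bar>fst z\<bar>) <..< \<rho> - \<bar>fst z\<bar>}"])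
  fix s assume "s \<in> {-(\<rho> - \<bar>fst z\<bar>) <..< \<rho> - \<bar>fst z\<bar>}"
  then have "(s + fst z, snd z) \<in> box2 \<rho>" using z by (auto simp: box2_def)
  moreover have eq: "a + vec2 z + s *\<^sub>R axis 1 1 = a + vec2 (s + fst z, snd z)" by (simp add: vec_eq_iff forall_2 axis_def)
  ultimately show "dval c (s + fst z) (snd z) = g (a + vec2 z + s *\<^sub>R axis 1 1)"
   using g[of "(s + fst z, snd z)"] unfolding eq by (simp add: pval_def)
 qed (use z in \<open>auto simp: box2_def\<close>)
 from vector_derivative_at[OF this] show "partial 1 g (a + vec2 z) = pval (dps_dx c) z" by (simp add: partial_def pval_def)
 have "((\<lambda>s. dval c (fst z) (s + snd z)) has_field_derivative dval (dps_dy c) (fst z) (snd z)) (at 0)"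
  using dval_deriv_y[OF bd zR] DERIV_shift[of "\<lambda>y. dval c (fst z) y" _ 0 "snd z"] by simp
 then have "((\<lambda>s. g (a + vec2 z + s *\<^sub>R axis 2 1)) has_vector_derivative dval (dps_dy c) (fst z) (snd z)) (at 0)"
  unfolding has_real_derivative_iff_has_vector_derivative
 proof (rule has_vector_derivative_transform_within_open[of _ _ _ "{-(\<rho> - \<bar>snd z\<bar>) <..< \<rho> - \<bar>snd z\<bar>}"])
  fix s assume "s \<in> {-(\<rho> - \<bar>snd z\<bar>) <..< \<rho> - \<bar>snd z\<bar>}"
  then have "(fst z, s + snd z) \<in> box2 \<rho>" using z by (auto simp: box2_def)
  moreover have eq: "a + vec2 z + s *\<^sub>R axis 2 1 = a + vec2 (fst z, s + snd z)" by (simp add: vec_eq_iff forall_2 axis_def)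
  ultimately show "dval c (fst z) (s + snd z) = g (a + vec2 z + s *\<^sub>R axis 2 1)"
   using g[of "(fst z, s + snd z)"] unfolding eq by (simp add: pval_def)
 qed (use z in \<open>auto simp: box2_def\<close>)
 from vector_derivative_at[OF this] show "partial 2 g (a + vec2 z) = pval (dps_dy c) z" by (simp add: partial_def pval_def)
qed

lemma hessian_local:
 assumes bd: "dps_bd c R C" and g: "!!z. z \<in> box2 R ==> g (a + vec2 z) = pval c z" and z: "z \<in> box2 (R/2)"
 shows "hessian_det g (a + vec2 z) = hess c z"
proof -
 have R: "R > 0" using bd by (rule dps_bd_pos)
 have sub: "w \<in> box2 R" if "w \<in> box2 (R/2)" for w using that R box2_mono[of "R/2" R] by auto
 have p: "partial 1 g (a + vec2 w) = pval (dps_dx c) w" "partial 2 g (a + vec2 w) = pval (dps_dy c) w" if "w \<in> box2 (R/2)" for w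
  by (rule partial_local[OF bd g order_refl sub[OF that]]; assumption)+
 note bx = dps_bd_dx[OF bd] and by' = dps_bd_dy[OF bd]
 show ?thesis unfolding hessian_det_def hess_def
  by (simp add: partial_local(1)[OF bx p(1) order_refl z] partial_local(2)[OF by' p(2) order_refl z] partial_local(1)[OF by' p(2) order_refl z])
qed

lemma cext_pval:
 assumes bd: "dps_bd c R C" and g: "!!z. z \<in> box2 R ==> g (a + vec2 z) = pval c z"
 shows "cext g a (R/4) (dval (\<lambda>i j. complex_of_real (c i j)))"
proof -
 have R: "R > 0" using bd by (rule dps_bd_pos)
 have "dval (\<lambda>i j. complex_of_real (c i j)) (of_real (fst z)) (of_real (snd z)) = of_real (g (a + vec2 z))" if "z \<in> box2 (R/4)" for z
 proof -
  have z: "z \<in> box2 R" using that R box2_mono[of "R/4" R] by auto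
  then show ?thesis using dval_of_real[OF bd, of "fst z" "snd z"] g[OF z] by (simp add: box2_def pval_def)
 qed
 then show ?thesis using R hol2_dval[OF dps_bd_of_real[OF bd]] by (simp add: cext_def)
qed

text \<open>The Hessian determinant is a polynomial in second derivatives, each extended by its own
  series of radius \<open>R/4\<close>; passing to a holomorphic function costs another factor
  4.\<close>

lemma cext_hess:
 assumes bd: "dps_bd c R C" and g: "!!z. z \<in> box2 R ==> g (a + vec2 z) = pval c z"
 shows "\<exists>k. cext (hessian_det g) a (R/16) k"
proof -
 have R: "R > 0" using bd by (rule dps_bd_pos)
 define D where "D F = dval (\<lambda>i j. complex_of_real (F i j))" for F
 have bds: "dps_bd (dps_dx (dps_dx c)) (R/4) (C/R/(R/2))" "dps_bd (dps_dx (dps_dy c)) (R/4) (C/R/(R/2))" "dps_bd (dps_dy (dps_dy c)) (R/4) (C/R/(R/2))"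
  using dps_bd_dx[OF dps_bd_dx[OF bd]] dps_bd_dx[OF dps_bd_dy[OF bd]] dps_bd_dy[OF dps_bd_dy[OF bd]] by simp_all
 have hol: "hol2 (R/16) (D F)" if "dps_bd F (R/4) C'" for F C'
  using hol2_dval[OF dps_bd_of_real[OF that]] by (simp add: D_def)
 have val: "D F (of_real (fst z)) (of_real (snd z)) = of_real (pval F z)" if "dps_bd F (R/4) C'" "z \<in> box2 (R/16)" for F C' z
  unfolding D_def pval_def by (rule dval_of_real[OF that(1)]) (use that(2) R in \<open>auto simp: box2_def\<close>)
 let ?k = "\<lambda>s t. D (dps_dx (dps_dx c)) s t * D (dps_dy (dps_dy c)) s t - D (dps_dx (dps_dy c)) s t * D (dps_dx (dps_dy c)) s t"
 have "hol2 (R/16) ?k" by (intro hol2_diff hol2_mult hol[OF bds(1)] hol[OF bds(2)] hol[OF bds(3)])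
 moreover have "?k (of_real (fst z)) (of_real (snd z)) = of_real (hessian_det g (a + vec2 z))" if z: "z \<in> box2 (R/16)" for z
 proof -
  have "z \<in> box2 (R/2)" using z R box2_mono[of "R/16" "R/2"] by auto
  have "hessian_det g (a + vec2 z) = hess c z" by (rule hessian_local[OF bd g \<open>z \<in> box2 (R/2)\<close>])
  then show ?thesis
   by (simp add: val[OF bds(1) z] val[OF bds(2) z] val[OF bds(3) z] hess_def power2_eq_square)
 qed
 ultimately have "cext (hessian_det g) a (R/16) ?k" using R by (simp add: cext_def)
 then show ?thesis by blast
qed

text \<open>Along the complex line through \<open>w\<close> and \<open>z\<close> the extension is
  holomorphic on a convex set containing the parameters 0 and 1, and it vanishes at real parameters
  near 0.\<close>

lemma cext_vanish:
 assumes k: "cext g a R k" and V: "open V" "w \<in> V" "V \<subseteq> box2 R" "!!z. z \<in> V ==> g (a + vec2 z) = 0" and z: "z \<in> box2 R"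
 shows "g (a + vec2 z) = 0"
proof -
 have R: "R > 0" and hk: "hol2 R k" and kv: "!!z. z \<in> box2 R ==> k (of_real (fst z)) (of_real (snd z)) = of_real (g (a + vec2 z))"
  using k by (auto simp: cext_def)
 define m where "m = max (max \<bar>fst w\<bar> \<bar>snd w\<bar>) (max \<bar>fst z\<bar> \<bar>snd z\<bar>)"
 have m: "\<bar>fst w\<bar> <= m" "\<bar>snd w\<bar> <= m" "\<bar>fst z\<bar> <= m" "\<bar>snd z\<bar> <= m" "m < R"
  using subsetD[OF V(3,2)] z by (auto simp: m_def box2_def le_max_iff_disj)
 define \<rho> where "\<rho> = (m + R) / 2"
 have \<rho>: "m < \<rho>" "\<rho> < R" "0 < \<rho>" using m R by (auto simp: \<rho>_def)
 define A where "A t = of_real (fst w) + t * of_real (fst z - fst w)" for t :: complex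
 define B where "B t = of_real (snd w) + t * of_real (snd z - snd w)" for t :: complex
 define U where "U = {t. norm (A t) < \<rho>} \<inter> {t. norm (B t) < \<rho>}"
 have cvx: "convex {t. norm (p + t * q) < \<rho>}" for p q :: complex
 proof -
  have d: "dist (- p) x = norm (p + x)" for x
  proof -
   have "- p - x = - (p + x)" by simp
   then show ?thesis unfolding dist_norm by (simp only: norm_minus_cancel)
  qed
  have "{t. norm (p + t * q) < \<rho>} = (\<lambda>t. t * q) -` ball (- p) \<rho>" by (simp only: vimage_def mem_ball d)
  moreover have "convex ((\<lambda>t. t * q) -` ball (- p) \<rho>)"
   by (rule convex_linear_vimage) (auto intro: linearI simp: algebra_simps)
  ultimately show ?thesis by simp
 qed
 have "convex U" unfolding U_def A_def B_def by (intro convex_Int cvx)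
 then have conn: "connected U" by (rule convex_connected)
 have oU: "open U" unfolding U_def A_def B_def by (intro open_Int open_Collect_less continuous_intros)
 have hol: "(\<lambda>t. k (A t) (B t)) holomorphic_on U"
  by (rule hol2_compose[OF hk oU _ _ \<rho>(3,2)]) (use \<rho> in \<open>auto simp: U_def A_def[abs_def] B_def[abs_def] intro!: holomorphic_intros\<close>)
 have U01: "0 \<in> U" "1 \<in> U" using m \<rho> by (auto simp: U_def A_def B_def)
 have "continuous_on UNIV (\<lambda>t::real. w + t *\<^sub>R (z - w))" by (intro continuous_intros)
 then have "open ((\<lambda>t::real. w + t *\<^sub>R (z - w)) -` V)" using V(1) by (intro open_vimage)
 moreover have "0 \<in> (\<lambda>t::real. w + t *\<^sub>R (z - w)) -` V" using V(2) by simp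
 ultimately obtain e where e: "e > 0" "ball 0 e \<subseteq> (\<lambda>t::real. w + t *\<^sub>R (z - w)) -` V" using open_contains_ball by blast
 obtain e' where e': "e' > 0" "ball 0 e' \<subseteq> U" using oU U01(1) open_contains_ball by blast
 define T where "T = complex_of_real ` ball 0 (min e e')"
 have Tz: "k (A t) (B t) = 0" if tT: "t \<in> T" for t
 proof -
  obtain x where x: "t = of_real x" "\<bar>x\<bar> < e" using tT by (auto simp: T_def)
  have v: "w + x *\<^sub>R (z - w) \<in> V" using e(2) x by auto
  have "k (A t) (B t) = of_real (g (a + vec2 (w + x *\<^sub>R (z - w))))"
   using kv[of "w + x *\<^sub>R (z - w)"] V(3) v x by (auto simp: A_def B_def)
  then show ?thesis using V(4)[OF v] by simp
 qed
 have "k (A 1) (B 1) = 0"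
 proof (rule analytic_continuation[OF hol oU conn _ U01(1) _ Tz U01(2)])
  show "T \<subseteq> U" using e'(2) by (auto simp: T_def)
  show "0 islimpt T" unfolding islimpt_approachable
  proof (intro allI impI)
   fix d :: real assume d: "d > 0"
   have "of_real (min d (min e e') / 2) \<in> T" using d e e' unfolding T_def by (intro imageI) auto
   moreover have "norm (complex_of_real (min d (min e e') / 2)) < d" unfolding norm_of_real using d e e' by auto
   moreover have "complex_of_real (min d (min e e') / 2) ~= 0" unfolding of_real_eq_0_iff using d e e' by auto
   ultimately show "\<exists>x'\<in>T. x' ~= 0 \<and> dist x' 0 < d" by (intro bexI[of _ "complex_of_real (min d (min e e') / 2)"]) (simp_all del: of_real_divide)
  qed
 qed
 then show ?thesis using kv[OF z] by (simp add: A_def B_def)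
qed

text \<open>Identity theorem by connectedness: by \<open>cext_vanish\<close>, points of the ball
  outside the interior of the zero set have neighbourhoods disjoint from that interior. It is needed
  because a nonzero value is given only somewhere in the ball, whereas exponents concern the germ at
  the origin.\<close>

lemma germ_nonzero:
 fixes g :: "real^2 => real"
 assumes ext: "!!a. a \<in> ball 0 r ==> \<exists>R k. cext g a R k" and r: "r > 0" and b: "b \<in> ball 0 r" "g b ~= 0" and \<rho>: "\<rho> > 0"
 shows "\<exists>z\<in>box2 \<rho>. g (vec2 z) ~= 0"
proof (rule ccontr)
 assume a: "\<not> ?thesis"
 define N where "N a R = {x. unvec2 (x - a) \<in> box2 R}" for a R
 have oN: "open (N a R)" for a R
 proof -
  have "continuous_on UNIV (\<lambda>x. unvec2 (x - a))" by (intro continuous_intros)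
  then have "open ((\<lambda>x. unvec2 (x - a)) -` box2 R)" by (intro open_vimage open_box2)
  then show ?thesis by (simp add: N_def vimage_def)
 qed
 have cN: "a \<in> N a R" if "R > 0" for a R using that by (simp add: N_def unvec2_def box2_def)
 define U where "U = interior {x. g x = 0}"
 obtain R where R: "!!a. a \<in> ball 0 r ==> \<exists>k. cext g a (R a) k" using ext by metis
 define V where "V = (\<Union>a\<in>ball 0 r - U. N a (R a))"
 have oV: "open V" unfolding V_def using oN by blast
 have oU: "open U" by (simp add: U_def)
 have disj: "U \<inter> V = {}"
 proof (rule ccontr)
  assume "U \<inter> V ~= {}"
  then obtain x p where x: "x \<in> U" and p: "p \<in> ball 0 r" "p \<notin> U" "x \<in> N p (R p)" by (auto simp: V_def)
  obtain k where k: "cext g p (R p) k" using R[OF p(1)] by blast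
  define O' where "O' = (\<lambda>z. p + vec2 z) -` U \<inter> box2 (R p)"
  have "continuous_on UNIV (\<lambda>z. p + vec2 z)" by (intro continuous_intros)
  then have oO: "open O'" unfolding O'_def using oU by (intro open_Int open_vimage open_box2)
  have O'sub: "O' \<subseteq> box2 (R p)" by (simp add: O'_def)
  have xO: "unvec2 (x - p) \<in> O'" using x p by (simp add: O'_def N_def)
  have zO: "g (p + vec2 z) = 0" if "z \<in> O'" for z
   using that interior_subset[of "{x. g x = 0}"] by (auto simp: O'_def U_def)
  have van: "g (p + vec2 z) = 0" if "z \<in> box2 (R p)" for z
   by (rule cext_vanish[OF k oO xO O'sub zO that])
  have "N p (R p) \<subseteq> {x. g x = 0}"
  proof
   fix y assume "y \<in> N p (R p)"
   then have "g (p + vec2 (unvec2 (y - p))) = 0" by (intro van) (simp add: N_def)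
   then show "y \<in> {x. g x = 0}" by simp
  qed
  then have "N p (R p) \<subseteq> U" unfolding U_def by (rule interior_maximal[OF _ oN])
  then show False using p cN[of "R p" p] k by (auto simp: cext_def)
 qed
 have cover: "ball 0 r \<subseteq> U \<union> V"
 proof
  fix p :: "real^2" assume p: "p \<in> ball 0 r"
  have "R p > 0" using R[OF p] by (auto simp: cext_def)
  from cN[OF this, of p] show "p \<in> U \<union> V" unfolding V_def using p by blast
 qed
 have "N 0 \<rho> \<subseteq> {x. g x = 0}"
 proof
  fix x assume "x \<in> N 0 \<rho>"
  then have "g (vec2 (unvec2 x)) = 0" using a by (auto simp: N_def simp del: vec2_unvec2)
  then show "x \<in> {x. g x = 0}" by simp
 qed
 then have "N 0 \<rho> \<subseteq> U" unfolding U_def by (rule interior_maximal[OF _ oN])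
 then have "U \<inter> ball 0 r ~= {}" using cN[OF \<rho>, of 0] r by auto
 then have "V \<inter> ball 0 r = {}" using connectedD[OF connected_ball oU oV, of 0 r] disj cover by auto
 then have "b \<in> U" using b(1) cover by blast
 then show False using b(2) interior_subset[of "{x. g x = 0}"] by (auto simp: U_def)
qed

text \<open>Lipschitz bounds at the origin, where the functions vanish; they provide the growth
  hypothesis of \<open>loc_exps_le\<close>.\<close>

lemma pval_growth:
 assumes bd: "dps_bd c R C"
 shows "pval c 0 = 0 ==> \<exists>M>0. \<forall>z \<rho>. z \<in> box2 (R/16) \<and> z \<in> box2 \<rho> --> \<bar>pval c z\<bar> <= M * \<rho>"
  and "hess c 0 = 0 ==> \<exists>M>0. \<forall>z \<rho>. z \<in> box2 (R/16) \<and> z \<in> box2 \<rho> --> \<bar>hess c z\<bar> <= M * \<rho>"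
proof -
 have R: "R > 0" using bd by (rule dps_bd_pos)
 obtain L where L: "L >= 1" "!!F z. F \<in> diff_ops ==> z \<in> box2 (R/16) ==> \<bar>pval (F c) z\<bar> <= L"
  "!!F z z'. F \<in> diff_ops ==> z \<in> box2 (R/16) ==> z' \<in> box2 (R/16) ==> \<bar>pval (F c) z - pval (F c) z'\<bar> <= L * dist z z'"
  "!!F z N. F \<in> diff_ops ==> z \<in> box2 (R/16) ==> \<bar>pval (F c) z - pval (F (dps_trunc N c)) z\<bar> <= L / 2^N"
  using pval_uniform_bounds[OF bd] by blast
 have z0: "(0 :: plane) \<in> box2 (R/16)" using R by (simp add: box2_def)
 have d: "\<bar>pval (F c) z - pval (F c) 0\<bar> <= 2 * L * \<rho>" if "F \<in> diff_ops" "z \<in> box2 (R/16)" "z \<in> box2 \<rho>" for F z \<rho>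
 proof -
  have "dist z 0 <= 2 * \<rho>" using norm_pair_le[of "fst z" "snd z"] that(3) by (simp add: box2_def)
  then have "L * dist z 0 <= L * (2 * \<rho>)" using L(1) by (intro mult_left_mono) auto
  then show ?thesis using L(3)[OF that(1,2) z0] by (simp add: mult_ac)
 qed
 show "\<exists>M>0. \<forall>z \<rho>. z \<in> box2 (R/16) \<and> z \<in> box2 \<rho> --> \<bar>pval c z\<bar> <= M * \<rho>" if "pval c 0 = 0"
 proof (intro exI[of _ "2 * L"] conjI allI impI)
  fix z \<rho> assume "z \<in> box2 (R/16) \<and> z \<in> box2 \<rho>"
  then show "\<bar>pval c z\<bar> <= 2 * L * \<rho>" using d[OF diff_ops_mem(1), of z \<rho>] that by simp
 qed (use L in simp)
 show "\<exists>M>0. \<forall>z \<rho>. z \<in> box2 (R/16) \<and> z \<in> box2 \<rho> --> \<bar>hess c z\<bar> <= M * \<rho>" if h0: "hess c 0 = 0"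
 proof (intro exI[of _ "8 * L\<^sup>2"] conjI allI impI)
  fix z \<rho> assume z: "z \<in> box2 (R/16) \<and> z \<in> box2 \<rho>"
  define a where "a z = pval (dps_dx (dps_dx c)) z" for z
  define b where "b z = pval (dps_dx (dps_dy c)) z" for z
  define e where "e z = pval (dps_dy (dps_dy c)) z" for z
  have ds: "\<bar>a z - a 0\<bar> <= 2 * L * \<rho>" "\<bar>b z - b 0\<bar> <= 2 * L * \<rho>" "\<bar>e z - e 0\<bar> <= 2 * L * \<rho>"
   using d[OF diff_ops_mem(4), of z \<rho>] d[OF diff_ops_mem(5), of z \<rho>] d[OF diff_ops_mem(6), of z \<rho>] z by (auto simp: a_def b_def e_def)
  have bs: "\<bar>a 0\<bar> <= L" "\<bar>e z\<bar> <= L" "\<bar>b z + b 0\<bar> <= 2 * L"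
   using L(2)[OF diff_ops_mem(4) z0] L(2)[OF diff_ops_mem(6), of z] L(2)[OF diff_ops_mem(5), of z] L(2)[OF diff_ops_mem(5) z0] z
   by (auto simp: a_def b_def e_def)
  \<comment> \<open>Products are expanded around their values at 0, the square as a difference of
    squares.\<close>
  have "hess c z = (a z - a 0) * e z + a 0 * (e z - e 0) - (b z - b 0) * (b z + b 0) + hess c 0"
   by (simp add: hess_def a_def b_def e_def algebra_simps power2_eq_square)
  then have "\<bar>hess c z\<bar> <= \<bar>a z - a 0\<bar> * \<bar>e z\<bar> + \<bar>a 0\<bar> * \<bar>e z - e 0\<bar> + \<bar>b z - b 0\<bar> * \<bar>b z + b 0\<bar>"
   unfolding h0 abs_mult[symmetric] by linarith
  also have "... <= (2 * L * \<rho>) * L + L * (2 * L * \<rho>) + (2 * L * \<rho>) * (2 * L)"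
   using ds bs L(1) by (intro add_mono mult_mono) (auto intro: order_trans[OF abs_ge_zero])
  finally show "\<bar>hess c z\<bar> <= 8 * L\<^sup>2 * \<rho>" by (simp add: power2_eq_square algebra_simps)
 qed (use L in simp)
qed

text \<open>The extension at the origin brings \<open>g\<close> into the setting of
  \<open>int_exp_sublevel\<close>. The positivity is used for \<open>S\<close> and for its Hessian
  determinant, the uniform square for the Hessian determinant.\<close>

theorem analytic_sublevel:
 fixes g :: "real^2 => real"
 assumes ext: "!!a. a \<in> ball 0 r ==> \<exists>R k. cext g a R k" and r: "r > 0" and b: "\<exists>b\<in>ball 0 r. g b ~= 0" and g0: "g 0 = 0"
  and M: "M > 0" "!!z \<rho>. z \<in> box2 \<rho>1 ==> z \<in> box2 \<rho> ==> \<bar>g (vec2 z)\<bar> <= M * \<rho>" and \<rho>1: "\<rho>1 > 0"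
 shows "int_exp g > 0"
  and "\<exists>\<eta>>0. \<forall>\<eta>' \<epsilon>. 0 < \<eta>' \<and> \<eta>' <= \<eta> \<and> 0 < \<epsilon> \<and> \<epsilon> < int_exp g --> SL (\<lambda>z. g (vec2 z)) \<epsilon> (box2 \<eta>')"
proof -
 obtain R k where "cext g 0 R k" using ext[of 0] r by auto
 then have R: "R > 0" and hk: "hol2 R k" and kv: "!!z. z \<in> box2 R ==> k (of_real (fst z)) (of_real (snd z)) = of_real (g (vec2 z))"
  by (auto simp: cext_def)
 interpret K: real_hol2 R k
 proof
  fix s t :: real assume "\<bar>s\<bar> < R" "\<bar>t\<bar> < R"
  then show "k (of_real s) (of_real t) \<in> \<real>" using kv[of "(s,t)"] by (simp add: box2_def)
 qed (use R hk in auto)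
 have Kg: "g (vec2 z) = K.g z" if "z \<in> box2 R" for z using kv[OF that] by (simp add: K.g_Re)
 have k00: "k 0 0 = 0" using kv[of 0] R g0 linear_0[OF linear_vec2] by (simp add: box2_def)
 obtain b' where b': "b' \<in> ball 0 r" "g b' ~= 0" using b by blast
 have nz: "\<exists>z\<in>box2 R. K.g z ~= 0" using germ_nonzero[OF ext r b' R] Kg by auto
 have gr: "\<bar>K.g z\<bar> <= M * \<rho>" if "z \<in> box2 (min \<rho>1 R)" "z \<in> box2 \<rho>" for z \<rho>
  using M(2)[OF subsetD[OF box2_mono[OF min.cobounded1] that(1)] that(2)] Kg[OF subsetD[OF box2_mono[OF min.cobounded2] that(1)]] by simp
 have pos: "min \<rho>1 R > 0" using \<rho>1 R by simp
 note main = K.int_exp_sublevel[OF k00 nz Kg M(1) gr pos]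
 show "int_exp g > 0" by (rule main(1))
 obtain \<eta> where \<eta>: "\<eta> > 0" "\<eta> <= R" "!!\<epsilon>. 0 < \<epsilon> \<and> \<epsilon> < int_exp g ==> SL K.g \<epsilon> (box2 \<eta>)" using main(2) by blast
 show "\<exists>\<eta>>0. \<forall>\<eta>' \<epsilon>. 0 < \<eta>' \<and> \<eta>' <= \<eta> \<and> 0 < \<epsilon> \<and> \<epsilon> < int_exp g --> SL (\<lambda>z. g (vec2 z)) \<epsilon> (box2 \<eta>')"
 proof (rule exI[of _ \<eta>], intro conjI allI impI \<eta>(1))
  fix \<eta>' \<epsilon> assume a: "0 < \<eta>' \<and> \<eta>' <= \<eta> \<and> 0 < \<epsilon> \<and> \<epsilon> < int_exp g"
  have sub: "box2 \<eta>' \<subseteq> box2 \<eta>" "box2 \<eta> \<subseteq> box2 R" using a \<eta> by (auto intro!: box2_mono)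
  have "SL K.g \<epsilon> (box2 \<eta>')" using K.SL_mono[OF \<eta>(3) sub(1) open_box2 sub(2)] a by simp
  moreover have "{z\<in>box2 \<eta>'. \<bar>g (vec2 z)\<bar> < \<delta>} = {z\<in>box2 \<eta>'. \<bar>K.g z\<bar> < \<delta>}" for \<delta> using Kg sub by auto
  ultimately show "SL (\<lambda>z. g (vec2 z)) \<epsilon> (box2 \<eta>')" unfolding SL_def by simp
 qed
qed

lemma pval_continuous:
 assumes bd: "dps_bd c R C" and F: "F \<in> diff_ops"
 shows "continuous_on (box2 (R/16)) (pval (F c))"
proof -
 obtain L where L: "L >= 1" "!!F z. F \<in> diff_ops ==> z \<in> box2 (R/16) ==> \<bar>pval (F c) z\<bar> <= L"
  "!!F z z'. F \<in> diff_ops ==> z \<in> box2 (R/16) ==> z' \<in> box2 (R/16) ==> \<bar>pval (F c) z - pval (F c) z'\<bar> <= L * dist z z'"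
  "!!F z N. F \<in> diff_ops ==> z \<in> box2 (R/16) ==> \<bar>pval (F c) z - pval (F (dps_trunc N c)) z\<bar> <= L / 2^N"
  using pval_uniform_bounds[OF bd] by blast
 have "L-lipschitz_on (box2 (R/16)) (pval (F c))"
  using L(1) L(3)[OF F] by (intro lipschitz_onI) (auto simp: dist_real_def)
 then show ?thesis by (rule lipschitz_on_continuous_on)
qed

section \<open>The graph over a small square as an instance of the incidence argument\<close>

text \<open>Cutting the functions to 0 outside the square makes them Borel measurable on the plane
  and changes nothing in the conditions, which only involve parameters in the square. The bound
  \<open>R/32\<close> is the domain of the fibre counts, and 1/4 keeps the area below 1.\<close>

lemma surf_box2:
 assumes bd: "dps_bd c R C" and \<rho>: "0 < \<rho>" "\<rho> <= R/32" "\<rho> <= 1/4"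
 shows "surf (box2 \<rho>) (\<lambda>t. if t \<in> box2 \<rho> then pval c t else 0) (\<lambda>t. if t \<in> box2 \<rho> then grad c t else 0)
  (\<lambda>t. if t \<in> box2 \<rho> then hess c t else 0)"
proof -
 have R: "R > 0" using bd by (rule dps_bd_pos)
 define Q where "Q = box2 \<rho>"
 have QR: "Q \<subseteq> box2 (R/32)" "Q \<subseteq> box2 (R/16)" using \<rho> R by (auto simp: Q_def box2_def)
 have Q [measurable]: "Q \<in> sets borel" unfolding Q_def using open_box2 by simp
 have cut: "(\<lambda>t. if t \<in> Q then f t else 0) \<in> borel_measurable borel" if "continuous_on (box2 (R/16)) f" for f :: "plane => 'b::{zero,topological_space}"
  by (intro borel_measurable_continuous_on_if continuous_on_subset[OF that]) (use QR in auto)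
 have pc: "continuous_on (box2 (R/16)) (pval c)" "continuous_on (box2 (R/16)) (pval (dps_dx c))" "continuous_on (box2 (R/16)) (pval (dps_dy c))"
  "continuous_on (box2 (R/16)) (pval (dps_dx (dps_dx c)))" "continuous_on (box2 (R/16)) (pval (dps_dx (dps_dy c)))" "continuous_on (box2 (R/16)) (pval (dps_dy (dps_dy c)))"
  using diff_ops_mem[THEN pval_continuous[OF bd]] by simp_all
 define s where "s t = (if t \<in> Q then pval c t else 0)" for t
 define G where "G t = (if t \<in> Q then grad c t else 0)" for t
 define h where "h t = (if t \<in> Q then hess c t else 0)" for t
 have s [measurable]: "s \<in> borel_measurable borel" unfolding s_def[abs_def] by (rule cut[OF pc(1)])
 have G [measurable]: "G \<in> borel_measurable borel" unfolding G_def[abs_def]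
  by (rule cut) (unfold grad_def[abs_def], intro continuous_intros pc)
 have h [measurable]: "h \<in> borel_measurable borel" unfolding h_def[abs_def]
  by (rule cut) (unfold hess_def[abs_def], intro continuous_intros pc)
 have cb: "cball z (R/32) \<subseteq> box2 (R/16)" if "z \<in> Q" for z
  by (rule cball_box2[of z "R/32"]) (use that QR R in auto)
 have R32: "R/32 > 0" using R by simp
 obtain L where L: "L >= 1"
  "C1_pair L (box2 (R/16)) (grad c) (pval (dps_dx (dps_dx c))) (pval (dps_dx (dps_dy c))) (pval (dps_dx (dps_dy c))) (pval (dps_dy (dps_dy c)))"
  "!!a b. C1_pair L {z. z \<in> box2 (R/16) \<and> z - a \<in> box2 (R/16) \<and> z - b \<in> box2 (R/16)} (chord_map c a b)
    (\<lambda>z. pval (dps_dx c) z - pval (dps_dx c) (z - a)) (\<lambda>z. pval (dps_dy c) z - pval (dps_dy c) (z - a))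
    (\<lambda>z. pval (dps_dx c) z - pval (dps_dx c) (z - b)) (\<lambda>z. pval (dps_dy c) z - pval (dps_dy c) (z - b))"
  "!!\<epsilon>. \<epsilon> > 0 ==> \<exists>M. \<forall>\<kappa>. 0 < \<kappa> \<and> \<kappa> <= 1 --> (\<exists>n. real n <= M * \<kappa> powr (-\<epsilon>) \<and>
   (\<forall>q. finite (grad_fibre c R \<kappa> q) \<and>
      card (grad_fibre c R \<kappa> q) <= n) \<and>
   (\<forall>a b q. finite (chord_fibre c R \<kappa> a b q) \<and>
      card (chord_fibre c R \<kappa> a b q) <= n))"
  using hypersurface_multiplicity[OF bd] by blast
 have sub: "finite A \<and> card A <= n" if "A \<subseteq> B" "finite B \<and> card B <= n" for A B :: "(plane) set" and n
  using that card_mono[of B A] finite_subset[of A B] by simp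
 have "surf Q s G h"
 proof
  show "vol Q <= 1"
  proof -
   have "Q = {-\<rho><..<\<rho>} \<times> {-\<rho><..<\<rho>}" by (auto simp: Q_def box2_def abs_less_iff)
   then have "vol Q = ennreal (4 * \<rho>\<^sup>2)" using \<rho> by (simp add: emeasure_lborel_Times ennreal_mult[symmetric] power2_eq_square)
   also have "... <= ennreal 1" using power_mono[OF \<rho>(3), of 2] \<rho> by (intro ennreal_leI) (simp add: power2_eq_square)
   finally show ?thesis by simp
  qed
  fix \<epsilon> :: real assume "\<epsilon> > 0"
  from L(4)[OF this] obtain M where M: "\<forall>\<kappa>. 0 < \<kappa> \<and> \<kappa> <= 1 --> (\<exists>n. real n <= M * \<kappa> powr (-\<epsilon>) \<and>
   (\<forall>q. finite (grad_fibre c R \<kappa> q) \<and>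
      card (grad_fibre c R \<kappa> q) <= n) \<and>
   (\<forall>a b q. finite (chord_fibre c R \<kappa> a b q) \<and>
      card (chord_fibre c R \<kappa> a b q) <= n))" ..
  show "\<exists>M. \<forall>\<kappa>. 0 < \<kappa> \<and> \<kappa> <= 1 --> (\<exists>n::nat. real n <= M * \<kappa> powr (-\<epsilon>) \<and>
   (\<forall>B\<in>sets borel. ennreal \<kappa> * vol {t\<in>Q. \<kappa> <= \<bar>h t\<bar> \<and> G t \<in> B} <= of_nat n * vol B) \<and>
   (\<forall>a b. \<forall>B\<in>sets borel. ennreal \<kappa> * vol {t\<in>Q. t - a \<in> Q \<and> t - b \<in> Q \<and>
     \<kappa> <= \<bar>det2 (G t - G (t - a)) (G t - G (t - b))\<bar> \<and> (s t - s (t - a), s t - s (t - b)) \<in> B}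
     <= of_nat n * vol B))"
  proof (rule exI[of _ M], intro allI impI)
   fix \<kappa> :: real assume \<kappa>: "0 < \<kappa> \<and> \<kappa> <= 1"
   then obtain n where n: "real n <= M * \<kappa> powr (-\<epsilon>)"
    and n1: "!!q. finite (grad_fibre c R \<kappa> q) \<and>
      card (grad_fibre c R \<kappa> q) <= n"
    and n2: "!!a b q. finite (chord_fibre c R \<kappa> a b q) \<and>
      card (chord_fibre c R \<kappa> a b q) <= n"
    using M[rule_format, OF \<kappa>] by (elim exE conjE) blast
   show "\<exists>n::nat. real n <= M * \<kappa> powr (-\<epsilon>) \<and>
   (\<forall>B\<in>sets borel. ennreal \<kappa> * vol {t\<in>Q. \<kappa> <= \<bar>h t\<bar> \<and> G t \<in> B} <= of_nat n * vol B) \<and>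
   (\<forall>a b. \<forall>B\<in>sets borel. ennreal \<kappa> * vol {t\<in>Q. t - a \<in> Q \<and> t - b \<in> Q \<and>
     \<kappa> <= \<bar>det2 (G t - G (t - a)) (G t - G (t - b))\<bar> \<and> (s t - s (t - a), s t - s (t - b)) \<in> B}
     <= of_nat n * vol B)"
   proof (rule exI[of _ n], intro conjI allI ballI n)
    fix B :: "(plane) set" assume B: "B \<in> sets borel"
    define A where "A = {t\<in>Q. \<kappa> <= \<bar>h t\<bar>}"
    have A: "A \<in> sets borel" unfolding A_def by measurable
    have Ah: "t \<in> A \<longleftrightarrow> t \<in> Q \<and> \<kappa> <= \<bar>hess c t\<bar>" for t by (auto simp: A_def h_def)
    have "ennreal \<kappa> * vol (A \<inter> grad c -` B) <= of_nat n * vol B"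
    proof (rule multiplicity_change_of_variables(2)[OF L(2) A R32 _ _ _ _ B])
     show "cball z (R/32) \<subseteq> box2 (R/16)" if "z \<in> A" for z using cb that Ah by blast
     show "0 < \<kappa>" using \<kappa> by simp
     show "\<kappa> <= \<bar>pval (dps_dx (dps_dx c)) z * pval (dps_dy (dps_dy c)) z - pval (dps_dx (dps_dy c)) z * pval (dps_dx (dps_dy c)) z\<bar>" if "z \<in> A" for z
      using that unfolding Ah by (simp add: hess_def power2_eq_square)
     show "finite {z\<in>A. grad c z = q} \<and> card {z\<in>A. grad c z = q} <= n" for q
      by (rule sub[OF _ n1[of q]]) (use Ah QR in auto)
    qed
    moreover have "A \<inter> grad c -` B = {t\<in>Q. \<kappa> <= \<bar>h t\<bar> \<and> G t \<in> B}" by (auto simp: A_def G_def)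
    ultimately show "ennreal \<kappa> * vol {t\<in>Q. \<kappa> <= \<bar>h t\<bar> \<and> G t \<in> B} <= of_nat n * vol B" by simp
   next
    fix a b :: "plane" and B :: "(plane) set" assume B: "B \<in> sets borel"
    define A where "A = {t\<in>Q. t - a \<in> Q \<and> t - b \<in> Q \<and> \<kappa> <= \<bar>det2 (G t - G (t - a)) (G t - G (t - b))\<bar>}"
    have A: "A \<in> sets borel" unfolding A_def det2_def by measurable
    have Ah: "t \<in> A \<longleftrightarrow> t \<in> Q \<and> t - a \<in> Q \<and> t - b \<in> Q \<and> \<kappa> <= \<bar>det2 (grad c t - grad c (t - a)) (grad c t - grad c (t - b))\<bar>" for t
     by (auto simp: A_def G_def)
    have "ennreal \<kappa> * vol (A \<inter> chord_map c a b -` B) <= of_nat n * vol B"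
    proof (rule multiplicity_change_of_variables(2)[OF L(3)[of a b] A R32 _ _ _ _ B])
     show "cball z (R/32) \<subseteq> {z. z \<in> box2 (R/16) \<and> z - a \<in> box2 (R/16) \<and> z - b \<in> box2 (R/16)}" if "z \<in> A" for z
     proof
      fix y assume y: "y \<in> cball z (R/32)"
      then have "y - a \<in> cball (z - a) (R/32)" "y - b \<in> cball (z - b) (R/32)" by (auto simp: dist_norm)
      then show "y \<in> {z. z \<in> box2 (R/16) \<and> z - a \<in> box2 (R/16) \<and> z - b \<in> box2 (R/16)}"
       using cb[of z] cb[of "z - a"] cb[of "z - b"] \<open>z \<in> A\<close> y unfolding Ah by blast
     qed
     show "0 < \<kappa>" using \<kappa> by simp
     show "\<kappa> <= \<bar>(pval (dps_dx c) z - pval (dps_dx c) (z - a)) * (pval (dps_dy c) z - pval (dps_dy c) (z - b))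
       - (pval (dps_dy c) z - pval (dps_dy c) (z - a)) * (pval (dps_dx c) z - pval (dps_dx c) (z - b))\<bar>" if "z \<in> A" for z
      using that unfolding Ah by (simp add: det2_def grad_def)
     show "finite {z\<in>A. chord_map c a b z = q} \<and> card {z\<in>A. chord_map c a b z = q} <= n" for q
     proof (rule sub[OF _ n2[of a b q]], rule subsetI)
      fix z assume "z \<in> {z\<in>A. chord_map c a b z = q}"
      then show "z \<in> (chord_fibre c R \<kappa> a b q)"
       using subsetD[OF QR(1)] by (simp add: Ah)
     qed
    qed
    moreover have "A \<inter> chord_map c a b -` B = {t\<in>Q. t - a \<in> Q \<and> t - b \<in> Q \<and>
     \<kappa> <= \<bar>det2 (G t - G (t - a)) (G t - G (t - b))\<bar> \<and> (s t - s (t - a), s t - s (t - b)) \<in> B}"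
     by (rule set_eqI) (simp add: A_def s_def chord_map_def conj_ac cong: conj_cong)
    ultimately show "ennreal \<kappa> * vol {t\<in>Q. t - a \<in> Q \<and> t - b \<in> Q \<and>
     \<kappa> <= \<bar>det2 (G t - G (t - a)) (G t - G (t - b))\<bar> \<and> (s t - s (t - a), s t - s (t - b)) \<in> B}
     <= of_nat n * vol B" by simp
   qed
  qed
 qed (use Q s G h in simp_all)
 then show ?thesis unfolding s_def[abs_def] G_def[abs_def] h_def[abs_def] Q_def .
qed

section \<open>Passage to \<open>real^3\<close>, Schwartz functions and the operator\<close>

definition vec3 :: "spc => real^3" where "vec3 z = vector [fst (fst z), snd (fst z), snd z]"
definition unvec3 :: "real^3 => spc" where "unvec3 v = ((v$1, v$2), v$3)"

lemma unvec3_vec3 [simp]: "unvec3 (vec3 z) = z" by (simp add: unvec3_def vec3_def)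
lemma vec3_unvec3 [simp]: "vec3 (unvec3 v) = v" by (simp add: unvec3_def vec3_def vec_eq_iff forall_3)
lemma vec3_nth [simp]: "vec3 z $ 1 = fst (fst z)" "vec3 z $ 2 = snd (fst z)" "vec3 z $ 3 = snd z" by (simp_all add: vec3_def)

lemma linear_vec3: "linear vec3" by (rule linearI) (simp_all add: vec_eq_iff forall_3)

lemma continuous_vec3 [continuous_intros]: "continuous_on S f ==> continuous_on S (\<lambda>x. vec3 (f x))"
 by (rule bounded_linear.continuous_on[OF linear_conv_bounded_linear[THEN iffD1, OF linear_vec3]])

lemma vec3_measurable [measurable]: "vec3 \<in> borel_measurable borel"
 using continuous_vec3[of UNIV "\<lambda>x. x"] by (intro borel_measurable_continuous_onI) simp

lemma unvec3_measurable [measurable]: "unvec3 \<in> borel_measurable borel"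
 unfolding unvec3_def[abs_def] by (intro borel_measurable_continuous_onI continuous_intros)

lemma lborel_vec3: "(lborel :: (real^3) measure) = distr lborel borel vec3"
proof (rule lborel_eqI)
 fix l u :: "real^3" assume le: "!!b. b \<in> Basis ==> l \<bullet> b <= u \<bullet> b"
 have le': "l$1 <= u$1" "l$2 <= u$2" "l$3 <= u$3"
  using le[of "axis 1 1"] le[of "axis 2 1"] le[of "axis 3 1"] by (auto simp: inner_axis axis_in_Basis_iff)
 have eq: "vec3 -` box l u = ({l$1<..<u$1} \<times> {l$2<..<u$2}) \<times> {l$3<..<u$3}"
  by (auto simp: mem_box_cart forall_3)
 have "emeasure (distr lborel borel vec3) (box l u) = vol (({l$1<..<u$1} \<times> {l$2<..<u$2}) \<times> {l$3<..<u$3})"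
  by (subst emeasure_distr) (auto simp: eq)
 also have "... = ennreal ((u$1 - l$1) * (u$2 - l$2) * (u$3 - l$3))"
  using le' by (simp add: emeasure_lborel_Times borel_Times ennreal_mult[symmetric])
 also have "(u$1 - l$1) * (u$2 - l$2) * (u$3 - l$3) = (\<Prod>i\<in>UNIV. u$i - l$i)"
  unfolding UNIV_3 by (simp add: mult.assoc)
 also have "... = (\<Prod>b\<in>(\<lambda>i. axis i 1) ` UNIV. (u - l) \<bullet> b)"
  by (subst prod.reindex) (auto simp: inj_on_def axis_eq_axis inner_axis)
 also have "(\<lambda>i. axis i 1) ` UNIV = (Basis :: (real^3) set)" by (auto simp: Basis_vec_def)
 finally show "emeasure (distr lborel borel vec3) (box l u) = ennreal (\<Prod>b\<in>Basis. (u - l) \<bullet> b)" .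
qed simp

lemma nn_integral_vec3:
 assumes "f \<in> borel_measurable borel"
 shows "(\<integral>\<^sup>+v. f v \<partial>(lborel :: (real^3) measure)) = (LI z. f (vec3 z))"
 by (subst lborel_vec3, subst nn_integral_distr) (use assms in auto)

lemma nn_integral_inverse_square: "(\<integral>\<^sup>+x. ennreal (1 / (1 + \<bar>x\<bar>)\<^sup>2) \<partial>(lborel :: real measure)) < \<infinity>"
proof -
 define f where "f x = 1 / (1 + \<bar>x\<bar>)\<^sup>2" for x :: real
 have f [measurable]: "f \<in> borel_measurable borel" unfolding f_def[abs_def] by measurable
 have "(LI x. ennreal (f x) * indicator {0..} x) = ennreal (0 - (- 1 / (1 + 0)))"
 proof (rule nn_integral_FTC_atLeast[OF f, of 0 "\<lambda>x. - 1 / (1 + x)"])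
  show "((\<lambda>x::real. - 1 / (1 + x)) has_real_derivative f x) (at x)" if "0 <= x" for x
   using that by (auto intro!: derivative_eq_intros simp: f_def power2_eq_square)
  show "((\<lambda>x::real. - 1 / (1 + x)) \<longlongrightarrow> 0) at_top"
   by (intro tendsto_divide_0[OF tendsto_const] filterlim_at_top_imp_at_infinity filterlim_tendsto_add_at_top[OF tendsto_const filterlim_ident])
 qed (simp add: f_def)
 then have 1: "(LI x. ennreal (f x) * indicator {0..} x) = 1" by simp
 have "(LI x. ennreal (f x)) <= (LI x. ennreal (f x) * indicator {0..} x + ennreal (f (0 - x)) * indicator {0..} (0 - x))"
  by (intro nn_integral_mono) (auto simp: indicator_def f_def)
 also have "... = (LI x. ennreal (f x) * indicator {0..} x) + (LI x. ennreal (f (0 - x)) * indicator {0..} (0 - x))"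
  by (rule nn_integral_add) measurable
 also have "(LI x. ennreal (f (0 - x)) * indicator {0..} (0 - x)) = (LI x. ennreal (f x) * indicator {0..} x)"
  by (rule nn_integral_lborel_reflect[symmetric]) measurable
 finally have "(LI x. ennreal (f x)) <= 1 + 1" unfolding 1 .
 also have "... < \<infinity>" by simp
 finally show ?thesis by (simp add: f_def)
qed

lemma schwartz_continuous: "schwartz f ==> continuous_on UNIV f"
 unfolding schwartz_def smooth_fun_def by (elim conjE) (drule spec[of _ "[]"], simp)

text \<open>Decay of order 6 dominates a product of three inverse squares, and since that product is
  at most 1, its p-th power is no larger.\<close>

lemma schwartz_powr_integrable:
 fixes f :: "real^3 => complex"
 assumes f: "schwartz f" and p: "p >= 1"
 shows "integrable lborel (\<lambda>x. norm (f x) powr p)"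
proof -
 have [measurable]: "f \<in> borel_measurable borel" by (rule borel_measurable_continuous_onI[OF schwartz_continuous[OF f]])
 have "bounded (range (\<lambda>x. (1 + norm x) ^ 6 *\<^sub>R iter_partial [] f x))" using f unfolding schwartz_def by blast
 then obtain D where D: "!!x. norm ((1 + norm x) ^ 6 *\<^sub>R f x) <= D" unfolding bounded_iff by auto
 define P where "P z = 1 / (1 + \<bar>fst (fst z)\<bar>)\<^sup>2 * (1 / (1 + \<bar>snd (fst z)\<bar>)\<^sup>2) * (1 / (1 + \<bar>snd z\<bar>)\<^sup>2)" for z :: "spc"
 have Pm: "(\<lambda>z. ennreal (P z)) \<in> borel_measurable borel" unfolding P_def[abs_def] by measurable
 have le1: "1 / (1 + \<bar>x\<bar>)\<^sup>2 <= 1" for x :: real by (simp add: divide_le_eq_1 power2_eq_square) (simp add: algebra_simps)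
 have P: "0 < P z" "P z <= 1" for z
 proof -
  show "0 < P z" by (simp add: P_def)
  have "P z <= 1 * 1 * 1" unfolding P_def by (intro mult_mono le1) auto
  then show "P z <= 1" by simp
 qed
 have D0: "D >= 0" using D[of 0] norm_ge_zero order_trans by blast
 have fb: "norm (f (vec3 z)) <= D * P z" for z
 proof -
  define n where "n = norm (vec3 z)"
  have n: "\<bar>fst (fst z)\<bar> <= n" "\<bar>snd (fst z)\<bar> <= n" "\<bar>snd z\<bar> <= n"
   using component_le_norm_cart[of "vec3 z" 1] component_le_norm_cart[of "vec3 z" 2] component_le_norm_cart[of "vec3 z" 3] by (simp_all add: n_def)
  have "(1 + \<bar>fst (fst z)\<bar>)\<^sup>2 * (1 + \<bar>snd (fst z)\<bar>)\<^sup>2 * (1 + \<bar>snd z\<bar>)\<^sup>2 <= (1 + n)\<^sup>2 * (1 + n)\<^sup>2 * (1 + n)\<^sup>2"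
   using n by (intro mult_mono power_mono) auto
  also have "... = (1 + n)^6" by (simp add: power_add[symmetric])
  finally have "((1 + \<bar>fst (fst z)\<bar>)\<^sup>2 * (1 + \<bar>snd (fst z)\<bar>)\<^sup>2 * (1 + \<bar>snd z\<bar>)\<^sup>2) * norm (f (vec3 z)) <= (1 + n)^6 * norm (f (vec3 z))"
   by (rule mult_right_mono) simp
  also have "... <= D" using D[of "vec3 z"] by (simp add: n_def)
  finally have "(1 / P z) * norm (f (vec3 z)) <= D" by (simp add: P_def)
  then show ?thesis using P(1)[of z] by (simp add: field_simps)
 qed
 have pw: "norm (f (vec3 z)) powr p <= D powr p * P z" for z
 proof -
  have "norm (f (vec3 z)) powr p <= (D * P z) powr p" using fb p by (intro powr_mono2) auto
  also have "... = D powr p * P z powr p" using D0 P(1)[of z] by (simp add: powr_mult)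
  also have "P z powr p <= P z powr 1" using P[of z] p by (intro powr_mono') auto
  finally show ?thesis using P(1)[of z] by (simp add: mult_left_mono)
 qed
 define J where "J = (\<integral>\<^sup>+x. ennreal (1 / (1 + \<bar>x\<bar>)\<^sup>2) \<partial>(lborel :: real measure))"
 have J: "J < \<infinity>" unfolding J_def by (rule nn_integral_inverse_square)
 have "(LI z. ennreal (P z)) = (LI w. LI s. ennreal (P (w,s)))"
  by (rule nn_integral_lborel_pair[OF Pm])
 also have "... = (LI w. ennreal (1 / (1 + \<bar>fst w\<bar>)\<^sup>2 * (1 / (1 + \<bar>snd w\<bar>)\<^sup>2)) * J)"
  unfolding P_def J_def fst_conv snd_conv
  by (intro nn_integral_cong, subst nn_integral_cmult[symmetric]) (simp_all add: ennreal_mult[symmetric])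
 also have "... = (LI w. ennreal (1 / (1 + \<bar>fst w\<bar>)\<^sup>2 * (1 / (1 + \<bar>snd w\<bar>)\<^sup>2))) * J"
  by (rule nn_integral_multc) measurable
 also have "(LI w. ennreal (1 / (1 + \<bar>fst w\<bar>)\<^sup>2 * (1 / (1 + \<bar>snd w\<bar>)\<^sup>2)))
   = (LI x. LI y. ennreal (1 / (1 + \<bar>x\<bar>)\<^sup>2 * (1 / (1 + \<bar>y\<bar>)\<^sup>2)))"
  by (subst nn_integral_lborel_pair) (simp_all, measurable)
 also have "... = (LI x. ennreal (1 / (1 + \<bar>x\<bar>)\<^sup>2) * J)"
  unfolding J_def by (intro nn_integral_cong, subst nn_integral_cmult[symmetric]) (simp_all add: ennreal_mult[symmetric])
 also have "... = J * J" by (subst nn_integral_multc) (simp_all add: J_def)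
 finally have PJ: "(LI z. ennreal (P z)) = J * J * J" .
 have "(LI x. ennreal (norm (norm (f x) powr p))) = (LI z. ennreal (norm (norm (f (vec3 z)) powr p)))"
  by (rule nn_integral_vec3) measurable
 also have "... <= (LI z. ennreal (D powr p) * ennreal (P z))"
  using pw P by (intro nn_integral_mono) (simp add: ennreal_mult[symmetric] ennreal_leI less_imp_le)
 also have "... = ennreal (D powr p) * (J * J * J)"
  by (subst nn_integral_cmult) (simp_all add: PJ Pm)
 also have "... < \<infinity>" using J by (simp add: ennreal_mult_less_top)
 finally show ?thesis unfolding integrable_iff_bounded by simp
qed

text \<open>If the integrand is not integrable, the left integral is 0 by convention.\<close>

lemma norm_integral_le_nn_integral:
 fixes f :: "'a => complex" shows "ennreal (norm (\<integral>x. f x \<partial>M)) <= (\<integral>\<^sup>+x. ennreal (norm (f x)) \<partial>M)"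
proof (cases "integrable M f")
 case True
 then show ?thesis by (rule integral_norm_bound_ennreal)
qed (simp add: not_integrable_integral_eq)

lemma bump_bounded:
 assumes "bump \<phi>" obtains B where "B > 0" "!!t. \<bar>\<phi> t\<bar> <= B"
proof -
 have c: "continuous_on UNIV \<phi>" using assms unfolding bump_def smooth_fun_def by (elim conjE) (drule spec[of _ "[]"], simp)
 define K where "K = closure {t. \<phi> t ~= 0}"
 have "bounded (\<phi> ` K)"
  using assms c by (intro compact_imp_bounded compact_continuous_image) (auto simp: bump_def K_def intro: continuous_on_subset)
 then obtain B where B: "B > 0" "!!t. t \<in> K ==> norm (\<phi> t) <= B" unfolding bounded_pos by blast
 have "\<bar>\<phi> t\<bar> <= B" for t
 proof (cases "\<phi> t = 0")
  case False
  then have "t \<in> K" using closure_subset[of "{t. \<phi> t ~= 0}"] by (auto simp: K_def)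
  then show ?thesis using B by simp
 qed (use B in simp)
 then show thesis using B that by blast
qed

text \<open>The integrand vanishes where \<phi> does, and elsewhere \<open>S\<close> agrees with
  \<open>s\<close>; bounding the density by \<open>B\<close> leaves the positive operator applied to
  |f|.\<close>

lemma avg_op_le_avg:
 fixes S :: "real^2 => real"
 assumes "surf Q s G h" and B: "B >= 0" "!!t. \<bar>\<phi> t\<bar> <= B" and supp: "!!t. \<phi> t ~= 0 ==> unvec2 t \<in> Q"
  and S: "!!t. unvec2 t \<in> Q ==> S t = s (unvec2 t)"
  and f: "f \<in> borel_measurable borel" and \<phi>: "\<phi> \<in> borel_measurable borel"
 shows "avg_op S \<phi> f \<in> borel_measurable borel"
  and "ennreal (norm (avg_op S \<phi> f x)) <= ennreal B * surf.avg Q s (\<lambda>z. norm (f (vec3 z))) (unvec3 x)"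
proof -
 interpret surf Q s G h by fact
 note [measurable] = f \<phi>
 have eq: "complex_of_real (\<phi> t) * f (vector [x$1 - t$1, x$2 - t$2, x$3 - S t]) = complex_of_real (\<phi> t) * f (vec3 (unvec3 x - gam (unvec2 t)))" for x t
 proof (cases "\<phi> t = 0")
  case False
  from S[OF supp[OF this]] have "vector [x$1 - t$1, x$2 - t$2, x$3 - S t] = vec3 (unvec3 x - gam (unvec2 t))"
   by (simp add: vec3_def unvec3_def gam_def unvec2_def)
  then show ?thesis by simp
 qed simp
 have T: "avg_op S \<phi> f x = (\<integral>t. complex_of_real (\<phi> t) * f (vec3 (unvec3 x - gam (unvec2 t))) \<partial>lborel)" for x
  unfolding avg_op_def eq ..
 have "(\<lambda>x. \<integral>t. complex_of_real (\<phi> t) * f (vec3 (unvec3 x - gam (unvec2 t))) \<partial>lborel) \<in> borel_measurable borel"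
  by (rule lborel.borel_measurable_lebesgue_integral) measurable
 then show "avg_op S \<phi> f \<in> borel_measurable borel" by (simp add: T[abs_def])
 have "ennreal (norm (avg_op S \<phi> f x)) <= (LI t. ennreal (norm (complex_of_real (\<phi> t) * f (vec3 (unvec3 x - gam (unvec2 t))))))"
  unfolding T by (rule norm_integral_le_nn_integral)
 also have "... <= (LI t. ennreal B * (indicator Q (unvec2 t) * ennreal (norm (f (vec3 (unvec3 x - gam (unvec2 t)))))))"
 proof (rule nn_integral_mono)
  fix t
  show "ennreal (norm (complex_of_real (\<phi> t) * f (vec3 (unvec3 x - gam (unvec2 t)))))
   <= ennreal B * (indicator Q (unvec2 t) * ennreal (norm (f (vec3 (unvec3 x - gam (unvec2 t))))))"
  proof (cases "\<phi> t = 0")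
   case False
   have "norm (complex_of_real (\<phi> t) * f (vec3 (unvec3 x - gam (unvec2 t)))) <= B * norm (f (vec3 (unvec3 x - gam (unvec2 t))))"
    using B(2)[of t] by (simp add: norm_mult mult_right_mono)
   then show ?thesis using supp[OF False] B(1) by (simp add: ennreal_mult[symmetric] ennreal_leI)
  qed simp
 qed
 also have "... = (LI t. ennreal B * (indicator Q t * ennreal (norm (f (vec3 (unvec3 x - gam t))))))"
  by (subst nn_integral_vec2) (simp_all, measurable)
 also have "... = ennreal B * avg (\<lambda>z. norm (f (vec3 z))) (unvec3 x)"
  unfolding avg_def by (rule nn_integral_cmult) measurable
 finally show "ennreal (norm (avg_op S \<phi> f x)) <= ennreal B * avg (\<lambda>z. norm (f (vec3 z))) (unvec3 x)" .
qed

text \<open>Homogeneity: \<open>f\<close> is divided by a number c above its norm, which brings it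
  into the class of the normalised bound, and c then decreases to the norm. This also covers the
  case of norm 0.\<close>

lemma avg_op_LpLq:
 fixes S :: "real^2 => real"
 assumes surf: "surf Q s G h" and B: "B > 0" "!!t. \<bar>\<phi> t\<bar> <= B" and supp: "!!t. \<phi> t ~= 0 ==> unvec2 t \<in> Q"
  and S: "!!t. unvec2 t \<in> Q ==> S t = s (unvec2 t)" and \<phi>: "\<phi> \<in> borel_measurable borel"
  and p: "p >= 1" and q: "q > 0" and K: "K > 0"
  and bd: "!!f u. unit_fun p f
   \<and> u \<in> borel_measurable borel \<and> (\<forall>z. 0 <= u z) \<and> (\<forall>z. ennreal (u z) <= surf.avg Q s f z) ==>
   (LI z. ennreal (u z powr q)) <= ennreal K"
 shows "LpLq_bounded p q (avg_op S \<phi>)"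
 unfolding LpLq_bounded_def
proof (rule exI[of _ "K powr (1/q) * B"], intro allI impI)
 interpret surf Q s G h by fact
 fix f :: "real^3 => complex" assume f: "schwartz f"
 have fm [measurable]: "f \<in> borel_measurable borel" by (rule borel_measurable_continuous_onI[OF schwartz_continuous[OF f]])
 have Tm [measurable]: "avg_op S \<phi> f \<in> borel_measurable borel"
  by (rule avg_op_le_avg(1)[OF surf less_imp_le[OF B(1)] B(2) supp S fm \<phi>])
 have Tle: "ennreal (norm (avg_op S \<phi> f x)) <= ennreal B * avg (\<lambda>z. norm (f (vec3 z))) (unvec3 x)" for x
  by (rule avg_op_le_avg(2)[OF surf less_imp_le[OF B(1)] B(2) supp S fm \<phi>])
 define I where "I = (\<integral>x. norm (f x) powr p \<partial>lborel)"
 define N where "N = I powr (1/p)"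
 have I0: "I >= 0" unfolding I_def by simp
 have I: "(LI z. ennreal (norm (f (vec3 z)) powr p)) = ennreal I"
 proof -
  have "(LI z. ennreal (norm (f (vec3 z)) powr p)) = (LI x. ennreal (norm (f x) powr p))"
   by (rule nn_integral_vec3[symmetric]) measurable
  also have "... = ennreal I" unfolding I_def by (rule nn_integral_eq_integral[OF schwartz_powr_integrable[OF f p]]) simp
  finally show ?thesis .
 qed
 have main: "(LI x. ennreal (norm (avg_op S \<phi> f x) powr q)) <= ennreal (K * (B * c) powr q)" if c: "c > N" for c
 proof -
  have N0: "N >= 0" by (simp add: N_def)
  have c0: "c > 0" using c N0 by simp
  define F where "F z = norm (f (vec3 z)) / c" for z
  define u where "u z = norm (avg_op S \<phi> f (vec3 z)) / (B * c)" for z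
  have Fm [measurable]: "F \<in> borel_measurable borel" unfolding F_def[abs_def] by measurable
  have um [measurable]: "u \<in> borel_measurable borel" unfolding u_def[abs_def] by measurable
  have "(LI z. ennreal (F z powr p)) = (LI z. ennreal (1 / c powr p) * ennreal (norm (f (vec3 z)) powr p))"
   using c0 by (intro nn_integral_cong) (simp add: F_def powr_divide ennreal_mult[symmetric])
  also have "... = ennreal (1 / c powr p) * ennreal I" unfolding I[symmetric] by (rule nn_integral_cmult) measurable
  also have "... = ennreal (I / c powr p)" using I0 by (simp add: ennreal_mult[symmetric])
  also have "... <= ennreal 1"
  proof (rule ennreal_leI)
   have "I = N powr p" using I0 p by (simp add: N_def powr_powr)
   also have "... <= c powr p" using c N0 p by (intro powr_mono2) auto
   finally show "I / c powr p <= 1" using c0 by (simp add: divide_le_eq)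
  qed
  finally have FN: "(LI z. ennreal (F z powr p)) <= 1" by simp
  have uF: "ennreal (u z) <= avg F z" for z
  proof -
   have "avg F z = (LI t. ennreal (1/c) * (indicator Q t * ennreal (norm (f (vec3 (z - gam t))))))"
    unfolding avg_def F_def using c0 by (intro nn_integral_cong) (simp add: ennreal_mult[symmetric] indicator_def)
   also have "... = ennreal (1/c) * avg (\<lambda>z. norm (f (vec3 z))) z"
    unfolding avg_def by (rule nn_integral_cmult) measurable
   finally have a: "avg F z = ennreal (1/c) * avg (\<lambda>z. norm (f (vec3 z))) z" .
   have "ennreal (u z) = ennreal (1/(B*c)) * ennreal (norm (avg_op S \<phi> f (vec3 z)))"
    using B c0 by (simp add: u_def ennreal_mult[symmetric])
   also have "... <= ennreal (1/(B*c)) * (ennreal B * avg (\<lambda>z. norm (f (vec3 z))) z)"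
    using Tle[of "vec3 z"] by (intro mult_left_mono) auto
   also have "... = avg F z" using B c0 unfolding a by (simp add: mult.assoc[symmetric] ennreal_mult[symmetric])
   finally show ?thesis .
  qed
  have le: "(LI z. ennreal (u z powr q)) <= ennreal K"
   by (rule bd[of F u]) (use Fm um FN uF c0 B in \<open>auto simp: F_def u_def\<close>)
  have "(LI x. ennreal (norm (avg_op S \<phi> f x) powr q)) = (LI z. ennreal (norm (avg_op S \<phi> f (vec3 z)) powr q))"
   by (rule nn_integral_vec3) measurable
  also have "... = (LI z. ennreal ((B * c) powr q) * ennreal (u z powr q))"
   using B c0 by (intro nn_integral_cong) (simp add: u_def powr_divide ennreal_mult[symmetric])
  also have "... = ennreal ((B * c) powr q) * (LI z. ennreal (u z powr q))" by (rule nn_integral_cmult) measurable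
  also have "... <= ennreal ((B * c) powr q) * ennreal K" by (intro mult_left_mono le) simp
  also have "... = ennreal (K * (B * c) powr q)" using K by (simp add: ennreal_mult[symmetric] mult.commute)
  finally show ?thesis .
 qed
 have int: "integrable lborel (\<lambda>x. norm (avg_op S \<phi> f x) powr q)"
 proof -
  have "(LI x. ennreal (norm (norm (avg_op S \<phi> f x) powr q))) < \<infinity>"
   using main[of "N + 1"] by (simp add: le_less_trans)
  then show ?thesis unfolding integrable_iff_bounded by simp
 qed
 define J where "J = (\<integral>x. norm (avg_op S \<phi> f x) powr q \<partial>lborel)"
 have J0: "J >= 0" unfolding J_def by simp
 have J: "ennreal J = (LI x. ennreal (norm (avg_op S \<phi> f x) powr q))"
  unfolding J_def by (rule nn_integral_eq_integral[OF int, symmetric]) simp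
 have KB: "K powr (1/q) * B > 0" using K B by simp
 have "J powr (1/q) / (K powr (1/q) * B) <= N"
 proof (rule dense_ge)
  fix c assume c: "N < c"
  have c0: "c > 0" using c by (rule le_less_trans[rotated]) (simp add: N_def)
  have "J <= K * (B * c) powr q" using main[OF c] K J0 unfolding J[symmetric] by (simp add: ennreal_le_iff)
  then have "J powr (1/q) <= (K * (B * c) powr q) powr (1/q)" using J0 q by (intro powr_mono2) auto
  also have "... = K powr (1/q) * (B * c)" using K q B c0 by (simp add: powr_mult powr_powr)
  finally show "J powr (1/q) / (K powr (1/q) * B) <= c" using KB by (simp add: pos_divide_le_eq mult_ac)
 qed
 then have "J powr (1/q) <= K powr (1/q) * B * N" using KB by (simp add: pos_divide_le_eq mult_ac)
 then show "integrable lborel (\<lambda>x. norm (avg_op S \<phi> f x) powr q) \<and>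
  (\<integral>x. norm (avg_op S \<phi> f x) powr q \<partial>lborel) powr (1/q) <= K powr (1/q) * B * (\<integral>x. norm (f x) powr p \<partial>lborel) powr (1/p)"
  using int by (simp add: J_def N_def I_def)
qed

text \<open>The square is fixed by the series of \<open>S\<close> at the origin and by the uniform
  sublevel bound for the Hessian determinant, before \<phi>, \<open>p\<close> and \<open>q\<close>
  appear. The exponent of \<open>S\<close> enters by arithmetic alone: the hypothesis on the
  exponents places the given trapezoid inside \<open>pyramid\<close>.\<close>

theorem theorem1p3:
  fixes S :: "real^2 \<Rightarrow> real" and r :: real
  assumes r: "r > 0"
    and analytic: "real_analytic_on S (ball 0 r)"
    and S_nonzero: "\<exists>t\<in>ball 0 r. S t \<noteq> 0"
    and S0: "S 0 = 0"
    and grad0: "partial 1 S 0 = 0" "partial 2 S 0 = 0"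
    and H0: "hessian_det S 0 = 0"
    and H_nonzero: "\<exists>t\<in>ball 0 r. hessian_det S t \<noteq> 0"
    and exps: "2 * int_exp (hessian_det S) / (1 + 2 * int_exp (hessian_det S)) \<ge> int_exp S"
  shows "\<exists>U. open U \<and> 0 \<in> U \<and>
    (\<forall>\<phi>. bump \<phi> \<and> closure {t. \<phi> t \<noteq> 0} \<subseteq> U \<longrightarrow>
      (\<forall>p q::real.
         1/q < 1/p \<and> 1/q > 1/p - int_exp S / (int_exp S + 1) \<and>
         1/q > (1/p) / 3 \<and> 1/q > 3 * (1/p) - 2
         \<longrightarrow> LpLq_bounded p q (avg_op S \<phi>)))"
proof -
 have loc: "\<exists>c R C. dps_bd c R C \<and> (\<forall>z\<in>box2 R. S (a + vec2 z) = pval c z)" if "a \<in> ball 0 r" for a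
  by (rule analytic_local[OF analytic that])
 have extS: "\<exists>R k. cext S a R k" if a: "a \<in> ball 0 r" for a
 proof -
  obtain c R C where c: "dps_bd c R C" "!!z. z \<in> box2 R ==> S (a + vec2 z) = pval c z" using loc[OF a] by blast
  show ?thesis using cext_pval[of c R C S a] c by blast
 qed
 have extH: "\<exists>R k. cext (hessian_det S) a R k" if a: "a \<in> ball 0 r" for a
 proof -
  obtain c R C where c: "dps_bd c R C" "!!z. z \<in> box2 R ==> S (a + vec2 z) = pval c z" using loc[OF a] by blast
  show ?thesis using cext_hess[of c R C S a] c by blast
 qed
 have v0: "vec2 0 = 0" by (rule linear_0[OF linear_vec2])
 obtain c R C where bd: "dps_bd c R C" and Sc': "!!z. z \<in> box2 R ==> S (0 + vec2 z) = pval c z" using loc[of 0] r by auto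
 have R: "R > 0" using bd by (rule dps_bd_pos)
 have Sc: "S (vec2 z) = pval c z" if "z \<in> box2 R" for z using Sc'[OF that] by simp
 have Hc: "hessian_det S (vec2 z) = hess c z" if "z \<in> box2 (R/2)" for z
  using hessian_local[of c R C S 0 z] bd Sc that by simp
 have z0: "(0 :: plane) \<in> box2 x" if "x > 0" for x using that by (simp add: box2_def)
 have S16: "z \<in> box2 R" "z \<in> box2 (R/2)" if "z \<in> box2 (R/16)" for z
  using that R box2_mono[of "R/16" R] box2_mono[of "R/16" "R/2"] by auto
 have p0: "pval c 0 = 0" using Sc[OF z0[OF R]] v0 S0 by simp
 have h0: "hess c 0 = 0" using Hc[OF z0] R v0 H0 by simp
 obtain M1 where M1: "M1 > 0" "\<forall>z \<rho>. z \<in> box2 (R/16) \<and> z \<in> box2 \<rho> --> \<bar>pval c z\<bar> <= M1 * \<rho>" using pval_growth(1)[OF bd p0] by blast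
 obtain M2 where M2: "M2 > 0" "\<forall>z \<rho>. z \<in> box2 (R/16) \<and> z \<in> box2 \<rho> --> \<bar>hess c z\<bar> <= M2 * \<rho>" using pval_growth(2)[OF bd h0] by blast
 have gS: "\<bar>S (vec2 z)\<bar> <= M1 * \<rho>" if "z \<in> box2 (R/16)" "z \<in> box2 \<rho>" for z \<rho> using M1(2)[rule_format, of z \<rho>] that Sc[OF S16(1)[OF that(1)]] by simp
 have gH: "\<bar>hessian_det S (vec2 z)\<bar> <= M2 * \<rho>" if "z \<in> box2 (R/16)" "z \<in> box2 \<rho>" for z \<rho> using M2(2)[rule_format, of z \<rho>] that Hc[OF S16(2)[OF that(1)]] by simp
 have R16: "R/16 > 0" using R by simp
 have etaS: "int_exp S > 0" by (rule analytic_sublevel(1)[OF extS r S_nonzero S0 M1(1) gS R16])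
 define \<eta> where "\<eta> = int_exp (hessian_det S)"
 have etaH: "\<eta> > 0" unfolding \<eta>_def by (rule analytic_sublevel(1)[OF extH r H_nonzero H0 M2(1) gH R16])
 have "\<exists>\<rho>0>0. \<forall>\<eta>' \<epsilon>. 0 < \<eta>' \<and> \<eta>' <= \<rho>0 \<and> 0 < \<epsilon> \<and> \<epsilon> < \<eta> --> SL (\<lambda>z. hessian_det S (vec2 z)) \<epsilon> (box2 \<eta>')"
  unfolding \<eta>_def by (rule analytic_sublevel(2)[OF extH r H_nonzero H0 M2(1) gH R16])
 then obtain \<rho>0 where \<rho>0: "\<rho>0 > 0" "!!\<eta>' \<epsilon>. 0 < \<eta>' \<and> \<eta>' <= \<rho>0 \<and> 0 < \<epsilon> \<and> \<epsilon> < \<eta> ==> SL (\<lambda>z. hessian_det S (vec2 z)) \<epsilon> (box2 \<eta>')" by blast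
 \<comment> \<open>\<rho>0 serves the sublevel bounds; the other two entries are the requirements of
   \<open>surf_box2\<close>.\<close>
 define \<rho> where "\<rho> = min \<rho>0 (min (R/32) (1/4))"
 have \<rho>: "0 < \<rho>" "\<rho> <= R/32" "\<rho> <= 1/4" "\<rho> <= \<rho>0" using \<rho>0 R by (auto simp: \<rho>_def)
 define s where "s t = (if t \<in> box2 \<rho> then pval c t else 0)" for t
 define G where "G t = (if t \<in> box2 \<rho> then grad c t else 0)" for t
 define h where "h t = (if t \<in> box2 \<rho> then hess c t else 0)" for t
 have surf: "surf (box2 \<rho>) s G h"
  unfolding s_def[abs_def] G_def[abs_def] h_def[abs_def] by (rule surf_box2[OF bd \<rho>(1-3)])
 have Q2: "z \<in> box2 R" "z \<in> box2 (R/2)" if "z \<in> box2 \<rho>" for z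
  using that \<rho> R box2_mono[of \<rho> R] box2_mono[of \<rho> "R/2"] by auto
 have SLh: "\<exists>C. \<forall>\<delta>>0. vol {t\<in>box2 \<rho>. \<bar>h t\<bar> < \<delta>} <= ennreal (C * \<delta> powr \<epsilon>)" if "0 < \<epsilon>" "\<epsilon> < \<eta>" for \<epsilon>
 proof -
  have "SL (\<lambda>z. hessian_det S (vec2 z)) \<epsilon> (box2 \<rho>)" using \<rho>0(2)[of \<rho> \<epsilon>] \<rho> that by simp
  moreover have "{t\<in>box2 \<rho>. \<bar>h t\<bar> < \<delta>} = {z\<in>box2 \<rho>. \<bar>hessian_det S (vec2 z)\<bar> < \<delta>}" for \<delta>
   using Hc[OF Q2(2)] by (auto simp: h_def)
  ultimately show ?thesis unfolding SL_def by auto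
 qed
 define U where "U = unvec2 -` box2 \<rho>"
 show ?thesis
 proof (rule exI[of _ U], intro conjI allI impI)
  have "continuous_on UNIV unvec2" using continuous_unvec2[of UNIV "\<lambda>x. x"] by simp
  then show "open U" unfolding U_def by (intro open_vimage open_box2)
  show "0 \<in> U" unfolding U_def using z0[OF \<rho>(1)] linear_0[OF linear_unvec2] by simp
  fix \<phi> :: "real^2 => real" and p q :: real
  assume \<phi>: "bump \<phi> \<and> closure {t. \<phi> t ~= 0} \<subseteq> U"
   and pq: "1/q < 1/p \<and> 1/q > 1/p - int_exp S / (int_exp S + 1) \<and> 1/q > (1/p) / 3 \<and> 1/q > 3 * (1/p) - 2"
  define x where "x = 1/p"
  define y where "y = 1/q"
  have xy: "y < x" "y > x - int_exp S / (int_exp S + 1)" "y > x/3" "y > 3 * x - 2" using pq by (auto simp: x_def y_def)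
  \<comment> \<open>y < x and y > x/3 give x > 0; y < x and y > 3x - 2 give x < 1.\<close>
  have x: "0 < x" "x < 1" "0 < y" using xy(1,3,4) by linarith+
  \<comment> \<open>As 1/0 = 0, positivity of \<open>x\<close> and \<open>y\<close> also excludes p
    = 0 and q = 0.\<close>
  have p: "p >= 1" "q > 0" using x by (auto simp: x_def y_def divide_less_eq zero_less_divide_iff split: if_splits)
  \<comment> \<open>e / (e + 1) increases in e, and at the largest admissible value e = 2\<eta> / (1
    + 2\<eta>) it equals 2\<eta> / (1 + 4\<eta>).\<close>
  have pyr: "(x - y) * (1 + 4 * \<eta>) < 2 * \<eta>"
  proof -
   define e where "e = int_exp S"
   have e: "e > 0" using etaS by (simp add: e_def)
   have "e <= 2 * \<eta> / (1 + 2 * \<eta>)" using exps by (simp add: e_def \<eta>_def)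
   then have e1: "e * (1 + 2 * \<eta>) <= 2 * \<eta>" using etaH by (simp add: pos_le_divide_eq)
   have "x - y < e / (e + 1)" using xy(2) by (simp add: e_def)
   then have "(x - y) * (e + 1) < e" using e by (simp add: pos_less_divide_eq)
   then have "(x - y) * (e + 1) * (1 + 4 * \<eta>) < e * (1 + 4 * \<eta>)" using etaH by (intro mult_strict_right_mono) auto
   also have "... = e * (1 + 2 * \<eta>) + 2 * e * \<eta>" by (simp add: algebra_simps)
   also have "... <= 2 * \<eta> + 2 * e * \<eta>" using e1 by simp
   finally have "(x - y) * (1 + 4 * \<eta>) * (e + 1) < 2 * \<eta> * (e + 1)" by (simp add: algebra_simps)
   then show ?thesis using e by (simp add: mult_less_cancel_right)
  qed
  interpret surf "box2 \<rho>" s G h by (rule surf)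
  have "pyramid \<eta> (1/p) (1/q)" unfolding pyramid_def using xy pyr unfolding x_def y_def by blast
  from avg_Lp_bound[OF etaH SLh this] obtain K where K: "K > 0" "!!f u. unit_fun p f
   \<and> u \<in> borel_measurable borel \<and> (\<forall>z. 0 <= u z) \<and> (\<forall>z. ennreal (u z) <= avg f z) ==>
   (LI z. ennreal (u z powr q)) <= ennreal K" by blast
  obtain B where B: "B > 0" "!!t. \<bar>\<phi> t\<bar> <= B" using bump_bounded \<phi> by blast
  have \<phi>m: "\<phi> \<in> borel_measurable borel"
  proof (rule borel_measurable_continuous_onI)
   show "continuous_on UNIV \<phi>" using \<phi> unfolding bump_def smooth_fun_def by (elim conjE) (drule spec[of _ "[]"], simp)
  qed
  show "LpLq_bounded p q (avg_op S \<phi>)"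
  proof (rule avg_op_LpLq[OF surf B _ _ \<phi>m p K])
   show "unvec2 t \<in> box2 \<rho>" if "\<phi> t ~= 0" for t
    using that \<phi> closure_subset[of "{t. \<phi> t ~= 0}"] by (auto simp: U_def)
   show "S t = s (unvec2 t)" if "unvec2 t \<in> box2 \<rho>" for t
    using Sc[OF Q2(1)[OF that]] that by (simp add: s_def)
  qed
 qed
qed

end
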